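(* Let $E,A\in\mathbb{R}^{n\times n}$ with $\mathrm{rank}(E)=m<n$, let $B,D\in\mathbb{R}^{n\times r}$, let $x_0\in\mathbb{R}^n$ and $T>0$. The equation $$E\,dx(t)=[Ax(t)+Bu(t)]\,dt+[Ax(t)+Du(t)]\,dW(t),\qquad Ex(0)=x_0,$$ has a unique solution $x(\cdot)\in L^2_{\mathcal{F}_t}(0,T;\mathbb{R}^n)$ for any $u(\cdot)\in L^2_{\mathcal{F}_t}(0,T;\mathbb{R}^r)$ if and only if there exist invertible matrices $M,N\in\mathbb{R}^{n\times n}$ such that $$MEN=\mathrm{diag}(I_h,G),\quad MAN=\mathrm{diag}(A_1,I_{n-h}),\quad MB=\begin{pmatrix} B_1 \\ B_2 \end{pmatrix},\quad MD=\begin{pmatrix} D_1 \\ B_2 \end{pmatrix},$$ where $A_1\in\mathbb{R}^{h\times h}$ is any matrix, $B_1,D_1\in\mathbb{R}^{h\times r}$, $G=\mathrm{diag}(G_1,\dots,G_l)\in\mathbb{R}^{(n-h)\times(n-h)}$ is a nilpotent matrix in which each $G_k\in\mathbb{R}^{m_k\times m_k}$ has entries $1$ on the first superdiagonal and $0$ elsewhere, $\sum_{k=1}^lm_k=n-h$, and $B_2=(B_{21}^{\mathrm T},\dots,B_{2l}^{\mathrm T})^{\mathrm T}\in\mathbb{R}^{(n-h)\times r}$, where each $B_{2k}\in\mathbb{R}^{m_k\times r}$ has first row $b_{k1}\in\mathbb{R}^{1\times r}$ and all other rows zero, $1\le k\le l$; and moreover the initial value satisfies $$\begin{pmatrix}\mathbf{0}_{(n-h)\times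 h}&I_{n-h}\end{pmatrix}Mx_0=\mathbf{0}_{(n-h)\times1}.$$
   Context: $(\Omega,\mathcal{F},\{\mathcal{F}_t\}_{t\ge0},\mathbb{P})$ is a complete filtered probability space carrying a one-dimensional standard Brownian motion $W$; $\{\mathcal{F}_t\}$ is the natural filtration of $W$ augmented by all $\mathbb{P}$-null sets. $L^2_{\mathcal{F}_t}(0,T;\mathbb{R}^k)$ is the space of $\mathcal{F}_t$-adapted $\mathbb{R}^k$-valued processes $x(\cdot)$ with $\mathbb{E}\int_0^T|x(t)|^2dt<\infty$. $I_k$ is the $k\times k$ identity matrix and $\mathbf{0}$ denotes zero matrices. All coefficient matrices are constant. The equation is understood in integrated It\^o form, $Ex(t)=x_0+\int_0^t[Ax(s)+Bu(s)]ds+\int_0^t[Ax(s)+Du(s)]dW(s)$; solutions need not be continuous (some components are only determined for a.e. $t$), so uniqueness is up to $dt\otimes d\mathbb{P}$-null sets. *)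

theory Defs
  imports
    "HOL-Probability.Probability"
    "Jordan_Normal_Form.Jordan_Normal_Form"
    "Jordan_Normal_Form.DL_Rank"
begin

unbundle no vec_syntax and no inner_syntax

hide_type (open) Finite_Cartesian_Product.vec
hide_const (open) Finite_Cartesian_Product.vec

section \<open>Brownian motion and its augmented natural filtration\<close>

definition std_brownian_motion :: "'w measure \<Rightarrow> (real \<Rightarrow> 'w \<Rightarrow> real) \<Rightarrow> bool" where
  "std_brownian_motion P W \<longleftrightarrow>
     prob_space P \<and>
     (\<forall>t\<ge>0. W t \<in> borel_measurable P) \<and>
     (AE \<omega> in P. W 0 \<omega> = 0) \<and>
     (AE \<omega> in P. continuous_on {0..} (\<lambda>t. W t \<omega>)) \<and>
     (\<forall>s t. 0 \<le> s \<and> s < t \<longrightarrow>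
        distributed P lborel (\<lambda>\<omega>. W t \<omega> - W s \<omega>) (\<lambda>x. ennreal (normal_density 0 (sqrt (t - s)) x))) \<and>
     (\<forall>(p::nat) \<tau>. 0 \<le> \<tau> 0 \<and> (\<forall>i<p. \<tau> i < \<tau> (Suc i)) \<longrightarrow>
        prob_space.indep_vars P (\<lambda>_. borel) (\<lambda>i \<omega>. W (\<tau> (Suc i)) \<omega> - W (\<tau> i) \<omega>) {..<p})"

definition augmented_filtration :: "'w measure \<Rightarrow> (real \<Rightarrow> 'w \<Rightarrow> real) \<Rightarrow> real \<Rightarrow> 'w measure" where
  "augmented_filtration P W t =
     sigma (space P) ((\<Union>s\<in>{0..t}. {W s -` S \<inter> space P | S. S \<in> sets borel}) \<union> null_sets P)"

section \<open>Adapted processes\<close>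

abbreviation time_space :: "'w measure \<Rightarrow> real \<Rightarrow> (real \<times> 'w) measure" where
  "time_space P T \<equiv> restrict_space lborel {0..T} \<Otimes>\<^sub>M P"

definition measurable_adapted ::
  "'w measure \<Rightarrow> (real \<Rightarrow> 'w measure) \<Rightarrow> real \<Rightarrow> (real \<Rightarrow> 'w \<Rightarrow> real) \<Rightarrow> bool" where
  "measurable_adapted P F T f \<longleftrightarrow>
     (\<lambda>(t, \<omega>). f t \<omega>) \<in> borel_measurable (time_space P T) \<and>
     (\<forall>t\<in>{0..T}. f t \<in> borel_measurable (F t))"

text \<open>
  A process is a function of time and outcome; only its values on the time interval from 0 to T
  matter. As usual, adapted processes with finite second moment are taken to be jointly measurable,
  so that the iterated integral makes sense. Elements are functions, not equivalence classes.
\<close>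

definition L2_adapted ::
  "'w measure \<Rightarrow> (real \<Rightarrow> 'w measure) \<Rightarrow> real \<Rightarrow> nat \<Rightarrow> (real \<Rightarrow> 'w \<Rightarrow> real vec) set" where
  "L2_adapted P F T k = {x.
     (\<forall>t\<in>{0..T}. \<forall>\<omega>\<in>space P. x t \<omega> \<in> carrier_vec k) \<and>
     (\<forall>i<k. measurable_adapted P F T (\<lambda>t \<omega>. x t \<omega> $ i)) \<and>
     (\<integral>\<^sup>+\<omega>. (\<integral>\<^sup>+t\<in>{0..T}. ennreal (scalar_prod (x t \<omega>) (x t \<omega>)) \<partial>lborel) \<partial>P) < \<infinity>}"

section \<open>The Ito integral\<close>

text \<open>
  A simple integrand on the interval from 0 to t takes the bounded, \<open>F (\<tau> i)\<close>-measurable value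
  \<open>\<xi> i\<close> on the half-open interval from \<open>\<tau> i\<close> (excluded) to \<open>\<tau> (Suc i)\<close> (included), \<open>i < p\<close>.
\<close>

definition simple_integrand ::
  "(real \<Rightarrow> 'w measure) \<Rightarrow> real \<Rightarrow> nat \<Rightarrow> (nat \<Rightarrow> real) \<Rightarrow> (nat \<Rightarrow> 'w \<Rightarrow> real) \<Rightarrow> bool" where
  "simple_integrand F t p \<tau> \<xi> \<longleftrightarrow>
     \<tau> 0 = 0 \<and> \<tau> p = t \<and> (\<forall>i<p. \<tau> i < \<tau> (Suc i)) \<and>
     (\<forall>i<p. \<xi> i \<in> borel_measurable (F (\<tau> i)) \<and>
            (\<exists>C. \<forall>\<omega>\<in>space (F (\<tau> i)). \<bar>\<xi> i \<omega>\<bar> \<le> C))"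

definition simple_process ::
  "nat \<Rightarrow> (nat \<Rightarrow> real) \<Rightarrow> (nat \<Rightarrow> 'w \<Rightarrow> real) \<Rightarrow> real \<Rightarrow> 'w \<Rightarrow> real" where
  "simple_process p \<tau> \<xi> s \<omega> = (\<Sum>i<p. \<xi> i \<omega> * indicator {\<tau> i<..\<tau> (Suc i)} s)"

definition simple_ito_integral ::
  "(real \<Rightarrow> 'w \<Rightarrow> real) \<Rightarrow> nat \<Rightarrow> (nat \<Rightarrow> real) \<Rightarrow> (nat \<Rightarrow> 'w \<Rightarrow> real) \<Rightarrow> 'w \<Rightarrow> real" where
  "simple_ito_integral W p \<tau> \<xi> \<omega> = (\<Sum>i<p. \<xi> i \<omega> * (W (\<tau> (Suc i)) \<omega> - W (\<tau> i) \<omega>))"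

text \<open>
  \<open>J\<close> is a version of the Ito integral of \<open>f\<close> with respect to \<open>W\<close> over the interval from 0 to t:
  the mean-square limit of integrals of simple integrands converging to \<open>f\<close> in mean square. It is
  a relation, as the integral is a random variable determined only up to null sets.
\<close>

definition has_ito_integral ::
  "'w measure \<Rightarrow> (real \<Rightarrow> 'w measure) \<Rightarrow> (real \<Rightarrow> 'w \<Rightarrow> real) \<Rightarrow> real \<Rightarrow>
   (real \<Rightarrow> 'w \<Rightarrow> real) \<Rightarrow> ('w \<Rightarrow> real) \<Rightarrow> bool" where
  "has_ito_integral P F W t f J \<longleftrightarrow>
     measurable_adapted P F t f \<and> J \<in> borel_measurable P \<and>
     (\<exists>(p :: nat \<Rightarrow> nat) \<tau> \<xi>.
        (\<forall>k. simple_integrand F t (p k) (\<tau> k) (\<xi> k)) \<and>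
        (\<lambda>k. \<integral>\<^sup>+\<omega>. (\<integral>\<^sup>+s\<in>{0..t}. ennreal ((f s \<omega> - simple_process (p k) (\<tau> k) (\<xi> k) s \<omega>)\<^sup>2) \<partial>lborel) \<partial>P)
          \<longlonglongrightarrow> 0 \<and>
        (\<lambda>k. \<integral>\<^sup>+\<omega>. ennreal ((J \<omega> - simple_ito_integral W (p k) (\<tau> k) (\<xi> k) \<omega>)\<^sup>2) \<partial>P) \<longlonglongrightarrow> 0)"

section \<open>Solutions\<close>

text \<open>
  Integrated form of \<open>E dx = (A x + B u) dt + (A x + D u) dW\<close>, \<open>E x(0) = x0\<close>. For each time the
  equation holds almost surely; the initial condition is the case \<open>t = 0\<close>. Paths of \<open>x\<close> need
  not be continuous. Vector integrals are taken componentwise.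
\<close>

definition is_solution ::
  "'w measure \<Rightarrow> (real \<Rightarrow> 'w measure) \<Rightarrow> (real \<Rightarrow> 'w \<Rightarrow> real) \<Rightarrow> real \<Rightarrow> nat \<Rightarrow>
   real mat \<Rightarrow> real mat \<Rightarrow> real mat \<Rightarrow> real mat \<Rightarrow> real vec \<Rightarrow>
   (real \<Rightarrow> 'w \<Rightarrow> real vec) \<Rightarrow> (real \<Rightarrow> 'w \<Rightarrow> real vec) \<Rightarrow> bool" where
  "is_solution P F W T n E A B D x0 u x \<longleftrightarrow>
     x \<in> L2_adapted P F T n \<and>
     (\<forall>t\<in>{0..T}. \<exists>J :: nat \<Rightarrow> 'w \<Rightarrow> real.
        (\<forall>i<n. has_ito_integral P F W t (\<lambda>s \<omega>. (A *\<^sub>v x s \<omega> + D *\<^sub>v u s \<omega>) $ i) (J i)) \<and>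
        (AE \<omega> in P. E *\<^sub>v x t \<omega> =
           x0 + vec n (\<lambda>i. LINT s:{0..t}|lborel. (A *\<^sub>v x s \<omega> + B *\<^sub>v u s \<omega>) $ i)
              + vec n (\<lambda>i. J i \<omega>)))"

definition has_unique_solution ::
  "'w measure \<Rightarrow> (real \<Rightarrow> 'w measure) \<Rightarrow> (real \<Rightarrow> 'w \<Rightarrow> real) \<Rightarrow> real \<Rightarrow> nat \<Rightarrow>
   real mat \<Rightarrow> real mat \<Rightarrow> real mat \<Rightarrow> real mat \<Rightarrow> real vec \<Rightarrow>
   (real \<Rightarrow> 'w \<Rightarrow> real vec) \<Rightarrow> bool" where
  "has_unique_solution P F W T n E A B D x0 u \<longleftrightarrow>
     (\<exists>x. is_solution P F W T n E A B D x0 u x) \<and>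
     (\<forall>x y. is_solution P F W T n E A B D x0 u x \<and> is_solution P F W T n E A B D x0 u y \<longrightarrow>
        (AE (t, \<omega>) in time_space P T. x t \<omega> = y t \<omega>))"

section \<open>Block matrices\<close>

definition append_cols :: "'a :: zero mat \<Rightarrow> 'a mat \<Rightarrow> 'a mat" (infixr \<open>@\<^sub>c\<close> 65) where
  "A @\<^sub>c B = four_block_mat A B (0\<^sub>m 0 (dim_col A)) (0\<^sub>m 0 (dim_col B))"

text \<open>The parameter \<open>c\<close> is the number of columns, needed for the empty list.\<close>

definition stack_rows :: "nat \<Rightarrow> 'a :: zero mat list \<Rightarrow> 'a mat" where
  "stack_rows c As = foldr append_rows As (0\<^sub>m 0 c)"

definition first_row_mat :: "nat \<Rightarrow> 'a :: zero mat \<Rightarrow> 'a mat" where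
  "first_row_mat k b = mat k (dim_col b) (\<lambda>(i, j). if i = 0 then b $$ (0, j) else 0)"

end

theory Submission
  imports Defs "Jordan_Normal_Form.Jordan_Normal_Form_Existence"
begin

text \<open>
  If \<open>det (c E - A)\<close> vanished for all \<open>c\<close>, a polynomial null vector of the pencil, with its powers
  replaced by iterated integrals \<open>\<eta> (k + 1) t = \<integral> \<eta> k ds + \<integral> \<eta> k dW\<close>, would give a nonzero solution of the
  homogeneous equation. Hence unique solvability makes the pencil regular, and it can be brought to
  Weierstrass form. The equation then splits into an ordinary linear stochastic equation, solved by
  Picard iteration, and the rows \<open>G dy = (y + B2 u) dt + (y + D2 u) dW\<close>.

  A process of the form constant plus drift plus stochastic integral vanishes only if all three parts
  do. Applied from the last row upwards, this shows that \<open>y = - B2 u = - D2 u\<close>, and \<open>G B2 u\<close>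
  is minus the initial value when \<open>u\<close> is constant. Constant controls therefore force \<open>B2 = D2\<close>,
  \<open>G B2 = 0\<close> and zero initial value, and conversely \<open>y = - B2 u\<close> is then the only solution; \<open>G B2 = 0\<close>
  says that only the rows of \<open>B2\<close> at the tops of the Jordan blocks can be nonzero.
\<close>

section \<open>Square integrable functions\<close>

text \<open>The coefficient \<open>A\<close> stands both before \<open>dt\<close> and before
  \<open>dW\<close>, so one pencil governs drift and noise, and the algebra of deterministic
  descriptor systems survives with integration replaced by (f, g) \<mapsto> \<integral> f ds +
  \<integral> g dW. Differentiation is replaced by the uniqueness of the parts of such a process.

  The obstacle is regularity. Solutions are only jointly measurable and adapted, equations hold
  almost surely for each fixed time, and the Ito integral is a relation given by mean square limits.
  Everything is therefore done in mean square: processes are vectors of one L2 space over time and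
  outcome, integrals are compared by the isometry, and values at a fixed time come from an equation
  or from mean square continuity. Integrals chosen separately for each time must be given a jointly
  measurable version before they can be integrands again.

  Approximations are taken with errors (1/8)^k or with factorial errors. Squared increments weighted
  by 2^k then remain summable, so the pointwise \<open>lim\<close> exists almost surely and inherits
  adaptedness.\<close>

definition L2 :: "'a measure \<Rightarrow> ('a \<Rightarrow> real) set" where
  "L2 M = {f \<in> borel_measurable M. integrable M (\<lambda>x. (f x)\<^sup>2)}"

lemma L2_measurable [measurable_dest]: "f \<in> L2 M \<Longrightarrow> f \<in> borel_measurable M"
  by (simp add: L2_def)

lemma L2_integrable_sq: "f \<in> L2 M \<Longrightarrow> integrable M (\<lambda>x. (f x)\<^sup>2)"
  by (simp add: L2_def)

lemma L2_iff_nn: "f \<in> L2 M \<longleftrightarrow> f \<in> borel_measurable M \<and> (\<integral>\<^sup>+x. ennreal ((f x)\<^sup>2) \<partial>M) < \<infinity>"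
  by (auto simp: L2_def integrable_iff_bounded)

lemma L2_nn_integral: "f \<in> L2 M \<Longrightarrow> (\<integral>\<^sup>+x. ennreal ((f x)\<^sup>2) \<partial>M) = ennreal (\<integral>x. (f x)\<^sup>2 \<partial>M)"
  by (intro nn_integral_eq_integral) (auto simp: L2_def)

lemma L2_mult_integrable:
  assumes "f \<in> L2 M" "g \<in> L2 M" shows "integrable M (\<lambda>x. f x * g x)"
proof (rule Bochner_Integration.integrable_bound)
  show "integrable M (\<lambda>x. (f x)\<^sup>2 + (g x)\<^sup>2)"
    using assms by (auto intro!: Bochner_Integration.integrable_add L2_integrable_sq)
  show "(\<lambda>x. f x * g x) \<in> borel_measurable M"
    using assms by measurable
  show "AE x in M. norm (f x * g x) \<le> norm ((f x)\<^sup>2 + (g x)\<^sup>2)"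
  proof (rule AE_I2)
    fix x
    have "2 * (\<bar>f x\<bar> * \<bar>g x\<bar>) \<le> (f x)\<^sup>2 + (g x)\<^sup>2" "0 \<le> \<bar>f x\<bar> * \<bar>g x\<bar>"
      using sum_squares_bound[of "\<bar>f x\<bar>" "\<bar>g x\<bar>"] by (simp_all add: mult.assoc)
    then show "norm (f x * g x) \<le> norm ((f x)\<^sup>2 + (g x)\<^sup>2)"
      unfolding real_norm_def abs_mult by linarith
  qed
qed

lemma L2_add: assumes "f \<in> L2 M" "g \<in> L2 M" shows "(\<lambda>x. f x + g x) \<in> L2 M"
  using assms integrable_mult_right[OF L2_mult_integrable[OF assms], of 2] unfolding L2_def
  by (auto simp: power2_sum mult.assoc)

lemma L2_cmult: assumes "f \<in> L2 M" shows "(\<lambda>x. c * f x) \<in> L2 M"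
  using assms unfolding L2_def by (auto simp: power_mult_distrib)

lemma L2_diff: assumes "f \<in> L2 M" "g \<in> L2 M" shows "(\<lambda>x. f x - g x) \<in> L2 M"
  using L2_add[OF assms(1) L2_cmult[OF assms(2), of "-1"]] by simp

lemma L2_zero: "(\<lambda>x. 0) \<in> L2 M"
  unfolding L2_def by simp

lemma L2_sum: "(\<And>i. i \<in> I \<Longrightarrow> f i \<in> L2 M) \<Longrightarrow> (\<lambda>x. \<Sum>i\<in>I. f i x) \<in> L2 M"
  by (induction I rule: infinite_finite_induct) (auto intro: L2_add L2_zero)

lemma L2_const: "finite_measure M \<Longrightarrow> (\<lambda>x. c) \<in> L2 M"
  unfolding L2_def by (auto intro: finite_measure.integrable_const)

lemma L2_integrable: "finite_measure M \<Longrightarrow> f \<in> L2 M \<Longrightarrow> integrable M f"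
  using L2_mult_integrable[of f M "\<lambda>_. 1"] L2_const[of M 1] by simp

lemma L2_bounded:
  assumes "finite_measure M" "f \<in> borel_measurable M" "\<And>x. x \<in> space M \<Longrightarrow> \<bar>f x\<bar> \<le> C"
  shows "f \<in> L2 M"
  unfolding L2_def
proof (safe intro!: assms finite_measure.integrable_const_bound[where B="C\<^sup>2"])
  show "AE x in M. norm ((f x)\<^sup>2) \<le> C\<^sup>2"
    using assms(3) by (auto intro!: AE_I2 simp: abs_le_square_iff[symmetric] intro: order_trans[OF _ abs_ge_self])
qed (use assms in measurable)

lemma L2_cong_AE:
  assumes "f \<in> L2 M" "g \<in> borel_measurable M" "AE x in M. f x = g x" shows "g \<in> L2 M"
  unfolding L2_def using assms
  by (auto simp: L2_def intro: integrable_cong_AE_imp[where g="\<lambda>x. (f x)\<^sup>2"])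

text \<open>Comes from the inequality for nonnegative integrals of the absolute values; square
  integrability makes every term finite, so it can be read in the reals.\<close>

lemma Cauchy_Schwarz_integral:
  assumes "f \<in> L2 M" "g \<in> L2 M"
  shows "(\<integral>x. f x * g x \<partial>M)\<^sup>2 \<le> (\<integral>x. (f x)\<^sup>2 \<partial>M) * (\<integral>x. (g x)\<^sup>2 \<partial>M)"
proof -
  have [measurable]: "f \<in> borel_measurable M" "g \<in> borel_measurable M"
    using assms by (auto dest: L2_measurable)
  have int: "integrable M (\<lambda>x. \<bar>f x\<bar> * \<bar>g x\<bar>)"
    using integrable_abs[OF L2_mult_integrable[OF assms]] by (simp add: abs_mult)
  have "(\<integral>\<^sup>+x. ennreal \<bar>f x\<bar> * ennreal \<bar>g x\<bar> \<partial>M)\<^sup>2 \<le> (\<integral>\<^sup>+x. ennreal \<bar>f x\<bar> ^ 2 \<partial>M) * (\<integral>\<^sup>+x. ennreal \<bar>g x\<bar> ^ 2 \<partial>M)"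
    by (rule Cauchy_Schwarz_nn_integral) auto
  also have "(\<lambda>x. ennreal \<bar>f x\<bar> * ennreal \<bar>g x\<bar>) = (\<lambda>x. ennreal (\<bar>f x\<bar> * \<bar>g x\<bar>))"
    by (simp add: ennreal_mult)
  also have "(\<lambda>x. ennreal \<bar>f x\<bar> ^ 2) = (\<lambda>x. ennreal ((f x)\<^sup>2))"
    by (simp add: ennreal_power)
  also have "(\<lambda>x. ennreal \<bar>g x\<bar> ^ 2) = (\<lambda>x. ennreal ((g x)\<^sup>2))"
    by (simp add: ennreal_power)
  also have "(\<integral>\<^sup>+x. ennreal (\<bar>f x\<bar> * \<bar>g x\<bar>) \<partial>M) = ennreal (\<integral>x. \<bar>f x\<bar> * \<bar>g x\<bar> \<partial>M)"
    by (intro nn_integral_eq_integral int) auto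
  finally have "ennreal ((\<integral>x. \<bar>f x\<bar> * \<bar>g x\<bar> \<partial>M)\<^sup>2) \<le> ennreal ((\<integral>x. (f x)\<^sup>2 \<partial>M) * (\<integral>x. (g x)\<^sup>2 \<partial>M))"
    unfolding L2_nn_integral[OF assms(1)] L2_nn_integral[OF assms(2)]
    by (simp add: ennreal_power ennreal_mult)
  then have "(\<integral>x. \<bar>f x\<bar> * \<bar>g x\<bar> \<partial>M)\<^sup>2 \<le> (\<integral>x. (f x)\<^sup>2 \<partial>M) * (\<integral>x. (g x)\<^sup>2 \<partial>M)"
    by (subst (asm) ennreal_le_iff) auto
  moreover have "\<bar>\<integral>x. f x * g x \<partial>M\<bar> \<le> (\<integral>x. \<bar>f x\<bar> * \<bar>g x\<bar> \<partial>M)"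
    using integral_abs_bound[of M "\<lambda>x. f x * g x"] by (simp add: abs_mult)
  then have "(\<integral>x. f x * g x \<partial>M)\<^sup>2 \<le> (\<integral>x. \<bar>f x\<bar> * \<bar>g x\<bar> \<partial>M)\<^sup>2"
    by (simp add: abs_le_square_iff[symmetric])
  ultimately show ?thesis by linarith
qed

lemma L2_mult_tendsto_zero:
  assumes "\<And>k. f k \<in> L2 M" "\<And>k. g k \<in> L2 M"
    and "(\<lambda>k. (\<integral>x. (f k x)\<^sup>2 \<partial>M) * (\<integral>x. (g k x)\<^sup>2 \<partial>M)) \<longlonglongrightarrow> 0"
  shows "(\<lambda>k. \<integral>x. f k x * g k x \<partial>M) \<longlonglongrightarrow> 0"
proof -
  have "(\<lambda>k. sqrt ((\<integral>x. (f k x)\<^sup>2 \<partial>M) * (\<integral>x. (g k x)\<^sup>2 \<partial>M))) \<longlonglongrightarrow> 0"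
    using tendsto_real_sqrt[OF assms(3)] by simp
  moreover have "norm (\<integral>x. f k x * g k x \<partial>M) \<le> sqrt ((\<integral>x. (f k x)\<^sup>2 \<partial>M) * (\<integral>x. (g k x)\<^sup>2 \<partial>M))" for k
    unfolding real_norm_def by (rule real_le_rsqrt) (simp only: power2_abs Cauchy_Schwarz_integral[OF assms(1,2)])
  ultimately show ?thesis
    by (rule Lim_null_comparison[OF always_eventually[OF allI], rotated])
qed

text \<open><fk, gk> is <f, g> plus <f - fk, g - gk> minus <f - fk, g> minus <f, g - gk>, and
  Cauchy-Schwarz sends the last three to 0. This continuity carries the isometry from simple
  integrands to all integrands.\<close>

lemma L2_inner_tendsto:
  assumes f: "f \<in> L2 M" "\<And>k. fk k \<in> L2 M" "(\<lambda>k. \<integral>x. (f x - fk k x)\<^sup>2 \<partial>M) \<longlonglongrightarrow> 0"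
    and g: "g \<in> L2 M" "\<And>k. gk k \<in> L2 M" "(\<lambda>k. \<integral>x. (g x - gk k x)\<^sup>2 \<partial>M) \<longlonglongrightarrow> 0"
  shows "(\<lambda>k. \<integral>x. fk k x * gk k x \<partial>M) \<longlonglongrightarrow> (\<integral>x. f x * g x \<partial>M)"
proof -
  let ?a = "\<lambda>k x. f x - fk k x" and ?b = "\<lambda>k x. g x - gk k x"
  have a: "?a k \<in> L2 M" and b: "?b k \<in> L2 M" for k
    using f g by (auto intro: L2_diff)
  have 1: "(\<lambda>k. \<integral>x. ?a k x * ?b k x \<partial>M) \<longlonglongrightarrow> 0"
    by (rule L2_mult_tendsto_zero[OF a b]) (use tendsto_mult[OF f(3) g(3)] in simp)
  have 2: "(\<lambda>k. \<integral>x. ?a k x * g x \<partial>M) \<longlonglongrightarrow> 0"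
    by (rule L2_mult_tendsto_zero[OF a g(1)]) (rule tendsto_mult_left_zero[OF f(3)])
  have 3: "(\<lambda>k. \<integral>x. f x * ?b k x \<partial>M) \<longlonglongrightarrow> 0"
    by (rule L2_mult_tendsto_zero[OF f(1) b]) (rule tendsto_mult_right_zero[OF g(3)])
  have "(\<lambda>k. (\<integral>x. f x * g x \<partial>M) + (\<integral>x. ?a k x * ?b k x \<partial>M) - (\<integral>x. ?a k x * g x \<partial>M) - (\<integral>x. f x * ?b k x \<partial>M))
      \<longlonglongrightarrow> (\<integral>x. f x * g x \<partial>M) + 0 - 0 - 0"
    by (rule tendsto_diff[OF tendsto_diff[OF tendsto_add[OF tendsto_const 1] 2] 3])
  moreover have "(\<integral>x. f x * g x \<partial>M) + (\<integral>x. ?a k x * ?b k x \<partial>M) - (\<integral>x. ?a k x * g x \<partial>M) - (\<integral>x. f x * ?b k x \<partial>M)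
     = (\<integral>x. fk k x * gk k x \<partial>M)" for k
  proof -
    have "(\<integral>x. f x * g x \<partial>M) + (\<integral>x. ?a k x * ?b k x \<partial>M) - (\<integral>x. ?a k x * g x \<partial>M) - (\<integral>x. f x * ?b k x \<partial>M)
      = (\<integral>x. f x * g x + ?a k x * ?b k x - ?a k x * g x - f x * ?b k x \<partial>M)"
      using L2_mult_integrable[OF f(1) g(1)] L2_mult_integrable[OF a b, of k k]
        L2_mult_integrable[OF a g(1), of k] L2_mult_integrable[OF f(1) b, of k] by simp
    also have "\<dots> = (\<integral>x. fk k x * gk k x \<partial>M)"
      by (intro Bochner_Integration.integral_cong) (auto simp: algebra_simps)
    finally show ?thesis .
  qed
  ultimately show ?thesis by simp
qed

lemma L2_sq_triangle:
  assumes "f \<in> L2 M" "g \<in> L2 M" "h \<in> L2 M"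
  shows "(\<integral>x. (f x - h x)\<^sup>2 \<partial>M) \<le> 2 * (\<integral>x. (f x - g x)\<^sup>2 \<partial>M) + 2 * (\<integral>x. (g x - h x)\<^sup>2 \<partial>M)"
proof -
  have i: "integrable M (\<lambda>x. (f x - g x)\<^sup>2)" "integrable M (\<lambda>x. (g x - h x)\<^sup>2)" "integrable M (\<lambda>x. (f x - h x)\<^sup>2)"
    using assms by (auto intro!: L2_integrable_sq L2_diff)
  have "(\<integral>x. (f x - h x)\<^sup>2 \<partial>M) \<le> (\<integral>x. 2 * (f x - g x)\<^sup>2 + 2 * (g x - h x)\<^sup>2 \<partial>M)"
  proof (rule integral_mono)
    fix x show "(f x - h x)\<^sup>2 \<le> 2 * (f x - g x)\<^sup>2 + 2 * (g x - h x)\<^sup>2"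
      using sum_squares_bound[of "f x - g x" "g x - h x"] by (simp add: power2_eq_square algebra_simps)
  qed (use i in auto)
  then show ?thesis using i by simp
qed

text \<open>The weights come from Chebyshev-type splitting: \<open>\<bar>d\<bar> \<le> 2\<^sup>-\<^sup>k + 2\<^sup>k d\<^sup>2\<close>.\<close>

lemma abs_le_power_split: "\<bar>d\<bar> \<le> (1/2)^k + 2^k * (d::real)\<^sup>2"
proof (cases "\<bar>d\<bar> \<le> (1/2)^k")
  case True then show ?thesis by (simp add: add_increasing2)
next
  case False
  then have "1 \<le> 2^k * \<bar>d\<bar>" by (simp add: power_one_over field_simps)
  then have "\<bar>d\<bar> * 1 \<le> \<bar>d\<bar> * (2^k * \<bar>d\<bar>)" by (intro mult_left_mono) auto
  also have "\<dots> = 2^k * d\<^sup>2" by (simp add: power2_eq_square)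
  finally show ?thesis by (simp add: add_increasing)
qed

text \<open>Cauchy-Schwarz with the weights (1/2)^j and 2^j. The first weights sum to at most 2,
  which is the constant, whatever the number of increments.\<close>

lemma telescope_sq_le:
  fixes x :: "nat \<Rightarrow> real"
  assumes "k \<le> l"
  shows "(x l - x k)\<^sup>2 \<le> 2 * (\<Sum>j\<in>{k..<l}. 2^j * (x (Suc j) - x j)\<^sup>2)"
proof -
  have g: "(\<Sum>j\<in>{k..<l}. (1/2::real)^j) \<le> 2"
  proof -
    have "(\<Sum>j\<in>{k..<l}. (1/2::real)^j) \<le> (\<Sum>j. (1/2)^j)"
      by (intro sum_le_suminf) (auto intro: summable_geometric)
    then show ?thesis by (simp add: suminf_geometric)
  qed
  have "x l - x k = (\<Sum>j\<in>{k..<l}. x (Suc j) - x j)"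
    using assms by (simp add: sum_Suc_diff')
  also have "\<dots> = (\<Sum>j\<in>{k..<l}. sqrt ((1/2)^j) * (sqrt (2^j) * (x (Suc j) - x j)))"
    by (intro sum.cong) (auto simp: real_sqrt_mult[symmetric] power_mult_distrib[symmetric] mult.assoc[symmetric])
  finally have "(x l - x k)\<^sup>2 \<le> (\<Sum>j\<in>{k..<l}. (sqrt ((1/2)^j))\<^sup>2) * (\<Sum>j\<in>{k..<l}. (sqrt (2^j) * (x (Suc j) - x j))\<^sup>2)"
    using Cauchy_Schwarz_ineq_sum[of "\<lambda>j. sqrt ((1/2)^j)" "\<lambda>j. sqrt (2^j) * (x (Suc j) - x j)" "{k..<l}"] by simp
  also have "\<dots> = (\<Sum>j\<in>{k..<l}. (1/2)^j) * (\<Sum>j\<in>{k..<l}. 2^j * (x (Suc j) - x j)\<^sup>2)"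
    by (simp add: power_mult_distrib)
  also have "\<dots> \<le> 2 * (\<Sum>j\<in>{k..<l}. 2^j * (x (Suc j) - x j)\<^sup>2)"
    by (intro mult_right_mono g sum_nonneg) auto
  finally show ?thesis .
qed

text \<open>The weight 2^k makes the whole sequence converge almost everywhere, with no passage to a
  subsequence. The limit is the pointwise \<open>lim\<close>, so it is measurable for any sigma
  algebra for which all \<open>X k\<close> are, and the explicit tail bound is uniform over families
  that share the bounds \<open>e\<close>.\<close>

lemma L2_complete:
  fixes X :: "nat \<Rightarrow> 'a \<Rightarrow> real"
  assumes "finite_measure M" and X: "\<And>k. X k \<in> L2 M"
    and e: "\<And>k. (\<integral>x. (X (Suc k) x - X k x)\<^sup>2 \<partial>M) \<le> e k" and s: "summable (\<lambda>k. 2^k * e k)"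
  defines "Y \<equiv> \<lambda>x. lim (\<lambda>k. X k x)"
  shows "AE x in M. (\<lambda>k. X k x) \<longlonglongrightarrow> Y x" "Y \<in> L2 M"
    "\<And>k. (\<integral>x. (Y x - X k x)\<^sup>2 \<partial>M) \<le> 2 * (\<Sum>j. 2^(j+k) * e (j+k))"
    "(\<lambda>k. \<integral>x. (Y x - X k x)\<^sup>2 \<partial>M) \<longlonglongrightarrow> 0"
proof -
  interpret finite_measure M by fact
  have [measurable]: "X k \<in> borel_measurable M" for k using X by auto
  have Ym [measurable]: "Y \<in> borel_measurable M" unfolding Y_def by measurable
  have e0: "0 \<le> e k" for k by (rule order_trans[OF integral_nonneg_AE e]) auto
  have D: "(\<lambda>x. X (Suc k) x - X k x) \<in> L2 M" for k using X by (auto intro: L2_diff)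
  have nn: "(\<integral>\<^sup>+x. ennreal ((X (Suc k) x - X k x)\<^sup>2) \<partial>M) \<le> ennreal (e k)" for k
    unfolding L2_nn_integral[OF D] using e by (simp add: ennreal_leI)
  \<comment> \<open>By \<open>abs_le_power_split\<close> this series dominates that of the absolute
    increments, so its finite integral gives absolute convergence almost everywhere.\<close>
  have sumfin: "(\<integral>\<^sup>+x. (\<Sum>k. ennreal ((1/2)^k + 2^k * (X (Suc k) x - X k x)\<^sup>2)) \<partial>M) < \<infinity>"
  proof -
    have "(\<integral>\<^sup>+x. (\<Sum>k. ennreal ((1/2)^k + 2^k * (X (Suc k) x - X k x)\<^sup>2)) \<partial>M)
      = (\<Sum>k. \<integral>\<^sup>+x. ennreal ((1/2)^k + 2^k * (X (Suc k) x - X k x)\<^sup>2) \<partial>M)"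
      by (intro nn_integral_suminf) auto
    also have "\<dots> \<le> (\<Sum>k. ennreal ((1/2)^k * measure M (space M) + 2^k * e k))"
    proof (intro suminf_le)
      fix k
      have "(\<integral>\<^sup>+x. ennreal ((1/2)^k + 2^k * (X (Suc k) x - X k x)\<^sup>2) \<partial>M)
        = (\<integral>\<^sup>+x. ennreal ((1/2)^k) + ennreal (2^k) * ennreal ((X (Suc k) x - X k x)\<^sup>2) \<partial>M)"
        by (simp add: ennreal_mult)
      also have "\<dots> = ennreal ((1/2)^k) * emeasure M (space M) + ennreal (2^k) * (\<integral>\<^sup>+x. ennreal ((X (Suc k) x - X k x)\<^sup>2) \<partial>M)"
        by (simp add: nn_integral_add nn_integral_cmult)
      also have "\<dots> \<le> ennreal ((1/2)^k) * emeasure M (space M) + ennreal (2^k) * ennreal (e k)"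
        using nn by (intro add_left_mono mult_left_mono) auto
      also have "\<dots> = ennreal ((1/2)^k * measure M (space M) + 2^k * e k)"
        using e0 by (simp add: emeasure_eq_measure ennreal_mult)
      finally show "(\<integral>\<^sup>+x. ennreal ((1/2)^k + 2^k * (X (Suc k) x - X k x)\<^sup>2) \<partial>M) \<le> ennreal ((1/2)^k * measure M (space M) + 2^k * e k)" .
    qed auto
    also have "\<dots> = ennreal (\<Sum>k. (1/2)^k * measure M (space M) + 2^k * e k)"
      by (intro suminf_ennreal_eq summable_sums summable_add s summable_mult2 summable_geometric) (auto simp: e0)
    finally show ?thesis by (simp add: le_less_trans)
  qed
  have "AE x in M. (\<Sum>k. ennreal ((1/2)^k + 2^k * (X (Suc k) x - X k x)\<^sup>2)) \<noteq> \<infinity>"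
    using sumfin by (intro nn_integral_noteq_infinite) auto
  then show conv: "AE x in M. (\<lambda>k. X k x) \<longlonglongrightarrow> Y x"
  proof eventually_elim
    case (elim x)
    then have "summable (\<lambda>k. (1/2)^k + 2^k * (X (Suc k) x - X k x)\<^sup>2)"
      by (intro summable_suminf_not_top) (auto intro!: add_nonneg_nonneg)
    then have "summable (\<lambda>k. X (Suc k) x - X k x)"
      by (rule summable_comparison_test'[where N=0]) (simp add: abs_le_power_split)
    then have "(\<lambda>n. \<Sum>k<n. X (Suc k) x - X k x) \<longlonglongrightarrow> (\<Sum>k. X (Suc k) x - X k x)"
      by (rule summable_LIMSEQ)
    from tendsto_add[OF this tendsto_const[of "X 0 x"]]
    have "(\<lambda>n. X n x) \<longlonglongrightarrow> (\<Sum>k. X (Suc k) x - X k x) + X 0 x"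
      by (simp only: sum_lessThan_telescope[of "\<lambda>k. X k x"] diff_add_cancel)
    then have "convergent (\<lambda>k. X k x)" by (auto simp: convergent_def)
    then show ?case unfolding Y_def by (simp add: convergent_LIMSEQ_iff)
  qed
  have bound: "(\<integral>\<^sup>+x. ennreal ((Y x - X k x)\<^sup>2) \<partial>M) \<le> ennreal (2 * (\<Sum>j. 2^(j+k) * e (j+k)))" for k
  proof -
    have sk: "summable (\<lambda>j. 2^(j+k) * e (j+k))" using s by (rule summable_iff_shift[of "\<lambda>j. 2^j * e j" k, THEN iffD2])
    have fin: "(\<integral>\<^sup>+x. ennreal ((X l x - X k x)\<^sup>2) \<partial>M) \<le> ennreal (2 * (\<Sum>j. 2^(j+k) * e (j+k)))" if "k \<le> l" for l
    proof -
      have "(\<integral>\<^sup>+x. ennreal ((X l x - X k x)\<^sup>2) \<partial>M) \<le> (\<integral>\<^sup>+x. (2 * (\<Sum>j\<in>{k..<l}. ennreal (2^j) * ennreal ((X (Suc j) x - X j x)\<^sup>2))) \<partial>M)"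
        using telescope_sq_le[OF that, of "\<lambda>j. X j _"]
        by (intro nn_integral_mono) (simp add: ennreal_mult[symmetric] ennreal_leI sum_nonneg flip: ennreal_numeral)
      also have "\<dots> = 2 * (\<Sum>j\<in>{k..<l}. ennreal (2^j) * (\<integral>\<^sup>+x. ennreal ((X (Suc j) x - X j x)\<^sup>2) \<partial>M))"
        by (simp add: nn_integral_cmult nn_integral_sum)
      also have "\<dots> \<le> 2 * (\<Sum>j\<in>{k..<l}. ennreal (2^j) * ennreal (e j))"
        by (intro mult_left_mono sum_mono nn) auto
      also have "\<dots> = ennreal (2 * (\<Sum>j\<in>{k..<l}. 2^j * e j))"
        using e0 by (simp add: ennreal_mult[symmetric] sum_nonneg flip: ennreal_numeral)
      also have "(\<Sum>j\<in>{k..<l}. 2^j * e j) = (\<Sum>j<l-k. 2^(j+k) * e (j+k))"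
        using that by (intro sum.reindex_bij_witness[of _ "\<lambda>j. j + k" "\<lambda>j. j - k"]) auto
      also have "ennreal (2 * (\<Sum>j<l-k. 2^(j+k) * e (j+k))) \<le> ennreal (2 * (\<Sum>j. 2^(j+k) * e (j+k)))"
        using sk e0 by (intro ennreal_leI mult_left_mono sum_le_suminf) auto
      finally show ?thesis .
    qed
    have "(\<integral>\<^sup>+x. ennreal ((Y x - X k x)\<^sup>2) \<partial>M) = (\<integral>\<^sup>+x. liminf (\<lambda>l. ennreal ((X l x - X k x)\<^sup>2)) \<partial>M)"
    proof (rule nn_integral_cong_AE)
      show "AE x in M. ennreal ((Y x - X k x)\<^sup>2) = liminf (\<lambda>l. ennreal ((X l x - X k x)\<^sup>2))"
        using conv
      proof eventually_elim
        case (elim x)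
        have "(\<lambda>l. ennreal ((X l x - X k x)\<^sup>2)) \<longlonglongrightarrow> ennreal ((Y x - X k x)\<^sup>2)"
          by (intro tendsto_intros tendsto_ennrealI elim)
        then show ?case by (intro lim_imp_Liminf[symmetric]) auto
      qed
    qed
    \<comment> \<open>Fatou's lemma passes the telescoped bound on X l - X k to the limit l
      \<rightarrow> \<infinity>.\<close>
    also have "\<dots> \<le> liminf (\<lambda>l. \<integral>\<^sup>+x. ennreal ((X l x - X k x)\<^sup>2) \<partial>M)"
      by (intro nn_integral_liminf) auto
    also have "\<dots> \<le> liminf (\<lambda>l::nat. ennreal (2 * (\<Sum>j. 2^(j+k) * e (j+k))))"
      using fin by (intro Liminf_mono) (auto simp: eventually_sequentially)
    also have "\<dots> = ennreal (2 * (\<Sum>j. 2^(j+k) * e (j+k)))" by (simp add: Liminf_const)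
    finally show ?thesis .
  qed
  have YX: "(\<lambda>x. Y x - X k x) \<in> L2 M" for k
    unfolding L2_iff_nn using bound[of k] by (auto intro: le_less_trans)
  from L2_add[OF YX[of 0] X[of 0]] show "Y \<in> L2 M" by simp
  show b2: "(\<integral>x. (Y x - X k x)\<^sup>2 \<partial>M) \<le> 2 * (\<Sum>j. 2^(j+k) * e (j+k))" for k
  proof -
    have "0 \<le> (\<Sum>j. 2^(j+k) * e (j+k))"
      using s e0 by (intro suminf_nonneg) (auto simp: summable_iff_shift[of "\<lambda>j. 2^j * e j"])
    then show ?thesis using bound[of k] unfolding L2_nn_integral[OF YX] by (subst (asm) ennreal_le_iff) auto
  qed
  have "(\<lambda>k. 2 * (\<Sum>j. 2^(j+k) * e (j+k))) \<longlonglongrightarrow> 0"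
    using tendsto_mult_left[OF suminf_exist_split2[OF s], of 2] by simp
  then show "(\<lambda>k. \<integral>x. (Y x - X k x)\<^sup>2 \<partial>M) \<longlonglongrightarrow> 0"
    by (rule Lim_null_comparison[rotated]) (simp add: b2)
qed

section \<open>Independence of Brownian increments from the past\<close>

locale brownian = prob_space P + complete_measure P for P :: "'w measure" +
  fixes W :: "real \<Rightarrow> 'w \<Rightarrow> real"
  assumes brownian: "std_brownian_motion P W"
begin

abbreviation Ft :: "real \<Rightarrow> 'w measure" where
  "Ft \<equiv> augmented_filtration P W"

lemma W_measurable [measurable]: "0 \<le> t \<Longrightarrow> W t \<in> borel_measurable P"
  using brownian by (auto simp: std_brownian_motion_def)

lemma W_0: "AE \<omega> in P. W 0 \<omega> = 0"
  using brownian by (auto simp: std_brownian_motion_def)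

lemma Ft_generator_sets:
  "(\<Union>s\<in>{0..t}. {W s -` S \<inter> space P | S. S \<in> sets borel}) \<union> null_sets P \<subseteq> sets P"
  by (auto intro: measurable_sets[OF W_measurable])

lemma space_Ft [simp]: "space (Ft t) = space P"
  by (simp add: augmented_filtration_def space_measure_of_conv)

lemma sets_Ft: "sets (Ft t) = sigma_sets (space P)
    ((\<Union>s\<in>{0..t}. {W s -` S \<inter> space P | S. S \<in> sets borel}) \<union> null_sets P)"
  unfolding augmented_filtration_def using Ft_generator_sets[of t] sets.sets_into_space
  by (intro sets_measure_of) blast

lemma sets_Ft_subset: "sets (Ft t) \<subseteq> sets P"
  unfolding sets_Ft by (rule sets.sigma_sets_subset[OF Ft_generator_sets])

lemma measurable_Ft_P: "f \<in> measurable (Ft t) N \<Longrightarrow> f \<in> measurable P N"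
  using sets_Ft_subset[of t] by (auto simp: measurable_def)

lemma sets_Ft_mono: "s \<le> t \<Longrightarrow> sets (Ft s) \<subseteq> sets (Ft t)"
  unfolding sets_Ft by (intro sigma_sets_mono' Un_mono UN_mono) auto

lemma measurable_Ft_mono: "f \<in> measurable (Ft s) N \<Longrightarrow> s \<le> t \<Longrightarrow> f \<in> measurable (Ft t) N"
  using sets_Ft_mono[of s t] by (auto simp: measurable_def)

lemma W_measurable_Ft: "0 \<le> s \<Longrightarrow> s \<le> t \<Longrightarrow> W s \<in> borel_measurable (Ft t)"
  by (rule measurableI) (auto simp: sets_Ft intro!: sigma_sets.Basic)

lemma null_sets_Ft: "N \<in> null_sets P \<Longrightarrow> N \<in> sets (Ft t)"
  by (auto simp: sets_Ft intro!: sigma_sets.Basic)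

text \<open>Off a null set the preimages agree. The part inside it is null by completeness, hence
  belongs to every member of the augmented filtration. Adaptedness thus survives an almost sure
  change.\<close>

lemma measurable_Ft_cong_AE:
  fixes f g :: "'w \<Rightarrow> real"
  assumes f: "f \<in> borel_measurable (Ft t)" and eq: "AE \<omega> in P. f \<omega> = g \<omega>"
  shows "g \<in> borel_measurable (Ft t)"
proof (rule measurableI)
  fix S :: "real set" assume S: "S \<in> sets borel"
  obtain N where N: "{\<omega>\<in>space P. \<not> f \<omega> = g \<omega>} \<subseteq> N" "emeasure P N = 0" "N \<in> sets P"
    using eq by (rule AE_E)
  then have N0: "N \<in> null_sets P" by auto
  have sub: "g -` S \<inter> N \<in> null_sets P"
    using complete[OF _ N0, of "g -` S \<inter> N"] N0 by (auto intro: null_sets_subset)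
  have "g -` S \<inter> space P = ((f -` S \<inter> space P) - N) \<union> (g -` S \<inter> N)"
    using N(1) sets.sets_into_space[OF N(3)] by auto
  moreover have "f -` S \<inter> space P \<in> sets (Ft t)"
    using measurable_sets[OF f S] by simp
  ultimately show "g -` S \<inter> space (Ft t) \<in> sets (Ft t)"
    using null_sets_Ft[OF N0, of t] null_sets_Ft[OF sub, of t] by auto
qed simp

text \<open>Built from W s - W 0 instead of W s, because independence is only assumed for increments
  and W 0 vanishes only almost surely.\<close>

definition cylinder_sets :: "real set \<Rightarrow> 'w set set" where
  "cylinder_sets J = sigma_sets (space P)
     (\<Union>s\<in>J. {(\<lambda>\<omega>. W s \<omega> - W 0 \<omega>) -` S \<inter> space P | S. S \<in> sets borel})"

lemma cylinder_sets_mono: "J \<subseteq> K \<Longrightarrow> cylinder_sets J \<subseteq> cylinder_sets K"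
  unfolding cylinder_sets_def by (intro sigma_sets_mono') auto

text \<open>The finitely many times of \<open>J\<close> are sorted together with 0 and c, and d is
  appended. Independence of consecutive increments separates the last one from the others, of which
  every W s - W 0 is a partial sum.\<close>

lemma cylinder_indep:
  assumes J: "finite J" "J \<subseteq> {0..c}" and cd: "0 \<le> c" "c < d"
    and A: "A \<in> cylinder_sets J" and S: "S \<in> sets borel"
  shows "A \<in> events" "prob (A \<inter> ((\<lambda>\<omega>. W d \<omega> - W c \<omega>) -` S \<inter> space P)) =
    prob A * prob ((\<lambda>\<omega>. W d \<omega> - W c \<omega>) -` S \<inter> space P)"
proof -
  define L where "L = sorted_list_of_set (insert 0 (insert c J))"
  define p where "p = length L"
  have L: "set L = insert 0 (insert c J)" "sorted_wrt (<) L"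
    unfolding L_def using J by (simp_all only: set_sorted_list_of_set strict_sorted_list_of_set finite_insert)
  have p: "0 < p" using L(1) by (auto simp: p_def)
  have mono: "L ! i < L ! j" if "i < j" "j < p" for i j
    using sorted_wrt_nth_less[OF L(2), of i j] that by (simp add: p_def)
  have range: "0 \<le> L ! i \<and> L ! i \<le> c" if "i < p" for i
    using that nth_mem[of i L] L(1) J cd by (auto simp: p_def)
  obtain i0 where i0: "i0 < p" "L ! i0 = 0"
    using L(1) by (metis in_set_conv_nth insertI1 p_def)
  have L0: "L ! 0 = 0"
    using mono[of 0 i0] range[of 0] i0 p by (cases "i0 = 0") auto
  obtain ic where ic: "ic < p" "L ! ic = c"
    using L(1) by (metis in_set_conv_nth insertI1 insertI2 p_def)
  have Lc: "L ! (p - 1) = c"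
  proof (cases "ic = p - 1")
    case False
    with ic have "ic < p - 1" by linarith
    with mono[of ic "p - 1"] range[of "p - 1"] ic p show ?thesis by simp
  qed (use ic in auto)
  \<comment> \<open>Index \<open>p\<close> is the appended time d; the values beyond it merely
    continue the sequence.\<close>
  define \<tau> where "\<tau> i = (if i < p then L ! i else d + real (i - p))" for i
  have tau: "\<tau> 0 = 0" "\<tau> (p - 1) = c" "\<tau> p = d"
    using L0 Lc p by (auto simp: \<tau>_def)
  have tmono: "\<tau> i < \<tau> (Suc i)" if "i < p" for i
    using that mono[of i "Suc i"] range[of i] cd by (auto simp: \<tau>_def)
  define X where "X i \<omega> = W (\<tau> (Suc i)) \<omega> - W (\<tau> i) \<omega>" for i \<omega>
  have "indep_vars (\<lambda>_. borel) (\<lambda>i \<omega>. W (\<tau> (Suc i)) \<omega> - W (\<tau> i) \<omega>) {..<p}"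
    using brownian tmono tau(1) unfolding std_brownian_motion_def by auto
  then have "indep_vars (\<lambda>_. borel) X {..<p}" by (simp add: X_def[abs_def])
  then have ind: "indep_var (PiM {..<p-1} (\<lambda>_. borel)) (\<lambda>\<omega>. restrict (\<lambda>i. X i \<omega>) {..<p-1})
     (PiM {p-1} (\<lambda>_. borel)) (\<lambda>\<omega>. restrict (\<lambda>i. X i \<omega>) {p-1})" (is "indep_var ?M1 ?X1 ?M2 ?X2")
    by (rule indep_var_restrict) (use p in auto)
  have X1: "?X1 \<in> measurable P ?M1" using ind by (simp add: indep_var_eq)
  have "A \<in> {?X1 -` B \<inter> space P | B. B \<in> sets ?M1}"
  proof -
    let ?V = "vimage_algebra (space P) ?X1 ?M1"
    have "sigma_sets (space ?V) (\<Union>s\<in>J. {(\<lambda>\<omega>. W s \<omega> - W 0 \<omega>) -` S \<inter> space P | S. S \<in> sets borel}) \<subseteq> sets ?V"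
    proof (rule sets.sigma_sets_subset, safe)
      fix s S' assume s: "s \<in> J" and S': "S' \<in> sets (borel :: real measure)"
      obtain k where k: "k < p" "s = L ! k"
        using L(1) s by (metis in_set_conv_nth insertI2 p_def)
      have "W s \<omega> - W 0 \<omega> = (\<Sum>i<k. ?X1 \<omega> i)" for \<omega>
      proof -
        have "(\<Sum>i<k. ?X1 \<omega> i) = (\<Sum>i<k. W (\<tau> (Suc i)) \<omega> - W (\<tau> i) \<omega>)"
          using k by (intro sum.cong) (auto simp: X_def)
        also have "\<dots> = W (\<tau> k) \<omega> - W (\<tau> 0) \<omega>"
          by (rule sum_lessThan_telescope[of "\<lambda>i. W (\<tau> i) \<omega>"])
        finally show ?thesis using k tau(1) by (simp add: \<tau>_def)
      qed
      then have "(\<lambda>\<omega>. W s \<omega> - W 0 \<omega>) -` S' \<inter> space P = ?X1 -` ((\<lambda>f. \<Sum>i<k. f i) -` S' \<inter> space ?M1) \<inter> space P"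
        using measurable_space[OF X1] by auto
      moreover have "(\<lambda>f. \<Sum>i<k. f i) \<in> borel_measurable ?M1"
        using k by (intro borel_measurable_sum measurable_component_singleton) auto
      then have "(\<lambda>f. \<Sum>i<k. f i) -` S' \<inter> space ?M1 \<in> sets ?M1"
        using S' by (rule measurable_sets)
      ultimately show "(\<lambda>\<omega>. W s \<omega> - W 0 \<omega>) -` S' \<inter> space P \<in> sets (vimage_algebra (space P) ?X1 ?M1)"
        by (simp only: in_vimage_algebra)
    qed
    then have "A \<in> sets ?V" using A by (auto simp: cylinder_sets_def)
    then show ?thesis
      using measurable_space[OF X1] by (subst (asm) sets_vimage_algebra2) auto
  qed
  then obtain B where B: "A = ?X1 -` B \<inter> space P" "B \<in> sets ?M1" by auto
  show "A \<in> events" unfolding B(1) by (rule measurable_sets[OF X1 B(2)])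
  have D: "(\<lambda>\<omega>. W d \<omega> - W c \<omega>) -` S \<inter> space P = ?X2 -` ((\<lambda>f. f (p-1)) -` S \<inter> space ?M2) \<inter> space P"
    using tau p by (auto simp: X_def space_PiM)
  have "(\<lambda>f. f (p-1)) -` S \<inter> space ?M2 \<in> sets ?M2"
    using S by (rule measurable_sets[rotated]) (auto intro: measurable_component_singleton)
  then have D': "?X2 -` ((\<lambda>f. f (p-1)) -` S \<inter> space ?M2) \<inter> space P \<in> sigma_sets (space P) {?X2 -` A \<inter> space P |A. A \<in> sets ?M2}"
    by (intro sigma_sets.Basic) blast
  have A': "A \<in> sigma_sets (space P) {?X1 -` A \<inter> space P |A. A \<in> sets ?M1}"
    using B by (intro sigma_sets.Basic) auto
  show "prob (A \<inter> ((\<lambda>\<omega>. W d \<omega> - W c \<omega>) -` S \<inter> space P)) =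
    prob A * prob ((\<lambda>\<omega>. W d \<omega> - W c \<omega>) -` S \<inter> space P)"
    unfolding D using ind A' D' unfolding indep_var_eq indep_sets2_eq by blast
qed

text \<open>Cylinder events over finite sets of times are closed under intersection, since two such
  sets have a finite union; so independence extends to the sigma algebra they generate. Each event
  of the augmented filtration differs from one of these by a null set.\<close>

lemma indep_set_increment:
  assumes cd: "0 \<le> c" "c < d"
  shows "indep_set (sets (Ft c)) (sigma_sets (space P) {(\<lambda>\<omega>. W d \<omega> - W c \<omega>) -` S \<inter> space P | S. S \<in> sets borel})"
    (is "indep_set _ (sigma_sets _ ?D)")
proof -
  have Dm: "(\<lambda>\<omega>. W d \<omega> - W c \<omega>) \<in> borel_measurable P" using cd by (intro borel_measurable_diff W_measurable) auto
  define G where "G = (\<Union>J\<in>{J. finite J \<and> J \<subseteq> {0..c}}. cylinder_sets J)"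
  have GD: "indep_set G ?D"
    unfolding indep_sets2_eq
  proof (intro conjI ballI subsetI)
    show "A \<in> events" if "A \<in> G" for A
      using that cylinder_indep(1)[OF _ _ cd, of _ A UNIV] by (auto simp: G_def)
    show "A \<in> events" if "A \<in> ?D" for A using that measurable_sets[OF Dm] by auto
    show "prob (a \<inter> b) = prob a * prob b" if "a \<in> G" "b \<in> ?D" for a b
      using that cylinder_indep(2)[OF _ _ cd] by (auto simp: G_def)
  qed
  have "Int_stable G"
  proof (rule Int_stableI)
    fix a b assume "a \<in> G" "b \<in> G"
    then obtain J K where JK: "finite J" "J \<subseteq> {0..c}" "a \<in> cylinder_sets J" "finite K" "K \<subseteq> {0..c}" "b \<in> cylinder_sets K"
      by (auto simp: G_def)
    interpret A: sigma_algebra "space P" "cylinder_sets (J \<union> K)"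
      unfolding cylinder_sets_def by (rule sigma_algebra_sigma_sets) auto
    have "a \<in> cylinder_sets (J \<union> K)" "b \<in> cylinder_sets (J \<union> K)"
      using JK cylinder_sets_mono[of J "J \<union> K"] cylinder_sets_mono[of K "J \<union> K"] by auto
    then have "a \<inter> b \<in> cylinder_sets (J \<union> K)" by auto
    then show "a \<inter> b \<in> G" using JK by (auto simp: G_def)
  qed
  moreover have "Int_stable ?D"
  proof (rule Int_stableI, safe)
    fix A B :: "real set" assume "A \<in> sets borel" "B \<in> sets borel"
    then show "\<exists>S. (\<lambda>\<omega>. W d \<omega> - W c \<omega>) -` A \<inter> space P \<inter> ((\<lambda>\<omega>. W d \<omega> - W c \<omega>) -` B \<inter> space P) =
      (\<lambda>\<omega>. W d \<omega> - W c \<omega>) -` S \<inter> space P \<and> S \<in> sets borel"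
      by (intro exI[of _ "A \<inter> B"]) auto
  qed
  ultimately have ind: "indep_set (sigma_sets (space P) G) (sigma_sets (space P) ?D)"
    by (intro indep_set_sigma_sets[OF GD])
  have GE: "sigma_sets (space P) G \<subseteq> events" and DE: "sigma_sets (space P) ?D \<subseteq> events"
    using ind unfolding indep_sets2_eq by auto
  \<comment> \<open>Induction over the generated sigma algebra: a null set is equivalent to the
    empty set, and an event of W s to the same event of W s - W 0.\<close>
  have ap: "A \<in> events \<and> (\<exists>A'\<in>sigma_sets (space P) G. AE \<omega> in P. \<omega> \<in> A \<longleftrightarrow> \<omega> \<in> A')" if "A \<in> sets (Ft c)" for A
    using that unfolding sets_Ft
  proof (induction rule: sigma_sets.induct)
    case (Basic A)
    then consider s S where "s \<in> {0..c}" "S \<in> sets borel" "A = W s -` S \<inter> space P" | "A \<in> null_sets P" by auto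
    then show ?case
    proof cases
      case 1
      then have "(\<lambda>\<omega>. W s \<omega> - W 0 \<omega>) -` S \<inter> space P \<in> cylinder_sets {s}"
        by (auto simp: cylinder_sets_def)
      with 1 have "(\<lambda>\<omega>. W s \<omega> - W 0 \<omega>) -` S \<inter> space P \<in> sigma_sets (space P) G"
        by (intro sigma_sets.Basic) (auto simp: G_def intro!: exI[of _ "{s}"])
      moreover have "AE \<omega> in P. \<omega> \<in> A \<longleftrightarrow> \<omega> \<in> (\<lambda>\<omega>. W s \<omega> - W 0 \<omega>) -` S \<inter> space P"
        using W_0 unfolding 1 by eventually_elim simp
      moreover have "A \<in> events" using 1 measurable_sets[OF W_measurable] by auto
      ultimately show ?thesis by blast
    next
      case 2
      then have "AE \<omega> in P. \<omega> \<in> A \<longleftrightarrow> \<omega> \<in> {}" using AE_not_in[OF 2] by auto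
      with 2 show ?thesis by (auto intro!: bexI[of _ "{}"] sigma_sets.Empty)
    qed
  next
    case Empty
    show ?case by (auto intro!: bexI[of _ "{}"] sigma_sets.Empty)
  next
    case (Compl A)
    then obtain A' where A': "A \<in> events" "A' \<in> sigma_sets (space P) G" "AE \<omega> in P. \<omega> \<in> A \<longleftrightarrow> \<omega> \<in> A'" by auto
    have "AE \<omega> in P. \<omega> \<in> space P - A \<longleftrightarrow> \<omega> \<in> space P - A'" using A'(3) by eventually_elim auto
    with A' show ?case by (auto intro!: bexI[of _ "space P - A'"] sigma_sets.Compl)
  next
    case (Union A)
    then have "\<forall>i. \<exists>A'\<in>sigma_sets (space P) G. AE \<omega> in P. \<omega> \<in> A i \<longleftrightarrow> \<omega> \<in> A'" by auto
    then obtain A' where A': "\<And>i::nat. A' i \<in> sigma_sets (space P) G" "\<And>i. AE \<omega> in P. \<omega> \<in> A i \<longleftrightarrow> \<omega> \<in> A' i"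
      by metis
    have "AE \<omega> in P. \<forall>i. \<omega> \<in> A i \<longleftrightarrow> \<omega> \<in> A' i" using A'(2) by (simp add: AE_all_countable)
    then have "AE \<omega> in P. \<omega> \<in> (\<Union>i. A i) \<longleftrightarrow> \<omega> \<in> (\<Union>i. A' i)" by eventually_elim auto
    moreover have "(\<Union>i. A' i) \<in> sigma_sets (space P) G" using A'(1) by (intro sigma_sets.Union)
    moreover have "(\<Union>i. A i) \<in> events" using Union by auto
    ultimately show ?case by blast
  qed
  show ?thesis
    unfolding indep_sets2_eq
  proof (intro conjI ballI DE sets_Ft_subset)
    fix a b assume a: "a \<in> sets (Ft c)" and b: "b \<in> sigma_sets (space P) ?D"
    obtain a' where a': "a \<in> events" "a' \<in> sigma_sets (space P) G" "AE \<omega> in P. \<omega> \<in> a \<longleftrightarrow> \<omega> \<in> a'"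
      using ap[OF a] by auto
    have "prob (a \<inter> b) = prob (a' \<inter> b)"
      using a' b GE DE by (intro finite_measure_eq_AE) auto
    also have "\<dots> = prob a' * prob b" using ind a'(2) b unfolding indep_sets2_eq by auto
    also have "prob a' = prob a" using a' GE by (intro finite_measure_eq_AE) auto
    finally show "prob (a \<inter> b) = prob a * prob b" .
  qed
qed

lemma indep_var_increment:
  assumes cd: "0 \<le> c" "c < d" and Y: "Y \<in> borel_measurable (Ft c)"
  shows "indep_var borel Y borel (\<lambda>\<omega>. W d \<omega> - W c \<omega>)"
  unfolding indep_var_eq
proof (intro conjI)
  have "sigma_sets (space P) {Y -` A \<inter> space P |A. A \<in> sets borel} \<subseteq> sets (Ft c)"
    using measurable_sets[OF Y] sets.sigma_sets_subset[of "{Y -` A \<inter> space P |A. A \<in> sets borel}" "Ft c"] by auto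
  then show "indep_set (sigma_sets (space P) {Y -` A \<inter> space P |A. A \<in> sets borel})
     (sigma_sets (space P) {(\<lambda>\<omega>. W d \<omega> - W c \<omega>) -` A \<inter> space P |A. A \<in> sets borel})"
    using indep_set_increment[OF cd] unfolding indep_sets2_eq by blast
qed (use cd in \<open>auto intro: measurable_Ft_P[OF Y]\<close>)

lemma increment_moments:
  assumes cd: "0 \<le> c" "c < d"
  shows "(\<lambda>\<omega>. W d \<omega> - W c \<omega>) \<in> L2 P" "expectation (\<lambda>\<omega>. W d \<omega> - W c \<omega>) = 0"
    "expectation (\<lambda>\<omega>. (W d \<omega> - W c \<omega>)\<^sup>2) = d - c"
proof -
  have s: "0 < sqrt (d - c)" using cd by simp
  have D: "distributed P lborel (\<lambda>\<omega>. W d \<omega> - W c \<omega>) (normal_density 0 (sqrt (d - c)))"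
    using brownian cd by (auto simp: std_brownian_motion_def)
  show e: "expectation (\<lambda>\<omega>. W d \<omega> - W c \<omega>) = 0"
    by (rule normal_distributed_expectation[OF s D])
  show "expectation (\<lambda>\<omega>. (W d \<omega> - W c \<omega>)\<^sup>2) = d - c"
    using normal_distributed_variance[OF s D] e cd by simp
  have "integrable lborel (\<lambda>x. normal_density 0 (sqrt (d - c)) x * x\<^sup>2)"
    using integrable_normal_moment[OF s, of 0 2] by simp
  then have "integrable P (\<lambda>\<omega>. (W d \<omega> - W c \<omega>)\<^sup>2)"
    by (subst distributed_integrable[OF D, of "\<lambda>x. x\<^sup>2", symmetric]) auto
  then show "(\<lambda>\<omega>. W d \<omega> - W c \<omega>) \<in> L2 P"
    using cd by (auto simp: L2_def)
qed

end

text \<open>The time space restricts the time factor before the product is taken. With the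
  restriction moved outside, all horizons become subsets of one measure space, on which processes
  can be compared.\<close>

lemma restrict_pair_measure_eq:
  fixes S :: "'a set"
  assumes "sigma_finite_measure M" "sigma_finite_measure N" and S: "S \<in> sets M"
  shows "restrict_space M S \<Otimes>\<^sub>M N = restrict_space (M \<Otimes>\<^sub>M N) (S \<times> space N)"
proof (rule pair_measure_eqI)
  interpret N: sigma_finite_measure N by fact
  have SN: "S \<times> space N \<inter> space (M \<Otimes>\<^sub>M N) \<in> sets (M \<Otimes>\<^sub>M N)" using S by auto
  show "sigma_finite_measure (restrict_space M S)"
    using assms(1) S by (intro sigma_finite_measure_restrict_space) auto
  show "sigma_finite_measure N" by fact
  show eq: "sets (restrict_space M S \<Otimes>\<^sub>M N) = sets (restrict_space (M \<Otimes>\<^sub>M N) (S \<times> space N))"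
  proof (rule antisym)
    have sp: "space (restrict_space M S) \<times> space N = space (restrict_space (M \<Otimes>\<^sub>M N) (S \<times> space N))"
      by (auto simp: space_restrict_space space_pair_measure)
    show "sets (restrict_space M S \<Otimes>\<^sub>M N) \<subseteq> sets (restrict_space (M \<Otimes>\<^sub>M N) (S \<times> space N))"
      unfolding sets_pair_measure sp
    proof (rule sets.sigma_sets_subset, safe)
      fix a b assume "a \<in> sets (restrict_space M S)" "b \<in> sets N"
      moreover then have "a \<times> b \<subseteq> S \<times> space N" using S sets.sets_into_space
        by (auto simp: sets_restrict_space_iff dest!: sets.sets_into_space)
      ultimately show "a \<times> b \<in> sets (restrict_space (M \<Otimes>\<^sub>M N) (S \<times> space N))"
        using S by (subst sets_restrict_space_iff[OF SN]) (auto simp: sets_restrict_space_iff)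
    qed
    show "sets (restrict_space (M \<Otimes>\<^sub>M N) (S \<times> space N)) \<subseteq> sets (restrict_space M S \<Otimes>\<^sub>M N)"
    proof
      fix A assume "A \<in> sets (restrict_space (M \<Otimes>\<^sub>M N) (S \<times> space N))"
      then have A: "A \<in> sets (M \<Otimes>\<^sub>M N)" "A \<subseteq> S \<times> space N" by (simp_all add: sets_restrict_space_iff[OF SN])
      have "(\<lambda>x. x) \<in> measurable (restrict_space M S) M" by (intro measurable_restrict_space1) simp
      then have "fst \<in> measurable (restrict_space M S \<Otimes>\<^sub>M N) M"
        using measurable_compose[OF measurable_fst] by fastforce
      then have "(\<lambda>z. z) \<in> measurable (restrict_space M S \<Otimes>\<^sub>M N) (M \<Otimes>\<^sub>M N)"
        by (subst measurable_pair_iff) (simp add: comp_def)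
      from measurable_sets[OF this A(1)]
      have "(\<lambda>z. z) -` A \<inter> space (restrict_space M S \<Otimes>\<^sub>M N) \<in> sets (restrict_space M S \<Otimes>\<^sub>M N)" .
      also have "(\<lambda>z. z) -` A \<inter> space (restrict_space M S \<Otimes>\<^sub>M N) = A"
        using A(2) S by (auto simp: space_pair_measure)
      finally show "A \<in> sets (restrict_space M S \<Otimes>\<^sub>M N)" .
    qed
  qed
  fix A B assume A: "A \<in> sets (restrict_space M S)" and B: "B \<in> sets N"
  have AS: "A \<subseteq> S" "A \<in> sets M" using A S by (auto simp: sets_restrict_space_iff)
  have "emeasure (restrict_space M S) A * emeasure N B = emeasure M A * emeasure N B"
    using AS S by (subst emeasure_restrict_space) auto
  also have "\<dots> = emeasure (M \<Otimes>\<^sub>M N) (A \<times> B)" using AS B by (simp add: N.emeasure_pair_measure_Times)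
  also have "\<dots> = emeasure (restrict_space (M \<Otimes>\<^sub>M N) (S \<times> space N)) (A \<times> B)"
    using AS sets.sets_into_space[OF B] by (subst emeasure_restrict_space[OF SN]) auto
  finally show "emeasure (restrict_space M S) A * emeasure N B = emeasure (restrict_space (M \<Otimes>\<^sub>M N) (S \<times> space N)) (A \<times> B)" .
qed

section \<open>The isometry for simple integrands\<close>

context brownian
begin

text \<open>These are the conditional moments of an increment given the past, expressed through
  independence of \<open>Y\<close> and the increment instead of conditional expectation.\<close>

lemma increment_mult:
  assumes Y: "Y \<in> borel_measurable (Ft c)" "integrable P Y" and cd: "0 \<le> c" "c < d"
  shows "integrable P (\<lambda>\<omega>. Y \<omega> * (W d \<omega> - W c \<omega>))"
    "expectation (\<lambda>\<omega>. Y \<omega> * (W d \<omega> - W c \<omega>)) = 0"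
    "integrable P (\<lambda>\<omega>. Y \<omega> * (W d \<omega> - W c \<omega>)\<^sup>2)"
    "expectation (\<lambda>\<omega>. Y \<omega> * (W d \<omega> - W c \<omega>)\<^sup>2) = expectation Y * (d - c)"
proof -
  note D = increment_moments[OF cd]
  have iD: "integrable P (\<lambda>\<omega>. W d \<omega> - W c \<omega>)"
    using D(1) finite_measure_axioms by (rule L2_integrable[rotated])
  have ind: "indep_var borel Y borel (\<lambda>\<omega>. W d \<omega> - W c \<omega>)"
    by (rule indep_var_increment[OF cd Y(1)])
  show "integrable P (\<lambda>\<omega>. Y \<omega> * (W d \<omega> - W c \<omega>))"
    by (rule indep_var_integrable[OF ind Y(2) iD])
  show "expectation (\<lambda>\<omega>. Y \<omega> * (W d \<omega> - W c \<omega>)) = 0"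
    using indep_var_lebesgue_integral[OF ind Y(2) iD] D(2) by simp
  have ind2: "indep_var borel Y borel (\<lambda>\<omega>. (W d \<omega> - W c \<omega>)\<^sup>2)"
    using indep_var_compose[OF ind, of "\<lambda>x. x" borel "\<lambda>x. x\<^sup>2" borel] by (simp add: comp_def)
  show "integrable P (\<lambda>\<omega>. Y \<omega> * (W d \<omega> - W c \<omega>)\<^sup>2)"
    by (rule indep_var_integrable[OF ind2 Y(2) L2_integrable_sq[OF D(1)]])
  show "expectation (\<lambda>\<omega>. Y \<omega> * (W d \<omega> - W c \<omega>)\<^sup>2) = expectation Y * (d - c)"
    using indep_var_lebesgue_integral[OF ind2 Y(2) L2_integrable_sq[OF D(1)]] D(3) by simp
qed

lemma bounded_mult_L2:
  assumes "\<xi> \<in> borel_measurable P" "\<And>\<omega>. \<omega> \<in> space P \<Longrightarrow> \<bar>\<xi> \<omega>\<bar> \<le> C" "X \<in> L2 P"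
  shows "(\<lambda>\<omega>. \<xi> \<omega> * X \<omega>) \<in> L2 P"
  unfolding L2_def
proof (safe)
  have [measurable]: "X \<in> borel_measurable P" "\<xi> \<in> borel_measurable P" using assms by (auto dest: L2_measurable)
  show "(\<lambda>\<omega>. \<xi> \<omega> * X \<omega>) \<in> borel_measurable P" by measurable
  show "integrable P (\<lambda>x. (\<xi> x * X x)\<^sup>2)"
  proof (rule Bochner_Integration.integrable_bound)
    show "integrable P (\<lambda>x. C\<^sup>2 * (X x)\<^sup>2)" using assms by (intro integrable_mult_right L2_integrable_sq)
    show "AE x in P. norm ((\<xi> x * X x)\<^sup>2) \<le> norm (C\<^sup>2 * (X x)\<^sup>2)"
    proof (rule AE_I2)
      fix x assume "x \<in> space P"
      then have "(\<xi> x)\<^sup>2 \<le> C\<^sup>2" using assms(2)[of x] by (simp add: abs_le_square_iff[symmetric])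
      then show "norm ((\<xi> x * X x)\<^sup>2) \<le> norm (C\<^sup>2 * (X x)\<^sup>2)"
        by (simp add: power_mult_distrib mult_right_mono)
    qed
  qed measurable
qed

lemma increment_L2: "0 \<le> c \<Longrightarrow> c \<le> d \<Longrightarrow> (\<lambda>\<omega>. W d \<omega> - W c \<omega>) \<in> L2 P"
  using increment_moments(1)[of c d] L2_zero[of P] by (cases "c = d") auto

text \<open>If b \<le> c, the later increment is independent of all other factors and has mean zero.
  Otherwise the product is cut at c and at the nearer right end, so that only the squared increment
  over the overlap contributes.\<close>

lemma step_product_ordered:
  assumes ab: "0 \<le> a" "a < b" and cd: "c < d" and ac: "a \<le> c"
    and \<xi>: "\<xi> \<in> borel_measurable (Ft a)" "\<And>\<omega>. \<omega> \<in> space P \<Longrightarrow> \<bar>\<xi> \<omega>\<bar> \<le> C"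
    and \<eta>: "\<eta> \<in> borel_measurable (Ft c)" "\<And>\<omega>. \<omega> \<in> space P \<Longrightarrow> \<bar>\<eta> \<omega>\<bar> \<le> D"
  shows "expectation (\<lambda>\<omega>. (\<xi> \<omega> * (W b \<omega> - W a \<omega>)) * (\<eta> \<omega> * (W d \<omega> - W c \<omega>))) =
    expectation (\<lambda>\<omega>. \<xi> \<omega> * \<eta> \<omega>) * max 0 (min b d - max a c)"
proof -
  define Z where "Z \<omega> = \<xi> \<omega> * \<eta> \<omega>" for \<omega>
  have Zc: "Z \<in> borel_measurable (Ft c)"
    unfolding Z_def[abs_def] using \<eta>(1) measurable_Ft_mono[OF \<xi>(1) ac] by measurable
  note Zm = measurable_Ft_P[OF Zc]
  have Zb: "\<bar>Z \<omega>\<bar> \<le> C * D" if "\<omega> \<in> space P" for \<omega>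
    using mult_mono[OF \<xi>(2)[OF that] \<eta>(2)[OF that]] \<xi>(2)[OF that] by (simp add: Z_def abs_mult)
  have Zi: "integrable P (\<lambda>\<omega>. Z \<omega> * X \<omega>)" if "X \<in> L2 P" for X
    using bounded_mult_L2[OF Zm Zb that] finite_measure_axioms by (rule L2_integrable[rotated])
  have eq: "(\<xi> \<omega> * (W b \<omega> - W a \<omega>)) * (\<eta> \<omega> * (W d \<omega> - W c \<omega>)) = Z \<omega> * (W b \<omega> - W a \<omega>) * (W d \<omega> - W c \<omega>)" for \<omega>
    by (simp add: Z_def)
  have c0: "0 \<le> c" using ab ac by simp
  show ?thesis
  proof (cases "b \<le> c")
    case True
    have "(\<lambda>\<omega>. Z \<omega> * (W b \<omega> - W a \<omega>)) \<in> borel_measurable (Ft c)"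
      using True ab by (intro borel_measurable_times borel_measurable_diff Zc W_measurable_Ft) auto
    from increment_mult(2)[OF this Zi[OF increment_L2] c0 cd]
    show ?thesis using True cd ab ac unfolding eq by (simp add: min_def max_def)
  next
    case False
    \<comment> \<open>The overlap is the interval from c to e; whichever interval reaches further
      sticks out from e to f.\<close>
    define e where "e = min b d"
    define f where "f = max b d"
    have e: "c < e" "e \<le> f" using False cd by (auto simp: e_def f_def)
    have 1: "(\<lambda>\<omega>. Z \<omega> * (W c \<omega> - W a \<omega>)) \<in> borel_measurable (Ft c)"
      using ab ac by (intro borel_measurable_times borel_measurable_diff Zc W_measurable_Ft) auto
    note 1 = increment_mult[OF 1 Zi[OF increment_L2[OF ab(1) ac]] c0 cd]
    have "integrable P Z" using Zi[OF L2_const[of P 1]] finite_measure_axioms by simp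
    note 2 = increment_mult[OF Zc this c0 e(1)]
    have 3: "integrable P (\<lambda>\<omega>. Z \<omega> * (W e \<omega> - W c \<omega>) * (W f \<omega> - W e \<omega>)) \<and>
      expectation (\<lambda>\<omega>. Z \<omega> * (W e \<omega> - W c \<omega>) * (W f \<omega> - W e \<omega>)) = 0"
    proof (cases "e = f")
      case False
      have "(\<lambda>\<omega>. Z \<omega> * (W e \<omega> - W c \<omega>)) \<in> borel_measurable (Ft e)"
        using c0 e by (intro borel_measurable_times borel_measurable_diff measurable_Ft_mono[OF Zc, of e] W_measurable_Ft) auto
      from increment_mult(1,2)[OF this Zi[OF increment_L2], of f] show ?thesis
        using False e c0 by auto
    qed simp
    have "(\<xi> \<omega> * (W b \<omega> - W a \<omega>)) * (\<eta> \<omega> * (W d \<omega> - W c \<omega>)) =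
      Z \<omega> * (W c \<omega> - W a \<omega>) * (W d \<omega> - W c \<omega>) + (Z \<omega> * (W e \<omega> - W c \<omega>)\<^sup>2 + Z \<omega> * (W e \<omega> - W c \<omega>) * (W f \<omega> - W e \<omega>))" for \<omega>
      unfolding eq by (cases "b \<le> d") (auto simp: e_def f_def min_def max_def power2_eq_square algebra_simps)
    then have "expectation (\<lambda>\<omega>. (\<xi> \<omega> * (W b \<omega> - W a \<omega>)) * (\<eta> \<omega> * (W d \<omega> - W c \<omega>))) = expectation Z * (e - c)"
      using 1 2 3 by simp
    then show ?thesis using e ac by (simp add: e_def Z_def[abs_def] max_def)
  qed
qed

lemma step_product:
  assumes ab: "0 \<le> a" "a < b" and cd: "0 \<le> c" "c < d"
    and \<xi>: "\<xi> \<in> borel_measurable (Ft a)" "\<And>\<omega>. \<omega> \<in> space P \<Longrightarrow> \<bar>\<xi> \<omega>\<bar> \<le> C"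
    and \<eta>: "\<eta> \<in> borel_measurable (Ft c)" "\<And>\<omega>. \<omega> \<in> space P \<Longrightarrow> \<bar>\<eta> \<omega>\<bar> \<le> D"
  shows "expectation (\<lambda>\<omega>. (\<xi> \<omega> * (W b \<omega> - W a \<omega>)) * (\<eta> \<omega> * (W d \<omega> - W c \<omega>))) =
    expectation (\<lambda>\<omega>. \<xi> \<omega> * \<eta> \<omega>) * max 0 (min b d - max a c)"
proof (cases "a \<le> c")
  case True
  from step_product_ordered[OF ab cd(2) True \<xi> \<eta>] show ?thesis .
next
  case False
  then have "c \<le> a" by simp
  from step_product_ordered[OF cd ab(2) this \<eta> \<xi>] show ?thesis
    by (simp add: mult.commute min.commute max.commute)
qed

abbreviation Q :: "(real \<times> 'w) measure" where
  "Q \<equiv> lborel \<Otimes>\<^sub>M P"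

sublocale Q: pair_sigma_finite lborel P ..

lemma time_space_eq: "time_space P t = restrict_space Q ({0..t} \<times> space P)"
  by (rule restrict_pair_measure_eq[OF lborel.sigma_finite_measure_axioms sigma_finite_measure_axioms]) simp

lemma simple_integrandD:
  assumes "simple_integrand Ft t p \<tau> \<xi>" "i < p"
  shows "0 \<le> \<tau> i" "\<tau> i < \<tau> (Suc i)" "\<tau> (Suc i) \<le> t" "\<xi> i \<in> borel_measurable (Ft (\<tau> i))"
    "\<xi> i \<in> borel_measurable P" "\<exists>C. \<forall>\<omega>\<in>space P. \<bar>\<xi> i \<omega>\<bar> \<le> C"
proof -
  have m: "\<tau> j \<le> \<tau> k" if "j \<le> k" "k \<le> p" for j k
    using that
  proof (induction k rule: dec_induct)
    case (step k)
    then have "\<tau> k < \<tau> (Suc k)" using assms(1) by (auto simp: simple_integrand_def)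
    then show ?case using step by simp
  qed simp
  show "0 \<le> \<tau> i" using m[of 0 i] assms by (simp add: simple_integrand_def)
  show "\<tau> (Suc i) \<le> t" using m[of "Suc i" p] assms by (simp add: simple_integrand_def)
  show "\<tau> i < \<tau> (Suc i)" "\<exists>C. \<forall>\<omega>\<in>space P. \<bar>\<xi> i \<omega>\<bar> \<le> C"
    "\<xi> i \<in> borel_measurable (Ft (\<tau> i))"
    using assms by (auto simp: simple_integrand_def)
  show "\<xi> i \<in> borel_measurable P" by (rule measurable_Ft_P) fact
qed

lemma simple_ito_integral_L2:
  assumes "simple_integrand Ft t p \<tau> \<xi>"
  shows "simple_ito_integral W p \<tau> \<xi> \<in> L2 P"
  unfolding simple_ito_integral_def[abs_def]
proof (rule L2_sum)
  fix i assume "i \<in> {..<p}"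
  then have i: "i < p" by simp
  obtain C where "\<forall>\<omega>\<in>space P. \<bar>\<xi> i \<omega>\<bar> \<le> C" using simple_integrandD(6)[OF assms i] by auto
  then show "(\<lambda>\<omega>. \<xi> i \<omega> * (W (\<tau> (Suc i)) \<omega> - W (\<tau> i) \<omega>)) \<in> L2 P"
    using simple_integrandD[OF assms i] by (intro bounded_mult_L2[of _ C] increment_L2) auto
qed

lemma simple_ito_integral_Ft:
  assumes "simple_integrand Ft t p \<tau> \<xi>"
  shows "simple_ito_integral W p \<tau> \<xi> \<in> borel_measurable (Ft t)"
  unfolding simple_ito_integral_def[abs_def]
proof (intro borel_measurable_sum borel_measurable_times borel_measurable_diff)
  fix i assume "i \<in> {..<p}"
  then have i: "i < p" by simp
  note D = simple_integrandD[OF assms i]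
  show "\<xi> i \<in> borel_measurable (Ft t)" using measurable_Ft_mono[OF D(4)] D by auto
  show "W (\<tau> (Suc i)) \<in> borel_measurable (Ft t)" "W (\<tau> i) \<in> borel_measurable (Ft t)"
    using D by (auto intro!: W_measurable_Ft)
qed

lemma product_integral:
  fixes f :: "real \<Rightarrow> real" and g :: "'w \<Rightarrow> real"
  assumes f: "integrable lborel f" and g: "integrable P g"
  shows "integrable Q (\<lambda>z. f (fst z) * g (snd z))"
    "(\<integral>z. f (fst z) * g (snd z) \<partial>Q) = (\<integral>x. f x \<partial>lborel) * expectation g"
proof -
  have [measurable]: "f \<in> borel_measurable borel" "g \<in> borel_measurable P" using f g by auto
  show *: "integrable Q (\<lambda>z. f (fst z) * g (snd z))"
    by (rule Q.Fubini_integrable) (use f g in \<open>auto simp: abs_mult\<close>)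
  show "(\<integral>z. f (fst z) * g (snd z) \<partial>Q) = (\<integral>x. f x \<partial>lborel) * expectation g"
    using Q.integral_fst'[OF *] by simp
qed

text \<open>The product of two steps lives on the intersection of their intervals, whose length is
  the same factor as in \<open>step_product\<close>.\<close>

lemma step_inner:
  assumes "\<xi> \<in> L2 P" "\<eta> \<in> L2 P"
  shows "integrable Q (\<lambda>z. (\<xi> (snd z) * indicator {a<..b} (fst z)) * (\<eta> (snd z) * indicator {c<..d} (fst z)))"
    "(\<integral>z. (\<xi> (snd z) * indicator {a<..b} (fst z)) * (\<eta> (snd z) * indicator {c<..d} (fst z)) \<partial>Q) =
      expectation (\<lambda>\<omega>. \<xi> \<omega> * \<eta> \<omega>) * max 0 (min b d - max a c)"
proof -
  have [measurable]: "\<xi> \<in> borel_measurable P" "\<eta> \<in> borel_measurable P"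
    using assms by (auto dest: L2_measurable)
  have i: "integrable P (\<lambda>\<omega>. \<xi> \<omega> * \<eta> \<omega>)" using assms by (rule L2_mult_integrable)
  have eq: "(\<xi> (snd z) * indicator {a<..b} (fst z)) * (\<eta> (snd z) * indicator {c<..d} (fst z))
    = indicator {max a c<..min b d} (fst z) * (\<xi> (snd z) * \<eta> (snd z))" for z
    by (auto simp: indicator_def)
  note pr = product_integral[of "indicator {max a c<..min b d}", OF _ i]
  have ind: "integrable lborel (indicator {max a c<..min b d} :: real \<Rightarrow> real)"
    by (cases "max a c \<le> min b d") (auto simp: integrable_indicator_iff)
  show "integrable Q (\<lambda>z. (\<xi> (snd z) * indicator {a<..b} (fst z)) * (\<eta> (snd z) * indicator {c<..d} (fst z)))"
    unfolding eq by (rule pr(1)[OF ind])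
  show "(\<integral>z. (\<xi> (snd z) * indicator {a<..b} (fst z)) * (\<eta> (snd z) * indicator {c<..d} (fst z)) \<partial>Q) =
      expectation (\<lambda>\<omega>. \<xi> \<omega> * \<eta> \<omega>) * max 0 (min b d - max a c)"
    unfolding eq pr(2)[OF ind] by (cases "max a c \<le> min b d") (auto simp: max_def)
qed

lemma simple_process_L2:
  assumes "simple_integrand Ft t p \<tau> \<xi>"
  shows "(\<lambda>z. simple_process p \<tau> \<xi> (fst z) (snd z)) \<in> L2 Q"
  unfolding simple_process_def
proof (rule L2_sum)
  fix i assume "i \<in> {..<p}"
  then have i: "i < p" by simp
  have [measurable]: "\<xi> i \<in> borel_measurable P" using simple_integrandD[OF assms i] by simp
  have "\<xi> i \<in> L2 P" using simple_integrandD(5,6)[OF assms i] finite_measure_axioms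
    by (auto intro: L2_bounded)
  from step_inner(1)[OF this this, of "\<tau> i" "\<tau> (Suc i)" "\<tau> i" "\<tau> (Suc i)"]
  show "(\<lambda>z. \<xi> i (snd z) * indicator {\<tau> i<..\<tau> (Suc i)} (fst z)) \<in> L2 Q"
    unfolding L2_def by (auto simp: power2_eq_square)
qed

lemma simple_process_support:
  assumes "simple_integrand Ft t p \<tau> \<xi>" "s \<notin> {0<..t}"
  shows "simple_process p \<tau> \<xi> s \<omega> = 0"
  unfolding simple_process_def
proof (rule sum.neutral, safe)
  fix i assume "i < p"
  with simple_integrandD[OF assms(1) this] assms(2)
  show "\<xi> i \<omega> * indicator {\<tau> i<..\<tau> (Suc i)} s = 0" by (auto simp: indicator_def)
qed

text \<open>Both sides are expanded into pairs of steps and compared pair by pair. This allows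
  different partitions and different horizons without a common refinement.\<close>

lemma simple_isometry:
  assumes S: "simple_integrand Ft s p \<tau> \<xi>" and T: "simple_integrand Ft t q \<sigma> \<eta>"
  shows "expectation (\<lambda>\<omega>. simple_ito_integral W p \<tau> \<xi> \<omega> * simple_ito_integral W q \<sigma> \<eta> \<omega>) =
    (\<integral>z. simple_process p \<tau> \<xi> (fst z) (snd z) * simple_process q \<sigma> \<eta> (fst z) (snd z) \<partial>Q)"
proof -
  have L2: "\<xi> i \<in> L2 P" if "i < p" for i
    using simple_integrandD(5,6)[OF S that] finite_measure_axioms by (auto intro: L2_bounded)
  have L2': "\<eta> j \<in> L2 P" if "j < q" for j
    using simple_integrandD(5,6)[OF T that] finite_measure_axioms by (auto intro: L2_bounded)
  have I1: "(\<lambda>\<omega>. \<xi> i \<omega> * (W (\<tau> (Suc i)) \<omega> - W (\<tau> i) \<omega>)) \<in> L2 P" if i: "i < p" for i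
  proof -
    obtain C where "\<forall>\<omega>\<in>space P. \<bar>\<xi> i \<omega>\<bar> \<le> C" using simple_integrandD(6)[OF S i] by auto
    then show ?thesis
      using simple_integrandD[OF S i] by (intro bounded_mult_L2[of _ C] increment_L2) auto
  qed
  have I2: "(\<lambda>\<omega>. \<eta> j \<omega> * (W (\<sigma> (Suc j)) \<omega> - W (\<sigma> j) \<omega>)) \<in> L2 P" if j: "j < q" for j
  proof -
    obtain C where "\<forall>\<omega>\<in>space P. \<bar>\<eta> j \<omega>\<bar> \<le> C" using simple_integrandD(6)[OF T j] by auto
    then show ?thesis
      using simple_integrandD[OF T j] by (intro bounded_mult_L2[of _ C] increment_L2) auto
  qed
  have "expectation (\<lambda>\<omega>. simple_ito_integral W p \<tau> \<xi> \<omega> * simple_ito_integral W q \<sigma> \<eta> \<omega>)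
    = (\<Sum>i<p. \<Sum>j<q. expectation (\<lambda>\<omega>. (\<xi> i \<omega> * (W (\<tau> (Suc i)) \<omega> - W (\<tau> i) \<omega>)) * (\<eta> j \<omega> * (W (\<sigma> (Suc j)) \<omega> - W (\<sigma> j) \<omega>))))"
    unfolding simple_ito_integral_def sum_product
    by (subst Bochner_Integration.integral_sum, (intro Bochner_Integration.integrable_sum L2_mult_integrable I1 I2; simp),
        intro sum.cong refl Bochner_Integration.integral_sum L2_mult_integrable I1 I2; simp)
  also have "\<dots> = (\<Sum>i<p. \<Sum>j<q. \<integral>z. (\<xi> i (snd z) * indicator {\<tau> i<..\<tau> (Suc i)} (fst z)) * (\<eta> j (snd z) * indicator {\<sigma> j<..\<sigma> (Suc j)} (fst z)) \<partial>Q)"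
  proof (intro sum.cong refl)
    fix i j assume "i \<in> {..<p}" "j \<in> {..<q}"
    then have i: "i < p" and j: "j < q" by auto
    obtain C where C: "\<And>\<omega>. \<omega> \<in> space P \<Longrightarrow> \<bar>\<xi> i \<omega>\<bar> \<le> C" using simple_integrandD(6)[OF S i] by auto
    obtain D where D: "\<And>\<omega>. \<omega> \<in> space P \<Longrightarrow> \<bar>\<eta> j \<omega>\<bar> \<le> D" using simple_integrandD(6)[OF T j] by auto
    show "expectation (\<lambda>\<omega>. (\<xi> i \<omega> * (W (\<tau> (Suc i)) \<omega> - W (\<tau> i) \<omega>)) * (\<eta> j \<omega> * (W (\<sigma> (Suc j)) \<omega> - W (\<sigma> j) \<omega>)))
      = (\<integral>z. (\<xi> i (snd z) * indicator {\<tau> i<..\<tau> (Suc i)} (fst z)) * (\<eta> j (snd z) * indicator {\<sigma> j<..\<sigma> (Suc j)} (fst z)) \<partial>Q)"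
      unfolding step_inner(2)[OF L2[OF i] L2'[OF j]]
      by (rule step_product[OF _ _ _ _ _ C _ D]) (use simple_integrandD[OF S i] simple_integrandD[OF T j] in auto)
  qed
  also have "\<dots> = (\<integral>z. simple_process p \<tau> \<xi> (fst z) (snd z) * simple_process q \<sigma> \<eta> (fst z) (snd z) \<partial>Q)"
    unfolding simple_process_def sum_product
    by (subst Bochner_Integration.integral_sum, (intro Bochner_Integration.integrable_sum step_inner L2 L2'; simp),
        intro sum.cong refl Bochner_Integration.integral_sum[symmetric] step_inner L2 L2'; simp)
  finally show ?thesis .
qed

end

text \<open>The definition of the Ito integral uses nonnegative integrals that may be infinite. Once
  one of them is finite, \<open>X\<close> differs from an element of L2 by an element of L2, and all
  of them become real integrals.\<close>

lemma L2_nn_tendsto: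
  assumes X: "X \<in> borel_measurable M" and Y: "\<And>k::nat. Y k \<in> L2 M"
    and lim: "(\<lambda>k. \<integral>\<^sup>+x. ennreal ((X x - Y k x)\<^sup>2) \<partial>M) \<longlonglongrightarrow> 0"
  shows "X \<in> L2 M" "(\<lambda>k. \<integral>x. (X x - Y k x)\<^sup>2 \<partial>M) \<longlonglongrightarrow> 0"
proof -
  have [measurable]: "Y k \<in> borel_measurable M" for k using Y by auto
  have "eventually (\<lambda>k. (\<integral>\<^sup>+x. ennreal ((X x - Y k x)\<^sup>2) \<partial>M) < 1) sequentially"
    using lim by (rule order_tendstoD) simp
  then obtain k where k: "(\<integral>\<^sup>+x. ennreal ((X x - Y k x)\<^sup>2) \<partial>M) < 1"
    by (auto simp: eventually_sequentially)
  have "(\<lambda>x. X x - Y k x) \<in> L2 M"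
    unfolding L2_iff_nn using X k by (auto intro: less_trans)
  from L2_add[OF this Y[of k]] show X2: "X \<in> L2 M" by simp
  have "(\<integral>\<^sup>+x. ennreal ((X x - Y k x)\<^sup>2) \<partial>M) = ennreal (\<integral>x. (X x - Y k x)\<^sup>2 \<partial>M)" for k
    by (rule L2_nn_integral[OF L2_diff[OF X2 Y]])
  with lim have "(\<lambda>k. ennreal (\<integral>x. (X x - Y k x)\<^sup>2 \<partial>M)) \<longlonglongrightarrow> ennreal 0" by simp
  then show "(\<lambda>k. \<integral>x. (X x - Y k x)\<^sup>2 \<partial>M) \<longlonglongrightarrow> 0"
    by (subst (asm) tendsto_ennreal_iff) auto
qed

lemma L2_tendsto_nn:
  assumes X: "X \<in> L2 M" and Y: "\<And>k::nat. Y k \<in> L2 M"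
    and lim: "(\<lambda>k. \<integral>x. (X x - Y k x)\<^sup>2 \<partial>M) \<longlonglongrightarrow> 0"
  shows "(\<lambda>k. \<integral>\<^sup>+x. ennreal ((X x - Y k x)\<^sup>2) \<partial>M) \<longlonglongrightarrow> 0"
proof -
  have "(\<integral>\<^sup>+x. ennreal ((X x - Y k x)\<^sup>2) \<partial>M) = ennreal (\<integral>x. (X x - Y k x)\<^sup>2 \<partial>M)" for k
    by (rule L2_nn_integral[OF L2_diff[OF X Y]])
  then show ?thesis using tendsto_ennrealI[OF lim] by simp
qed

lemma L2_AE_zero:
  assumes "X \<in> L2 M" "(\<integral>x. (X x)\<^sup>2 \<partial>M) = 0"
  shows "AE x in M. X x = 0"
  using assms integral_nonneg_eq_0_iff_AE[of M "\<lambda>x. (X x)\<^sup>2"] by (auto simp: L2_def)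

section \<open>Square integrable adapted processes and their Ito integrals\<close>

context brownian
begin

text \<open>A process is set to zero outside the time interval, so that all processes live in one space.\<close>

definition cutoff :: "real \<Rightarrow> (real \<Rightarrow> 'w \<Rightarrow> real) \<Rightarrow> real \<times> 'w \<Rightarrow> real" where
  "cutoff t f z = (if 0 \<le> fst z \<and> fst z \<le> t then f (fst z) (snd z) else 0)"

definition H :: "real \<Rightarrow> (real \<Rightarrow> 'w \<Rightarrow> real) set" where
  "H t = {f. measurable_adapted P Ft t f \<and> cutoff t f \<in> L2 Q}"

lemma measurable_cut: "(\<lambda>(s, \<omega>). f s \<omega>) \<in> borel_measurable (time_space P t) \<longleftrightarrow> cutoff t f \<in> borel_measurable Q"
proof -
  have "{0..t} \<times> space P \<inter> space Q \<in> sets Q" by auto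
  from borel_measurable_restrict_space_iff[OF this, of "\<lambda>(s, \<omega>). f s \<omega>"]
  have "(\<lambda>(s, \<omega>). f s \<omega>) \<in> borel_measurable (time_space P t) \<longleftrightarrow>
     (\<lambda>x. indicator ({0..t} \<times> space P) x *\<^sub>R (\<lambda>(s, \<omega>). f s \<omega>) x) \<in> borel_measurable Q"
    unfolding time_space_eq .
  also have "\<dots> \<longleftrightarrow> cutoff t f \<in> borel_measurable Q"
    by (intro measurable_cong) (auto simp: cutoff_def space_pair_measure indicator_def)
  finally show ?thesis .
qed

lemma nn_integral_cut:
  assumes "cutoff t f \<in> borel_measurable Q"
  shows "(\<integral>\<^sup>+\<omega>. (\<integral>\<^sup>+s\<in>{0..t}. ennreal ((f s \<omega>)\<^sup>2) \<partial>lborel) \<partial>P) = (\<integral>\<^sup>+z. ennreal ((cutoff t f z)\<^sup>2) \<partial>Q)"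
proof -
  have [measurable]: "cutoff t f \<in> borel_measurable Q" by fact
  have "(\<integral>\<^sup>+\<omega>. (\<integral>\<^sup>+s. ennreal ((cutoff t f (s, \<omega>))\<^sup>2) \<partial>lborel) \<partial>P) = (\<integral>\<^sup>+z. ennreal ((cutoff t f z)\<^sup>2) \<partial>Q)"
    by (rule Q.nn_integral_snd) measurable
  moreover have "ennreal ((cutoff t f (s, \<omega>))\<^sup>2) = ennreal ((f s \<omega>)\<^sup>2) * indicator {0..t} s" for s \<omega>
    by (auto simp: cutoff_def indicator_def)
  ultimately show ?thesis by simp
qed

lemma cut_simple_process:
  assumes "simple_integrand Ft t p \<tau> \<xi>"
  shows "cutoff t (\<lambda>s \<omega>. f s \<omega> - simple_process p \<tau> \<xi> s \<omega>) = (\<lambda>z. cutoff t f z - simple_process p \<tau> \<xi> (fst z) (snd z))"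
  using simple_process_support[OF assms] by (auto simp: cutoff_def fun_eq_iff)

text \<open>Approximability by simple processes already forces \<open>f\<close> and \<open>J\<close>
  to be square integrable, so the definition becomes convergence in two Hilbert spaces, over
  \<open>Q\<close> and over \<open>P\<close>.\<close>

lemma has_ito_iff:
  "has_ito_integral P Ft W t f J \<longleftrightarrow> f \<in> H t \<and> J \<in> L2 P \<and>
    (\<exists>p \<tau> \<xi>. (\<forall>k. simple_integrand Ft t (p k) (\<tau> k) (\<xi> k)) \<and>
      (\<lambda>k. \<integral>z. (cutoff t f z - simple_process (p k) (\<tau> k) (\<xi> k) (fst z) (snd z))\<^sup>2 \<partial>Q) \<longlonglongrightarrow> 0 \<and>
      (\<lambda>k. \<integral>\<omega>. (J \<omega> - simple_ito_integral W (p k) (\<tau> k) (\<xi> k) \<omega>)\<^sup>2 \<partial>P) \<longlonglongrightarrow> 0)" (is "?L \<longleftrightarrow> ?R")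
proof -
  have nn: "(\<integral>\<^sup>+\<omega>. (\<integral>\<^sup>+s\<in>{0..t}. ennreal ((f s \<omega> - simple_process p \<tau> \<xi> s \<omega>)\<^sup>2) \<partial>lborel) \<partial>P)
      = (\<integral>\<^sup>+z. ennreal ((cutoff t f z - simple_process p \<tau> \<xi> (fst z) (snd z))\<^sup>2) \<partial>Q)"
    if m: "cutoff t f \<in> borel_measurable Q" and S: "simple_integrand Ft t p \<tau> \<xi>" for p \<tau> \<xi>
  proof -
    have "cutoff t (\<lambda>s \<omega>. f s \<omega> - simple_process p \<tau> \<xi> s \<omega>) \<in> borel_measurable Q"
      unfolding cut_simple_process[OF S] by (intro borel_measurable_diff m L2_measurable[OF simple_process_L2[OF S]])
    from nn_integral_cut[OF this] show ?thesis unfolding cut_simple_process[OF S] .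
  qed
  show ?thesis
  proof
    assume L: ?L
    then obtain p \<tau> \<xi> where S: "\<And>k. simple_integrand Ft t (p k) (\<tau> k) (\<xi> k)"
      and f: "(\<lambda>k. \<integral>\<^sup>+\<omega>. (\<integral>\<^sup>+s\<in>{0..t}. ennreal ((f s \<omega> - simple_process (p k) (\<tau> k) (\<xi> k) s \<omega>)\<^sup>2) \<partial>lborel) \<partial>P) \<longlonglongrightarrow> 0"
      and J: "(\<lambda>k. \<integral>\<^sup>+\<omega>. ennreal ((J \<omega> - simple_ito_integral W (p k) (\<tau> k) (\<xi> k) \<omega>)\<^sup>2) \<partial>P) \<longlonglongrightarrow> 0"
      unfolding has_ito_integral_def by auto
    have ma: "measurable_adapted P Ft t f" "J \<in> borel_measurable P" using L by (auto simp: has_ito_integral_def)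
    then have m: "cutoff t f \<in> borel_measurable Q" by (simp add: measurable_adapted_def measurable_cut)
    note 1 = L2_nn_tendsto[OF m simple_process_L2[OF S] f[unfolded nn[OF m S]]]
    note 2 = L2_nn_tendsto[OF ma(2) simple_ito_integral_L2[OF S] J]
    show ?R unfolding H_def using S 1 2 ma(1) by blast
  next
    assume R: ?R
    then obtain p \<tau> \<xi> where S: "\<And>k. simple_integrand Ft t (p k) (\<tau> k) (\<xi> k)"
      and f: "(\<lambda>k. \<integral>z. (cutoff t f z - simple_process (p k) (\<tau> k) (\<xi> k) (fst z) (snd z))\<^sup>2 \<partial>Q) \<longlonglongrightarrow> 0"
      and J: "(\<lambda>k. \<integral>\<omega>. (J \<omega> - simple_ito_integral W (p k) (\<tau> k) (\<xi> k) \<omega>)\<^sup>2 \<partial>P) \<longlonglongrightarrow> 0"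
      by auto
    have fL: "cutoff t f \<in> L2 Q" "measurable_adapted P Ft t f" and JL: "J \<in> L2 P" using R by (auto simp: H_def)
    note 1 = L2_tendsto_nn[OF fL(1) simple_process_L2[OF S] f]
    note 2 = L2_tendsto_nn[OF JL simple_ito_integral_L2[OF S] J]
    show ?L unfolding has_ito_integral_def
      using S 1[folded nn[OF L2_measurable[OF fL(1)] S]] 2 fL(2) L2_measurable[OF JL] by blast
  qed
qed

lemma ito_L2: "has_ito_integral P Ft W t f J \<Longrightarrow> J \<in> L2 P"
  and ito_H: "has_ito_integral P Ft W t f J \<Longrightarrow> f \<in> H t"
  by (simp_all add: has_ito_iff)

lemma H_L2: "f \<in> H t \<Longrightarrow> cutoff t f \<in> L2 Q"
  by (simp add: H_def)

text \<open>The isometry of simple integrals passes to the limit by continuity of both inner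
  products. With different horizons it gives the covariance of the integral process at two
  times.\<close>

lemma ito_isometry:
  assumes "has_ito_integral P Ft W s f J" "has_ito_integral P Ft W t g K"
  shows "expectation (\<lambda>\<omega>. J \<omega> * K \<omega>) = (\<integral>z. cutoff s f z * cutoff t g z \<partial>Q)"
proof -
  obtain p \<tau> \<xi> where S: "\<And>k. simple_integrand Ft s (p k) (\<tau> k) (\<xi> k)"
    and f: "(\<lambda>k. \<integral>z. (cutoff s f z - simple_process (p k) (\<tau> k) (\<xi> k) (fst z) (snd z))\<^sup>2 \<partial>Q) \<longlonglongrightarrow> 0"
    and J: "(\<lambda>k. \<integral>\<omega>. (J \<omega> - simple_ito_integral W (p k) (\<tau> k) (\<xi> k) \<omega>)\<^sup>2 \<partial>P) \<longlonglongrightarrow> 0"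
    using assms(1) unfolding has_ito_iff by auto
  obtain q \<sigma> \<eta> where T: "\<And>k. simple_integrand Ft t (q k) (\<sigma> k) (\<eta> k)"
    and g: "(\<lambda>k. \<integral>z. (cutoff t g z - simple_process (q k) (\<sigma> k) (\<eta> k) (fst z) (snd z))\<^sup>2 \<partial>Q) \<longlonglongrightarrow> 0"
    and K: "(\<lambda>k. \<integral>\<omega>. (K \<omega> - simple_ito_integral W (q k) (\<sigma> k) (\<eta> k) \<omega>)\<^sup>2 \<partial>P) \<longlonglongrightarrow> 0"
    using assms(2) unfolding has_ito_iff by auto
  note A = L2_inner_tendsto[OF ito_L2[OF assms(1)] simple_ito_integral_L2[OF S] J
      ito_L2[OF assms(2)] simple_ito_integral_L2[OF T] K]
  note B = L2_inner_tendsto[OF H_L2[OF ito_H[OF assms(1)]] simple_process_L2[OF S] f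
      H_L2[OF ito_H[OF assms(2)]] simple_process_L2[OF T] g]
  from A show ?thesis unfolding simple_isometry[OF S T] by (rule LIMSEQ_unique[OF _ B])
qed

lemma ito_inner_sum:
  assumes "finite I" "\<And>i. i \<in> I \<Longrightarrow> has_ito_integral P Ft W t (f i) (J i)" "has_ito_integral P Ft W t h K"
  shows "expectation (\<lambda>\<omega>. K \<omega> * (\<Sum>i\<in>I. a i * J i \<omega>)) = (\<integral>z. cutoff t h z * (\<Sum>i\<in>I. a i * cutoff t (f i) z) \<partial>Q)"
proof -
  have "expectation (\<lambda>\<omega>. K \<omega> * (\<Sum>i\<in>I. a i * J i \<omega>)) = expectation (\<lambda>\<omega>. (\<Sum>i\<in>I. a i * (K \<omega> * J i \<omega>)))"
    by (simp add: sum_distrib_left ac_simps)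
  also have "\<dots> = (\<Sum>i\<in>I. a i * expectation (\<lambda>\<omega>. K \<omega> * J i \<omega>))"
    using assms by (subst Bochner_Integration.integral_sum) (auto intro!: integrable_mult_right L2_mult_integrable ito_L2)
  also have "\<dots> = (\<Sum>i\<in>I. a i * (\<integral>z. cutoff t h z * cutoff t (f i) z \<partial>Q))"
    using assms by (intro sum.cong refl arg_cong2[where f="(*)"] ito_isometry) auto
  also have "\<dots> = (\<integral>z. (\<Sum>i\<in>I. a i * (cutoff t h z * cutoff t (f i) z)) \<partial>Q)"
    using assms by (subst Bochner_Integration.integral_sum) (auto intro!: integrable_mult_right L2_mult_integrable H_L2 ito_H)
  also have "\<dots> = (\<integral>z. cutoff t h z * (\<Sum>i\<in>I. a i * cutoff t (f i) z) \<partial>Q)"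
    by (simp add: sum_distrib_left ac_simps)
  finally show ?thesis .
qed

text \<open>The second moment of the difference expands into inner products, each equal to the
  integral of the square of \<open>cutoff t h\<close> by the isometry. Linearity thus requires no
  common partition of the approximating sequences, and uniqueness of the integral is the case of one
  summand.\<close>

lemma ito_linear:
  assumes I: "finite I" and J: "\<And>i. i \<in> I \<Longrightarrow> has_ito_integral P Ft W t (f i) (J i)"
    and K: "has_ito_integral P Ft W t h K"
    and h: "AE z in Q. cutoff t h z = (\<Sum>i\<in>I. a i * cutoff t (f i) z)"
  shows "AE \<omega> in P. K \<omega> = (\<Sum>i\<in>I. a i * J i \<omega>)"
proof -
  let ?X = "\<lambda>\<omega>. \<Sum>i\<in>I. a i * J i \<omega>"
  have X: "?X \<in> L2 P" by (auto intro!: L2_sum L2_cmult ito_L2[OF J])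
  have fL: "(\<lambda>z. \<Sum>i\<in>I. a i * cutoff t (f i) z) \<in> L2 Q" by (auto intro!: L2_sum L2_cmult H_L2 ito_H[OF J])
  note [measurable] = L2_measurable[OF H_L2[OF ito_H[OF K]]] L2_measurable[OF fL]
  have fi: "cutoff t (f i) \<in> borel_measurable Q" if "i \<in> I" for i
    using that J H_L2 ito_H L2_measurable by blast
  have KX: "expectation (\<lambda>\<omega>. K \<omega> * ?X \<omega>) = (\<integral>z. (cutoff t h z)\<^sup>2 \<partial>Q)"
  proof -
    have "expectation (\<lambda>\<omega>. K \<omega> * ?X \<omega>) = (\<integral>z. cutoff t h z * (\<Sum>i\<in>I. a i * cutoff t (f i) z) \<partial>Q)"
      by (rule ito_inner_sum[OF I J K])
    also have "\<dots> = (\<integral>z. (cutoff t h z)\<^sup>2 \<partial>Q)"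
      using h by (intro integral_cong_AE) (auto simp: power2_eq_square)
    finally show ?thesis .
  qed
  have iX: "expectation (\<lambda>\<omega>. J i \<omega> * ?X \<omega>) = (\<integral>z. cutoff t (f i) z * cutoff t h z \<partial>Q)" if "i \<in> I" for i
  proof -
    have "expectation (\<lambda>\<omega>. J i \<omega> * ?X \<omega>) = (\<integral>z. cutoff t (f i) z * (\<Sum>i\<in>I. a i * cutoff t (f i) z) \<partial>Q)"
      by (rule ito_inner_sum[OF I J J[OF that]])
    also have "\<dots> = (\<integral>z. cutoff t (f i) z * cutoff t h z \<partial>Q)"
      using h fi[OF that] by (intro integral_cong_AE) auto
    finally show ?thesis .
  qed
  have "expectation (\<lambda>\<omega>. ?X \<omega> * ?X \<omega>) = expectation (\<lambda>\<omega>. \<Sum>i\<in>I. a i * (J i \<omega> * ?X \<omega>))"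
    by (subst sum_distrib_right) (simp add: ac_simps)
  also have "\<dots> = (\<Sum>i\<in>I. a i * expectation (\<lambda>\<omega>. J i \<omega> * ?X \<omega>))"
    using ito_L2[OF J] X by (subst Bochner_Integration.integral_sum) (auto intro!: integrable_mult_right L2_mult_integrable)
  also have "\<dots> = (\<Sum>i\<in>I. a i * (\<integral>z. cutoff t (f i) z * cutoff t h z \<partial>Q))"
    by (intro sum.cong) (auto simp: iX)
  also have "\<dots> = (\<integral>z. (\<Sum>i\<in>I. a i * (cutoff t (f i) z * cutoff t h z)) \<partial>Q)"
    using J K by (subst Bochner_Integration.integral_sum) (auto intro!: integrable_mult_right L2_mult_integrable H_L2 ito_H)
  also have "\<dots> = (\<integral>z. (\<Sum>i\<in>I. a i * cutoff t (f i) z) * cutoff t h z \<partial>Q)"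
    by (subst sum_distrib_right) (simp add: ac_simps)
  also have "\<dots> = (\<integral>z. (cutoff t h z)\<^sup>2 \<partial>Q)"
    using h by (intro integral_cong_AE) (auto simp: power2_eq_square)
  finally have XX: "expectation (\<lambda>\<omega>. ?X \<omega> * ?X \<omega>) = (\<integral>z. (cutoff t h z)\<^sup>2 \<partial>Q)" .
  have KK: "expectation (\<lambda>\<omega>. K \<omega> * K \<omega>) = (\<integral>z. (cutoff t h z)\<^sup>2 \<partial>Q)"
    using ito_isometry[OF K K] by (simp add: power2_eq_square)
  have "expectation (\<lambda>\<omega>. (K \<omega> - ?X \<omega>)\<^sup>2) = expectation (\<lambda>\<omega>. K \<omega> * K \<omega> - 2 * (K \<omega> * ?X \<omega>) + ?X \<omega> * ?X \<omega>)"
    by (intro Bochner_Integration.integral_cong) (auto simp: power2_eq_square algebra_simps)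
  also have "\<dots> = expectation (\<lambda>\<omega>. K \<omega> * K \<omega>) - 2 * expectation (\<lambda>\<omega>. K \<omega> * ?X \<omega>) + expectation (\<lambda>\<omega>. ?X \<omega> * ?X \<omega>)"
    using L2_mult_integrable[OF ito_L2[OF K] ito_L2[OF K]] L2_mult_integrable[OF ito_L2[OF K] X] L2_mult_integrable[OF X X] by simp
  also have "\<dots> = 0" using KX XX KK by simp
  finally have "AE \<omega> in P. K \<omega> - ?X \<omega> = 0"
    by (intro L2_AE_zero L2_diff ito_L2[OF K] X)
  then show ?thesis by simp
qed

lemma H_mono: assumes f: "f \<in> H t" and st: "s \<le> t" shows "f \<in> H s"
proof -
  have eq: "cutoff s f z = indicator ({0..s} \<times> space P) z * cutoff t f z" if "z \<in> space Q" for z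
    using st that by (auto simp: cutoff_def indicator_def space_pair_measure)
  have S: "{0..s} \<times> space P \<in> sets Q" by auto
  have ft: "cutoff t f \<in> L2 Q" using f by (simp add: H_def)
  note [measurable] = L2_measurable[OF ft] S
  have m: "cutoff s f \<in> borel_measurable Q"
    by (subst measurable_cong[OF eq]) measurable
  have "integrable Q (\<lambda>z. (cutoff s f z)\<^sup>2)"
  proof (rule Bochner_Integration.integrable_bound[OF L2_integrable_sq[OF ft]])
    show "(\<lambda>z. (cutoff s f z)\<^sup>2) \<in> borel_measurable Q" using m by measurable
    show "AE z in Q. norm ((cutoff s f z)\<^sup>2) \<le> norm ((cutoff t f z)\<^sup>2)" using st by (auto simp: cutoff_def)
  qed
  with m have "cutoff s f \<in> L2 Q" by (simp add: L2_def)
  then show ?thesis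
    using f st m by (auto simp: H_def measurable_adapted_def measurable_cut)
qed

lemma cut_add: "cutoff t (\<lambda>s \<omega>. f s \<omega> + g s \<omega>) = (\<lambda>z. cutoff t f z + cutoff t g z)"
  by (auto simp: cutoff_def fun_eq_iff)

lemma cut_cmult: "cutoff t (\<lambda>s \<omega>. c * f s \<omega>) = (\<lambda>z. c * cutoff t f z)"
  by (auto simp: cutoff_def fun_eq_iff)

lemma cut_diff: "cutoff t (\<lambda>s \<omega>. f s \<omega> - g s \<omega>) = (\<lambda>z. cutoff t f z - cutoff t g z)"
  by (auto simp: cutoff_def fun_eq_iff)

lemma cut_sum: "cutoff t (\<lambda>s \<omega>. \<Sum>i\<in>I. f i s \<omega>) = (\<lambda>z. \<Sum>i\<in>I. cutoff t (f i) z)"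
  by (auto simp: cutoff_def fun_eq_iff)

lemma H_iff: "f \<in> H t \<longleftrightarrow> cutoff t f \<in> L2 Q \<and> (\<forall>s\<in>{0..t}. f s \<in> borel_measurable (Ft s))"
  by (auto simp: H_def measurable_adapted_def measurable_cut dest: L2_measurable)

lemma H_add: "f \<in> H t \<Longrightarrow> g \<in> H t \<Longrightarrow> (\<lambda>s \<omega>. f s \<omega> + g s \<omega>) \<in> H t"
  by (auto simp: H_iff cut_add intro!: L2_add borel_measurable_add)

lemma H_diff: "f \<in> H t \<Longrightarrow> g \<in> H t \<Longrightarrow> (\<lambda>s \<omega>. f s \<omega> - g s \<omega>) \<in> H t"
  by (auto simp: H_iff cut_diff intro!: L2_diff borel_measurable_diff)

lemma H_cmult: "f \<in> H t \<Longrightarrow> (\<lambda>s \<omega>. c * f s \<omega>) \<in> H t"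
  by (auto simp: H_iff cut_cmult intro: L2_cmult)

lemma H_const: "(\<lambda>s \<omega>. c) \<in> H t"
proof -
  have "cutoff t (\<lambda>s \<omega>. c) = (\<lambda>z. c * (indicator {0..t} (fst z) * 1))"
    by (auto simp: cutoff_def indicator_def fun_eq_iff)
  moreover have "(\<lambda>z. indicator {0..t} (fst z) * (1::real)) \<in> L2 Q"
    unfolding L2_def
  proof safe
    have "integrable Q (\<lambda>z. indicator {0..t} (fst z) * (1::real))"
      by (rule product_integral) (auto simp: integrable_indicator_iff emeasure_lborel_Icc_eq)
    moreover have "(\<lambda>z::real \<times> 'w. (indicator {0..t} (fst z) * (1::real))\<^sup>2) = (\<lambda>z. indicator {0..t} (fst z) * (1::real))"
      by (auto simp: indicator_def fun_eq_iff)
    ultimately show "integrable Q (\<lambda>z. (indicator {0..t} (fst z) * (1::real))\<^sup>2)" by simp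
  qed measurable
  ultimately show ?thesis by (auto simp: H_iff intro: L2_cmult)
qed

lemma H_sum: "(\<And>i. i \<in> I \<Longrightarrow> f i \<in> H t) \<Longrightarrow> (\<lambda>s \<omega>. \<Sum>i\<in>I. f i s \<omega>) \<in> H t"
  by (induction I rule: infinite_finite_induct) (auto intro: H_add H_const)

lemma H_cong: "f \<in> H t \<Longrightarrow> (\<And>s \<omega>. s \<in> {0..t} \<Longrightarrow> \<omega> \<in> space P \<Longrightarrow> f s \<omega> = g s \<omega>) \<Longrightarrow> g \<in> H t"
proof -
  assume f: "f \<in> H t" and eq: "\<And>s \<omega>. s \<in> {0..t} \<Longrightarrow> \<omega> \<in> space P \<Longrightarrow> f s \<omega> = g s \<omega>"
  have ceq: "cutoff t f z = cutoff t g z" if "z \<in> space Q" for z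
    using that eq by (auto simp: cutoff_def space_pair_measure)
  have "cutoff t g \<in> L2 Q"
  proof (rule L2_cong_AE)
    show f2: "cutoff t f \<in> L2 Q" using f by (simp add: H_iff)
    show "cutoff t g \<in> borel_measurable Q"
      using L2_measurable[OF f2] by (subst (asm) measurable_cong[OF ceq])
  qed (use ceq in auto)
  moreover have "g s \<in> borel_measurable (Ft s)" if s: "s \<in> {0..t}" for s
  proof -
    have "f s \<in> borel_measurable (Ft s) \<longleftrightarrow> g s \<in> borel_measurable (Ft s)"
      by (rule measurable_cong) (use eq[OF s] in auto)
    then show ?thesis using f s by (auto simp: H_iff)
  qed
  ultimately show ?thesis by (auto simp: H_iff)
qed

end

section \<open>Continuity of translation in the mean\<close>

text \<open>Continuity of translations in L1, in the sequential form that suits dominated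
  convergence.\<close>

definition translation_continuous :: "(real \<Rightarrow> real) \<Rightarrow> bool" where
  "translation_continuous g \<longleftrightarrow> integrable lborel g \<and>
    (\<forall>h. h \<longlonglongrightarrow> 0 \<longrightarrow> (\<lambda>k. \<integral>t. \<bar>g (t + h k) - g t\<bar> \<partial>lborel) \<longlonglongrightarrow> 0)"

lemma lborel_shift:
  fixes g :: "real \<Rightarrow> real"
  assumes "integrable lborel g"
  shows "integrable lborel (\<lambda>t. g (t + h))" "(\<integral>t. g (t + h) \<partial>lborel) = (\<integral>t. g t \<partial>lborel)"
  using lborel_integrable_real_affine[OF assms, of 1 h] lborel_integral_real_affine[of 1 g h]
  by (simp_all add: add.commute)

text \<open>Translation preserves the integral, so replacing \<open>g\<close> by \<open>G i\<close>
  costs the same before and after the shift: the error is below e/4 + e/2 + e/4.\<close>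

lemma translation_continuous_closed:
  assumes g: "integrable lborel g" and G: "\<And>i. translation_continuous (G i)"
    and lim: "(\<lambda>i. \<integral>t. \<bar>G i t - g t\<bar> \<partial>lborel) \<longlonglongrightarrow> 0"
  shows "translation_continuous g"
  unfolding translation_continuous_def
proof (intro conjI allI impI g)
  fix h :: "nat \<Rightarrow> real" assume h: "h \<longlonglongrightarrow> 0"
  show "(\<lambda>k. \<integral>t. \<bar>g (t + h k) - g t\<bar> \<partial>lborel) \<longlonglongrightarrow> 0"
  proof (rule LIMSEQ_I)
    fix e :: real assume e: "0 < e"
    then have "eventually (\<lambda>i. (\<integral>t. \<bar>G i t - g t\<bar> \<partial>lborel) < e/4) sequentially"
      by (intro order_tendstoD[OF lim]) simp
    then obtain i where i: "(\<integral>t. \<bar>G i t - g t\<bar> \<partial>lborel) < e/4" by (auto simp: eventually_sequentially)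
    have Gi: "integrable lborel (G i)" using G by (simp add: translation_continuous_def)
    have "(\<lambda>k. \<integral>t. \<bar>G i (t + h k) - G i t\<bar> \<partial>lborel) \<longlonglongrightarrow> 0"
      using G h by (simp add: translation_continuous_def)
    then have "eventually (\<lambda>k. (\<integral>t. \<bar>G i (t + h k) - G i t\<bar> \<partial>lborel) < e/2) sequentially"
      by (rule order_tendstoD(2)) (use e in simp)
    then obtain n where n: "\<And>k. k \<ge> n \<Longrightarrow> (\<integral>t. \<bar>G i (t + h k) - G i t\<bar> \<partial>lborel) < e/2"
      by (auto simp: eventually_sequentially)
    show "\<exists>n. \<forall>k\<ge>n. norm ((\<integral>t. \<bar>g (t + h k) - g t\<bar> \<partial>lborel) - 0) < e"
    proof (intro exI[of _ n] allI impI)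
      fix k assume k: "n \<le> k"
      let ?D = "\<lambda>t. \<bar>G i t - g t\<bar>"
      have D: "integrable lborel ?D" using Gi g by auto
      note Ds = lborel_shift[OF D, of "h k"]
      have E: "integrable lborel (\<lambda>t. \<bar>G i (t + h k) - G i t\<bar>)"
        using Gi lborel_shift(1)[OF Gi, of "h k"] by auto
      have "(\<integral>t. \<bar>g (t + h k) - g t\<bar> \<partial>lborel) \<le> (\<integral>t. ?D (t + h k) + (\<bar>G i (t + h k) - G i t\<bar> + ?D t) \<partial>lborel)"
        using g lborel_shift(1)[OF g, of "h k"] Ds(1) D E by (intro integral_mono) auto
      also have "\<dots> = (\<integral>t. ?D (t + h k) \<partial>lborel) + ((\<integral>t. \<bar>G i (t + h k) - G i t\<bar> \<partial>lborel) + (\<integral>t. ?D t \<partial>lborel))"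
        using Ds(1) D E by simp
      also have "\<dots> < e" using Ds(2) i n[OF k] by simp
      finally show "norm ((\<integral>t. \<bar>g (t + h k) - g t\<bar> \<partial>lborel) - 0) < e" by simp
    qed
  qed
qed

lemma translation_continuous_add:
  assumes f: "translation_continuous f" and g: "translation_continuous g"
  shows "translation_continuous (\<lambda>t. f t + g t)"
  unfolding translation_continuous_def
proof (intro conjI allI impI)
  have fi: "integrable lborel f" and gi: "integrable lborel g"
    using f g by (auto simp: translation_continuous_def)
  then show "integrable lborel (\<lambda>t. f t + g t)" by simp
  fix h :: "nat \<Rightarrow> real" assume h: "h \<longlonglongrightarrow> 0"
  have F: "integrable lborel (\<lambda>t. \<bar>f (t + h k) - f t\<bar>)" and G: "integrable lborel (\<lambda>t. \<bar>g (t + h k) - g t\<bar>)" for k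
    using fi gi lborel_shift(1)[OF fi, of "h k"] lborel_shift(1)[OF gi, of "h k"] by auto
  have "(\<lambda>k. (\<integral>t. \<bar>f (t + h k) - f t\<bar> \<partial>lborel) + (\<integral>t. \<bar>g (t + h k) - g t\<bar> \<partial>lborel)) \<longlonglongrightarrow> 0 + 0"
    using f g h by (intro tendsto_add) (auto simp: translation_continuous_def)
  then have lim: "(\<lambda>k. (\<integral>t. \<bar>f (t + h k) - f t\<bar> \<partial>lborel) + (\<integral>t. \<bar>g (t + h k) - g t\<bar> \<partial>lborel)) \<longlonglongrightarrow> 0" by simp
  show "(\<lambda>k. \<integral>t. \<bar>f (t + h k) + g (t + h k) - (f t + g t)\<bar> \<partial>lborel) \<longlonglongrightarrow> 0"
  proof (rule Lim_null_comparison[OF always_eventually lim], rule allI)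
    fix k
    have "(\<integral>t. \<bar>f (t + h k) + g (t + h k) - (f t + g t)\<bar> \<partial>lborel) \<le> (\<integral>t. \<bar>f (t + h k) - f t\<bar> + \<bar>g (t + h k) - g t\<bar> \<partial>lborel)"
      using fi gi lborel_shift(1)[OF fi, of "h k"] lborel_shift(1)[OF gi, of "h k"] F G by (intro integral_mono) auto
    then show "norm (\<integral>t. \<bar>f (t + h k) + g (t + h k) - (f t + g t)\<bar> \<partial>lborel)
      \<le> (\<integral>t. \<bar>f (t + h k) - f t\<bar> \<partial>lborel) + (\<integral>t. \<bar>g (t + h k) - g t\<bar> \<partial>lborel)"
      using F G by simp
  qed
qed

lemma translation_continuous_cmult:
  assumes f: "translation_continuous f" shows "translation_continuous (\<lambda>t. c * f t)"
  unfolding translation_continuous_def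
proof (intro conjI allI impI)
  show "integrable lborel (\<lambda>t. c * f t)" using f by (auto simp: translation_continuous_def)
  fix h :: "nat \<Rightarrow> real" assume h: "h \<longlonglongrightarrow> 0"
  have "(\<lambda>k. \<bar>c\<bar> * (\<integral>t. \<bar>f (t + h k) - f t\<bar> \<partial>lborel)) \<longlonglongrightarrow> \<bar>c\<bar> * 0"
    using f h by (intro tendsto_mult_left) (auto simp: translation_continuous_def)
  moreover have "\<bar>c * f (t + h k) - c * f t\<bar> = \<bar>c\<bar> * \<bar>f (t + h k) - f t\<bar>" for t k
    by (simp add: abs_mult[symmetric] right_diff_distrib)
  ultimately show "(\<lambda>k. \<integral>t. \<bar>c * f (t + h k) - c * f t\<bar> \<partial>lborel) \<longlonglongrightarrow> 0" by simp
qed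

text \<open>Away from the two endpoints the shifted indicator is eventually equal to the original
  one.\<close>

lemma translation_continuous_interval: "translation_continuous (indicator {a<..b::real})"
proof (cases "a \<le> b")
  case True
  show ?thesis
    unfolding translation_continuous_def
  proof (intro conjI allI impI)
    show "integrable lborel (indicator {a<..b} :: real \<Rightarrow> real)" using True by (simp add: integrable_indicator_iff)
    fix h :: "nat \<Rightarrow> real" assume h: "h \<longlonglongrightarrow> 0"
    \<comment> \<open>All shifted intervals stay within distance \<open>B\<close> of the original,
      which provides the dominating function.\<close>
    then obtain B where B: "\<And>k. \<bar>h k\<bar> \<le> B" by (metis Bseq_def convergentI convergent_imp_Bseq real_norm_def)
    have "(\<lambda>k. \<integral>t. \<bar>indicator {a<..b} (t + h k) - indicator {a<..b} t\<bar> \<partial>lborel) \<longlonglongrightarrow> (\<integral>t. (0::real) \<partial>(lborel :: real measure))"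
    proof (rule integral_dominated_convergence[where w="indicator {a - B..b + B}"])
      show "integrable lborel (indicator {a - B..b + B} :: real \<Rightarrow> real)"
        by (simp add: integrable_indicator_iff emeasure_lborel_Icc_eq)
      show "AE t in lborel. (\<lambda>k. \<bar>indicator {a<..b} (t + h k) - indicator {a<..b} t\<bar>) \<longlonglongrightarrow> (0::real)"
        using AE_lborel_singleton[of a] AE_lborel_singleton[of b]
      proof eventually_elim
        case (elim t)
        have th: "(\<lambda>k. t + h k) \<longlonglongrightarrow> t" using tendsto_add[OF tendsto_const[of t] h] by simp
        have "eventually (\<lambda>k. indicator {a<..b} (t + h k) = (indicator {a<..b} t :: real)) sequentially"
        proof -
          consider "t < a" | "a < t" "t < b" | "b < t" using elim by linarith
          then show ?thesis
          proof cases
            case 1 then show ?thesis using order_tendstoD(2)[OF th 1] by (auto elim!: eventually_mono simp: indicator_def)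
          next
            case 2 show ?thesis using order_tendstoD(1)[OF th 2(1)] order_tendstoD(2)[OF th 2(2)]
              by eventually_elim (use 2 in \<open>auto simp: indicator_def\<close>)
          next
            case 3 then show ?thesis using order_tendstoD(1)[OF th 3] by (auto elim!: eventually_mono simp: indicator_def)
          qed
        qed
        then show ?case by (intro tendsto_eventually) (auto elim!: eventually_mono)
      qed
      show "AE t in lborel. norm \<bar>indicator {a<..b} (t + h k) - indicator {a<..b} t :: real\<bar> \<le> indicator {a - B..b + B} t" for k
      proof (rule AE_I2)
        fix t show "norm \<bar>indicator {a<..b} (t + h k) - indicator {a<..b} t :: real\<bar> \<le> indicator {a - B..b + B} t"
          using B[of k] by (auto simp: indicator_def)
      qed
    qed auto
    then show "(\<lambda>k. \<integral>t. \<bar>indicator {a<..b} (t + h k) - indicator {a<..b} t\<bar> \<partial>lborel) \<longlonglongrightarrow> (0::real)" by simp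
  qed
next
  case False
  then have "indicator {a<..b} = (\<lambda>t::real. 0::real)" by auto
  then show ?thesis by (simp add: translation_continuous_def)
qed

text \<open>Dynkin induction from half-open intervals. The bounded window keeps all indicators
  integrable, so that complements are differences and disjoint unions are dominated limits.\<close>

lemma translation_continuous_window:
  assumes "A \<in> sets borel"
  shows "translation_continuous (indicator (A \<inter> {- real n<..real n}))"
proof -
  let ?K = "{- real n<..real n}"
  have Ki: "integrable lborel (indicator (B \<inter> ?K) :: real \<Rightarrow> real)" if "B \<in> sets borel" for B
  proof (rule Bochner_Integration.integrable_bound)
    show "integrable lborel (indicator ?K :: real \<Rightarrow> real)" by (simp add: integrable_indicator_iff)
  qed (use that in \<open>auto simp: indicator_def\<close>)
  have eq: "sets (borel :: real measure) = sigma_sets UNIV (range (\<lambda>(a, b). {a <.. b::real}))"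
    by (subst borel_sigma_sets_Ioc) simp
  have "A \<in> sigma_sets UNIV (range (\<lambda>(a, b). {a <.. b::real}))" using assms by (simp add: eq)
  have IS: "Int_stable (range (\<lambda>(a, b). {a <.. b::real}))"
    proof (rule Int_stableI, safe)
      fix a b c d :: real
      show "{a<..b} \<inter> {c<..d} \<in> range (\<lambda>(a, b). {a<..b})"
        by (auto intro!: image_eqI[of _ _ "(max a c, min b d)"])
    qed
  have "range (\<lambda>(a, b). {a <.. b::real}) \<subseteq> Pow UNIV" by auto
  from IS this \<open>A \<in> sigma_sets UNIV _\<close> show ?thesis
  proof (induction rule: sigma_sets_induct_disjoint)
    case (basic A)
    then obtain a b where "A = {a<..b}" by auto
    then have "A \<inter> ?K = {max a (- real n)<..min b (real n)}" by auto
    then show ?case using translation_continuous_interval by simp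
  next
    case empty
    show ?case by (simp add: translation_continuous_def)
  next
    case (compl A)
    have "indicator ((UNIV - A) \<inter> ?K) = (\<lambda>t. indicator ?K t + (-1) * indicator (A \<inter> ?K) t :: real)"
      by (auto simp: indicator_def fun_eq_iff)
    then show ?case
      using translation_continuous_add[OF translation_continuous_interval translation_continuous_cmult[OF compl(2), of "-1"]]
      by simp
  next
    case (union A)
    have Ai: "A i \<in> sets borel" for i using union(2) by (auto simp: eq)
    show ?case
    proof (rule translation_continuous_closed)
      show "integrable lborel (indicator (\<Union> (range A) \<inter> ?K) :: real \<Rightarrow> real)" using Ai by (intro Ki) auto
      show "translation_continuous (indicator ((\<Union>i<m. A i) \<inter> ?K))" for m
      proof (induction m)
        case 0 show ?case by (simp add: translation_continuous_def)
      next
        case (Suc m)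
        have "A m \<inter> A i = {}" if "i < m" for i
          using union(1) that by (auto simp: disjoint_family_on_def)
        then have "indicator ((\<Union>i<Suc m. A i) \<inter> ?K) = (\<lambda>t. indicator ((\<Union>i<m. A i) \<inter> ?K) t + indicator (A m \<inter> ?K) t :: real)"
          by (auto simp: indicator_def fun_eq_iff less_Suc_eq)
        then show ?case using translation_continuous_add[OF Suc union(3)[of m]] by simp
      qed
      have "(\<lambda>m. \<integral>t. \<bar>indicator ((\<Union>i<m. A i) \<inter> ?K) t - indicator (\<Union> (range A) \<inter> ?K) t\<bar> \<partial>lborel) \<longlonglongrightarrow> (\<integral>t. (0::real) \<partial>(lborel :: real measure))"
      proof (rule integral_dominated_convergence[where w="indicator ?K"])
        show "integrable lborel (indicator ?K :: real \<Rightarrow> real)" by (simp add: integrable_indicator_iff)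
        show "AE t in lborel. (\<lambda>m. \<bar>indicator ((\<Union>i<m. A i) \<inter> ?K) t - indicator (\<Union> (range A) \<inter> ?K) t\<bar>) \<longlonglongrightarrow> (0::real)"
        proof (rule AE_I2)
          fix t
          show "(\<lambda>m. \<bar>indicator ((\<Union>i<m. A i) \<inter> ?K) t - indicator (\<Union> (range A) \<inter> ?K) t\<bar>) \<longlonglongrightarrow> (0::real)"
          proof (cases "\<exists>i. t \<in> A i")
            case True
            then obtain i where i: "t \<in> A i" by auto
            show ?thesis
              by (rule tendsto_eventually) (use i in \<open>auto simp: eventually_sequentially indicator_def intro!: exI[of _ "Suc i"]\<close>)
          qed (auto simp: indicator_def)
        qed
        show "AE t in lborel. norm \<bar>indicator ((\<Union>i<m. A i) \<inter> ?K) t - indicator (\<Union> (range A) \<inter> ?K) t :: real\<bar> \<le> indicator ?K t" for m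
          by (rule AE_I2) (auto simp: indicator_def)
      qed (use Ai in auto)
      then show "(\<lambda>m. \<integral>t. \<bar>indicator ((\<Union>i<m. A i) \<inter> ?K) t - indicator (\<Union> (range A) \<inter> ?K) t\<bar> \<partial>lborel) \<longlonglongrightarrow> (0::real)" by simp
    qed
  qed
qed

lemma translation_continuous:
  fixes g :: "real \<Rightarrow> real"
  assumes "integrable lborel g" shows "translation_continuous g"
  using assms
proof (induction rule: integrable_induct)
  case (base A c)
  have A: "A \<in> sets borel" using base by simp
  have "translation_continuous (indicator A)"
  proof (rule translation_continuous_closed[OF _ translation_continuous_window[OF A]])
    show iA: "integrable lborel (indicator A :: real \<Rightarrow> real)" using base by (simp add: integrable_indicator_iff)
    have "(\<lambda>n. \<integral>t. \<bar>indicator (A \<inter> {- real n<..real n}) t - indicator A t\<bar> \<partial>lborel) \<longlonglongrightarrow> (\<integral>t. (0::real) \<partial>(lborel :: real measure))"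
    proof (rule integral_dominated_convergence[where w="indicator A", OF _ _ iA])
      show "AE t in lborel. (\<lambda>n. \<bar>indicator (A \<inter> {- real n<..real n}) t - indicator A t\<bar>) \<longlonglongrightarrow> (0::real)"
      proof (rule AE_I2)
        fix t :: real
        obtain m where m: "\<bar>t\<bar> < real m" using reals_Archimedean2 by blast
        show "(\<lambda>n. \<bar>indicator (A \<inter> {- real n<..real n}) t - indicator A t\<bar>) \<longlonglongrightarrow> (0::real)"
          by (rule tendsto_eventually) (use m in \<open>auto simp: eventually_sequentially indicator_def intro!: exI[of _ m]\<close>)
      qed
      show "AE t in lborel. norm \<bar>indicator (A \<inter> {- real n<..real n}) t - indicator A t :: real\<bar> \<le> indicator A t" for n
        by (rule AE_I2) (auto simp: indicator_def)
    qed (use A in auto)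
    then show "(\<lambda>n. \<integral>t. \<bar>indicator (A \<inter> {- real n<..real n}) t - indicator A t\<bar> \<partial>lborel) \<longlonglongrightarrow> (0::real)" by simp
  qed
  from translation_continuous_cmult[OF this, of c] show ?case by (simp add: mult.commute)
next
  case (add f g)
  then show ?case by (simp add: translation_continuous_add)
next
  case (lim f s)
  show ?case
  proof (rule translation_continuous_closed[OF lim(4) lim(5)])
    have "(\<lambda>i. \<integral>t. \<bar>s i t - f t\<bar> \<partial>lborel) \<longlonglongrightarrow> (\<integral>t. (0::real) \<partial>(lborel :: real measure))"
    proof (rule integral_dominated_convergence[where w="\<lambda>t. 3 * \<bar>f t\<bar>"])
      show "integrable lborel (\<lambda>t. 3 * \<bar>f t\<bar>)" using lim(4) by simp
      show "AE t in lborel. (\<lambda>i. \<bar>s i t - f t\<bar>) \<longlonglongrightarrow> 0"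
      proof (rule AE_I2)
        fix t
        have "(\<lambda>i. s i t) \<longlonglongrightarrow> f t" using lim(2) by simp
        from tendsto_rabs[OF tendsto_diff[OF this tendsto_const[of "f t"]]]
        show "(\<lambda>i. \<bar>s i t - f t\<bar>) \<longlonglongrightarrow> 0" by simp
      qed
      show "AE t in lborel. norm \<bar>s i t - f t\<bar> \<le> 3 * \<bar>f t\<bar>" for i
      proof (rule AE_I2)
        fix t
        have "\<bar>s i t\<bar> \<le> 2 * \<bar>f t\<bar>" using lim(3)[of t i] by simp
        then show "norm \<bar>s i t - f t\<bar> \<le> 3 * \<bar>f t\<bar>" by simp
      qed
    qed (use lim(1,4) in auto)
    then show "(\<lambda>i. \<integral>t. \<bar>s i t - f t\<bar> \<partial>lborel) \<longlonglongrightarrow> 0" by simp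
  qed
qed

section \<open>Approximation by simple processes\<close>

lemma partition_cell:
  fixes \<tau> :: "nat \<Rightarrow> real"
  assumes "\<And>i. i < p \<Longrightarrow> \<tau> i < \<tau> (Suc i)" "\<tau> 0 < t" "t \<le> \<tau> p"
  shows "\<exists>i<p. \<tau> i < t \<and> t \<le> \<tau> (Suc i)"
  using assms
proof (induction p)
  case (Suc p)
  show ?case
  proof (cases "t \<le> \<tau> p")
    case True
    with Suc show ?thesis by (metis less_Suc_eq)
  qed (use Suc.prems in auto)
qed auto

lemma simple_process_eq:
  assumes mono: "\<And>i. i < p \<Longrightarrow> \<tau> i < \<tau> (Suc i)" and i: "i < p" "\<tau> i < s" "s \<le> \<tau> (Suc i)"
  shows "simple_process p \<tau> \<xi> s \<omega> = \<xi> i \<omega>"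
proof -
  have m: "\<tau> j \<le> \<tau> k" if "j \<le> k" "k \<le> p" for j k
    using that
  proof (induction k rule: dec_induct)
    case (step k) then show ?case using mono[of k] by simp
  qed simp
  have "\<xi> j \<omega> * indicator {\<tau> j<..\<tau> (Suc j)} s = (if j = i then \<xi> i \<omega> else 0)" if "j < p" for j
  proof -
    consider "j = i" | "Suc j \<le> i" | "Suc i \<le> j" by linarith
    then show ?thesis
      using i m[of "Suc j" i] m[of "Suc i" j] that by cases (auto simp: indicator_def)
  qed
  then have "simple_process p \<tau> \<xi> s \<omega> = (\<Sum>j<p. if j = i then \<xi> i \<omega> else 0)"
    unfolding simple_process_def by (intro sum.cong) auto
  then show ?thesis using i by simp
qed

context brownian
begin

text \<open>Almost every path is integrable, so the one-dimensional result applies to it. The path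
  errors are dominated by twice the L1 norm of the path, which is integrable in \<omega>.\<close>

lemma nn_translation_continuous:
  assumes g: "integrable Q g" and h: "h \<longlonglongrightarrow> 0"
  shows "(\<lambda>k. \<integral>\<^sup>+z. ennreal \<bar>g (fst z + h k, snd z) - g z\<bar> \<partial>Q) \<longlonglongrightarrow> 0"
proof -
  have [measurable]: "g \<in> borel_measurable Q" using g by auto
  have int: "AE \<omega> in P. integrable lborel (\<lambda>t. g (t, \<omega>))"
    by (rule Q.AE_integrable_snd) (use g in simp)
  define \<phi> where "\<phi> k \<omega> = (\<integral>\<^sup>+t. ennreal \<bar>g (t + h k, \<omega>) - g (t, \<omega>)\<bar> \<partial>lborel)" for k \<omega>
  have eq: "(\<integral>\<^sup>+z. ennreal \<bar>g (fst z + h k, snd z) - g z\<bar> \<partial>Q) = (\<integral>\<^sup>+\<omega>. \<phi> k \<omega> \<partial>P)" for k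
    unfolding \<phi>_def by (subst Q.nn_integral_snd[symmetric]) auto
  have "(\<lambda>k. \<integral>\<^sup>+\<omega>. \<phi> k \<omega> \<partial>P) \<longlonglongrightarrow> (\<integral>\<^sup>+\<omega>. 0 \<partial>P)"
  proof (rule nn_integral_dominated_convergence)
    show "\<phi> k \<in> borel_measurable P" for k unfolding \<phi>_def[abs_def] by measurable
    let ?w = "\<lambda>\<omega>. 2 * (\<integral>\<^sup>+t. ennreal \<bar>g (t, \<omega>)\<bar> \<partial>lborel)"
    show "?w \<in> borel_measurable P" by measurable
    have "(\<integral>\<^sup>+\<omega>. ?w \<omega> \<partial>P) = 2 * (\<integral>\<^sup>+\<omega>. (\<integral>\<^sup>+t. ennreal \<bar>g (t, \<omega>)\<bar> \<partial>lborel) \<partial>P)"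
      by (rule nn_integral_cmult) measurable
    also have "\<dots> = 2 * (\<integral>\<^sup>+z. ennreal \<bar>g z\<bar> \<partial>Q)" by (subst Q.nn_integral_snd) auto
    also have "\<dots> < \<infinity>"
      using g by (auto simp: integrable_iff_bounded ennreal_mult_less_top)
    finally show "(\<integral>\<^sup>+\<omega>. ?w \<omega> \<partial>P) < \<infinity>" .
    show "AE \<omega> in P. \<phi> k \<omega> \<le> ?w \<omega>" for k
    proof (rule AE_I2)
      fix \<omega> assume [measurable]: "\<omega> \<in> space P"
      have "\<phi> k \<omega> \<le> (\<integral>\<^sup>+t. ennreal \<bar>g (t + h k, \<omega>)\<bar> + ennreal \<bar>g (t, \<omega>)\<bar> \<partial>lborel)"
        unfolding \<phi>_def by (intro nn_integral_mono) (simp add: ennreal_plus[symmetric] ennreal_leI del: ennreal_plus)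
      also have "\<dots> = (\<integral>\<^sup>+t. ennreal \<bar>g (t + h k, \<omega>)\<bar> \<partial>lborel) + (\<integral>\<^sup>+t. ennreal \<bar>g (t, \<omega>)\<bar> \<partial>lborel)"
        by (rule nn_integral_add) measurable
      also have "(\<integral>\<^sup>+t. ennreal \<bar>g (t + h k, \<omega>)\<bar> \<partial>lborel) = (\<integral>\<^sup>+t. ennreal \<bar>g (t, \<omega>)\<bar> \<partial>lborel)"
        using nn_integral_real_affine[of "\<lambda>t. ennreal \<bar>g (t, \<omega>)\<bar>" 1 "h k"] by (simp add: add.commute)
      finally show "\<phi> k \<omega> \<le> ?w \<omega>" by (simp add: mult_2)
    qed
    show "AE \<omega> in P. (\<lambda>k. \<phi> k \<omega>) \<longlonglongrightarrow> 0"
      using int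
    proof eventually_elim
      case (elim \<omega>)
      have "(\<lambda>k. \<integral>t. \<bar>g (t + h k, \<omega>) - g (t, \<omega>)\<bar> \<partial>lborel) \<longlonglongrightarrow> 0"
        using translation_continuous[OF elim] h by (simp add: translation_continuous_def)
      from tendsto_ennrealI[OF this]
      have "(\<lambda>k. ennreal (\<integral>t. \<bar>g (t + h k, \<omega>) - g (t, \<omega>)\<bar> \<partial>lborel)) \<longlonglongrightarrow> 0" by simp
      moreover have "\<phi> k \<omega> = ennreal (\<integral>t. \<bar>g (t + h k, \<omega>) - g (t, \<omega>)\<bar> \<partial>lborel)" for k
        unfolding \<phi>_def using elim lborel_shift(1)[OF elim, of "h k"]
        by (intro nn_integral_eq_integral) auto
      ultimately show ?case by simp
    qed
  qed simp
  then show ?thesis unfolding eq by simp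
qed

definition translation_error :: "(real \<times> 'w \<Rightarrow> real) \<Rightarrow> real \<Rightarrow> ennreal" where
  "translation_error g h = (\<integral>\<^sup>+z. ennreal ((g (fst z + h, snd z) - g z)\<^sup>2) \<partial>Q)"

text \<open>Boundedness turns the mean error into a mean square error, as the square is at most 2 C
  times the absolute value. A sequence of bad shifts h k \<le> 1/(k+1) would contradict the
  sequential statement.\<close>

lemma translation_error_small:
  assumes g: "integrable Q g" and C: "\<And>z. \<bar>g z\<bar> \<le> C" and e: "0 < e"
  shows "\<exists>\<delta>>0. \<forall>h. 0 < h \<and> h \<le> \<delta> \<longrightarrow> translation_error g h \<le> ennreal e"
proof (rule ccontr)
  assume "\<not> ?thesis"
  then have "\<forall>k. \<exists>h. 0 < h \<and> h \<le> 1 / real (Suc k) \<and> \<not> translation_error g h \<le> ennreal e" by force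
  then obtain h where h: "\<And>k. 0 < h k \<and> h k \<le> 1 / real (Suc k) \<and> \<not> translation_error g (h k) \<le> ennreal e" by metis
  have [measurable]: "g \<in> borel_measurable Q" using g by auto
  have "h \<longlonglongrightarrow> 0"
    by (rule tendsto_sandwich[OF _ _ tendsto_const LIMSEQ_inverse_real_of_nat])
       (use h in \<open>auto intro!: always_eventually less_imp_le simp: inverse_eq_divide\<close>)
  from nn_translation_continuous[OF g this]
  have "(\<lambda>k. ennreal (2 * C) * (\<integral>\<^sup>+z. ennreal \<bar>g (fst z + h k, snd z) - g z\<bar> \<partial>Q)) \<longlonglongrightarrow> ennreal (2 * C) * 0"
    by (intro ennreal_tendsto_cmult) simp_all
  then have "eventually (\<lambda>k. ennreal (2 * C) * (\<integral>\<^sup>+z. ennreal \<bar>g (fst z + h k, snd z) - g z\<bar> \<partial>Q) < ennreal e) sequentially"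
    by (rule order_tendstoD(2)) (use e in simp)
  then obtain k where k: "ennreal (2 * C) * (\<integral>\<^sup>+z. ennreal \<bar>g (fst z + h k, snd z) - g z\<bar> \<partial>Q) < ennreal e"
    by (auto simp: eventually_sequentially)
  have C0: "0 \<le> C" using C[of undefined] by linarith
  have "translation_error g (h k) \<le> (\<integral>\<^sup>+z. ennreal (2 * C) * ennreal \<bar>g (fst z + h k, snd z) - g z\<bar> \<partial>Q)"
    unfolding translation_error_def
  proof (rule nn_integral_mono)
    fix z
    have "\<bar>g (fst z + h k, snd z) - g z\<bar> \<le> 2 * C" using C[of "(fst z + h k, snd z)"] C[of z] by linarith
    then have "\<bar>g (fst z + h k, snd z) - g z\<bar> * \<bar>g (fst z + h k, snd z) - g z\<bar> \<le> 2 * C * \<bar>g (fst z + h k, snd z) - g z\<bar>"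
      by (rule mult_right_mono) simp
    then show "ennreal ((g (fst z + h k, snd z) - g z)\<^sup>2) \<le> ennreal (2 * C) * ennreal \<bar>g (fst z + h k, snd z) - g z\<bar>"
      using C0 by (subst ennreal_mult[symmetric]) (auto simp: power2_eq_square intro!: ennreal_leI)
  qed
  also have "\<dots> = ennreal (2 * C) * (\<integral>\<^sup>+z. ennreal \<bar>g (fst z + h k, snd z) - g z\<bar> \<partial>Q)"
    by (rule nn_integral_cmult) measurable
  finally show False using k h[of k] by (meson le_less_trans less_imp_le)
qed

text \<open>The grid has mesh \<open>\<delta>\<close> and offset \<open>s\<close>; averaging the mean square error over all offsets
  reduces it to the mean error of translations by at most \<open>\<delta>\<close>.\<close>

definition grid_error :: "(real \<times> 'w \<Rightarrow> real) \<Rightarrow> real \<Rightarrow> nat \<Rightarrow> real \<Rightarrow> ennreal" where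
  "grid_error g \<delta> N s = (\<Sum>j<N. \<integral>\<^sup>+h. (\<integral>\<^sup>+\<omega>. ennreal ((g (s + real j * \<delta> + h, \<omega>) - g (s + real j * \<delta>, \<omega>))\<^sup>2) \<partial>P)
     * indicator {0<..\<delta>} h \<partial>lborel)"

text \<open>After exchanging the integrals the shift h is fixed, and as s runs through one mesh the
  points s + j \<delta> run through disjoint intervals. The sum over the whole grid is therefore at
  most one integral over the line, whatever \<open>N\<close> is.\<close>

lemma grid_error_average:
  assumes [measurable]: "g \<in> borel_measurable Q" and \<delta>: "0 < \<delta>"
    and b: "\<And>h. 0 < h \<Longrightarrow> h \<le> \<delta> \<Longrightarrow> translation_error g h \<le> ennreal e"
  shows "(\<integral>\<^sup>+s. grid_error g \<delta> N s * indicator {0<..<\<delta>} s \<partial>lborel) \<le> ennreal e * ennreal \<delta>"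
proof -
  define E where "E z = (\<integral>\<^sup>+\<omega>. ennreal ((g (fst z + snd z, \<omega>) - g (fst z, \<omega>))\<^sup>2) \<partial>P)" for z :: "real \<times> real"
  have Em [measurable]: "E \<in> borel_measurable (borel \<Otimes>\<^sub>M borel)"
    unfolding E_def[abs_def] by measurable
  have Em2: "(\<lambda>u. E (u + c, h)) \<in> borel_measurable lborel" for c h
    by measurable
  have "(\<integral>\<^sup>+s. grid_error g \<delta> N s * indicator {0<..<\<delta>} s \<partial>lborel)
     = (\<integral>\<^sup>+s. (\<Sum>j<N. \<integral>\<^sup>+h. E (s + real j * \<delta>, h) * indicator {0<..\<delta>} h \<partial>lborel) * indicator {0<..<\<delta>} s \<partial>lborel)"
    by (simp add: grid_error_def E_def)
  also have "\<dots> = (\<integral>\<^sup>+s. (\<Sum>j<N. \<integral>\<^sup>+h. E (s + real j * \<delta>, h) * indicator {0<..\<delta>} h * indicator {0<..<\<delta>} s \<partial>lborel) \<partial>lborel)"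
  proof (rule nn_integral_cong)
    fix s :: real
    show "(\<Sum>j<N. \<integral>\<^sup>+h. E (s + real j * \<delta>, h) * indicator {0<..\<delta>} h \<partial>lborel) * indicator {0<..<\<delta>} s
      = (\<Sum>j<N. \<integral>\<^sup>+h. E (s + real j * \<delta>, h) * indicator {0<..\<delta>} h * indicator {0<..<\<delta>} s \<partial>lborel)"
      unfolding sum_distrib_right by (intro sum.cong refl nn_integral_multc[symmetric]) measurable
  qed
  also have "\<dots> = (\<Sum>j<N. \<integral>\<^sup>+s. (\<integral>\<^sup>+h. E (s + real j * \<delta>, h) * indicator {0<..\<delta>} h * indicator {0<..<\<delta>} s \<partial>lborel) \<partial>lborel)"
    by (rule nn_integral_sum) measurable
  also have "\<dots> = (\<Sum>j<N. \<integral>\<^sup>+h. (\<integral>\<^sup>+s. E (s + real j * \<delta>, h) * indicator {0<..\<delta>} h * indicator {0<..<\<delta>} s \<partial>lborel) \<partial>lborel)"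
  proof (rule sum.cong[OF refl])
    fix j
    show "(\<integral>\<^sup>+s. (\<integral>\<^sup>+h. E (s + real j * \<delta>, h) * indicator {0<..\<delta>} h * indicator {0<..<\<delta>} s \<partial>lborel) \<partial>lborel) =
      (\<integral>\<^sup>+h. (\<integral>\<^sup>+s. E (s + real j * \<delta>, h) * indicator {0<..\<delta>} h * indicator {0<..<\<delta>} s \<partial>lborel) \<partial>lborel)"
      by (rule lborel_pair.Fubini'[where f="\<lambda>h s. E (s + real j * \<delta>, h) * indicator {0<..\<delta>} h * indicator {0<..<\<delta>} s"]) measurable
  qed
  also have "\<dots> = (\<integral>\<^sup>+h. (\<Sum>j<N. \<integral>\<^sup>+s. E (s + real j * \<delta>, h) * indicator {0<..\<delta>} h * indicator {0<..<\<delta>} s \<partial>lborel) \<partial>lborel)"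
    by (rule nn_integral_sum[symmetric]) measurable
  also have "\<dots> \<le> (\<integral>\<^sup>+h. ennreal e * indicator {0<..\<delta>} h \<partial>lborel)"
  proof (rule nn_integral_mono)
    fix h :: real
    have shift: "(\<integral>\<^sup>+s. E (s + real j * \<delta>, h) * indicator {0<..<\<delta>} s \<partial>lborel) =
       (\<integral>\<^sup>+u. E (u, h) * indicator {real j * \<delta><..<real (Suc j) * \<delta>} u \<partial>lborel)" for j
    proof -
      have Suc_eq: "real (Suc j) * \<delta> = real j * \<delta> + \<delta>" by (simp add: algebra_simps)
      have "(\<integral>\<^sup>+u. E (u, h) * indicator {real j * \<delta><..<real (Suc j) * \<delta>} u \<partial>lborel)
        = ennreal \<bar>1\<bar> * (\<integral>\<^sup>+s. E (real j * \<delta> + 1 * s, h) * indicator {real j * \<delta><..<real (Suc j) * \<delta>} (real j * \<delta> + 1 * s) \<partial>lborel)"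
        by (rule nn_integral_real_affine) (use Em2[of 0 h] in auto)
      also have "\<dots> = (\<integral>\<^sup>+s. E (s + real j * \<delta>, h) * indicator {0<..<\<delta>} s \<partial>lborel)"
      proof -
        have "E (real j * \<delta> + 1 * s, h) * indicator {real j * \<delta><..<real (Suc j) * \<delta>} (real j * \<delta> + 1 * s)
          = E (s + real j * \<delta>, h) * indicator {0<..<\<delta>} s" for s
          unfolding Suc_eq by (simp add: indicator_def add.commute)
        then show ?thesis by simp
      qed
      finally show ?thesis by simp
    qed
    have disj: "disjoint_family_on (\<lambda>j. {real j * \<delta><..<real (Suc j) * \<delta>}) {..<N}"
    proof -
      have "{real i * \<delta><..<real (Suc i) * \<delta>} \<inter> {real j * \<delta><..<real (Suc j) * \<delta>} = {}" if "i < j" for i j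
      proof -
        have "real (Suc i) * \<delta> \<le> real j * \<delta>" using that \<delta> by (intro mult_right_mono) auto
        then show ?thesis by (auto simp del: of_nat_Suc)
      qed
      then show ?thesis
        unfolding disjoint_family_on_def by (metis Int_commute linorder_neqE_nat)
    qed
    have le1: "(\<Sum>j<N. indicator {real j * \<delta><..<real (Suc j) * \<delta>} u) \<le> (1::ennreal)" for u
      unfolding indicator_UN_disjoint[OF finite_lessThan disj, symmetric] by (simp add: indicator_def)
    show "(\<Sum>j<N. \<integral>\<^sup>+s. E (s + real j * \<delta>, h) * indicator {0<..\<delta>} h * indicator {0<..<\<delta>} s \<partial>lborel) \<le> ennreal e * indicator {0<..\<delta>} h"
    proof (cases "h \<in> {0<..\<delta>}")
      case True
      have "(\<Sum>j<N. \<integral>\<^sup>+s. E (s + real j * \<delta>, h) * indicator {0<..\<delta>} h * indicator {0<..<\<delta>} s \<partial>lborel)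
        = (\<Sum>j<N. \<integral>\<^sup>+u. E (u, h) * indicator {real j * \<delta><..<real (Suc j) * \<delta>} u \<partial>lborel)"
        using True shift by simp
      also have "\<dots> = (\<integral>\<^sup>+u. (\<Sum>j<N. E (u, h) * indicator {real j * \<delta><..<real (Suc j) * \<delta>} u) \<partial>lborel)"
        using Em2[of 0 h] by (intro nn_integral_sum[symmetric]) auto
      also have "\<dots> \<le> (\<integral>\<^sup>+u. E (u, h) \<partial>lborel)"
      proof (rule nn_integral_mono)
        fix u
        show "(\<Sum>j<N. E (u, h) * indicator {real j * \<delta><..<real (Suc j) * \<delta>} u) \<le> E (u, h)"
          unfolding sum_distrib_left[symmetric] using mult_left_mono[OF le1[of u], of "E (u, h)"] by (simp only: mult_1_right zero_le)
      qed
      also have "\<dots> = translation_error g h"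
        unfolding E_def translation_error_def by (subst nn_integral_fst[symmetric]) auto
      also have "\<dots> \<le> ennreal e" using b True by simp
      finally show ?thesis using True by simp
    qed simp
  qed
  also have "\<dots> = ennreal e * ennreal \<delta>" using \<delta> by (subst nn_integral_cmult_indicator) auto
  finally show ?thesis .
qed

lemma H_integrable: assumes "f \<in> H t" shows "integrable Q (cutoff t f)"
proof -
  have "(\<lambda>z. cutoff t f z * cutoff t (\<lambda>s \<omega>. 1) z) = cutoff t f"
    by (auto simp: cutoff_def fun_eq_iff)
  with L2_mult_integrable[OF H_L2[OF assms] H_L2[OF H_const[of 1 t]]] show ?thesis by simp
qed

text \<open>Sampling on a fixed grid may hit exceptional times, as nothing is continuous in time.
  But the error is small on average over the offsets of the grid, so some offset is good; sampling
  at the left end of a cell keeps the steps adapted.\<close>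

lemma simple_dense_bounded:
  assumes f: "f \<in> H T" and T: "0 < T" and C: "\<And>s \<omega>. \<bar>f s \<omega>\<bar> \<le> C" and e: "0 < e"
  shows "\<exists>p \<tau> \<xi>. simple_integrand Ft T p \<tau> \<xi> \<and>
    (\<integral>\<^sup>+z. ennreal ((cutoff T f z - simple_process p \<tau> \<xi> (fst z) (snd z))\<^sup>2) \<partial>Q) \<le> ennreal e"
proof -
  define g where "g = cutoff T f"
  have C0: "0 \<le> C" using C[of undefined undefined] by linarith
  have gC: "\<bar>g z\<bar> \<le> C" for z using C C0 by (auto simp: g_def cutoff_def)
  have gi: "integrable Q g" unfolding g_def by (rule H_integrable[OF f])
  have gm [measurable]: "g \<in> borel_measurable Q" using gi by auto
  obtain \<delta>0 where \<delta>0: "0 < \<delta>0" "\<And>h. 0 < h \<Longrightarrow> h \<le> \<delta>0 \<Longrightarrow> translation_error g h \<le> ennreal (e/4)"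
    using translation_error_small[OF gi gC, of "e/4"] e by auto
  \<comment> \<open>The second bound limits the loss on the first cell, at most C^2 \<delta>, to
    e/4.\<close>
  define \<delta>1 where "\<delta>1 = min \<delta>0 (e / (4 * (C\<^sup>2 + 1)))"
  have C1: "0 < C\<^sup>2 + 1" by (simp add: add_nonneg_pos)
  have \<delta>1: "0 < \<delta>1" using \<delta>0 e C1 by (auto simp: \<delta>1_def)
  obtain N :: nat where N: "T / \<delta>1 < real N" using reals_Archimedean2 by blast
  have N0: "0 < N" using N divide_pos_pos[OF T \<delta>1] by (cases N) auto
  define \<delta> where "\<delta> = T / real N"
  have "T \<le> \<delta>1 * real N" using N by (simp add: pos_divide_less_eq[OF \<delta>1] mult.commute)
  then have \<delta>: "0 < \<delta>" "\<delta> \<le> \<delta>1" using N0 T by (simp_all add: \<delta>_def pos_divide_le_eq)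
  have ND: "real N * \<delta> = T" using N0 by (simp add: \<delta>_def)
  have avg: "(\<integral>\<^sup>+s. grid_error g \<delta> N s * indicator {0<..<\<delta>} s \<partial>lborel) \<le> ennreal (e/4) * ennreal \<delta>"
    by (rule grid_error_average[OF gm \<delta>(1)]) (use \<delta> \<delta>0 in \<open>auto simp: \<delta>1_def\<close>)
  \<comment> \<open>An error above e/2 at every offset would contradict the average of e/4.\<close>
  have "\<exists>s. 0 < s \<and> s < \<delta> \<and> grid_error g \<delta> N s \<le> ennreal (e/2)"
  proof (rule ccontr)
    assume "\<not> ?thesis"
    then have big: "ennreal (e/2) \<le> grid_error g \<delta> N s" if "0 < s" "s < \<delta>" for s using that by force
    have "ennreal (e/2) * ennreal \<delta> = (\<integral>\<^sup>+s. ennreal (e/2) * indicator {0<..<\<delta>} s \<partial>lborel)"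
      using \<delta> by (subst nn_integral_cmult_indicator) auto
    also have "\<dots> \<le> (\<integral>\<^sup>+s. grid_error g \<delta> N s * indicator {0<..<\<delta>} s \<partial>lborel)"
      using big by (intro nn_integral_mono) (auto simp: indicator_def)
    also have "\<dots> \<le> ennreal (e/4) * ennreal \<delta>" by (rule avg)
    finally have "ennreal (e/2 * \<delta>) \<le> ennreal (e/4 * \<delta>)" using e \<delta> by (simp add: ennreal_mult[symmetric])
    then have "e/2 * \<delta> \<le> e/4 * \<delta>" using e \<delta> by (subst (asm) ennreal_le_iff) auto
    then show False using e \<delta> by simp
  qed
  then obtain s where s: "0 < s" "s < \<delta>" "grid_error g \<delta> N s \<le> ennreal (e/2)" by auto
  \<comment> \<open>The partition 0, s, s + \<delta>, ..., s + (N-1) \<delta>, T: inner cells have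
    length \<delta>, and the last one is cut off at T.\<close>
  define \<tau> where "\<tau> i = (if i = 0 then 0 else if i \<le> N then s + real (i - 1) * \<delta> else T)" for i
  \<comment> \<open>The sampling point of the first cell would be s - \<delta>, which is negative,
    so the step there is 0.\<close>
  define \<xi> where "\<xi> i \<omega> = (if i = 0 then 0 else f (\<tau> i) \<omega>)" for i \<omega>
  have mono: "\<tau> i < \<tau> (Suc i)" if iN: "i < Suc N" for i
  proof -
    consider "i = 0" | "0 < i" "i < N" | "i = N" using iN by (metis less_Suc_eq neq0_conv)
    then show ?thesis
    proof cases
      case 1 then show ?thesis using N0 s by (simp add: \<tau>_def)
    next
      case 2 then show ?thesis using \<delta> by (simp add: \<tau>_def of_nat_diff)
    next
      case 3
      have "real (N - 1) * \<delta> + \<delta> = real N * \<delta>" using N0 by (simp add: of_nat_diff algebra_simps)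
      moreover have "\<tau> i = s + real (N - 1) * \<delta>" "\<tau> (Suc i) = T" using 3 N0 by (auto simp: \<tau>_def)
      ultimately show ?thesis using s ND by linarith
    qed
  qed
  have range: "0 \<le> \<tau> i \<and> \<tau> i \<le> T" if "i < Suc N" for i
  proof -
    have le: "real (i - 1) * \<delta> \<le> real (N - 1) * \<delta>" using that \<delta> by (intro mult_right_mono) auto
    have eq: "real (N - 1) * \<delta> + \<delta> = real N * \<delta>" using N0 by (simp add: of_nat_diff algebra_simps)
    have ge: "0 \<le> real (i - 1) * \<delta>" using \<delta> by (intro mult_nonneg_nonneg) auto
    show ?thesis
    proof (cases "i = 0")
      case True then show ?thesis using T by (simp add: \<tau>_def)
    next
      case False
      then have "\<tau> i = s + real (i - 1) * \<delta>" using that by (simp add: \<tau>_def)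
      then show ?thesis using le eq ge s ND by linarith
    qed
  qed
  have fm: "f (\<tau> i) \<in> borel_measurable (Ft (\<tau> i))" if "i < Suc N" for i
    using f range[OF that] by (auto simp: H_iff)
  have simple: "simple_integrand Ft T (Suc N) \<tau> \<xi>"
    unfolding simple_integrand_def
  proof (intro conjI allI impI)
    show "\<tau> 0 = 0" "\<tau> (Suc N) = T" by (simp_all add: \<tau>_def)
    fix i assume i: "i < Suc N"
    show "\<tau> i < \<tau> (Suc i)" by (rule mono[OF i])
    show "\<xi> i \<in> borel_measurable (Ft (\<tau> i))"
      using fm[OF i] by (cases "i = 0") (auto simp: \<xi>_def[abs_def])
    show "\<exists>C. \<forall>\<omega>\<in>space (Ft (\<tau> i)). \<bar>\<xi> i \<omega>\<bar> \<le> C"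
      using C C0 by (intro exI[of _ C]) (auto simp: \<xi>_def)
  qed
  let ?S = "\<lambda>z. simple_process (Suc N) \<tau> \<xi> (fst z) (snd z)"
  let ?cell = "\<lambda>j. {s + real j * \<delta><..s + real j * \<delta> + \<delta>}"
  have pw: "ennreal ((g z - ?S z)\<^sup>2) \<le> ennreal (C\<^sup>2) * indicator {0..s} (fst z) +
      (\<Sum>j<N. ennreal ((g z - g (s + real j * \<delta>, snd z))\<^sup>2) * indicator (?cell j) (fst z))" for z
  proof -
    let ?t = "fst z"
    consider "?t < 0 \<or> T < ?t" | "0 \<le> ?t" "?t \<le> s" | "s < ?t" "?t \<le> T" by linarith
    then show ?thesis
    proof cases
      case 1
      then have "g z = 0" "?S z = 0"
        using simple_process_support[OF simple, of ?t] T by (auto simp: g_def cutoff_def)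
      then show ?thesis by simp
    next
      case 2
      have "?S z = 0"
      proof (cases "?t = 0")
        case True then show ?thesis using simple_process_support[OF simple, of ?t] by simp
      next
        case False
        then have "?S z = \<xi> 0 (snd z)"
          using 2 N0 by (intro simple_process_eq mono) (auto simp: \<tau>_def)
        then show ?thesis by (simp add: \<xi>_def)
      qed
      moreover have "(g z)\<^sup>2 \<le> C\<^sup>2" using gC[of z] by (simp add: abs_le_square_iff[symmetric])
      ultimately have "ennreal ((g z - ?S z)\<^sup>2) \<le> ennreal (C\<^sup>2) * indicator {0..s} (fst z)"
        using 2 by (simp add: ennreal_leI)
      then show ?thesis by (simp add: add_increasing2)
    next
      case 3
      then obtain i where i: "i < Suc N" "\<tau> i < ?t" "?t \<le> \<tau> (Suc i)"
        using partition_cell[of "Suc N" \<tau> ?t, OF mono] s by (auto simp: \<tau>_def)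
      have i0: "i \<noteq> 0" 
      proof
        assume "i = 0"
        then have "?t \<le> s" using i N0 by (simp add: \<tau>_def)
        with 3 show False by simp
      qed
      define j where "j = i - 1"
      have j: "j < N" "i = Suc j" using i i0 by (auto simp: j_def)
      have ti: "\<tau> i = s + real j * \<delta>" using j i by (simp add: \<tau>_def)
      have "\<tau> (Suc i) \<le> s + real j * \<delta> + \<delta>"
      proof (cases "Suc i \<le> N")
        case True then show ?thesis using j by (simp add: \<tau>_def algebra_simps)
      next
        case False
        then have "N = Suc j" using i j by simp
        then show ?thesis using ND s j by (simp add: \<tau>_def algebra_simps)
      qed
      then have cell: "?t \<in> ?cell j" using i ti by auto
      have "?S z = \<xi> i (snd z)" by (rule simple_process_eq[OF mono i])
      also have "\<dots> = g (s + real j * \<delta>, snd z)"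
        using range[OF i(1)] i0 by (simp add: \<xi>_def g_def cutoff_def ti)
      finally have "ennreal ((g z - ?S z)\<^sup>2) = ennreal ((g z - g (s + real j * \<delta>, snd z))\<^sup>2) * indicator (?cell j) (fst z)"
        using cell by simp
      also have "\<dots> \<le> (\<Sum>j<N. ennreal ((g z - g (s + real j * \<delta>, snd z))\<^sup>2) * indicator (?cell j) (fst z))"
        using j by (intro member_le_sum) auto
      finally show ?thesis by (simp add: add_increasing)
    qed
  qed
  have gjm [measurable]: "(\<lambda>\<omega>. g (a, \<omega>)) \<in> borel_measurable P" for a by measurable
  have "(\<integral>\<^sup>+z. ennreal ((g z - ?S z)\<^sup>2) \<partial>Q) \<le> (\<integral>\<^sup>+z. ennreal (C\<^sup>2) * indicator {0..s} (fst z) +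
      (\<Sum>j<N. ennreal ((g z - g (s + real j * \<delta>, snd z))\<^sup>2) * indicator (?cell j) (fst z)) \<partial>Q)"
    by (intro nn_integral_mono pw)
  also have "\<dots> = (\<integral>\<^sup>+z. ennreal (C\<^sup>2) * indicator {0..s} (fst z) \<partial>Q) +
      (\<Sum>j<N. \<integral>\<^sup>+z. ennreal ((g z - g (s + real j * \<delta>, snd z))\<^sup>2) * indicator (?cell j) (fst z) \<partial>Q)"
    by (subst nn_integral_add, measurable) (subst nn_integral_sum, measurable)
  also have "(\<integral>\<^sup>+z. ennreal (C\<^sup>2) * indicator {0..s} (fst z) \<partial>Q) = ennreal (C\<^sup>2) * ennreal s"
  proof -
    have "(\<integral>\<^sup>+z. ennreal (C\<^sup>2) * indicator {0..s} (fst z) \<partial>Q) = (\<integral>\<^sup>+t. \<integral>\<^sup>+\<omega>. ennreal (C\<^sup>2) * indicator {0..s} t \<partial>P \<partial>lborel)"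
      by (subst nn_integral_fst[symmetric]) auto
    also have "\<dots> = (\<integral>\<^sup>+t. ennreal (C\<^sup>2) * indicator {0..s} t \<partial>lborel)" by (simp add: emeasure_space_1)
    also have "\<dots> = ennreal (C\<^sup>2) * ennreal s" using s by (subst nn_integral_cmult_indicator) auto
    finally show ?thesis .
  qed
  also have "(\<Sum>j<N. \<integral>\<^sup>+z. ennreal ((g z - g (s + real j * \<delta>, snd z))\<^sup>2) * indicator (?cell j) (fst z) \<partial>Q) = grid_error g \<delta> N s"
    unfolding grid_error_def
  proof (rule sum.cong[OF refl])
    fix j
    let ?a = "s + real j * \<delta>"
    have "(\<integral>\<^sup>+z. ennreal ((g z - g (?a, snd z))\<^sup>2) * indicator (?cell j) (fst z) \<partial>Q)
      = (\<integral>\<^sup>+t. \<integral>\<^sup>+\<omega>. ennreal ((g (t, \<omega>) - g (?a, \<omega>))\<^sup>2) * indicator (?cell j) t \<partial>P \<partial>lborel)"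
      by (subst nn_integral_fst[symmetric]) auto
    also have "\<dots> = (\<integral>\<^sup>+t. (\<integral>\<^sup>+\<omega>. ennreal ((g (t, \<omega>) - g (?a, \<omega>))\<^sup>2) \<partial>P) * indicator (?cell j) t \<partial>lborel)"
      by (intro nn_integral_cong nn_integral_multc) measurable
    also have "\<dots> = ennreal \<bar>1\<bar> * (\<integral>\<^sup>+h. (\<integral>\<^sup>+\<omega>. ennreal ((g (?a + 1 * h, \<omega>) - g (?a, \<omega>))\<^sup>2) \<partial>P) * indicator (?cell j) (?a + 1 * h) \<partial>lborel)"
    proof (rule nn_integral_real_affine)
      have "(\<lambda>t. (\<integral>\<^sup>+\<omega>. ennreal ((g (t, \<omega>) - g (?a, \<omega>))\<^sup>2) \<partial>P) * indicator (?cell j) t) \<in> borel_measurable lborel"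
        by measurable
      then show "(\<lambda>t. (\<integral>\<^sup>+\<omega>. ennreal ((g (t, \<omega>) - g (?a, \<omega>))\<^sup>2) \<partial>P) * indicator (?cell j) t) \<in> borel_measurable borel"
        by simp
    qed simp
    also have "\<dots> = (\<integral>\<^sup>+h. (\<integral>\<^sup>+\<omega>. ennreal ((g (?a + h, \<omega>) - g (?a, \<omega>))\<^sup>2) \<partial>P) * indicator {0<..\<delta>} h \<partial>lborel)"
    proof -
      have "indicator (?cell j) (?a + 1 * h) = (indicator {0<..\<delta>} h :: ennreal)" for h
        by (simp add: indicator_def)
      then show ?thesis by (simp only: mult_1 abs_one ennreal_1)
    qed
    finally show "(\<integral>\<^sup>+z. ennreal ((g z - g (?a, snd z))\<^sup>2) * indicator (?cell j) (fst z) \<partial>Q) =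
      (\<integral>\<^sup>+h. (\<integral>\<^sup>+\<omega>. ennreal ((g (?a + h, \<omega>) - g (?a, \<omega>))\<^sup>2) \<partial>P) * indicator {0<..\<delta>} h \<partial>lborel)" .
  qed
  also have "ennreal (C\<^sup>2) * ennreal s + grid_error g \<delta> N s \<le> ennreal (e/4) + ennreal (e/2)"
  proof (rule add_mono[OF _ s(3)])
    have "C\<^sup>2 * s \<le> (C\<^sup>2 + 1) * (e / (4 * (C\<^sup>2 + 1)))"
      using s \<delta> by (intro mult_mono) (auto simp: \<delta>1_def)
    also have "\<dots> = e / 4" using C1 by (simp add: field_simps)
    finally show "ennreal (C\<^sup>2) * ennreal s \<le> ennreal (e/4)"
      using s by (subst ennreal_mult[symmetric]) (auto intro: ennreal_leI)
  qed
  also have "\<dots> \<le> ennreal e" using e by (subst ennreal_plus[symmetric]) (auto intro: ennreal_leI)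
  finally show ?thesis using simple unfolding g_def by blast
qed

lemma AE_Q_fst_neq: "AE z in Q. fst z \<noteq> (a::real)"
proof (rule Q.AE_pair_measure)
  show "{x \<in> space Q. fst x \<noteq> a} \<in> sets Q" by measurable
  show "AE x in lborel. AE y in P. fst (x, y) \<noteq> a" using AE_lborel_singleton[of a] by simp
qed

text \<open>Truncation at level n keeps the process adapted and converges in mean square by
  dominated convergence; the truncated process is bounded.\<close>

lemma simple_dense:
  assumes f: "f \<in> H T" and T: "0 \<le> T" and e: "0 < e"
  shows "\<exists>p \<tau> \<xi>. simple_integrand Ft T p \<tau> \<xi> \<and>
    (\<integral>z. (cutoff T f z - simple_process p \<tau> \<xi> (fst z) (snd z))\<^sup>2 \<partial>Q) \<le> e"
proof (cases "T = 0")
  case True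
  \<comment> \<open>A degenerate interval admits only the partition without cells, and the slice at
    time 0 is null.\<close>
  have S: "simple_integrand Ft T 0 (\<lambda>_. 0) (\<lambda>_ _. 0)" using True by (simp add: simple_integrand_def)
  have "AE z in Q. (cutoff T f z - simple_process 0 (\<lambda>_. 0) (\<lambda>_ _. 0) (fst z) (snd z))\<^sup>2 = 0"
    using AE_Q_fst_neq[of 0] by eventually_elim (auto simp: True cutoff_def simple_process_def)
  then have "(\<integral>z. (cutoff T f z - simple_process 0 (\<lambda>_. 0) (\<lambda>_ _. 0) (fst z) (snd z))\<^sup>2 \<partial>Q) = 0"
    by (rule integral_eq_zero_AE)
  with S e show ?thesis by (intro exI conjI) auto
next
  case False
  define c where "c n x = max (- real n) (min (real n) x)" for n x
  define fn where "fn n s \<omega> = c n (f s \<omega>)" for n s \<omega>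
  have cx: "\<bar>c n x\<bar> \<le> \<bar>x\<bar>" "\<bar>x - c n x\<bar> \<le> \<bar>x\<bar>" "\<bar>c n x\<bar> \<le> real n" for n x
    by (auto simp: c_def)
  have c0: "c n 0 = 0" for n by (simp add: c_def)
  have cm [measurable]: "c n \<in> borel_measurable borel" for n unfolding c_def[abs_def] by measurable
  have cut: "cutoff T (fn n) = (\<lambda>z. c n (cutoff T f z))" for n
    by (auto simp: fn_def cutoff_def fun_eq_iff c0)
  have fL: "cutoff T f \<in> L2 Q" using f by (rule H_L2)
  note [measurable] = L2_measurable[OF fL]
  have fnH: "fn n \<in> H T" for n
    unfolding H_iff
  proof (intro conjI ballI)
    show "cutoff T (fn n) \<in> L2 Q"
      unfolding cut L2_def
    proof safe
      show "integrable Q (\<lambda>x. (c n (cutoff T f x))\<^sup>2)"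
      proof (rule Bochner_Integration.integrable_bound[OF L2_integrable_sq[OF fL]])
        show "AE x in Q. norm ((c n (cutoff T f x))\<^sup>2) \<le> norm ((cutoff T f x)\<^sup>2)"
          using abs_le_square_iff[THEN iffD1, OF cx(1)] by simp
      qed measurable
    qed measurable
    fix s assume "s \<in> {0..T}"
    then have "f s \<in> borel_measurable (Ft s)" using f by (auto simp: H_iff)
    then show "fn n s \<in> borel_measurable (Ft s)" unfolding fn_def[abs_def] by measurable
  qed
  have "(\<lambda>n. \<integral>z. (cutoff T f z - c n (cutoff T f z))\<^sup>2 \<partial>Q) \<longlonglongrightarrow> (\<integral>z. 0 \<partial>Q)"
  proof (rule integral_dominated_convergence[where w="\<lambda>z. (cutoff T f z)\<^sup>2"])
    show "AE z in Q. (\<lambda>n. (cutoff T f z - c n (cutoff T f z))\<^sup>2) \<longlonglongrightarrow> 0"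
    proof (rule AE_I2)
      fix z
      obtain m where m: "\<bar>cutoff T f z\<bar> \<le> real m" using real_arch_simple by blast
      have "(cutoff T f z - c n (cutoff T f z))\<^sup>2 = 0" if "m \<le> n" for n
      proof -
        have "\<bar>cutoff T f z\<bar> \<le> real n" using m that by (meson of_nat_le_iff order_trans)
        then show ?thesis by (simp add: c_def abs_le_iff)
      qed
      then show "(\<lambda>n. (cutoff T f z - c n (cutoff T f z))\<^sup>2) \<longlonglongrightarrow> 0"
        by (intro tendsto_eventually) (auto simp: eventually_sequentially intro: exI[of _ m])
    qed
    show "AE z in Q. norm ((cutoff T f z - c n (cutoff T f z))\<^sup>2) \<le> (cutoff T f z)\<^sup>2" for n
      using abs_le_square_iff[THEN iffD1, OF cx(2)] by simp
  qed (use L2_integrable_sq[OF fL] in auto)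
  then have "(\<lambda>n. \<integral>z. (cutoff T f z - cutoff T (fn n) z)\<^sup>2 \<partial>Q) \<longlonglongrightarrow> 0" by (simp add: cut)
  then have "eventually (\<lambda>n. (\<integral>z. (cutoff T f z - cutoff T (fn n) z)\<^sup>2 \<partial>Q) < e/4) sequentially"
    by (rule order_tendstoD(2)) (use e in simp)
  then obtain n where n: "(\<integral>z. (cutoff T f z - cutoff T (fn n) z)\<^sup>2 \<partial>Q) < e/4" by (auto simp: eventually_sequentially)
  have "\<bar>fn n s \<omega>\<bar> \<le> real n" for s \<omega> using cx(3) by (simp add: fn_def)
  from simple_dense_bounded[OF fnH _ this, of "e/4"] T False e
  obtain p \<tau> \<xi> where S: "simple_integrand Ft T p \<tau> \<xi>"
    and le: "(\<integral>\<^sup>+z. ennreal ((cutoff T (fn n) z - simple_process p \<tau> \<xi> (fst z) (snd z))\<^sup>2) \<partial>Q) \<le> ennreal (e/4)" by auto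
  note SL = simple_process_L2[OF S]
  have "(\<integral>z. (cutoff T (fn n) z - simple_process p \<tau> \<xi> (fst z) (snd z))\<^sup>2 \<partial>Q) \<le> e/4"
    using le unfolding L2_nn_integral[OF L2_diff[OF H_L2[OF fnH] SL]] using e by (subst (asm) ennreal_le_iff) auto
  with L2_sq_triangle[OF fL H_L2[OF fnH] SL, of n] n
  have "(\<integral>z. (cutoff T f z - simple_process p \<tau> \<xi> (fst z) (snd z))\<^sup>2 \<partial>Q) \<le> e" by linarith
  then show ?thesis using S by blast
qed

text \<open>The rate 1/8 leaves the summable (1/4)^k after multiplication by the weight 2^k of
  \<open>L2_complete\<close>.\<close>

lemma simple_approx:
  assumes f: "f \<in> H t" and t: "0 \<le> t"
  obtains p \<tau> \<xi> where "\<And>k::nat. simple_integrand Ft t (p k) (\<tau> k) (\<xi> k)"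
    "\<And>k. (\<integral>z. (cutoff t f z - simple_process (p k) (\<tau> k) (\<xi> k) (fst z) (snd z))\<^sup>2 \<partial>Q) \<le> (1/8)^k"
proof -
  have "\<forall>k::nat. \<exists>p \<tau> \<xi>. simple_integrand Ft t p \<tau> \<xi> \<and>
    (\<integral>z. (cutoff t f z - simple_process p \<tau> \<xi> (fst z) (snd z))\<^sup>2 \<partial>Q) \<le> (1/8)^k" (is "\<forall>k. \<exists>p \<tau> \<xi>. ?R k p \<tau> \<xi>")
    using simple_dense[OF f t] by simp
  from choice[OF this] obtain p where "\<forall>k. \<exists>\<tau> \<xi>. ?R k (p k) \<tau> \<xi>" by blast
  from choice[OF this] obtain \<tau> where "\<forall>k. \<exists>\<xi>. ?R k (p k) (\<tau> k) \<xi>" by blast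
  from choice[OF this] obtain \<xi> where "\<forall>k. ?R k (p k) (\<tau> k) (\<xi> k)" by blast
  then show ?thesis by (intro that[of p \<tau> \<xi>]) blast+
qed

lemma simple_isometry_diff:
  assumes S: "simple_integrand Ft t p \<tau> \<xi>" and T: "simple_integrand Ft t q \<sigma> \<eta>"
  shows "expectation (\<lambda>\<omega>. (simple_ito_integral W p \<tau> \<xi> \<omega> - simple_ito_integral W q \<sigma> \<eta> \<omega>)\<^sup>2) =
    (\<integral>z. (simple_process p \<tau> \<xi> (fst z) (snd z) - simple_process q \<sigma> \<eta> (fst z) (snd z))\<^sup>2 \<partial>Q)"
proof -
  have expand: "(\<integral>x. (X x - Y x)\<^sup>2 \<partial>M) = (\<integral>x. X x * X x \<partial>M) - 2 * (\<integral>x. X x * Y x \<partial>M) + (\<integral>x. Y x * Y x \<partial>M)"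
    if X: "X \<in> L2 M" and Y: "Y \<in> L2 M" for X Y and M :: "'c measure"
  proof -
    have "(\<integral>x. (X x - Y x)\<^sup>2 \<partial>M) = (\<integral>x. X x * X x - 2 * (X x * Y x) + Y x * Y x \<partial>M)"
      by (intro Bochner_Integration.integral_cong) (auto simp: power2_eq_square algebra_simps)
    then show ?thesis
      using L2_mult_integrable[OF X X] L2_mult_integrable[OF X Y] L2_mult_integrable[OF Y Y] by simp
  qed
  show ?thesis
    unfolding expand[OF simple_ito_integral_L2[OF S] simple_ito_integral_L2[OF T]]
      expand[OF simple_process_L2[OF S] simple_process_L2[OF T]]
      simple_isometry[OF S S] simple_isometry[OF S T] simple_isometry[OF T T] ..
qed

end

section \<open>Fast mean square limits and existence of the Ito integral\<close>

lemma summable_mesh: "summable (\<lambda>k. 2^k * (c * (1/8::real)^k))"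
proof -
  have "2^k * (1/8::real)^k = (1/4)^k" for k
    by (subst power_mult_distrib[symmetric]) simp
  then have "(\<lambda>k. 2^k * (c * (1/8::real)^k)) = (\<lambda>k. c * (1/4)^k)"
    by (simp only: mult.left_commute)
  moreover have "summable (\<lambda>k. c * (1/4::real)^k)" by (rule summable_mult[OF summable_geometric]) simp
  ultimately show ?thesis by (simp only:)
qed

lemma tendsto_mesh: "(\<lambda>k. c * (1/8::real)^k) \<longlonglongrightarrow> 0"
  using tendsto_mult_right_zero[OF LIMSEQ_realpow_zero[of "1/8::real"]] by simp

lemma L2_consecutive:
  assumes f: "f \<in> L2 M" and S: "\<And>k. S k \<in> L2 M" and le: "\<And>k. (\<integral>z. (f z - S k z)\<^sup>2 \<partial>M) \<le> (1/8)^k"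
  shows "(\<integral>z. (S (Suc k) z - S k z)\<^sup>2 \<partial>M) \<le> 4 * (1/8)^k"
proof -
  have "(\<integral>z. (S (Suc k) z - S k z)\<^sup>2 \<partial>M) \<le> 2 * (\<integral>z. (S (Suc k) z - f z)\<^sup>2 \<partial>M) + 2 * (\<integral>z. (f z - S k z)\<^sup>2 \<partial>M)"
    by (rule L2_sq_triangle[OF S f S])
  also have "(\<integral>z. (S (Suc k) z - f z)\<^sup>2 \<partial>M) = (\<integral>z. (f z - S (Suc k) z)\<^sup>2 \<partial>M)"
    by (simp add: power2_commute)
  finally have 1: "(\<integral>z. (S (Suc k) z - S k z)\<^sup>2 \<partial>M) \<le> 2 * (\<integral>z. (f z - S (Suc k) z)\<^sup>2 \<partial>M) + 2 * (\<integral>z. (f z - S k z)\<^sup>2 \<partial>M)" .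
  have "(1/8::real)^Suc k \<le> (1/8)^k" by (intro power_decreasing) auto
  with 1 le[of k] le[of "Suc k"] show ?thesis by linarith
qed

text \<open>Both \<open>f\<close> and the pointwise \<open>lim\<close> are mean square limits of the
  same sequence. In this way a given \<open>f\<close> acquires the measurability of its
  approximations, for instance with respect to the filtration.\<close>

lemma L2_fast_limit:
  assumes "finite_measure M" and f: "f \<in> L2 M" and X: "\<And>k. X k \<in> L2 M" and c: "0 \<le> c"
    and le: "\<And>k. (\<integral>z. (f z - X k z)\<^sup>2 \<partial>M) \<le> c * (1/8)^k"
  shows "AE z in M. f z = lim (\<lambda>k. X k z)"
proof -
  have cons: "(\<integral>z. (X (Suc k) z - X k z)\<^sup>2 \<partial>M) \<le> (4 * c) * (1/8)^k" for k
  proof -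
    have "(\<integral>z. (X (Suc k) z - X k z)\<^sup>2 \<partial>M) \<le> 2 * (\<integral>z. (X (Suc k) z - f z)\<^sup>2 \<partial>M) + 2 * (\<integral>z. (f z - X k z)\<^sup>2 \<partial>M)"
      by (rule L2_sq_triangle[OF X f X])
    moreover have "(\<integral>z. (X (Suc k) z - f z)\<^sup>2 \<partial>M) = (\<integral>z. (f z - X (Suc k) z)\<^sup>2 \<partial>M)"
      by (simp add: power2_commute)
    moreover have "c * (1/8)^Suc k \<le> c * (1/8)^k" using c by (intro mult_left_mono power_decreasing) auto
    ultimately show ?thesis using le[of k] le[of "Suc k"] by linarith
  qed
  define Y where "Y z = lim (\<lambda>k. X k z)" for z
  note LC = L2_complete[OF assms(1) X cons summable_mesh, folded Y_def]
  have "(\<integral>z. (f z - Y z)\<^sup>2 \<partial>M) \<le> 0"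
  proof (rule LIMSEQ_le_const)
    show "(\<lambda>k. 2 * (c * (1/8)^k) + 2 * (\<integral>z. (Y z - X k z)\<^sup>2 \<partial>M)) \<longlonglongrightarrow> 0"
      using tendsto_add[OF tendsto_mult_right_zero[OF tendsto_mesh[of c], of 2] tendsto_mult_right_zero[OF LC(4), of 2]] by simp
    show "\<exists>N. \<forall>k\<ge>N. (\<integral>z. (f z - Y z)\<^sup>2 \<partial>M) \<le> 2 * (c * (1/8)^k) + 2 * (\<integral>z. (Y z - X k z)\<^sup>2 \<partial>M)"
    proof (intro exI allI impI)
      fix k
      have "(\<integral>z. (f z - Y z)\<^sup>2 \<partial>M) \<le> 2 * (\<integral>z. (f z - X k z)\<^sup>2 \<partial>M) + 2 * (\<integral>z. (X k z - Y z)\<^sup>2 \<partial>M)"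
        by (rule L2_sq_triangle[OF f X LC(2)])
      also have "(\<integral>z. (X k z - Y z)\<^sup>2 \<partial>M) = (\<integral>z. (Y z - X k z)\<^sup>2 \<partial>M)" by (simp add: power2_commute)
      finally show "(\<integral>z. (f z - Y z)\<^sup>2 \<partial>M) \<le> 2 * (c * (1/8)^k) + 2 * (\<integral>z. (Y z - X k z)\<^sup>2 \<partial>M)"
        using le[of k] by simp
    qed
  qed
  then have "(\<integral>z. (f z - Y z)\<^sup>2 \<partial>M) = 0"
    by (intro antisym integral_nonneg_AE) auto
  then have "AE z in M. f z - Y z = 0"
    by (intro L2_AE_zero L2_diff f LC(2))
  then show ?thesis by (auto simp: Y_def)
qed

context brownian
begin

text \<open>By the isometry the integrals of a fast approximating sequence are as close to each
  other as the integrands. Their pointwise \<open>lim\<close> is a version that is measurable at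
  time t.\<close>

lemma ito_exists:
  assumes f: "f \<in> H t" and t: "0 \<le> t"
  shows "\<exists>J. J \<in> borel_measurable (Ft t) \<and> has_ito_integral P Ft W t f J"
proof -
  obtain p \<tau> \<xi> where S: "\<And>k::nat. simple_integrand Ft t (p k) (\<tau> k) (\<xi> k)"
    and le: "\<And>k. (\<integral>z. (cutoff t f z - simple_process (p k) (\<tau> k) (\<xi> k) (fst z) (snd z))\<^sup>2 \<partial>Q) \<le> (1/8)^k"
    using simple_approx[OF f t] by blast
  let ?X = "\<lambda>k. simple_ito_integral W (p k) (\<tau> k) (\<xi> k)"
  define J where "J \<omega> = lim (\<lambda>k. ?X k \<omega>)" for \<omega>
  have le2: "(\<integral>\<omega>. (?X (Suc k) \<omega> - ?X k \<omega>)\<^sup>2 \<partial>P) \<le> 4 * (1/8)^k" for k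
    unfolding simple_isometry_diff[OF S S] by (rule L2_consecutive[OF H_L2[OF f] simple_process_L2[OF S] le])
  note LC = L2_complete[OF finite_measure_axioms simple_ito_integral_L2[OF S] le2 summable_mesh, folded J_def]
  have "J \<in> borel_measurable (Ft t)"
    unfolding J_def[abs_def] by (intro borel_measurable_lim_metric simple_ito_integral_Ft[OF S])
  moreover have "(\<lambda>k. \<integral>z. (cutoff t f z - simple_process (p k) (\<tau> k) (\<xi> k) (fst z) (snd z))\<^sup>2 \<partial>Q) \<longlonglongrightarrow> 0"
    by (rule Lim_null_comparison[OF _ tendsto_mesh[of 1]]) (use le in \<open>simp add: eventually_sequentially\<close>)
  then have "has_ito_integral P Ft W t f J"
    unfolding has_ito_iff using f LC(2,4) S by blast
  ultimately show ?thesis by blast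
qed

section \<open>Time integrals\<close>

text \<open>Cauchy-Schwarz in time against the indicator of the interval, for almost every path;
  this is the source of the factor b - a.\<close>

lemma time_integral_bound:
  assumes c: "c \<in> L2 Q" and ab: "a \<le> b" and supp: "\<And>z. fst z < a \<or> b < fst z \<Longrightarrow> c z = 0"
  shows "AE \<omega> in P. integrable lborel (\<lambda>s. c (s, \<omega>))"
    "(\<lambda>\<omega>. \<integral>s. c (s, \<omega>) \<partial>lborel) \<in> L2 P"
    "expectation (\<lambda>\<omega>. (\<integral>s. c (s, \<omega>) \<partial>lborel)\<^sup>2) \<le> (b - a) * (\<integral>z. (c z)\<^sup>2 \<partial>Q)"
proof -
  have [measurable]: "c \<in> borel_measurable Q" using c by auto
  let ?I = "indicator {a..b} :: real \<Rightarrow> real"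
  have I2: "?I \<in> L2 lborel"
  proof -
    have "(\<lambda>x. (?I x)\<^sup>2) = ?I" by (auto simp: indicator_def fun_eq_iff)
    moreover have "integrable lborel ?I" by (simp add: integrable_indicator_iff emeasure_lborel_Icc_eq)
    ultimately show ?thesis by (simp add: L2_def)
  qed
  have eq: "c (s, \<omega>) = ?I s * c (s, \<omega>)" for s \<omega> using supp[of "(s, \<omega>)"]
    by (cases "s < a \<or> b < s") (auto simp: indicator_def)
  have "(\<integral>\<^sup>+\<omega>. (\<integral>\<^sup>+s. ennreal ((c (s, \<omega>))\<^sup>2) \<partial>lborel) \<partial>P) = (\<integral>\<^sup>+z. ennreal ((c z)\<^sup>2) \<partial>Q)"
    by (rule Q.nn_integral_snd) measurable
  also have "\<dots> < \<infinity>" using c by (simp add: L2_iff_nn)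
  finally have "AE \<omega> in P. (\<integral>\<^sup>+s. ennreal ((c (s, \<omega>))\<^sup>2) \<partial>lborel) \<noteq> \<infinity>"
    by (intro nn_integral_noteq_infinite) auto
  then have c2: "AE \<omega> in P. (\<lambda>s. c (s, \<omega>)) \<in> L2 lborel"
    using AE_space
  proof eventually_elim
    case (elim \<omega>)
    then show ?case unfolding L2_iff_nn by (auto simp: less_top)
  qed
  show "AE \<omega> in P. integrable lborel (\<lambda>s. c (s, \<omega>))"
    using c2
  proof eventually_elim
    case (elim \<omega>)
    from L2_mult_integrable[OF I2 this] show ?case unfolding eq[symmetric] .
  qed
  have m: "(\<lambda>\<omega>. \<integral>s. c (s, \<omega>) \<partial>lborel) \<in> borel_measurable P" by measurable
  have "AE \<omega> in P. ennreal ((\<integral>s. c (s, \<omega>) \<partial>lborel)\<^sup>2) \<le> ennreal (b - a) * (\<integral>\<^sup>+s. ennreal ((c (s, \<omega>))\<^sup>2) \<partial>lborel)"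
    using c2
  proof eventually_elim
    case (elim \<omega>)
    have "(\<integral>s. c (s, \<omega>) \<partial>lborel)\<^sup>2 \<le> (\<integral>s. (?I s)\<^sup>2 \<partial>lborel) * (\<integral>s. (c (s, \<omega>))\<^sup>2 \<partial>lborel)"
      using Cauchy_Schwarz_integral[OF I2 elim] unfolding eq[symmetric] .
    also have "(\<integral>s. (?I s)\<^sup>2 \<partial>lborel) = (\<integral>s. ?I s \<partial>lborel)"
      by (intro Bochner_Integration.integral_cong) (auto simp: indicator_def)
    also have "\<dots> = b - a" using ab by simp
    finally have "ennreal ((\<integral>s. c (s, \<omega>) \<partial>lborel)\<^sup>2) \<le> ennreal ((b - a) * (\<integral>s. (c (s, \<omega>))\<^sup>2 \<partial>lborel))"
      by (rule ennreal_leI)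
    then show ?case unfolding L2_nn_integral[OF elim] using ab by (simp add: ennreal_mult)
  qed
  then have "(\<integral>\<^sup>+\<omega>. ennreal ((\<integral>s. c (s, \<omega>) \<partial>lborel)\<^sup>2) \<partial>P) \<le> (\<integral>\<^sup>+\<omega>. ennreal (b - a) * (\<integral>\<^sup>+s. ennreal ((c (s, \<omega>))\<^sup>2) \<partial>lborel) \<partial>P)"
    by (rule nn_integral_mono_AE)
  also have "\<dots> = ennreal (b - a) * (\<integral>\<^sup>+\<omega>. (\<integral>\<^sup>+s. ennreal ((c (s, \<omega>))\<^sup>2) \<partial>lborel) \<partial>P)"
    by (rule nn_integral_cmult) measurable
  also have "\<dots> = ennreal (b - a) * (\<integral>\<^sup>+z. ennreal ((c z)\<^sup>2) \<partial>Q)"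
    by (subst Q.nn_integral_snd) auto
  also have "\<dots> = ennreal ((b - a) * (\<integral>z. (c z)\<^sup>2 \<partial>Q))"
    unfolding L2_nn_integral[OF c] using ab by (simp add: ennreal_mult)
  finally have le: "(\<integral>\<^sup>+\<omega>. ennreal ((\<integral>s. c (s, \<omega>) \<partial>lborel)\<^sup>2) \<partial>P) \<le> ennreal ((b - a) * (\<integral>z. (c z)\<^sup>2 \<partial>Q))" .
  then show L: "(\<lambda>\<omega>. \<integral>s. c (s, \<omega>) \<partial>lborel) \<in> L2 P"
    unfolding L2_iff_nn using m by (auto intro: le_less_trans)
  show "expectation (\<lambda>\<omega>. (\<integral>s. c (s, \<omega>) \<partial>lborel)\<^sup>2) \<le> (b - a) * (\<integral>z. (c z)\<^sup>2 \<partial>Q)"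
    using le unfolding L2_nn_integral[OF L] using ab by (subst (asm) ennreal_le_iff) auto
qed

definition drift :: "real \<Rightarrow> (real \<Rightarrow> 'w \<Rightarrow> real) \<Rightarrow> 'w \<Rightarrow> real" where
  "drift t f \<omega> = (\<integral>s. cutoff t f (s, \<omega>) \<partial>lborel)"

lemma drift_eq: "drift t f \<omega> = (LINT s:{0..t}|lborel. f s \<omega>)"
  unfolding drift_def set_lebesgue_integral_def
  by (intro Bochner_Integration.integral_cong) (auto simp: cutoff_def indicator_def)

lemma cutoff_outside: "fst z < 0 \<or> t < fst z \<Longrightarrow> cutoff t f z = 0"
  by (auto simp: cutoff_def)

lemma path_integrable: "f \<in> H t \<Longrightarrow> 0 \<le> t \<Longrightarrow> AE \<omega> in P. integrable lborel (\<lambda>s. cutoff t f (s, \<omega>))"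
  by (rule time_integral_bound(1)[OF H_L2 _ cutoff_outside])

lemma drift_L2: "f \<in> H t \<Longrightarrow> 0 \<le> t \<Longrightarrow> drift t f \<in> L2 P"
  unfolding drift_def[abs_def] by (rule time_integral_bound(2)[OF H_L2 _ cutoff_outside])

lemma drift_bound: "f \<in> H t \<Longrightarrow> 0 \<le> t \<Longrightarrow> expectation (\<lambda>\<omega>. (drift t f \<omega>)\<^sup>2) \<le> t * (\<integral>z. (cutoff t f z)\<^sup>2 \<partial>Q)"
  unfolding drift_def[abs_def] using time_integral_bound(3)[OF H_L2, of f t 0 t] cutoff_outside[of _ t f] by simp

lemma drift_linear:
  assumes I: "finite I" and f: "\<And>i. i \<in> I \<Longrightarrow> f i \<in> H t" and t: "0 \<le> t"
    and h: "\<And>s \<omega>. s \<in> {0..t} \<Longrightarrow> \<omega> \<in> space P \<Longrightarrow> h s \<omega> = (\<Sum>i\<in>I. a i * f i s \<omega>)"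
  shows "AE \<omega> in P. drift t h \<omega> = (\<Sum>i\<in>I. a i * drift t (f i) \<omega>)"
proof -
  have "AE \<omega> in P. \<forall>i\<in>I. integrable lborel (\<lambda>s. cutoff t (f i) (s, \<omega>))"
    by (rule AE_finite_allI[OF I path_integrable[OF f t]])
  then show ?thesis
    using AE_space
  proof eventually_elim
    case (elim \<omega>)
    have "drift t h \<omega> = (\<integral>s. (\<Sum>i\<in>I. a i * cutoff t (f i) (s, \<omega>)) \<partial>lborel)"
      unfolding drift_def using h elim(2) by (intro Bochner_Integration.integral_cong) (auto simp: cutoff_def)
    also have "\<dots> = (\<Sum>i\<in>I. a i * drift t (f i) \<omega>)"
      unfolding drift_def using elim(1) by (subst Bochner_Integration.integral_sum) auto
    finally show ?case .
  qed
qed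

text \<open>The two cutoffs differ exactly by \<open>f\<close> on the interval between s and t, and
  their squares by its square. The additional factor t - s, which the Ito integral lacks, is what
  separates drift from noise.\<close>

lemma drift_increment_bound:
  assumes f: "f \<in> H t" and st: "0 \<le> s" "s \<le> t"
  shows "expectation (\<lambda>\<omega>. (drift t f \<omega> - drift s f \<omega>)\<^sup>2) \<le> (t - s) * ((\<integral>z. (cutoff t f z)\<^sup>2 \<partial>Q) - (\<integral>z. (cutoff s f z)\<^sup>2 \<partial>Q))"
proof -
  let ?c = "\<lambda>z. cutoff t f z - cutoff s f z"
  have fs: "f \<in> H s" using H_mono[OF f st(2)] .
  have fm [measurable]: "cutoff t f \<in> borel_measurable Q" "cutoff s f \<in> borel_measurable Q"
    using H_L2[OF f] H_L2[OF fs] by auto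
  have c: "?c \<in> L2 Q" by (intro L2_diff H_L2 f fs)
  have supp: "?c z = 0" if "fst z < s \<or> t < fst z" for z using that st by (auto simp: cutoff_def)
  have "expectation (\<lambda>\<omega>. (\<integral>r. ?c (r, \<omega>) \<partial>lborel)\<^sup>2) \<le> (t - s) * (\<integral>z. (?c z)\<^sup>2 \<partial>Q)"
    by (rule time_integral_bound(3)[OF c st(2) supp])
  also have "(\<integral>z. (?c z)\<^sup>2 \<partial>Q) = (\<integral>z. (cutoff t f z)\<^sup>2 - (cutoff s f z)\<^sup>2 \<partial>Q)"
    by (intro Bochner_Integration.integral_cong) (use st in \<open>auto simp: cutoff_def\<close>)
  also have "\<dots> = (\<integral>z. (cutoff t f z)\<^sup>2 \<partial>Q) - (\<integral>z. (cutoff s f z)\<^sup>2 \<partial>Q)"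
    by (intro Bochner_Integration.integral_diff L2_integrable_sq H_L2 f fs)
  also have "expectation (\<lambda>\<omega>. (\<integral>r. ?c (r, \<omega>) \<partial>lborel)\<^sup>2) = expectation (\<lambda>\<omega>. (drift t f \<omega> - drift s f \<omega>)\<^sup>2)"
  proof (rule integral_cong_AE)
    show "AE \<omega> in P. (\<integral>r. ?c (r, \<omega>) \<partial>lborel)\<^sup>2 = (drift t f \<omega> - drift s f \<omega>)\<^sup>2"
      using path_integrable[OF f] path_integrable[OF fs] st
      by (auto simp: drift_def)
    show "(\<lambda>\<omega>. (drift t f \<omega> - drift s f \<omega>)\<^sup>2) \<in> borel_measurable P"
      unfolding drift_def by measurable
  qed measurable
  finally show ?thesis .
qed

lemma drift_simple_Ft:
  assumes S: "simple_integrand Ft t p \<tau> \<xi>"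
  shows "(\<lambda>\<omega>. \<integral>s. simple_process p \<tau> \<xi> s \<omega> \<partial>lborel) \<in> borel_measurable (Ft t)"
proof -
  have "(\<integral>s. simple_process p \<tau> \<xi> s \<omega> \<partial>lborel) = (\<Sum>i<p. \<xi> i \<omega> * (\<tau> (Suc i) - \<tau> i))" for \<omega>
  proof -
    have "(\<integral>s. simple_process p \<tau> \<xi> s \<omega> \<partial>lborel) = (\<Sum>i<p. \<integral>s. \<xi> i \<omega> * indicator {\<tau> i<..\<tau> (Suc i)} s \<partial>lborel)"
      unfolding simple_process_def
      by (rule Bochner_Integration.integral_sum)
         (use simple_integrandD(2)[OF S] in \<open>auto intro!: integrable_mult_right simp: integrable_indicator_iff less_imp_le\<close>)
    also have "\<dots> = (\<Sum>i<p. \<xi> i \<omega> * (\<tau> (Suc i) - \<tau> i))"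
      using simple_integrandD(2)[OF S] by (intro sum.cong) (auto simp: less_imp_le)
    finally show ?thesis .
  qed
  moreover have "\<xi> i \<in> borel_measurable (Ft t)" if "i < p" for i
    using measurable_Ft_mono[OF simple_integrandD(4)[OF S that], of t] simple_integrandD[OF S that] by auto
  ultimately show ?thesis by (simp add: borel_measurable_sum)
qed

text \<open>The process is only assumed measurable and adapted, not progressively measurable, so this
  needs the approximation by simple processes.\<close>

lemma drift_Ft:
  assumes f: "f \<in> H t" and t: "0 \<le> t"
  shows "drift t f \<in> borel_measurable (Ft t)"
proof -
  obtain p \<tau> \<xi> where S: "\<And>k::nat. simple_integrand Ft t (p k) (\<tau> k) (\<xi> k)"
    and le: "\<And>k. (\<integral>z. (cutoff t f z - simple_process (p k) (\<tau> k) (\<xi> k) (fst z) (snd z))\<^sup>2 \<partial>Q) \<le> (1/8)^k"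
    using simple_approx[OF f t] by blast
  let ?S = "\<lambda>k z. simple_process (p k) (\<tau> k) (\<xi> k) (fst z) (snd z)"
  define X where "X k \<omega> = (\<integral>s. simple_process (p k) (\<tau> k) (\<xi> k) s \<omega> \<partial>lborel)" for k \<omega>
  have supp: "?S k z = 0" if "fst z < 0 \<or> t < fst z" for k z
    using simple_process_support[OF S, of "fst z" k] that by auto
  note SL = simple_process_L2[OF S]
  note S1 = time_integral_bound(1)[OF SL t supp, simplified]
  have XL: "X k \<in> L2 P" for k unfolding X_def[abs_def] using time_integral_bound(2)[OF SL t supp] by simp
  have Xm: "X k \<in> borel_measurable (Ft t)" for k unfolding X_def[abs_def] by (rule drift_simple_Ft[OF S])
  have fX: "expectation (\<lambda>\<omega>. (drift t f \<omega> - X k \<omega>)\<^sup>2) \<le> t * (1/8)^k" for k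
  proof -
    let ?c = "\<lambda>z. cutoff t f z - ?S k z"
    have "expectation (\<lambda>\<omega>. (drift t f \<omega> - X k \<omega>)\<^sup>2) = expectation (\<lambda>\<omega>. (\<integral>r. ?c (r, \<omega>) \<partial>lborel)\<^sup>2)"
    proof (rule integral_cong_AE)
      have "AE \<omega> in P. (\<integral>r. ?c (r, \<omega>) \<partial>lborel) = drift t f \<omega> - X k \<omega>"
        using path_integrable[OF f t] S1[of k] by eventually_elim (simp add: drift_def X_def)
      then show "AE \<omega> in P. (drift t f \<omega> - X k \<omega>)\<^sup>2 = (\<integral>r. ?c (r, \<omega>) \<partial>lborel)\<^sup>2" by eventually_elim simp
      show "(\<lambda>\<omega>. (drift t f \<omega> - X k \<omega>)\<^sup>2) \<in> borel_measurable P"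
        using drift_L2[OF f t] XL[of k] by measurable
      have "?c \<in> borel_measurable Q" using H_L2[OF f] SL[of k] by measurable
      then show "(\<lambda>\<omega>. (\<integral>r. ?c (r, \<omega>) \<partial>lborel)\<^sup>2) \<in> borel_measurable P" by measurable
    qed
    also have "\<dots> \<le> (t - 0) * (\<integral>z. (?c z)\<^sup>2 \<partial>Q)"
      using supp[of _ k] by (intro time_integral_bound(3)[OF L2_diff[OF H_L2[OF f] SL] t]) (auto simp: cutoff_def)
    also have "\<dots> \<le> t * (1/8)^k" using le t by (simp add: mult_left_mono)
    finally show ?thesis .
  qed
  have "AE \<omega> in P. drift t f \<omega> = lim (\<lambda>k. X k \<omega>)"
    by (rule L2_fast_limit[OF finite_measure_axioms drift_L2[OF f t] XL t fX])
  then show ?thesis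
    by (intro measurable_Ft_cong_AE[OF borel_measurable_lim_metric[OF Xm]]) auto
qed

section \<open>The Ito process of a pair of integrands\<close>

text \<open>\<open>has_ito_integral\<close> asks only for measurability with respect to
  \<open>P\<close>; the choice fixes a version measurable at time t. Versions for different times
  are chosen independently of each other.\<close>

definition ito :: "real \<Rightarrow> (real \<Rightarrow> 'w \<Rightarrow> real) \<Rightarrow> 'w \<Rightarrow> real" where
  "ito t f = (SOME J. J \<in> borel_measurable (Ft t) \<and> has_ito_integral P Ft W t f J)"

definition stoch :: "real \<Rightarrow> (real \<Rightarrow> 'w \<Rightarrow> real) \<Rightarrow> (real \<Rightarrow> 'w \<Rightarrow> real) \<Rightarrow> 'w \<Rightarrow> real" where
  "stoch t f g \<omega> = drift t f \<omega> + ito t g \<omega>"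

definition sqnorm :: "real \<Rightarrow> (real \<Rightarrow> 'w \<Rightarrow> real) \<Rightarrow> real" where
  "sqnorm t f = (\<integral>z. (cutoff t f z)\<^sup>2 \<partial>Q)"

lemma ito:
  assumes "f \<in> H t" "0 \<le> t"
  shows ito_Ft: "ito t f \<in> borel_measurable (Ft t)" and has_ito: "has_ito_integral P Ft W t f (ito t f)"
  using someI_ex[OF ito_exists[OF assms]] by (auto simp: ito_def)

lemma has_ito_unique:
  assumes "has_ito_integral P Ft W t f J" "has_ito_integral P Ft W t f K"
  shows "AE \<omega> in P. J \<omega> = K \<omega>"
  using ito_linear[of "{()}" t "\<lambda>_. f" "\<lambda>_. K" f J "\<lambda>_. 1"] assms by simp

lemma sqnorm_nonneg: "0 \<le> sqnorm t f"
  by (simp add: sqnorm_def)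

lemma sqnorm_0: "sqnorm 0 f = 0"
proof -
  have "AE z in Q. (cutoff 0 f z)\<^sup>2 = 0"
    using AE_Q_fst_neq[of 0] by eventually_elim (auto simp: cutoff_def)
  then show ?thesis unfolding sqnorm_def by (rule integral_eq_zero_AE)
qed

lemma ito_norm: "f \<in> H t \<Longrightarrow> 0 \<le> t \<Longrightarrow> expectation (\<lambda>\<omega>. (ito t f \<omega>)\<^sup>2) = sqnorm t f"
  using ito_isometry[OF has_ito has_ito, of f t f t] by (simp add: power2_eq_square sqnorm_def)

lemma stoch_L2: "f \<in> H t \<Longrightarrow> g \<in> H t \<Longrightarrow> 0 \<le> t \<Longrightarrow> stoch t f g \<in> L2 P"
  unfolding stoch_def[abs_def] by (intro L2_add drift_L2 ito_L2[OF has_ito])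

lemma stoch_Ft: "f \<in> H t \<Longrightarrow> g \<in> H t \<Longrightarrow> 0 \<le> t \<Longrightarrow> stoch t f g \<in> borel_measurable (Ft t)"
  unfolding stoch_def[abs_def] by (intro borel_measurable_add drift_Ft ito_Ft)

lemma L2_sq_add:
  assumes "X \<in> L2 P" "Y \<in> L2 P"
  shows "expectation (\<lambda>\<omega>. (X \<omega> + Y \<omega>)\<^sup>2) \<le> 2 * expectation (\<lambda>\<omega>. (X \<omega>)\<^sup>2) + 2 * expectation (\<lambda>\<omega>. (Y \<omega>)\<^sup>2)"
  using L2_sq_triangle[OF assms(1) L2_zero L2_cmult[OF assms(2), of "-1"]] by simp

lemma stoch_bound:
  assumes "f \<in> H t" "g \<in> H t" "0 \<le> t"
  shows "expectation (\<lambda>\<omega>. (stoch t f g \<omega>)\<^sup>2) \<le> 2 * t * sqnorm t f + 2 * sqnorm t g"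
  unfolding stoch_def
  using L2_sq_add[OF drift_L2 ito_L2[OF has_ito], of f t g t] drift_bound[of f t] ito_norm[of g t] assms
  by (simp add: sqnorm_def)

lemma stoch_linear:
  assumes I: "finite I" and f: "\<And>i. i \<in> I \<Longrightarrow> f i \<in> H t" and g: "\<And>i. i \<in> I \<Longrightarrow> g i \<in> H t" and t: "0 \<le> t"
    and h: "\<And>s \<omega>. s \<in> {0..t} \<Longrightarrow> \<omega> \<in> space P \<Longrightarrow> h s \<omega> = (\<Sum>i\<in>I. a i * f i s \<omega>)"
    and k: "\<And>s \<omega>. s \<in> {0..t} \<Longrightarrow> \<omega> \<in> space P \<Longrightarrow> k s \<omega> = (\<Sum>i\<in>I. a i * g i s \<omega>)"
  shows "AE \<omega> in P. stoch t h k \<omega> = (\<Sum>i\<in>I. a i * stoch t (f i) (g i) \<omega>)"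
proof -
  have "(\<lambda>s \<omega>. \<Sum>i\<in>I. a i * g i s \<omega>) \<in> H t" using g by (intro H_sum H_cmult)
  then have kH: "k \<in> H t" by (rule H_cong) (simp add: k)
  have "AE \<omega> in P. ito t k \<omega> = (\<Sum>i\<in>I. a i * ito t (g i) \<omega>)"
  proof (rule ito_linear[OF I])
    show "has_ito_integral P Ft W t (g i) (ito t (g i))" if "i \<in> I" for i using has_ito g that t by auto
    show "has_ito_integral P Ft W t k (ito t k)" by (rule has_ito[OF kH t])
    show "AE z in Q. cutoff t k z = (\<Sum>i\<in>I. a i * cutoff t (g i) z)"
      by (rule AE_I2) (auto simp: cutoff_def k space_pair_measure)
  qed
  moreover have "AE \<omega> in P. drift t h \<omega> = (\<Sum>i\<in>I. a i * drift t (f i) \<omega>)"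
    by (rule drift_linear[OF I f t h])
  ultimately show ?thesis
    by eventually_elim (simp add: stoch_def sum.distrib distrib_left)
qed

text \<open>The isometry with horizons s and t shows that the integral up to s is orthogonal to the
  increment after s, so the second moments subtract.\<close>

lemma ito_increment:
  assumes f: "f \<in> H t" and st: "0 \<le> s" "s \<le> t"
  shows "expectation (\<lambda>\<omega>. (ito t f \<omega> - ito s f \<omega>)\<^sup>2) = sqnorm t f - sqnorm s f"
proof -
  have fs: "f \<in> H s" and t: "0 \<le> t" using H_mono[OF f st(2)] st by auto
  note It = has_ito[OF f t] and Is = has_ito[OF fs st(1)]
  have "expectation (\<lambda>\<omega>. (ito t f \<omega> - ito s f \<omega>)\<^sup>2) = expectation (\<lambda>\<omega>. ito t f \<omega> * ito t f \<omega> - 2 * (ito s f \<omega> * ito t f \<omega>) + ito s f \<omega> * ito s f \<omega>)"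
    by (intro Bochner_Integration.integral_cong) (auto simp: power2_eq_square algebra_simps)
  also have "\<dots> = expectation (\<lambda>\<omega>. ito t f \<omega> * ito t f \<omega>) - 2 * expectation (\<lambda>\<omega>. ito s f \<omega> * ito t f \<omega>) + expectation (\<lambda>\<omega>. ito s f \<omega> * ito s f \<omega>)"
    using L2_mult_integrable[OF ito_L2[OF It] ito_L2[OF It]] L2_mult_integrable[OF ito_L2[OF Is] ito_L2[OF It]] L2_mult_integrable[OF ito_L2[OF Is] ito_L2[OF Is]] by simp
  also have "\<dots> = (\<integral>z. cutoff t f z * cutoff t f z \<partial>Q) - 2 * (\<integral>z. cutoff s f z * cutoff t f z \<partial>Q) + (\<integral>z. cutoff s f z * cutoff s f z \<partial>Q)"
    by (simp only: ito_isometry[OF It It] ito_isometry[OF Is It] ito_isometry[OF Is Is])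
  also have "(\<integral>z. cutoff s f z * cutoff t f z \<partial>Q) = (\<integral>z. cutoff s f z * cutoff s f z \<partial>Q)"
    using st by (intro Bochner_Integration.integral_cong) (auto simp: cutoff_def)
  finally show ?thesis by (simp add: sqnorm_def power2_eq_square)
qed

lemma stoch_increment:
  assumes f: "f \<in> H t" and g: "g \<in> H t" and st: "0 \<le> s" "s \<le> t"
  shows "expectation (\<lambda>\<omega>. (stoch t f g \<omega> - stoch s f g \<omega>)\<^sup>2) \<le> 2 * (t - s) * (sqnorm t f - sqnorm s f) + 2 * (sqnorm t g - sqnorm s g)"
proof -
  have s: "f \<in> H s" "g \<in> H s" and t: "0 \<le> t" using H_mono[OF f st(2)] H_mono[OF g st(2)] st by auto
  have "expectation (\<lambda>\<omega>. (stoch t f g \<omega> - stoch s f g \<omega>)\<^sup>2) = expectation (\<lambda>\<omega>. ((drift t f \<omega> - drift s f \<omega>) + (ito t g \<omega> - ito s g \<omega>))\<^sup>2)"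
    by (simp add: stoch_def algebra_simps)
  also have "\<dots> \<le> 2 * expectation (\<lambda>\<omega>. (drift t f \<omega> - drift s f \<omega>)\<^sup>2) + 2 * expectation (\<lambda>\<omega>. (ito t g \<omega> - ito s g \<omega>)\<^sup>2)"
    using s t st by (intro L2_sq_add L2_diff drift_L2 ito_L2[OF has_ito] f g) auto
  finally have le: "expectation (\<lambda>\<omega>. (stoch t f g \<omega> - stoch s f g \<omega>)\<^sup>2) \<le>
    2 * expectation (\<lambda>\<omega>. (drift t f \<omega> - drift s f \<omega>)\<^sup>2) + 2 * expectation (\<lambda>\<omega>. (ito t g \<omega> - ito s g \<omega>)\<^sup>2)" .
  define K where "K = (t - s) * (sqnorm t f - sqnorm s f)"
  have "expectation (\<lambda>\<omega>. (drift t f \<omega> - drift s f \<omega>)\<^sup>2) \<le> K"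
    using drift_increment_bound[OF f st] unfolding K_def sqnorm_def .
  then have "expectation (\<lambda>\<omega>. (stoch t f g \<omega> - stoch s f g \<omega>)\<^sup>2) \<le> 2 * K + 2 * (sqnorm t g - sqnorm s g)"
    using le unfolding ito_increment[OF g st] by linarith
  then show ?thesis unfolding K_def mult.assoc .
qed

lemma sqnorm_mono:
  assumes f: "f \<in> H t" and st: "s \<le> t" shows "sqnorm s f \<le> sqnorm t f"
  unfolding sqnorm_def
  by (rule integral_mono[OF L2_integrable_sq[OF H_L2[OF H_mono[OF f st]]] L2_integrable_sq[OF H_L2[OF f]]])
     (use st in \<open>auto simp: cutoff_def\<close>)

text \<open>At a point whose time differs from t the cutoff is constant for horizons near t, and the
  slice at time t is null.\<close>

lemma sqnorm_continuous:
  assumes f: "f \<in> H T"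
  shows "continuous_on {0..T} (\<lambda>t. sqnorm t f)"
proof (rule continuous_on_sequentiallyI)
  fix u t assume u: "\<forall>n. u n \<in> {0..T}" and t: "t \<in> {0..T}" and lim: "u \<longlonglongrightarrow> t"
  show "(\<lambda>n. sqnorm (u n) f) \<longlonglongrightarrow> sqnorm t f"
    unfolding sqnorm_def
  proof (rule integral_dominated_convergence[where w="\<lambda>z. (cutoff T f z)\<^sup>2"])
    have m: "cutoff s f \<in> borel_measurable Q" if "s \<in> {0..T}" for s
      using L2_measurable[OF H_L2[OF H_mono[OF f]]] that by auto
    show "(\<lambda>z. (cutoff t f z)\<^sup>2) \<in> borel_measurable Q" using m[OF t] by measurable
    show "(\<lambda>z. (cutoff (u n) f z)\<^sup>2) \<in> borel_measurable Q" for n using m[OF u[rule_format, of n]] by measurable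
    show "integrable Q (\<lambda>z. (cutoff T f z)\<^sup>2)" by (rule L2_integrable_sq[OF H_L2[OF f]])
    show "AE z in Q. (\<lambda>n. (cutoff (u n) f z)\<^sup>2) \<longlonglongrightarrow> (cutoff t f z)\<^sup>2"
      using AE_Q_fst_neq[of t]
    proof eventually_elim
      case (elim z)
      have "eventually (\<lambda>n. cutoff (u n) f z = cutoff t f z) sequentially"
      proof (cases "fst z < t")
        case True
        show ?thesis
          by (rule eventually_mono[OF order_tendstoD(1)[OF lim True]]) (use True in \<open>auto simp: cutoff_def\<close>)
      next
        case False
        with elim have less: "t < fst z" by simp
        show ?thesis
          by (rule eventually_mono[OF order_tendstoD(2)[OF lim less]]) (use less in \<open>auto simp: cutoff_def\<close>)
      qed
      then show ?case by (intro tendsto_eventually) (auto elim!: eventually_mono)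
    qed
    show "AE z in Q. norm ((cutoff (u n) f z)\<^sup>2) \<le> (cutoff T f z)\<^sup>2" for n
      using u[rule_format, of n] by (auto simp: cutoff_def)
  qed
qed

text \<open>The second moment of an increment is at most the increment of the single function 2 T
  \<open>sqnorm t f\<close> + 2 \<open>sqnorm t g\<close>, which is continuous on a compact
  interval.\<close>

lemma stoch_uniformly_continuous:
  assumes f: "f \<in> H T" and g: "g \<in> H T" and T: "0 \<le> T" and e: "0 < e"
  shows "\<exists>d>0. \<forall>s t. 0 \<le> s \<and> s \<le> t \<and> t \<le> T \<and> t - s < d \<longrightarrow> expectation (\<lambda>\<omega>. (stoch t f g \<omega> - stoch s f g \<omega>)\<^sup>2) \<le> e"
proof -
  let ?N = "\<lambda>t. 2 * T * sqnorm t f + 2 * sqnorm t g"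
  have "continuous_on {0..T} ?N"
    by (intro continuous_on_add continuous_on_mult continuous_on_const sqnorm_continuous f g)
  then have "uniformly_continuous_on {0..T} ?N" by (rule compact_uniformly_continuous) simp
  then obtain d where d: "0 < d" "\<And>s t. s \<in> {0..T} \<Longrightarrow> t \<in> {0..T} \<Longrightarrow> dist t s < d \<Longrightarrow> dist (?N t) (?N s) < e"
    using e unfolding uniformly_continuous_on_def by metis
  show ?thesis
  proof (intro exI[of _ d] conjI allI impI d(1))
    fix s t assume st: "0 \<le> s \<and> s \<le> t \<and> t \<le> T \<and> t - s < d"
    have ft: "f \<in> H t" and gt: "g \<in> H t" using H_mono f g st by blast+
    have "expectation (\<lambda>\<omega>. (stoch t f g \<omega> - stoch s f g \<omega>)\<^sup>2) \<le> 2 * (t - s) * (sqnorm t f - sqnorm s f) + 2 * (sqnorm t g - sqnorm s g)"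
      using stoch_increment[OF ft gt] st by auto
    also have "\<dots> \<le> 2 * T * (sqnorm t f - sqnorm s f) + 2 * (sqnorm t g - sqnorm s g)"
      using sqnorm_mono[OF ft, of s] st by (intro add_right_mono mult_right_mono) auto
    also have "\<dots> = ?N t - ?N s" by (simp add: algebra_simps)
    also have "\<dots> \<le> e" using d(2)[of s t] st by (auto simp: dist_real_def)
    finally show "expectation (\<lambda>\<omega>. (stoch t f g \<omega> - stoch s f g \<omega>)\<^sup>2) \<le> e" .
  qed
qed

section \<open>Jointly measurable versions of mean square continuous families\<close>

lemma nn_sqnorm:
  assumes "cutoff t f \<in> borel_measurable Q"
  shows "(\<integral>\<^sup>+z. ennreal ((cutoff t f z)\<^sup>2) \<partial>Q) = (\<integral>\<^sup>+s. (\<integral>\<^sup>+\<omega>. ennreal ((f s \<omega>)\<^sup>2) \<partial>P) * indicator {0..t} s \<partial>lborel)"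
proof -
  have [measurable]: "cutoff t f \<in> borel_measurable Q" by fact
  have "(\<integral>\<^sup>+z. ennreal ((cutoff t f z)\<^sup>2) \<partial>Q) = (\<integral>\<^sup>+s. \<integral>\<^sup>+\<omega>. ennreal ((cutoff t f (s, \<omega>))\<^sup>2) \<partial>P \<partial>lborel)"
    by (subst nn_integral_fst[symmetric]) auto
  also have "\<dots> = (\<integral>\<^sup>+s. (\<integral>\<^sup>+\<omega>. ennreal ((f s \<omega>)\<^sup>2) \<partial>P) * indicator {0..t} s \<partial>lborel)"
    by (intro nn_integral_cong) (auto simp: cutoff_def indicator_def)
  finally show ?thesis .
qed

lemma H_I:
  assumes m: "cutoff T Y \<in> borel_measurable Q" and a: "\<And>t. t \<in> {0..T} \<Longrightarrow> Y t \<in> borel_measurable (Ft t)"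
    and L: "\<And>t. t \<in> {0..T} \<Longrightarrow> Y t \<in> L2 P" and b: "\<And>t. t \<in> {0..T} \<Longrightarrow> expectation (\<lambda>\<omega>. (Y t \<omega>)\<^sup>2) \<le> B"
    and T: "0 \<le> T"
  shows "Y \<in> H T" "sqnorm T Y \<le> B * T"
proof -
  have B: "0 \<le> B" using b[of 0] T by (intro order_trans[OF _ b[of 0]]) (auto intro: integral_nonneg_AE)
  have "(\<integral>\<^sup>+z. ennreal ((cutoff T Y z)\<^sup>2) \<partial>Q) \<le> (\<integral>\<^sup>+s. ennreal B * indicator {0..T} s \<partial>lborel)"
    unfolding nn_sqnorm[OF m]
  proof (rule nn_integral_mono)
    fix s show "(\<integral>\<^sup>+\<omega>. ennreal ((Y s \<omega>)\<^sup>2) \<partial>P) * indicator {0..T} s \<le> ennreal B * indicator {0..T} s"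
    proof (cases "s \<in> {0..T}")
      case True then show ?thesis unfolding L2_nn_integral[OF L[OF True]] using b[OF True] by (simp add: ennreal_leI)
    qed simp
  qed
  also have "\<dots> = ennreal (B * T)" using T B by (subst nn_integral_cmult_indicator) (auto simp: ennreal_mult)
  finally have le: "(\<integral>\<^sup>+z. ennreal ((cutoff T Y z)\<^sup>2) \<partial>Q) \<le> ennreal (B * T)" .
  then have L2: "cutoff T Y \<in> L2 Q" unfolding L2_iff_nn using m by (auto intro: le_less_trans)
  then show "Y \<in> H T" using a by (auto simp: H_iff)
  show "sqnorm T Y \<le> B * T"
    using le unfolding L2_nn_integral[OF L2] sqnorm_def using B T by (subst (asm) ennreal_le_iff) auto
qed

text \<open>The members of the family are chosen separately for each time, so nothing makes them
  jointly measurable. Step processes that hold the value at the left end of a cell are jointly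
  measurable and adapted. With meshes chosen for the error (1/8)^k, their pointwise limit is a
  version at every time.\<close>

lemma modification:
  assumes T: "0 < T" and X: "\<And>t. t \<in> {0..T} \<Longrightarrow> X t \<in> L2 P" "\<And>t. t \<in> {0..T} \<Longrightarrow> X t \<in> borel_measurable (Ft t)"
    and b: "\<And>t. t \<in> {0..T} \<Longrightarrow> expectation (\<lambda>\<omega>. (X t \<omega>)\<^sup>2) \<le> B"
    and uc: "\<And>e. 0 < e \<Longrightarrow> \<exists>d>0. \<forall>s t. 0 \<le> s \<and> s \<le> t \<and> t \<le> T \<and> t - s < d \<longrightarrow> expectation (\<lambda>\<omega>. (X t \<omega> - X s \<omega>)\<^sup>2) \<le> e"
  shows "\<exists>Y\<in>H T. \<forall>t\<in>{0..T}. AE \<omega> in P. Y t \<omega> = X t \<omega>"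
proof -
  have "\<forall>k::nat. \<exists>d>0. \<forall>s t. 0 \<le> s \<and> s \<le> t \<and> t \<le> T \<and> t - s < d \<longrightarrow> expectation (\<lambda>\<omega>. (X t \<omega> - X s \<omega>)\<^sup>2) \<le> (1/8)^k"
    using uc by simp
  from choice[OF this] obtain d where d: "\<And>k. 0 < d k"
    "\<And>k s t. 0 \<le> s \<Longrightarrow> s \<le> t \<Longrightarrow> t \<le> T \<Longrightarrow> t - s < d k \<Longrightarrow> expectation (\<lambda>\<omega>. (X t \<omega> - X s \<omega>)\<^sup>2) \<le> (1/8)^k" by blast
  \<comment> \<open>Halving makes the cells strictly shorter than the modulus
    \<open>d k\<close>.\<close>
  define \<delta> where "\<delta> k = d k / 2" for k
  have \<delta>: "0 < \<delta> k" "\<delta> k < d k" for k using d(1)[of k] by (auto simp: \<delta>_def)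
  define N where "N k = nat \<lceil>T / \<delta> k\<rceil>" for k
  define J where "J k = {j. j \<le> N k \<and> real j * \<delta> k \<le> T}" for k
  define cell where "cell k j = {real j * \<delta> k..<real (Suc j) * \<delta> k}" for k j
  define Yk where "Yk k t \<omega> = (\<Sum>j\<in>J k. indicator (cell k j) t * X (real j * \<delta> k) \<omega>)" for k t \<omega>
  have finJ: "finite (J k)" for k unfolding J_def by simp
  have JT: "real j * \<delta> k \<in> {0..T}" if "j \<in> J k" for j k using that \<delta>[of k] by (auto simp: J_def)
  have Yeq: "\<exists>s. 0 \<le> s \<and> s \<le> t \<and> t - s < d k \<and> Yk k t = X s" if t: "t \<in> {0..T}" for k t
  proof -
    define j where "j = nat \<lfloor>t / \<delta> k\<rfloor>"
    have tp: "0 \<le> t / \<delta> k" using t \<delta>[of k] by auto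
    have j: "real j \<le> t / \<delta> k" "t / \<delta> k < real j + 1" using tp by (auto simp: j_def)
    have jt: "real j * \<delta> k \<le> t" "t < real (Suc j) * \<delta> k"
      using j \<delta>[of k] by (auto simp: pos_le_divide_eq pos_divide_less_eq algebra_simps)
    have "t / \<delta> k \<le> T / \<delta> k" using t \<delta>[of k] by (intro divide_right_mono) auto
    then have jN: "j \<le> N k" unfolding j_def N_def by (intro nat_mono) linarith
    have jJ: "j \<in> J k" using jN jt t by (auto simp: J_def)
    have "indicator (cell k i) t = (if i = j then 1 else 0 :: real)" for i
    proof (cases "i = j")
      case True then show ?thesis using jt by (simp add: cell_def)
    next
      case False
      have "t \<notin> cell k i"
      proof
        assume "t \<in> cell k i"
        then have "real i * \<delta> k \<le> t" "t < real (Suc i) * \<delta> k" by (auto simp: cell_def)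
        then have "real i * \<delta> k < real (Suc j) * \<delta> k" "real j * \<delta> k < real (Suc i) * \<delta> k" using jt by linarith+
        from this[unfolded mult_less_cancel_right_pos[OF \<delta>(1)[of k]]] False show False by simp
      qed
      with False show ?thesis by simp
    qed
    then have "Yk k t \<omega> = (\<Sum>i\<in>J k. if i = j then X (real j * \<delta> k) \<omega> else 0)" for \<omega>
      unfolding Yk_def by (intro sum.cong) auto
    then have "Yk k t = X (real j * \<delta> k)" using jJ finJ by (auto simp: fun_eq_iff)
    moreover have "t - real j * \<delta> k < d k" using jt \<delta>[of k] by (simp add: algebra_simps)
    ultimately show ?thesis using jt \<delta>[of k] by (intro exI[of _ "real j * \<delta> k"]) auto
  qed
  have YL: "Yk k t \<in> L2 P" and YF: "Yk k t \<in> borel_measurable (Ft t)"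
    and YX: "expectation (\<lambda>\<omega>. (X t \<omega> - Yk k t \<omega>)\<^sup>2) \<le> 1 * (1/8)^k" if t: "t \<in> {0..T}" for k t
  proof -
    obtain s where s: "0 \<le> s" "s \<le> t" "t - s < d k" "Yk k t = X s" using Yeq[OF t, of k] by auto
    have sT: "s \<in> {0..T}" using s t by auto
    show "Yk k t \<in> L2 P" using X(1)[OF sT] s by simp
    show "Yk k t \<in> borel_measurable (Ft t)" using measurable_Ft_mono[OF X(2)[OF sT] s(2)] s by simp
    show "expectation (\<lambda>\<omega>. (X t \<omega> - Yk k t \<omega>)\<^sup>2) \<le> 1 * (1/8)^k" unfolding s(4) using d(2)[OF s(1,2) _ s(3)] t by simp
  qed
  define Y where "Y t \<omega> = lim (\<lambda>k. Yk k t \<omega>)" for t \<omega>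
  have eq: "AE \<omega> in P. X t \<omega> = Y t \<omega>" if t: "t \<in> {0..T}" for t
    unfolding Y_def by (rule L2_fast_limit[OF finite_measure_axioms X(1)[OF t] YL[OF t] _ YX[OF t]]) simp
  have YFt: "Y t \<in> borel_measurable (Ft t)" if t: "t \<in> {0..T}" for t
    unfolding Y_def[abs_def] by (intro borel_measurable_lim_metric YF[OF t])
  have YL2: "Y t \<in> L2 P" if t: "t \<in> {0..T}" for t
    by (rule L2_cong_AE[OF X(1)[OF t] measurable_Ft_P[OF YFt[OF t]] eq[OF t]])
  have m: "cutoff T Y \<in> borel_measurable Q"
  proof -
    have Xm [measurable]: "X (real j * \<delta> k) \<in> borel_measurable P" if "j \<in> J k" for j k
      using X(1)[OF JT[OF that]] by auto
    have cm [measurable]: "cell k j \<in> sets borel" for k j by (simp add: cell_def)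
    have "(\<lambda>z. \<Sum>j\<in>J k. indicator (cell k j) (fst z) * X (real j * \<delta> k) (snd z)) \<in> borel_measurable Q" for k
      by (rule borel_measurable_sum) measurable
    then have Ym [measurable]: "(\<lambda>z. Yk k (fst z) (snd z)) \<in> borel_measurable Q" for k unfolding Yk_def .
    have "cutoff T Y = (\<lambda>z. if 0 \<le> fst z \<and> fst z \<le> T then lim (\<lambda>k. Yk k (fst z) (snd z)) else 0)"
      by (auto simp: cutoff_def Y_def fun_eq_iff)
    also have "\<dots> \<in> borel_measurable Q" by measurable
    finally show ?thesis .
  qed
  have "expectation (\<lambda>\<omega>. (Y t \<omega>)\<^sup>2) \<le> B" if t: "t \<in> {0..T}" for t
  proof -
    have "expectation (\<lambda>\<omega>. (Y t \<omega>)\<^sup>2) = expectation (\<lambda>\<omega>. (X t \<omega>)\<^sup>2)"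
      using eq[OF t] YL2[OF t] X(1)[OF t] by (intro integral_cong_AE) auto
    then show ?thesis using b[OF t] by simp
  qed
  then have "Y \<in> H T" using m YFt YL2 T by (intro H_I(1)) auto
  moreover have "AE \<omega> in P. Y t \<omega> = X t \<omega>" if "t \<in> {0..T}" for t
    using eq[OF that] by eventually_elim simp
  ultimately show ?thesis by blast
qed

lemma stoch_process:
  assumes f: "f \<in> H T" and g: "g \<in> H T" and T: "0 < T"
  shows "\<exists>Y\<in>H T. \<forall>t\<in>{0..T}. AE \<omega> in P. Y t \<omega> = c + stoch t f g \<omega>"
proof (rule modification[OF T])
  have ft: "f \<in> H t" and gt: "g \<in> H t" if "t \<in> {0..T}" for t using that H_mono f g by auto
  show "(\<lambda>\<omega>. c + stoch t f g \<omega>) \<in> L2 P" if "t \<in> {0..T}" for t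
    using that by (intro L2_add L2_const finite_measure_axioms stoch_L2 ft gt) auto
  show "(\<lambda>\<omega>. c + stoch t f g \<omega>) \<in> borel_measurable (Ft t)" if "t \<in> {0..T}" for t
    using that by (intro borel_measurable_add borel_measurable_const stoch_Ft ft gt) auto
  show "expectation (\<lambda>\<omega>. (c + stoch t f g \<omega>)\<^sup>2) \<le> 2 * c\<^sup>2 + 2 * (2 * T * sqnorm T f + 2 * sqnorm T g)" if t: "t \<in> {0..T}" for t
  proof -
    have "expectation (\<lambda>\<omega>. (c + stoch t f g \<omega>)\<^sup>2) \<le> 2 * expectation (\<lambda>\<omega>. c\<^sup>2) + 2 * expectation (\<lambda>\<omega>. (stoch t f g \<omega>)\<^sup>2)"
      using t by (intro L2_sq_add L2_const finite_measure_axioms stoch_L2 ft gt) auto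
    also have "expectation (\<lambda>\<omega>. (stoch t f g \<omega>)\<^sup>2) \<le> 2 * t * sqnorm t f + 2 * sqnorm t g"
      using t by (intro stoch_bound ft gt) auto
    also have "2 * t * sqnorm t f \<le> 2 * T * sqnorm T f"
      using t sqnorm_mono[OF f, of t] by (intro mult_mono) (auto simp: sqnorm_nonneg)
    also have "sqnorm t g \<le> sqnorm T g" using t sqnorm_mono[OF g, of t] by auto
    finally show ?thesis by (simp add: prob_space)
  qed
  fix e :: real assume "0 < e"
  from stoch_uniformly_continuous[OF f g _ this] T
  show "\<exists>d>0. \<forall>s t. 0 \<le> s \<and> s \<le> t \<and> t \<le> T \<and> t - s < d \<longrightarrow> expectation (\<lambda>\<omega>. (c + stoch t f g \<omega> - (c + stoch s f g \<omega>))\<^sup>2) \<le> e"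
    by simp
qed

lemma stoch_0: assumes "f \<in> H 0" "g \<in> H 0" shows "AE \<omega> in P. stoch 0 f g \<omega> = 0"
proof -
  have "expectation (\<lambda>\<omega>. (stoch 0 f g \<omega>)\<^sup>2) \<le> 0"
    using stoch_bound[OF assms] by (simp add: sqnorm_0)
  then have "expectation (\<lambda>\<omega>. (stoch 0 f g \<omega>)\<^sup>2) = 0" by (intro antisym) auto
  then show ?thesis by (intro L2_AE_zero stoch_L2 assms) auto
qed

end

section \<open>Uniqueness of the constant, the drift and the noise of a process\<close>

lemma AE_dense:
  assumes "AE t in lborel. t \<in> {0..T} \<longrightarrow> R t" and T: "0 < T" and t: "t \<in> {0..T}" and d: "0 < (d::real)"
  shows "\<exists>t'\<in>{0..T}. R t' \<and> \<bar>t' - t\<bar> < d"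
proof (rule ccontr)
  assume neg: "\<not> ?thesis"
  define a where "a = max 0 (t - d/2)"
  define b where "b = min T (t + d/2)"
  have ab: "a < b" "a \<in> {0..T}" "b \<in> {0..T}" "t - d < a" "b < t + d" using T t d by (auto simp: a_def b_def)
  have "AE s in lborel. s \<notin> {a..b}"
    using assms(1)
  proof eventually_elim
    case (elim s)
    show ?case
    proof
      assume "s \<in> {a..b}"
      then have "s \<in> {0..T}" "\<bar>s - t\<bar> < d" using ab by auto
      with elim neg show False by blast
    qed
  qed
  then have "emeasure lborel {a..b} = 0"
    using AE_iff_null_sets[of "{a..b}" lborel] by auto
  then show False using ab by simp
qed

context brownian
begin

text \<open>All increments of the drift vanish, so \<open>f\<close> is orthogonal to every simple
  process; these are dense, so \<open>f\<close> is orthogonal to itself.\<close>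

lemma drift_zero_imp_zero:
  assumes f: "f \<in> H T" and T: "0 \<le> T" and z: "\<And>t. t \<in> {0..T} \<Longrightarrow> AE \<omega> in P. drift t f \<omega> = 0"
  shows "AE z in Q. cutoff T f z = 0"
proof -
  have fL: "cutoff T f \<in> L2 Q" by (rule H_L2[OF f])
  have [measurable]: "cutoff T f \<in> borel_measurable Q" using fL by auto
  have zero: "(\<integral>z. cutoff T f z * simple_process p \<tau> \<xi> (fst z) (snd z) \<partial>Q) = 0" if S: "simple_integrand Ft T p \<tau> \<xi>" for p \<tau> \<xi>
  proof -
    have stepL: "(\<lambda>z. \<xi> i (snd z) * indicator {\<tau> i<..\<tau> (Suc i)} (fst z)) \<in> L2 Q" if i: "i < p" for i
    proof -
      have [measurable]: "\<xi> i \<in> borel_measurable P" using simple_integrandD[OF S i] by simp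
      have "\<xi> i \<in> L2 P" using simple_integrandD(5,6)[OF S i] finite_measure_axioms
        by (auto intro: L2_bounded)
      from step_inner(1)[OF this this, of "\<tau> i" "\<tau> (Suc i)" "\<tau> i" "\<tau> (Suc i)"]
      show ?thesis unfolding L2_def by (auto simp: power2_eq_square)
    qed
    have "(\<integral>z. cutoff T f z * simple_process p \<tau> \<xi> (fst z) (snd z) \<partial>Q)
      = (\<Sum>i<p. \<integral>z. cutoff T f z * (\<xi> i (snd z) * indicator {\<tau> i<..\<tau> (Suc i)} (fst z)) \<partial>Q)"
      unfolding simple_process_def sum_distrib_left
      by (rule Bochner_Integration.integral_sum) (auto intro!: L2_mult_integrable[OF fL] stepL)
    also have "\<dots> = 0"
    proof (rule sum.neutral, safe)
      fix i assume i: "i < p"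
      note D = simple_integrandD[OF S i]
      let ?a = "\<tau> i" and ?b = "\<tau> (Suc i)"
      have aT: "?a \<in> {0..T}" "?b \<in> {0..T}" and b0: "0 \<le> ?b" using D by auto
      have "(\<integral>z. cutoff T f z * (\<xi> i (snd z) * indicator {?a<..?b} (fst z)) \<partial>Q)
        = (\<integral>\<omega>. (\<integral>s. cutoff T f (s, \<omega>) * (\<xi> i \<omega> * indicator {?a<..?b} s) \<partial>lborel) \<partial>P)"
        using Q.integral_snd[of "\<lambda>s \<omega>. cutoff T f (s, \<omega>) * (\<xi> i \<omega> * indicator {?a<..?b} s)"] L2_mult_integrable[OF fL stepL[OF i]]
        by (simp add: case_prod_unfold)
      also have "\<dots> = (\<integral>\<omega>. 0 \<partial>P)"
      proof (rule integral_cong_AE)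
        have [measurable]: "\<xi> i \<in> borel_measurable P" using D by simp
        show "(\<lambda>\<omega>. \<integral>s. cutoff T f (s, \<omega>) * (\<xi> i \<omega> * indicator {?a<..?b} s) \<partial>lborel) \<in> borel_measurable P" by measurable
        have fH: "f \<in> H ?a" "f \<in> H ?b" using H_mono[OF f] aT by auto
        show "AE \<omega> in P. (\<integral>s. cutoff T f (s, \<omega>) * (\<xi> i \<omega> * indicator {?a<..?b} s) \<partial>lborel) = 0"
          using z[OF aT(1)] z[OF aT(2)] path_integrable[OF fH(1) D(1)] path_integrable[OF fH(2) b0]
        proof eventually_elim
          case (elim \<omega>)
          note i2 = elim(4)
          \<comment> \<open>The factor \<xi> i depends on \<omega> only, and \<open>f\<close>
            restricted to the cell is a difference of two cutoffs.\<close>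
          have "(\<integral>s. cutoff T f (s, \<omega>) * (\<xi> i \<omega> * indicator {?a<..?b} s) \<partial>lborel)
            = (\<integral>s. \<xi> i \<omega> * (cutoff ?b f (s, \<omega>) - cutoff ?a f (s, \<omega>)) \<partial>lborel)"
            using D by (intro Bochner_Integration.integral_cong) (auto simp: cutoff_def indicator_def)
          also have "\<dots> = \<xi> i \<omega> * (drift ?b f \<omega> - drift ?a f \<omega>)"
            using elim(3) i2 by (simp add: drift_def)
          also have "\<dots> = 0" using elim(1,2) by simp
          finally show ?case .
        qed
      qed simp
      finally show "(\<integral>z. cutoff T f z * (\<xi> i (snd z) * indicator {?a<..?b} (fst z)) \<partial>Q) = 0" by simp
    qed
    finally show ?thesis .
  qed
  obtain p \<tau> \<xi> where S: "\<And>k::nat. simple_integrand Ft T (p k) (\<tau> k) (\<xi> k)"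
    and le: "\<And>k. (\<integral>z. (cutoff T f z - simple_process (p k) (\<tau> k) (\<xi> k) (fst z) (snd z))\<^sup>2 \<partial>Q) \<le> (1/8)^k"
    using simple_approx[OF f T] by blast
  have lim: "(\<lambda>k. \<integral>z. (cutoff T f z - simple_process (p k) (\<tau> k) (\<xi> k) (fst z) (snd z))\<^sup>2 \<partial>Q) \<longlonglongrightarrow> 0"
    by (rule Lim_null_comparison[OF _ tendsto_mesh[of 1]]) (use le in \<open>simp add: eventually_sequentially\<close>)
  have "(\<lambda>k. \<integral>z. cutoff T f z * simple_process (p k) (\<tau> k) (\<xi> k) (fst z) (snd z) \<partial>Q) \<longlonglongrightarrow> (\<integral>z. cutoff T f z * cutoff T f z \<partial>Q)"
    by (rule L2_inner_tendsto[OF fL fL _ fL simple_process_L2[OF S] lim]) simp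
  moreover have "(\<integral>z. cutoff T f z * simple_process (p k) (\<tau> k) (\<xi> k) (fst z) (snd z) \<partial>Q) = 0" for k
    by (rule zero[OF S])
  ultimately have "(\<integral>z. cutoff T f z * cutoff T f z \<partial>Q) = 0"
    by (simp add: LIMSEQ_const_iff)
  then show ?thesis by (intro L2_AE_zero fL) (simp add: power2_eq_square)
qed

text \<open>Uniqueness of the semimartingale decomposition: on a cell of a partition the second moment of
  the martingale increment equals that of the drift increment, which is of the order of the mesh.\<close>

lemma stoch_zero_imp_zero:
  assumes T: "0 < T" and f: "f \<in> H T" and g: "g \<in> H T"
    and z: "AE t in lborel. t \<in> {0..T} \<longrightarrow> (AE \<omega> in P. c + stoch t f g \<omega> = 0)"
  shows "c = 0" "AE z in Q. cutoff T f z = 0" "AE z in Q. cutoff T g z = 0"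
proof -
  have ft: "f \<in> H t" and gt: "g \<in> H t" if "t \<in> {0..T}" for t using that H_mono f g by auto
  have XL: "(\<lambda>\<omega>. c + stoch t f g \<omega>) \<in> L2 P" if "t \<in> {0..T}" for t
    using that by (intro L2_add L2_const finite_measure_axioms stoch_L2 ft gt) auto
  \<comment> \<open>The hypothesis covers almost every t. Mean square continuity extends it to every
    t: to 0, where it isolates c, and to the partition points used below.\<close>
  have all: "AE \<omega> in P. c + stoch t f g \<omega> = 0" if t: "t \<in> {0..T}" for t
  proof -
    have small: "expectation (\<lambda>\<omega>. (c + stoch t f g \<omega>)\<^sup>2) \<le> e" if e: "0 < e" for e
    proof -
      obtain d where d: "0 < d" "\<And>s t. 0 \<le> s \<Longrightarrow> s \<le> t \<Longrightarrow> t \<le> T \<Longrightarrow> t - s < d \<Longrightarrow> expectation (\<lambda>\<omega>. (stoch t f g \<omega> - stoch s f g \<omega>)\<^sup>2) \<le> e"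
        using stoch_uniformly_continuous[OF f g _ e] T by auto
      obtain t' where t': "t' \<in> {0..T}" "AE \<omega> in P. c + stoch t' f g \<omega> = 0" "\<bar>t' - t\<bar> < d"
        using AE_dense[OF z T t d(1)] by blast
      have "expectation (\<lambda>\<omega>. (c + stoch t f g \<omega>)\<^sup>2) = expectation (\<lambda>\<omega>. (stoch t f g \<omega> - stoch t' f g \<omega>)\<^sup>2)"
      proof (rule integral_cong_AE)
        show "AE \<omega> in P. (c + stoch t f g \<omega>)\<^sup>2 = (stoch t f g \<omega> - stoch t' f g \<omega>)\<^sup>2"
          using t'(2)
        proof eventually_elim
          case (elim \<omega>)
          then have "c = - stoch t' f g \<omega>" by simp
          then show ?case by simp
        qed
        show "(\<lambda>\<omega>. (c + stoch t f g \<omega>)\<^sup>2) \<in> borel_measurable P" using XL[OF t] by measurable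
        have "stoch t f g \<in> L2 P" "stoch t' f g \<in> L2 P" using t t' by (auto intro!: stoch_L2 ft gt)
        then show "(\<lambda>\<omega>. (stoch t f g \<omega> - stoch t' f g \<omega>)\<^sup>2) \<in> borel_measurable P" by measurable
      qed
      also have "\<dots> \<le> e"
      proof (cases "t' \<le> t")
        case True then show ?thesis using d(2)[of t' t] t t' by auto
      next
        case False then show ?thesis using d(2)[of t t'] t t' by (auto simp: power2_commute)
      qed
      finally show ?thesis .
    qed
    have "expectation (\<lambda>\<omega>. (c + stoch t f g \<omega>)\<^sup>2) \<le> 0"
    proof (rule field_le_epsilon)
      fix e :: real assume "0 < e"
      from small[OF this] show "expectation (\<lambda>\<omega>. (c + stoch t f g \<omega>)\<^sup>2) \<le> 0 + e" by (simp only: add_0_left)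
    qed
    then have "expectation (\<lambda>\<omega>. (c + stoch t f g \<omega>)\<^sup>2) = 0" by (intro antisym) auto
    then show ?thesis by (intro L2_AE_zero XL t)
  qed
  have "AE \<omega> in P. c = 0"
  proof -
    have 0: "0 \<in> {0..T}" using T by simp
    from all[OF 0] stoch_0[OF ft[OF 0] gt[OF 0]] show ?thesis by eventually_elim simp
  qed
  then show c: "c = 0" by simp
  \<comment> \<open>As the total is zero, the martingale increment is minus the drift increment,
    whose bound carries the factor t - s.\<close>
  have inc: "sqnorm t g - sqnorm s g \<le> (t - s) * (sqnorm t f - sqnorm s f)" if st: "0 \<le> s" "s \<le> t" "t \<le> T" for s t
  proof -
    have s: "s \<in> {0..T}" and t: "t \<in> {0..T}" using st by auto
    have "sqnorm t g - sqnorm s g = expectation (\<lambda>\<omega>. (ito t g \<omega> - ito s g \<omega>)\<^sup>2)"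
      by (rule ito_increment[OF gt[OF t] st(1,2), symmetric])
    also have "\<dots> = expectation (\<lambda>\<omega>. (drift t f \<omega> - drift s f \<omega>)\<^sup>2)"
    proof (rule integral_cong_AE)
      show "AE \<omega> in P. (ito t g \<omega> - ito s g \<omega>)\<^sup>2 = (drift t f \<omega> - drift s f \<omega>)\<^sup>2"
        using all[OF s] all[OF t]
      proof eventually_elim
        case (elim \<omega>)
        then have "ito t g \<omega> - ito s g \<omega> = - (drift t f \<omega> - drift s f \<omega>)" using c by (simp add: stoch_def)
        then show ?case by (simp only: power2_minus)
      qed
      have "ito t g \<in> L2 P" "ito s g \<in> L2 P" "drift t f \<in> L2 P" "drift s f \<in> L2 P"
        using s t by (auto intro!: ito_L2[OF has_ito] drift_L2 ft gt)
      then show "(\<lambda>\<omega>. (ito t g \<omega> - ito s g \<omega>)\<^sup>2) \<in> borel_measurable P" "(\<lambda>\<omega>. (drift t f \<omega> - drift s f \<omega>)\<^sup>2) \<in> borel_measurable P" by measurable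
    qed
    also have "\<dots> \<le> (t - s) * (sqnorm t f - sqnorm s f)"
      unfolding sqnorm_def by (rule drift_increment_bound[OF ft[OF t] st(1,2)])
    finally show ?thesis .
  qed
  \<comment> \<open>Both sides telescope over n + 1 equal cells, and the mesh T/(n+1) stays in
    front.\<close>
  have part: "sqnorm T g \<le> T * sqnorm T f * inverse (real (Suc n))" for n
  proof -
    define h where "h = T / real (Suc n)"
    have h: "0 \<le> h" "real (Suc n) * h = T" using T by (simp_all add: h_def)
    let ?t = "\<lambda>i. real i * h"
    have "sqnorm (?t (Suc i)) g - sqnorm (?t i) g \<le> h * (sqnorm (?t (Suc i)) f - sqnorm (?t i) f)" if i: "i < Suc n" for i
    proof -
      have "?t (Suc i) \<le> real (Suc n) * h" using i h(1) by (intro mult_right_mono) auto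
      then have 1: "?t (Suc i) \<le> T" using h(2) by linarith
      have 3: "?t (Suc i) = ?t i + h" by (simp add: distrib_right)
      have 2: "?t i \<le> ?t (Suc i)" "0 \<le> ?t i" using h(1) unfolding 3 by simp_all
      have 4: "?t (Suc i) - ?t i = h" unfolding 3 by simp
      show ?thesis using inc[OF 2(2) 2(1) 1] unfolding 4 .
    qed
    then have "(\<Sum>i<Suc n. sqnorm (?t (Suc i)) g - sqnorm (?t i) g) \<le> (\<Sum>i<Suc n. h * (sqnorm (?t (Suc i)) f - sqnorm (?t i) f))"
      by (intro sum_mono) blast
    then have "sqnorm (?t (Suc n)) g - sqnorm (?t 0) g \<le> h * (sqnorm (?t (Suc n)) f - sqnorm (?t 0) f)"
      unfolding sum_distrib_left[symmetric] sum_lessThan_telescope[of "\<lambda>i. sqnorm (?t i) g"] sum_lessThan_telescope[of "\<lambda>i. sqnorm (?t i) f"] .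
    then have "sqnorm T g \<le> h * sqnorm T f"
      unfolding h(2) by (simp add: sqnorm_0)
    then show ?thesis by (simp add: h_def divide_inverse ac_simps)
  qed
  have "sqnorm T g \<le> 0"
  proof (rule LIMSEQ_le_const)
    show "(\<lambda>n. T * sqnorm T f * inverse (real (Suc n))) \<longlonglongrightarrow> 0"
      using tendsto_mult_right_zero[OF LIMSEQ_inverse_real_of_nat] by simp
  qed (use part in blast)
  then have g0: "sqnorm T g = 0" using sqnorm_nonneg[of T g] by simp
  then show "AE z in Q. cutoff T g z = 0" unfolding sqnorm_def by (intro L2_AE_zero H_L2 g)
  show "AE z in Q. cutoff T f z = 0"
  proof (rule drift_zero_imp_zero[OF f less_imp_le[OF T]])
    fix t assume t: "t \<in> {0..T}"
    have "expectation (\<lambda>\<omega>. (ito t g \<omega>)\<^sup>2) = 0"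
      using ito_norm[OF gt[OF t]] sqnorm_mono[OF g, of t] sqnorm_nonneg[of t g] g0 t by auto
    then have "AE \<omega> in P. ito t g \<omega> = 0" using t by (intro L2_AE_zero ito_L2[OF has_ito] gt) auto
    with all[OF t] show "AE \<omega> in P. drift t f \<omega> = 0" by eventually_elim (simp add: stoch_def c)
  qed
qed

section \<open>Linear stochastic differential equations\<close>

lemma nn_integral_power:
  assumes t: "0 \<le> t" and c: "0 \<le> c"
  shows "(\<integral>\<^sup>+s. ennreal (c * s^k) * indicator {0..t} s \<partial>lborel) = ennreal (c * t^Suc k / real (Suc k))"
proof -
  have "((\<lambda>s. c * s^Suc k / real (Suc k)) has_real_derivative c * s^k) (at s)" for s
    by (rule derivative_eq_intros refl | simp)+
  then have "(\<integral>\<^sup>+s. ennreal (c * s^k) * indicator {0..t} s \<partial>lborel) = ennreal (c * t^Suc k / real (Suc k) - c * 0^Suc k / real (Suc k))"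
    using t c by (intro nn_integral_FTC_Icc) auto
  then show ?thesis by simp
qed

text \<open>Integrating c s^k in time raises the power and divides by k + 1; iterated, this produces
  the factorials of the Picard estimate.\<close>

lemma sqnorm_growth:
  assumes y: "y \<in> H T" and t: "t \<in> {0..T}" and L: "\<And>s. s \<in> {0..T} \<Longrightarrow> y s \<in> L2 P"
    and c: "0 \<le> c" and b: "\<And>s. s \<in> {0..t} \<Longrightarrow> expectation (\<lambda>\<omega>. (y s \<omega>)\<^sup>2) \<le> c * s^k"
  shows "sqnorm t y \<le> c * t^Suc k / real (Suc k)"
proof -
  have yt: "y \<in> H t" using H_mono[OF y] t by auto
  have yL: "cutoff t y \<in> L2 Q" by (rule H_L2[OF yt])
  have "ennreal (sqnorm t y) = (\<integral>\<^sup>+s. (\<integral>\<^sup>+\<omega>. ennreal ((y s \<omega>)\<^sup>2) \<partial>P) * indicator {0..t} s \<partial>lborel)"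
    unfolding sqnorm_def L2_nn_integral[OF yL, symmetric] by (rule nn_sqnorm) (use yL in auto)
  also have "\<dots> \<le> (\<integral>\<^sup>+s. ennreal (c * s^k) * indicator {0..t} s \<partial>lborel)"
  proof (rule nn_integral_mono)
    fix s show "(\<integral>\<^sup>+\<omega>. ennreal ((y s \<omega>)\<^sup>2) \<partial>P) * indicator {0..t} s \<le> ennreal (c * s^k) * indicator {0..t} s"
    proof (cases "s \<in> {0..t}")
      case True
      then have sT: "s \<in> {0..T}" using t by auto
      show ?thesis unfolding L2_nn_integral[OF L[OF sT]] using b[OF True] True by (simp add: ennreal_leI)
    qed simp
  qed
  also have "\<dots> = ennreal (c * t^Suc k / real (Suc k))" using t c by (intro nn_integral_power) auto
  finally show ?thesis using t c by (subst (asm) ennreal_le_iff) auto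
qed

lemma sqnorm_lin:
  assumes "\<And>j. j < h \<Longrightarrow> d j \<in> H t"
  shows "sqnorm t (\<lambda>s \<omega>. \<Sum>j<h. b j * d j s \<omega>) \<le> (\<Sum>j<h. (b j)\<^sup>2) * (\<Sum>j<h. sqnorm t (d j))"
proof -
  have L: "cutoff t (d j) \<in> L2 Q" if "j < h" for j using H_L2 assms that by auto
  have I: "(\<lambda>s \<omega>. \<Sum>j<h. b j * d j s \<omega>) \<in> H t" using assms by (intro H_sum H_cmult) auto
  have "sqnorm t (\<lambda>s \<omega>. \<Sum>j<h. b j * d j s \<omega>) \<le> (\<integral>z. (\<Sum>j<h. (b j)\<^sup>2) * (\<Sum>j<h. (cutoff t (d j) z)\<^sup>2) \<partial>Q)"
    unfolding sqnorm_def
  proof (rule integral_mono)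
    show "integrable Q (\<lambda>z. (cutoff t (\<lambda>s \<omega>. \<Sum>j<h. b j * d j s \<omega>) z)\<^sup>2)" by (rule L2_integrable_sq[OF H_L2[OF I]])
    show "integrable Q (\<lambda>z. (\<Sum>j<h. (b j)\<^sup>2) * (\<Sum>j<h. (cutoff t (d j) z)\<^sup>2))"
      using L by (intro integrable_mult_right Bochner_Integration.integrable_sum L2_integrable_sq) auto
    show "(cutoff t (\<lambda>s \<omega>. \<Sum>j<h. b j * d j s \<omega>) z)\<^sup>2 \<le> (\<Sum>j<h. (b j)\<^sup>2) * (\<Sum>j<h. (cutoff t (d j) z)\<^sup>2)" for z
      unfolding cut_sum cut_cmult by (rule Cauchy_Schwarz_ineq_sum)
  qed
  also have "\<dots> = (\<Sum>j<h. (b j)\<^sup>2) * (\<Sum>j<h. sqnorm t (d j))"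
    unfolding sqnorm_def using L by (simp add: L2_integrable_sq)
  finally show ?thesis .
qed

text \<open>The Picard map of dy = (a y + p) dt + (a y + q) dW with y(0) = c, by components; its
  fixed points are the solutions.\<close>

definition rhs :: "nat \<Rightarrow> (nat \<Rightarrow> nat \<Rightarrow> real) \<Rightarrow> (nat \<Rightarrow> real) \<Rightarrow> (nat \<Rightarrow> real \<Rightarrow> 'w \<Rightarrow> real) \<Rightarrow>
    (nat \<Rightarrow> real \<Rightarrow> 'w \<Rightarrow> real) \<Rightarrow> (nat \<Rightarrow> real \<Rightarrow> 'w \<Rightarrow> real) \<Rightarrow> nat \<Rightarrow> real \<Rightarrow> 'w \<Rightarrow> real" where
  "rhs h a c p q y i t \<omega> = c i + stoch t (\<lambda>s \<omega>. (\<Sum>j<h. a i j * y j s \<omega>) + p i s \<omega>)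
      (\<lambda>s \<omega>. (\<Sum>j<h. a i j * y j s \<omega>) + q i s \<omega>) \<omega>"

lemma rhs_L2:
  assumes u: "\<And>j. j < h \<Longrightarrow> u j \<in> H T"
    and p: "\<And>j. j < h \<Longrightarrow> p j \<in> H T" and q: "\<And>j. j < h \<Longrightarrow> q j \<in> H T"
    and t: "t \<in> {0..T}" and i: "i < h"
  shows "rhs h a c p q u i t \<in> L2 P"
proof -
  have "u j \<in> H t" if "j < h" for j using H_mono[OF u[OF that]] t by auto
  moreover have "p i \<in> H t" "q i \<in> H t" using H_mono[OF p[OF i]] H_mono[OF q[OF i]] t by auto
  ultimately show ?thesis
    unfolding rhs_def[abs_def] using t
    by (intro L2_add L2_const finite_measure_axioms stoch_L2 H_add H_sum H_cmult) auto
qed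

text \<open>The inhomogeneities cancel, and what remains is the integral process of a (u - v) in
  both slots. The factor 2 T + 2 comes from \<open>stoch_bound\<close>, the double sum from
  Cauchy-Schwarz over the coefficients.\<close>

lemma rhs_lipschitz:
  fixes a :: "nat \<Rightarrow> nat \<Rightarrow> real"
  assumes u: "\<And>j. j < h \<Longrightarrow> u j \<in> H T" and v: "\<And>j. j < h \<Longrightarrow> v j \<in> H T"
    and p: "\<And>j. j < h \<Longrightarrow> p j \<in> H T" and q: "\<And>j. j < h \<Longrightarrow> q j \<in> H T"
    and t: "t \<in> {0..T}" and i: "i < h"
  defines "K \<equiv> (2 * T + 2) * (\<Sum>i<h. \<Sum>j<h. (a i j)\<^sup>2)"
  shows "expectation (\<lambda>\<omega>. (rhs h a c p q u i t \<omega> - rhs h a c p q v i t \<omega>)\<^sup>2) \<le> K * (\<Sum>j<h. sqnorm t (\<lambda>s \<omega>. u j s \<omega> - v j s \<omega>))"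
proof -
  have ut: "u j \<in> H t" and vt: "v j \<in> H t" if "j < h" for j using H_mono[OF u[OF that]] H_mono[OF v[OF that]] t by auto
  have pt: "p i \<in> H t" and qt: "q i \<in> H t" using H_mono[OF p[OF i]] H_mono[OF q[OF i]] t by auto
  have t0: "0 \<le> t" "t \<le> T" using t by auto
  let ?f = "\<lambda>y s \<omega>. (\<Sum>j<h. a i j * y j s \<omega>) + p i s \<omega>"
  let ?g = "\<lambda>y s \<omega>. (\<Sum>j<h. a i j * y j s \<omega>) + q i s \<omega>"
  let ?d = "\<lambda>s \<omega>. \<Sum>j<h. a i j * (u j s \<omega> - v j s \<omega>)"
  have fu: "?f u \<in> H t" "?g u \<in> H t" using ut pt qt by (auto intro!: H_add H_sum H_cmult)
  have fv: "?f v \<in> H t" "?g v \<in> H t" using vt pt qt by (auto intro!: H_add H_sum H_cmult)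
  have dd: "?d \<in> H t" using ut vt by (auto intro!: H_sum H_cmult H_diff)
  \<comment> \<open>A difference is written as a linear combination over \<open>bool\<close> with
    the coefficients 1 and -1.\<close>
  have "AE \<omega> in P. stoch t ?d ?d \<omega> = (\<Sum>b\<in>UNIV. (if b then 1 else -1) * stoch t (if b then ?f u else ?f v) (if b then ?g u else ?g v) \<omega>)"
  proof (rule stoch_linear)
    show "?d s \<omega> = (\<Sum>b\<in>UNIV. (if b then 1 else -1) * (if b then ?f u else ?f v) s \<omega>)" for s \<omega>
      by (simp add: UNIV_bool sum_subtractf right_diff_distrib)
    show "?d s \<omega> = (\<Sum>b\<in>UNIV. (if b then 1 else -1) * (if b then ?g u else ?g v) s \<omega>)" for s \<omega>
      by (simp add: UNIV_bool sum_subtractf right_diff_distrib)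
  qed (use fu fv t0 in auto)
  then have eq: "AE \<omega> in P. (rhs h a c p q u i t \<omega> - rhs h a c p q v i t \<omega>)\<^sup>2 = (stoch t ?d ?d \<omega>)\<^sup>2"
    by eventually_elim (simp add: rhs_def UNIV_bool)
  have "expectation (\<lambda>\<omega>. (rhs h a c p q u i t \<omega> - rhs h a c p q v i t \<omega>)\<^sup>2) = expectation (\<lambda>\<omega>. (stoch t ?d ?d \<omega>)\<^sup>2)"
  proof (rule integral_cong_AE[OF _ _ eq])
    show "(\<lambda>\<omega>. (stoch t ?d ?d \<omega>)\<^sup>2) \<in> borel_measurable P" using stoch_L2[OF dd dd t0(1)] by measurable
    have "stoch t (?f u) (?g u) \<in> L2 P" "stoch t (?f v) (?g v) \<in> L2 P" by (intro stoch_L2 fu fv t0)+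
    then show "(\<lambda>\<omega>. (rhs h a c p q u i t \<omega> - rhs h a c p q v i t \<omega>)\<^sup>2) \<in> borel_measurable P"
      unfolding rhs_def by measurable
  qed
  also have "\<dots> \<le> 2 * t * sqnorm t ?d + 2 * sqnorm t ?d" by (rule stoch_bound[OF dd dd t0(1)])
  also have "\<dots> = (2 * t + 2) * sqnorm t ?d" by (simp add: distrib_right)
  also have "\<dots> \<le> (2 * T + 2) * ((\<Sum>i<h. \<Sum>j<h. (a i j)\<^sup>2) * (\<Sum>j<h. sqnorm t (\<lambda>s \<omega>. u j s \<omega> - v j s \<omega>)))"
  proof (rule mult_mono)
    have "sqnorm t ?d \<le> (\<Sum>j<h. (a i j)\<^sup>2) * (\<Sum>j<h. sqnorm t (\<lambda>s \<omega>. u j s \<omega> - v j s \<omega>))"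
      using ut vt by (intro sqnorm_lin H_diff) auto
    also have "\<dots> \<le> (\<Sum>i<h. \<Sum>j<h. (a i j)\<^sup>2) * (\<Sum>j<h. sqnorm t (\<lambda>s \<omega>. u j s \<omega> - v j s \<omega>))"
      using i by (intro mult_right_mono sum_nonneg sqnorm_nonneg member_le_sum) (auto intro: sum_nonneg)
    finally show "sqnorm t ?d \<le> (\<Sum>i<h. \<Sum>j<h. (a i j)\<^sup>2) * (\<Sum>j<h. sqnorm t (\<lambda>s \<omega>. u j s \<omega> - v j s \<omega>))" .
  qed (use t0 in \<open>auto simp: sqnorm_nonneg\<close>)
  finally show "expectation (\<lambda>\<omega>. (rhs h a c p q u i t \<omega> - rhs h a c p q v i t \<omega>)\<^sup>2) \<le> K * (\<Sum>j<h. sqnorm t (\<lambda>s \<omega>. u j s \<omega> - v j s \<omega>))"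
    unfolding K_def mult.assoc .
qed

text \<open>The induction step behind both uniqueness, where d' is a component of d, and existence,
  where d and d' are successive Picard differences.\<close>

lemma gronwall_step:
  assumes d: "\<And>j. j < h \<Longrightarrow> d j \<in> H T" and dL: "\<And>j s. j < h \<Longrightarrow> s \<in> {0..T} \<Longrightarrow> d j s \<in> L2 P"
    and K: "0 \<le> K" and c: "0 \<le> c"
    and b: "\<And>j s. j < h \<Longrightarrow> s \<in> {0..T} \<Longrightarrow> expectation (\<lambda>\<omega>. (d j s \<omega>)\<^sup>2) \<le> c * (real h * K * s)^k / fact k"
    and e: "\<And>t. t \<in> {0..T} \<Longrightarrow> expectation (\<lambda>\<omega>. (d' t \<omega>)\<^sup>2) \<le> K * (\<Sum>j<h. sqnorm t (d j))"
    and t: "t \<in> {0..T}"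
  shows "expectation (\<lambda>\<omega>. (d' t \<omega>)\<^sup>2) \<le> c * (real h * K * t)^Suc k / fact (Suc k)"
proof -
  let ?L = "real h * K"
  have "sqnorm t (d j) \<le> (c * ?L^k / fact k) * t^Suc k / real (Suc k)" if j: "j < h" for j
  proof (rule sqnorm_growth[OF d[OF j] t dL[OF j]])
    show "0 \<le> c * ?L^k / fact k" using c K by (intro divide_nonneg_nonneg mult_nonneg_nonneg zero_le_power) auto
    show "expectation (\<lambda>\<omega>. (d j s \<omega>)\<^sup>2) \<le> c * ?L^k / fact k * s^k" if "s \<in> {0..t}" for s
      using b[OF j, of s] that t by (simp add: power_mult_distrib)
  qed
  then have "(\<Sum>j<h. sqnorm t (d j)) \<le> (\<Sum>j<h. (c * ?L^k / fact k) * t^Suc k / real (Suc k))"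
    by (intro sum_mono) auto
  also have "\<dots> = real h * ((c * ?L^k / fact k) * t^Suc k / real (Suc k))" by simp
  finally have "K * (\<Sum>j<h. sqnorm t (d j)) \<le> K * (real h * ((c * ?L^k / fact k) * t^Suc k / real (Suc k)))"
    using K by (rule mult_left_mono)
  also have "\<dots> = c * (?L * t)^Suc k / fact (Suc k)"
    by (simp add: power_mult_distrib field_simps del: of_nat_Suc)
  finally show ?thesis using e[OF t] by linarith
qed

lemma factorial_tendsto: "(\<lambda>k. c * (x::real)^k / fact k) \<longlonglongrightarrow> 0"
  using tendsto_mult_right_zero[OF summable_LIMSEQ_zero[OF summable_exp[of x]], of c]
  by (simp add: divide_inverse ac_simps)

lemma sde_unique:
  assumes T: "0 < T" and y: "\<And>j. j < h \<Longrightarrow> y j \<in> H T" and z: "\<And>j. j < h \<Longrightarrow> z j \<in> H T"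
    and p: "\<And>j. j < h \<Longrightarrow> p j \<in> H T" and q: "\<And>j. j < h \<Longrightarrow> q j \<in> H T"
    and eqy: "\<And>t j. t \<in> {0..T} \<Longrightarrow> j < h \<Longrightarrow> AE \<omega> in P. y j t \<omega> = rhs h a c p q y j t \<omega>"
    and eqz: "\<And>t j. t \<in> {0..T} \<Longrightarrow> j < h \<Longrightarrow> AE \<omega> in P. z j t \<omega> = rhs h a c p q z j t \<omega>"
    and j: "j < h"
  shows "AE w in Q. cutoff T (y j) w = cutoff T (z j) w"
proof -
  define K where "K = (2 * T + 2) * (\<Sum>i<h. \<Sum>j<h. (a i j)\<^sup>2)"
  have K: "0 \<le> K" unfolding K_def using T by (intro mult_nonneg_nonneg sum_nonneg) auto
  let ?d = "\<lambda>j s \<omega>. y j s \<omega> - z j s \<omega>"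
  have dH: "?d j \<in> H T" if "j < h" for j using y z that by (intro H_diff) auto
  \<comment> \<open>Membership in \<open>H T\<close> controls the second moment only for almost
    every time; the equation supplies it at every time.\<close>
  have yL: "y j s \<in> L2 P" if "j < h" "s \<in> {0..T}" for j s
  proof (rule L2_cong_AE)
    show "rhs h a c p q y j s \<in> L2 P" by (rule rhs_L2[where T=T]) (use y p q that in auto)
    show "y j s \<in> borel_measurable P"
    proof (rule measurable_Ft_P)
      show "y j s \<in> borel_measurable (Ft s)" using y[OF that(1)] that(2) by (auto simp: H_iff)
    qed
    show "AE \<omega> in P. rhs h a c p q y j s \<omega> = y j s \<omega>"
      using eqy[OF that(2,1)] by eventually_elim simp
  qed
  have zL: "z j s \<in> L2 P" if "j < h" "s \<in> {0..T}" for j s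
  proof (rule L2_cong_AE)
    show "rhs h a c p q z j s \<in> L2 P" by (rule rhs_L2[where T=T]) (use z p q that in auto)
    show "z j s \<in> borel_measurable P"
    proof (rule measurable_Ft_P)
      show "z j s \<in> borel_measurable (Ft s)" using z[OF that(1)] that(2) by (auto simp: H_iff)
    qed
    show "AE \<omega> in P. rhs h a c p q z j s \<omega> = z j s \<omega>"
      using eqz[OF that(2,1)] by eventually_elim simp
  qed
  have dL: "?d j s \<in> L2 P" if "j < h" "s \<in> {0..T}" for j s using yL zL that by (intro L2_diff) auto
  have step: "expectation (\<lambda>\<omega>. (?d j t \<omega>)\<^sup>2) \<le> K * (\<Sum>j<h. sqnorm t (?d j))" if t: "t \<in> {0..T}" and j: "j < h" for t j
  proof -
    have "expectation (\<lambda>\<omega>. (?d j t \<omega>)\<^sup>2) = expectation (\<lambda>\<omega>. (rhs h a c p q y j t \<omega> - rhs h a c p q z j t \<omega>)\<^sup>2)"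
    proof (rule integral_cong_AE)
      show "AE \<omega> in P. (?d j t \<omega>)\<^sup>2 = (rhs h a c p q y j t \<omega> - rhs h a c p q z j t \<omega>)\<^sup>2"
        using eqy[OF t j] eqz[OF t j] by eventually_elim simp
      show "(\<lambda>\<omega>. (?d j t \<omega>)\<^sup>2) \<in> borel_measurable P" using dL[OF j t] by measurable
      show "(\<lambda>\<omega>. (rhs h a c p q y j t \<omega> - rhs h a c p q z j t \<omega>)\<^sup>2) \<in> borel_measurable P"
        using rhs_L2[where u=y and a=a and c=c, OF y p q t j] rhs_L2[where u=z and a=a and c=c, OF z p q t j]
        by measurable
    qed
    also have "\<dots> \<le> K * (\<Sum>j<h. sqnorm t (?d j))"
      unfolding K_def by (rule rhs_lipschitz[OF y z p q t j])
    finally show ?thesis .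
  qed
  \<comment> \<open>The induction must start from a bound that is uniform in t; the estimate
    \<open>step\<close> itself provides one.\<close>
  define c0 where "c0 = K * (\<Sum>j<h. sqnorm T (?d j))"
  have c0: "0 \<le> c0" unfolding c0_def by (intro mult_nonneg_nonneg K sum_nonneg sqnorm_nonneg)
  have bound: "\<forall>t\<in>{0..T}. \<forall>j<h. expectation (\<lambda>\<omega>. (?d j t \<omega>)\<^sup>2) \<le> c0 * (real h * K * t)^k / fact k" for k
  proof (induction k)
    case 0
    show ?case
    proof (intro ballI allI impI)
      fix t j assume t: "t \<in> {0..T}" and j: "j < h"
      have "(\<Sum>j<h. sqnorm t (?d j)) \<le> (\<Sum>j<h. sqnorm T (?d j))"
        using t by (intro sum_mono sqnorm_mono dH) auto
      then have "K * (\<Sum>j<h. sqnorm t (?d j)) \<le> c0" unfolding c0_def by (rule mult_left_mono[OF _ K])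
      with step[OF t j] show "expectation (\<lambda>\<omega>. (?d j t \<omega>)\<^sup>2) \<le> c0 * (real h * K * t)^0 / fact 0"
        by simp
    qed
  next
    case (Suc k)
    show ?case
    proof (intro ballI allI impI)
      fix t j assume t: "t \<in> {0..T}" and j: "j < h"
      show "expectation (\<lambda>\<omega>. (?d j t \<omega>)\<^sup>2) \<le> c0 * (real h * K * t)^Suc k / fact (Suc k)"
        by (rule gronwall_step[OF dH dL K c0 _ step t]) (use Suc j in auto)
    qed
  qed
  have zero: "expectation (\<lambda>\<omega>. (?d j t \<omega>)\<^sup>2) \<le> 0" if t: "t \<in> {0..T}" for t
    by (rule LIMSEQ_le_const[OF factorial_tendsto[of c0 "real h * K * t"]]) (use bound t j in auto)
  have "sqnorm T (?d j) \<le> 0 * T^Suc 0 / real (Suc 0)"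
    by (rule sqnorm_growth[OF dH[OF j] _ dL[OF j]]) (use zero T in auto)
  then have "sqnorm T (?d j) = 0" using sqnorm_nonneg[of T "?d j"] by simp
  then have "AE w in Q. cutoff T (?d j) w = 0"
    unfolding sqnorm_def by (intro L2_AE_zero H_L2 dH j)
  then show ?thesis unfolding cut_diff by eventually_elim simp
qed

lemma sde_exists:
  assumes T: "0 < T" and p: "\<And>j. j < h \<Longrightarrow> p j \<in> H T" and q: "\<And>j. j < h \<Longrightarrow> q j \<in> H T"
  shows "\<exists>Y. (\<forall>j<h. Y j \<in> H T) \<and> (\<forall>t\<in>{0..T}. \<forall>j<h. AE \<omega> in P. Y j t \<omega> = rhs h a c p q Y j t \<omega>)"
proof -
  define K where "K = (2 * T + 2) * (\<Sum>i<h. \<Sum>j<h. (a i j)\<^sup>2)"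
  have K: "0 \<le> K" unfolding K_def using T by (intro mult_nonneg_nonneg sum_nonneg) auto
  have ex: "\<exists>Y. (\<forall>j<h. Y j \<in> H T) \<and> (\<forall>t\<in>{0..T}. \<forall>j<h. AE \<omega> in P. Y j t \<omega> = rhs h a c p q u j t \<omega>)"
    if u: "\<And>j. j < h \<Longrightarrow> u j \<in> H T" for u
  proof -
    have "\<forall>j. \<exists>Y. j < h \<longrightarrow> Y \<in> H T \<and> (\<forall>t\<in>{0..T}. AE \<omega> in P. Y t \<omega> = rhs h a c p q u j t \<omega>)"
    proof (rule allI)
      fix j
      show "\<exists>Y. j < h \<longrightarrow> Y \<in> H T \<and> (\<forall>t\<in>{0..T}. AE \<omega> in P. Y t \<omega> = rhs h a c p q u j t \<omega>)"
      proof (cases "j < h")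
        case True
        have "\<exists>Y\<in>H T. \<forall>t\<in>{0..T}. AE \<omega> in P. Y t \<omega> = rhs h a c p q u j t \<omega>"
          unfolding rhs_def using u p[OF True] q[OF True] by (intro stoch_process T H_add H_sum H_cmult) auto
        then show ?thesis by blast
      qed simp
    qed
    from choice[OF this] show ?thesis by blast
  qed
  \<comment> \<open>\<open>rhs\<close> is determined separately at each time; \<Phi> replaces it by
    a process in \<open>H T\<close>, which can be inserted into \<open>rhs\<close> again.\<close>
  define \<Phi> where "\<Phi> u = (SOME Y. (\<forall>j<h. Y j \<in> H T) \<and> (\<forall>t\<in>{0..T}. \<forall>j<h. AE \<omega> in P. Y j t \<omega> = rhs h a c p q u j t \<omega>))" for u
  define y where "y k = (\<Phi> ^^ k) (\<lambda>j s \<omega>. 0)" for k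
  have \<Phi>: "\<Phi> u j \<in> H T" "t \<in> {0..T} \<Longrightarrow> AE \<omega> in P. \<Phi> u j t \<omega> = rhs h a c p q u j t \<omega>"
    if "\<And>j. j < h \<Longrightarrow> u j \<in> H T" "j < h" for u j t
    using someI_ex[OF ex[OF that(1)]] that(2) unfolding \<Phi>_def by auto
  have yH: "y k j \<in> H T" if "j < h" for k j
    using that
  proof (induction k arbitrary: j)
    case (Suc k) then show ?case using \<Phi>(1)[of "y k" j] by (simp add: y_def)
  qed (simp add: y_def H_const)
  have yeq: "AE \<omega> in P. y (Suc k) j t \<omega> = rhs h a c p q (y k) j t \<omega>" if "j < h" "t \<in> {0..T}" for k j t
    using \<Phi>(2)[of "y k" j t] yH that by (simp add: y_def)
  have yF: "y k j t \<in> borel_measurable (Ft t)" if "j < h" "t \<in> {0..T}" for k j t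
    using yH[OF that(1)] that(2) by (auto simp: H_iff)
  have rL: "rhs h a c p q (y k) j t \<in> L2 P" if "j < h" "t \<in> {0..T}" for k j t
    by (rule rhs_L2[OF yH p q that(2,1)])
  have yL: "y k j t \<in> L2 P" if "j < h" "t \<in> {0..T}" for k j t
  proof (cases k)
    case 0 then show ?thesis by (simp add: y_def L2_zero)
  next
    case (Suc l)
    have "AE \<omega> in P. rhs h a c p q (y l) j t \<omega> = y (Suc l) j t \<omega>" using yeq[OF that, of l] by eventually_elim simp
    then show ?thesis unfolding Suc by (rule L2_cong_AE[OF rL[OF that] measurable_Ft_P[OF yF[OF that]]])
  qed
  let ?d = "\<lambda>k j s \<omega>. y (Suc k) j s \<omega> - y k j s \<omega>"
  have dH: "?d k j \<in> H T" if "j < h" for k j using yH that by (intro H_diff) auto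
  have dL: "?d k j s \<in> L2 P" if "j < h" "s \<in> {0..T}" for k j s using yL that by (intro L2_diff) auto
  have step: "expectation (\<lambda>\<omega>. (?d (Suc k) j t \<omega>)\<^sup>2) \<le> K * (\<Sum>j<h. sqnorm t (?d k j))" if t: "t \<in> {0..T}" and j: "j < h" for k t j
  proof -
    have "expectation (\<lambda>\<omega>. (?d (Suc k) j t \<omega>)\<^sup>2) = expectation (\<lambda>\<omega>. (rhs h a c p q (y (Suc k)) j t \<omega> - rhs h a c p q (y k) j t \<omega>)\<^sup>2)"
    proof (rule integral_cong_AE)
      show "AE \<omega> in P. (?d (Suc k) j t \<omega>)\<^sup>2 = (rhs h a c p q (y (Suc k)) j t \<omega> - rhs h a c p q (y k) j t \<omega>)\<^sup>2"
        using yeq[OF j t, of k] yeq[OF j t, of "Suc k"] by eventually_elim simp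
      show "(\<lambda>\<omega>. (?d (Suc k) j t \<omega>)\<^sup>2) \<in> borel_measurable P" using dL[OF j t] by measurable
      show "(\<lambda>\<omega>. (rhs h a c p q (y (Suc k)) j t \<omega> - rhs h a c p q (y k) j t \<omega>)\<^sup>2) \<in> borel_measurable P"
        using rL[OF j t, of k] rL[OF j t, of "Suc k"] by measurable
    qed
    also have "\<dots> \<le> K * (\<Sum>j<h. sqnorm t (?d k j))"
      unfolding K_def by (rule rhs_lipschitz[OF yH yH p q t j])
    finally show ?thesis .
  qed
  have "\<exists>B\<ge>0. \<forall>t\<in>{0..T}. \<forall>j<h. expectation (\<lambda>\<omega>. (?d 0 j t \<omega>)\<^sup>2) \<le> B"
  proof -
    let ?B = "\<lambda>j. 2 * (c j)\<^sup>2 + 2 * (2 * T * sqnorm T (p j) + 2 * sqnorm T (q j))"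
    have B0: "0 \<le> ?B j" for j using T by (intro add_nonneg_nonneg mult_nonneg_nonneg sqnorm_nonneg) auto
    have "expectation (\<lambda>\<omega>. (?d 0 j t \<omega>)\<^sup>2) \<le> ?B j" if t: "t \<in> {0..T}" and j: "j < h" for t j
    proof -
      have pt: "p j \<in> H t" "q j \<in> H t" using H_mono p[OF j] q[OF j] t by auto
      have y0: "rhs h a c p q (y 0) j t = (\<lambda>\<omega>. c j + stoch t (p j) (q j) \<omega>)" by (simp add: rhs_def fun_eq_iff y_def)
      have "expectation (\<lambda>\<omega>. (?d 0 j t \<omega>)\<^sup>2) = expectation (\<lambda>\<omega>. (c j + stoch t (p j) (q j) \<omega>)\<^sup>2)"
      proof (rule integral_cong_AE)
        show "AE \<omega> in P. (?d 0 j t \<omega>)\<^sup>2 = (c j + stoch t (p j) (q j) \<omega>)\<^sup>2"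
          using yeq[OF j t, of 0] unfolding y0 by eventually_elim (simp add: y_def)
        show "(\<lambda>\<omega>. (?d 0 j t \<omega>)\<^sup>2) \<in> borel_measurable P" using dL[OF j t] by measurable
        show "(\<lambda>\<omega>. (c j + stoch t (p j) (q j) \<omega>)\<^sup>2) \<in> borel_measurable P"
          using rL[OF j t, of 0] unfolding y0 by measurable
      qed
      also have "\<dots> \<le> 2 * expectation (\<lambda>\<omega>. (c j)\<^sup>2) + 2 * expectation (\<lambda>\<omega>. (stoch t (p j) (q j) \<omega>)\<^sup>2)"
        using t by (intro L2_sq_add L2_const finite_measure_axioms stoch_L2 pt) auto
      also have "expectation (\<lambda>\<omega>. (stoch t (p j) (q j) \<omega>)\<^sup>2) \<le> 2 * t * sqnorm t (p j) + 2 * sqnorm t (q j)"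
        using t by (intro stoch_bound pt) auto
      also have "2 * t * sqnorm t (p j) \<le> 2 * T * sqnorm T (p j)"
        using t sqnorm_mono[OF p[OF j], of t] by (intro mult_mono) (auto simp: sqnorm_nonneg)
      also have "sqnorm t (q j) \<le> sqnorm T (q j)" using t sqnorm_mono[OF q[OF j], of t] by auto
      finally show ?thesis by (simp add: prob_space)
    qed
    moreover have "?B j \<le> (\<Sum>j<h. ?B j)" if "j < h" for j
      using that B0 by (intro member_le_sum) auto
    ultimately have "\<forall>t\<in>{0..T}. \<forall>j<h. expectation (\<lambda>\<omega>. (?d 0 j t \<omega>)\<^sup>2) \<le> (\<Sum>j<h. ?B j)"
      by (meson order_trans)
    moreover have "0 \<le> (\<Sum>j<h. ?B j)" using B0 by (intro sum_nonneg)
    ultimately show ?thesis by blast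
  qed
  then obtain c0 where c0: "0 \<le> c0" "\<And>t j. t \<in> {0..T} \<Longrightarrow> j < h \<Longrightarrow> expectation (\<lambda>\<omega>. (?d 0 j t \<omega>)\<^sup>2) \<le> c0" by auto
  have bound: "\<forall>t\<in>{0..T}. \<forall>j<h. expectation (\<lambda>\<omega>. (?d k j t \<omega>)\<^sup>2) \<le> c0 * (real h * K * t)^k / fact k" for k
  proof (induction k)
    case 0 show ?case using c0(2) by simp
  next
    case (Suc k)
    show ?case
    proof (intro ballI allI impI)
      fix t j assume t: "t \<in> {0..T}" and j: "j < h"
      show "expectation (\<lambda>\<omega>. (?d (Suc k) j t \<omega>)\<^sup>2) \<le> c0 * (real h * K * t)^Suc k / fact (Suc k)"
        by (rule gronwall_step[where d="?d k" and d'="?d (Suc k) j", OF dH dL K c0(1) _ step[OF _ j] t]) (use Suc in auto)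
    qed
  qed
  define e where "e k = c0 * (real h * K * T)^k / fact k" for k
  have be: "expectation (\<lambda>\<omega>. (?d k j t \<omega>)\<^sup>2) \<le> e k" if "t \<in> {0..T}" "j < h" for k t j
  proof -
    have "c0 * (real h * K * t)^k / fact k \<le> e k"
      unfolding e_def using that K c0(1) by (intro divide_right_mono mult_left_mono power_mono) auto
    then show ?thesis using bound that by (meson order_trans)
  qed
  have es: "summable (\<lambda>k. 2^k * e k)"
  proof -
    have "2^k * e k = c0 * (inverse (fact k) * (2 * (real h * K * T))^k)" for k
      unfolding e_def by (simp add: power_mult_distrib divide_inverse)
    then show ?thesis using summable_mult[OF summable_exp[of "2 * (real h * K * T)"], of c0] by (simp only:)
  qed
  \<comment> \<open>This bounds the distance to the limit by the same number for all times, so that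
    it integrates to a bound for the process.\<close>
  define r where "r k = 2 * (\<Sum>j. 2^(j+k) * e (j+k))" for k
  have r0: "r \<longlonglongrightarrow> 0"
    unfolding r_def[abs_def] by (rule tendsto_mult_right_zero[OF suminf_exist_split2[OF es]])
  define Y where "Y j t \<omega> = lim (\<lambda>k. y k j t \<omega>)" for j t \<omega>
  have LC: "Y j t \<in> L2 P" "expectation (\<lambda>\<omega>. (Y j t \<omega> - y k j t \<omega>)\<^sup>2) \<le> r k" if "t \<in> {0..T}" "j < h" for t j k
    using L2_complete(2,3)[OF finite_measure_axioms yL[OF that(2,1)] be[OF that] es] unfolding Y_def[abs_def] r_def by auto
  have Ym: "cutoff T (Y j) \<in> borel_measurable Q" if j: "j < h" for j
  proof -
    have [measurable]: "cutoff T (y k j) \<in> borel_measurable Q" for k using H_L2[OF yH[OF j]] by auto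
    have "cutoff T (Y j) = (\<lambda>z. if 0 \<le> fst z \<and> fst z \<le> T then lim (\<lambda>k. cutoff T (y k j) z) else 0)"
      by (auto simp: cutoff_def Y_def fun_eq_iff)
    also have "\<dots> \<in> borel_measurable Q" by measurable
    finally show ?thesis .
  qed
  have YF: "Y j t \<in> borel_measurable (Ft t)" if "t \<in> {0..T}" "j < h" for t j
    unfolding Y_def[abs_def] by (intro borel_measurable_lim_metric yF that)
  have YdH: "(\<lambda>s \<omega>. Y j s \<omega> - y k j s \<omega>) \<in> H T" and Yds: "sqnorm T (\<lambda>s \<omega>. Y j s \<omega> - y k j s \<omega>) \<le> r k * T" if j: "j < h" for j k
  proof -
    have m: "cutoff T (\<lambda>s \<omega>. Y j s \<omega> - y k j s \<omega>) \<in> borel_measurable Q"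
      unfolding cut_diff using Ym[OF j] H_L2[OF yH[OF j, of k]] by measurable
    have a: "(\<lambda>\<omega>. Y j t \<omega> - y k j t \<omega>) \<in> borel_measurable (Ft t)" if "t \<in> {0..T}" for t
      by (intro borel_measurable_diff YF yF that j)
    have L: "(\<lambda>\<omega>. Y j t \<omega> - y k j t \<omega>) \<in> L2 P" if "t \<in> {0..T}" for t
      by (intro L2_diff LC(1) yL that j)
    note HI = H_I[where Y="\<lambda>s \<omega>. Y j s \<omega> - y k j s \<omega>", OF m a L LC(2)[OF _ j] less_imp_le[OF T]]
    show "(\<lambda>s \<omega>. Y j s \<omega> - y k j s \<omega>) \<in> H T" by (rule HI(1))
    show "sqnorm T (\<lambda>s \<omega>. Y j s \<omega> - y k j s \<omega>) \<le> r k * T" by (rule HI(2))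
  qed
  have YH: "Y j \<in> H T" if j: "j < h" for j
    using H_add[OF YdH[OF j, of 0] yH[OF j, of 0]] by simp
  have "AE \<omega> in P. Y j t \<omega> = rhs h a c p q Y j t \<omega>" if t: "t \<in> {0..T}" and j: "j < h" for t j
  proof -
    have RL: "rhs h a c p q Y j t \<in> L2 P" by (rule rhs_L2[OF YH p q t j])
    \<comment> \<open>The iterate \<open>y (Suc k)\<close> is near \<open>Y\<close> by completeness
      and near the image of \<open>Y\<close> by the Lipschitz bound, being itself a version of the
      image of \<open>y k\<close>.\<close>
    have "expectation (\<lambda>\<omega>. (Y j t \<omega> - rhs h a c p q Y j t \<omega>)\<^sup>2) \<le> 0"
    proof (rule LIMSEQ_le_const)
      have "(\<lambda>k. 2 * r (Suc k) + 2 * (K * (real h * (r k * T)))) \<longlonglongrightarrow> 2 * 0 + 2 * (K * (real h * (0 * T)))"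
        using r0 LIMSEQ_Suc[OF r0] by (intro tendsto_add tendsto_mult tendsto_const)
      then show "(\<lambda>k. 2 * r (Suc k) + 2 * (K * (real h * (r k * T)))) \<longlonglongrightarrow> 0" by simp
      show "\<exists>N. \<forall>k\<ge>N. expectation (\<lambda>\<omega>. (Y j t \<omega> - rhs h a c p q Y j t \<omega>)\<^sup>2) \<le> 2 * r (Suc k) + 2 * (K * (real h * (r k * T)))"
      proof (intro exI allI impI)
        fix k
        have "expectation (\<lambda>\<omega>. (Y j t \<omega> - rhs h a c p q Y j t \<omega>)\<^sup>2) \<le>
          2 * expectation (\<lambda>\<omega>. (Y j t \<omega> - y (Suc k) j t \<omega>)\<^sup>2) + 2 * expectation (\<lambda>\<omega>. (y (Suc k) j t \<omega> - rhs h a c p q Y j t \<omega>)\<^sup>2)"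
          by (rule L2_sq_triangle[OF LC(1)[OF t j] yL[OF j t] RL])
        also have "expectation (\<lambda>\<omega>. (y (Suc k) j t \<omega> - rhs h a c p q Y j t \<omega>)\<^sup>2) = expectation (\<lambda>\<omega>. (rhs h a c p q Y j t \<omega> - rhs h a c p q (y k) j t \<omega>)\<^sup>2)"
        proof (rule integral_cong_AE)
          show "AE \<omega> in P. (y (Suc k) j t \<omega> - rhs h a c p q Y j t \<omega>)\<^sup>2 = (rhs h a c p q Y j t \<omega> - rhs h a c p q (y k) j t \<omega>)\<^sup>2"
            using yeq[OF j t, of k] by eventually_elim (simp add: power2_commute)
          show "(\<lambda>\<omega>. (y (Suc k) j t \<omega> - rhs h a c p q Y j t \<omega>)\<^sup>2) \<in> borel_measurable P" using yL[OF j t, of "Suc k"] RL by measurable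
          show "(\<lambda>\<omega>. (rhs h a c p q Y j t \<omega> - rhs h a c p q (y k) j t \<omega>)\<^sup>2) \<in> borel_measurable P" using rL[OF j t, of k] RL by measurable
        qed
        also have "\<dots> \<le> K * (\<Sum>j<h. sqnorm t (\<lambda>s \<omega>. Y j s \<omega> - y k j s \<omega>))"
          unfolding K_def by (rule rhs_lipschitz[OF YH yH p q t j])
        also have "\<dots> \<le> K * (\<Sum>j<h. r k * T)"
          using t by (intro mult_left_mono sum_mono K order_trans[OF sqnorm_mono[OF YdH] Yds]) auto
        also have "(\<Sum>j<h. r k * T) = real h * (r k * T)" by simp
        finally show "expectation (\<lambda>\<omega>. (Y j t \<omega> - rhs h a c p q Y j t \<omega>)\<^sup>2) \<le> 2 * r (Suc k) + 2 * (K * (real h * (r k * T)))"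
          using LC(2)[OF t j, of "Suc k"] by linarith
      qed
    qed
    then have "expectation (\<lambda>\<omega>. (Y j t \<omega> - rhs h a c p q Y j t \<omega>)\<^sup>2) = 0" by (intro antisym) auto
    then have "AE \<omega> in P. Y j t \<omega> - rhs h a c p q Y j t \<omega> = 0" by (intro L2_AE_zero L2_diff LC(1) RL t j)
    then show ?thesis by eventually_elim simp
  qed
  then show ?thesis using YH by blast
qed

end

section \<open>The Weierstrass form of a regular pencil\<close>

lemma mat_inverse_exists:
  fixes A :: "'a :: field mat"
  assumes A: "A \<in> carrier_mat n n" and d: "det A \<noteq> 0"
  obtains B where "B \<in> carrier_mat n n" "A * B = 1\<^sub>m n" "B * A = 1\<^sub>m n"
  using det_non_zero_imp_unit[OF A d, of "()"] that unfolding Units_def ring_mat_def by auto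

lemma det_nonzeroI:
  fixes A :: "'a :: field mat"
  assumes A: "A \<in> carrier_mat n n" and k: "\<And>v. v \<in> carrier_vec n \<Longrightarrow> A *\<^sub>v v = 0\<^sub>v n \<Longrightarrow> v = 0\<^sub>v n"
  shows "det A \<noteq> 0"
  using det_0_iff_vec_prod_zero_field[OF A] k by auto

lemma invertible_matI:
  fixes A :: "'a :: semiring_1 mat"
  assumes "A \<in> carrier_mat n n" "B \<in> carrier_mat n n" "A * B = 1\<^sub>m n" "B * A = 1\<^sub>m n"
  shows "invertible_mat A"
  unfolding invertible_mat_def inverts_mat_def using assms by (auto intro!: exI[of _ B])

abbreviation diag2 :: "'a :: zero mat \<Rightarrow> 'a mat \<Rightarrow> 'a mat" where
  "diag2 A D \<equiv> four_block_mat A (0\<^sub>m (dim_row A) (dim_col D)) (0\<^sub>m (dim_row D) (dim_col A)) D"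

lemma diag2_mult:
  fixes A A' :: "'a :: semiring_1 mat"
  assumes "A \<in> carrier_mat n n" "A' \<in> carrier_mat n n" "D \<in> carrier_mat m m" "D' \<in> carrier_mat m m"
  shows "diag2 A D * diag2 A' D' = diag2 (A * A') (D * D')"
proof -
  have "diag2 A D * diag2 A' D' = four_block_mat (A * A' + 0\<^sub>m n m * 0\<^sub>m m n) (A * 0\<^sub>m n m + 0\<^sub>m n m * D')
      (0\<^sub>m m n * A' + D * 0\<^sub>m m n) (0\<^sub>m m n * 0\<^sub>m n m + D * D')"
    using assms by (subst mult_four_block_mat[of _ n n _ m _ m]) auto
  also have "\<dots> = diag2 (A * A') (D * D')"
    using assms by (intro cong_four_block_mat) auto
  finally show ?thesis .
qed

lemma diag2_carrier [simp]: "A \<in> carrier_mat n n \<Longrightarrow> D \<in> carrier_mat m m \<Longrightarrow> diag2 A D \<in> carrier_mat (n + m) (n + m)"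
  by simp

lemma similar_matE:
  assumes "similar_mat A B" "A \<in> carrier_mat n n"
  obtains S T where "S \<in> carrier_mat n n" "T \<in> carrier_mat n n" "B \<in> carrier_mat n n" "S * T = 1\<^sub>m n" "T * S = 1\<^sub>m n" "A = S * B * T"
proof -
  from assms(1) obtain S T where "similar_mat_wit A B S T" unfolding similar_mat_def by blast
  from similar_mat_witD2[OF assms(2) this] show ?thesis using that[of S T] by simp
qed

lemma zero_mat_mult_vec: "v \<in> carrier_vec m \<Longrightarrow> 0\<^sub>m n m *\<^sub>v v = (0\<^sub>v n :: 'a :: semiring_0 vec)"
  by (intro eq_vecI) auto

text \<open>A Jordan form needs a characteristic polynomial that splits. Over the complex numbers
  all eigenvalues of a nilpotent matrix are 0, so the polynomial is X^n; comparing coefficients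
  shows that it splits for the real matrix too.\<close>

lemma nilpotent_jordan:
  fixes K :: "real mat"
  assumes K: "K \<in> carrier_mat n n" and q: "K ^\<^sub>m q = 0\<^sub>m n n"
  shows "\<exists>ms. (\<forall>k\<in>set ms. 0 < k) \<and> sum_list ms = n \<and> similar_mat K (diag_block_mat (map (\<lambda>k. jordan_block k 0) ms))"
proof -
  let ?C = "map_mat complex_of_real K"
  have C: "?C \<in> carrier_mat n n" using K by simp
  obtain as where as: "char_poly ?C = (\<Prod>a\<leftarrow>as. [:- a, 1:])" "length as = n"
    using char_poly_factorized[OF C] by auto
  have Cq: "?C ^\<^sub>m q = 0\<^sub>m n n"
  proof -
    have "?C ^\<^sub>m q = map_mat complex_of_real (K ^\<^sub>m q)" by (rule of_real_hom.mat_hom_pow[OF K, symmetric])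
    then show ?thesis unfolding q by (auto intro!: eq_matI)
  qed
  have "a = 0" if "a \<in> set as" for a
  proof -
    have "poly (char_poly ?C) a = 0"
      unfolding as(1) using that by (induction as) auto
    then have "eigenvalue ?C a" using eigenvalue_root_char_poly[OF C] by simp
    then obtain v where v: "eigenvector ?C v a" by (auto simp: eigenvalue_def)
    from eigenvector_pow[OF C v, of q] have "a ^ q \<cdot>\<^sub>v v = 0\<^sub>v n"
      unfolding Cq using v C by (auto simp: eigenvector_def zero_mat_mult_vec)
    moreover have "v \<in> carrier_vec n" "v \<noteq> 0\<^sub>v n" using v C by (auto simp: eigenvector_def)
    then obtain i where "i < n" "v $ i \<noteq> 0" by (metis carrier_vecD eq_vecI index_zero_vec(1) zero_carrier_vec)
    ultimately have "a ^ q * v $ i = 0" using \<open>v \<in> carrier_vec n\<close> by (metis carrier_vecD index_smult_vec(1) index_zero_vec(1))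
    with \<open>v $ i \<noteq> 0\<close> show "a = 0" by simp
  qed
  then have "as = replicate n 0" using as(2) by (metis replicate_eqI)
  then have cC: "char_poly ?C = monom 1 n"
    unfolding as(1) by (simp add: monom_altdef prod_list_replicate)
  have cK: "char_poly K = monom 1 n"
  proof (rule poly_eqI)
    fix i
    have "coeff (char_poly ?C) i = complex_of_real (coeff (char_poly K) i)"
      unfolding of_real_hom.char_poly_hom[OF K] by simp
    then have "complex_of_real (coeff (char_poly K) i) = (if n = i then 1 else 0)"
      unfolding cC by (simp add: coeff_monom)
    then have "complex_of_real (coeff (char_poly K) i) = complex_of_real (coeff (monom 1 n) i)"
      by simp
    then show "coeff (char_poly K) i = coeff (monom 1 n) i" by (simp only: of_real_eq_iff)
  qed
  have "char_poly K = (\<Prod>a\<leftarrow>replicate n 0. [:- a, 1:])"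
    unfolding cK by (simp add: monom_altdef prod_list_replicate)
  from jordan_nf_exists[OF K this] obtain n_as where J: "jordan_nf K n_as" by blast
  then have sim: "similar_mat K (jordan_matrix n_as)" and pos: "0 \<notin> fst ` set n_as"
    by (auto simp: jordan_nf_def)
  have z: "a = 0" if "(k, a) \<in> set n_as" for k a
  proof -
    have "0 < k" using pos that by force
    have "poly (char_poly K) a = 0"
      unfolding jordan_nf_char_poly[OF J] using that \<open>0 < k\<close> by (induction n_as) auto
    then show "a = 0" unfolding cK by (simp add: poly_monom)
  qed
  have eq: "jordan_matrix n_as = diag_block_mat (map (\<lambda>k. jordan_block k 0) (map fst n_as))"
    unfolding jordan_matrix_def map_map using z by (intro arg_cong[where f=diag_block_mat] map_cong) auto
  have "dim_row (jordan_matrix n_as) = n" using similar_matE[OF sim K] by (metis carrier_matD(1))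
  then have "sum_list (map fst n_as) = n" by simp
  moreover have "\<forall>k\<in>set (map fst n_as). 0 < k" using pos by force
  ultimately show ?thesis using sim unfolding eq by blast
qed

section \<open>Splitting a matrix into a nilpotent and an invertible part\<close>

lemma similar_mat_conj:
  fixes A :: "'a :: semiring_1 mat"
  assumes "A \<in> carrier_mat n n" "S \<in> carrier_mat n n" "T \<in> carrier_mat n n" "S * T = 1\<^sub>m n" "T * S = 1\<^sub>m n"
  shows "similar_mat A (T * A * S)"
proof -
  have "S * (T * A * S) * T = (S * T) * A * (S * T)"
    using assms(1-3) by (simp add: assoc_mult_mat[of _ n n _ n _ n])
  also have "\<dots> = A" using assms by simp
  finally have eq: "A = S * (T * A * S) * T" by simp
  have "T * A * S \<in> carrier_mat n n" using assms(1-3) by auto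
  from similar_mat_witI[OF assms(4,5) eq assms(1) this assms(2,3)] show ?thesis
    unfolding similar_mat_def by blast
qed

lemma pow_mat_Suc_left:
  fixes A :: "'a :: semiring_1 mat"
  assumes A: "A \<in> carrier_mat n n"
  shows "A ^\<^sub>m Suc k = A * A ^\<^sub>m k"
proof (induction k)
  case (Suc k)
  have "A ^\<^sub>m Suc (Suc k) = (A * A ^\<^sub>m k) * A" using Suc by simp
  also have "\<dots> = A * (A ^\<^sub>m k * A)" using A by (intro assoc_mult_mat[of _ n n _ n _ n]) auto
  finally show ?case by simp
qed (use A in simp)

lemma mult_vec_unit:
  assumes "A \<in> carrier_mat n n" "j < n"
  shows "A *\<^sub>v unit_vec n j = (col A j :: 'a :: semiring_1 vec)"
  using assms by (intro eq_vecI) auto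

text \<open>Deflation: in a basis that starts with the kernel vector the first column
  vanishes.\<close>

lemma kernel_vector_block:
  fixes K :: "'a :: field mat"
  assumes K: "K \<in> carrier_mat (Suc m) (Suc m)" and v: "v \<in> carrier_vec (Suc m)" "v \<noteq> 0\<^sub>v (Suc m)" "K *\<^sub>v v = 0\<^sub>v (Suc m)"
  shows "\<exists>w K'. w \<in> carrier_mat 1 m \<and> K' \<in> carrier_mat m m \<and> similar_mat K (four_block_mat (0\<^sub>m 1 1) w (0\<^sub>m m 1) K')"
proof -
  let ?n = "Suc m"
  obtain i where i: "i < ?n" "v $ i \<noteq> 0" using v by (metis carrier_vecD eq_vecI index_zero_vec(1) zero_carrier_vec)
  \<comment> \<open>For c \<ge> 1 this enumerates the indices other than i, so the columns of
    \<open>P\<close> are v and all unit vectors but the one at i, where v is nonzero.\<close>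
  define \<sigma> where "\<sigma> c = (if c \<le> i then c - 1 else c)" for c :: nat
  define P where "P = mat ?n ?n (\<lambda>(r, c). if c = 0 then v $ r else if r = \<sigma> c then 1 else 0)"
  have P: "P \<in> carrier_mat ?n ?n" by (simp add: P_def)
  have "det P \<noteq> 0"
  proof (rule det_nonzeroI[OF P])
    fix w assume w: "w \<in> carrier_vec ?n" "P *\<^sub>v w = 0\<^sub>v ?n"
    have row: "v $ r * w $ 0 + (\<Sum>c=1..<?n. (if r = \<sigma> c then 1 else 0) * w $ c) = 0" if r: "r < ?n" for r
    proof -
      have "0 = (P *\<^sub>v w) $ r" using r w by simp
      also have "\<dots> = (\<Sum>c=0..<?n. P $$ (r, c) * w $ c)" using r w(1) P by (simp add: scalar_prod_def del: sum.op_ivl_Suc)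
      also have "\<dots> = P $$ (r, 0) * w $ 0 + (\<Sum>c=1..<?n. P $$ (r, c) * w $ c)"
        by (subst sum.atLeast_Suc_lessThan) auto
      also have "\<dots> = v $ r * w $ 0 + (\<Sum>c=1..<?n. (if r = \<sigma> c then 1 else 0) * w $ c)"
        using r by (intro arg_cong2[where f="(+)"] sum.cong) (auto simp: P_def)
      finally show ?thesis by simp
    qed
    have "(\<Sum>c=1..<?n. (if i = \<sigma> c then 1 else 0) * w $ c) = 0"
      by (intro sum.neutral) (auto simp: \<sigma>_def)
    with row[OF i(1)] i(2) have w0: "w $ 0 = 0" by simp
    have "w $ c = 0" if c: "c < ?n" for c
    proof (cases "c = 0")
      case False
      have r: "\<sigma> c < ?n" using c by (auto simp: \<sigma>_def)
      have "(\<Sum>d=1..<?n. (if \<sigma> c = \<sigma> d then 1 else 0) * w $ d) = (\<Sum>d=1..<?n. if d = c then w $ c else 0)"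
        using False by (intro sum.cong) (auto simp: \<sigma>_def split: if_splits)
      also have "\<dots> = w $ c" using False c by simp
      finally show ?thesis using row[OF r] w0 by simp
    qed (simp add: w0)
    then show "w = 0\<^sub>v ?n" using w by (intro eq_vecI) auto
  qed
  then obtain T where T: "T \<in> carrier_mat ?n ?n" "P * T = 1\<^sub>m ?n" "T * P = 1\<^sub>m ?n" using mat_inverse_exists[OF P] by blast
  define L where "L = T * K * P"
  have L: "L \<in> carrier_mat ?n ?n" using T K P by (auto simp: L_def)
  have sim: "similar_mat K L" unfolding L_def by (rule similar_mat_conj[OF K P T])
  have colP: "P *\<^sub>v unit_vec ?n 0 = v"
    unfolding mult_vec_unit[OF P zero_less_Suc] using v by (intro eq_vecI) (auto simp: P_def)
  have "L *\<^sub>v unit_vec ?n 0 = T *\<^sub>v (K *\<^sub>v (P *\<^sub>v unit_vec ?n 0))"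
    unfolding L_def using T(1) K P mult_carrier_mat[OF T(1) K] mult_carrier_mat[OF K P]
    by (simp add: assoc_mult_mat_vec[of _ ?n ?n _ ?n])
  also have "\<dots> = 0\<^sub>v ?n" unfolding colP v(3) using T by auto
  finally have "col L 0 = 0\<^sub>v ?n" using mult_vec_unit[OF L zero_less_Suc] by simp
  then have L0: "L $$ (r, 0) = 0" if "r < ?n" for r using that L by (metis carrier_matD index_col index_zero_vec(1) zero_less_Suc)
  obtain a w b K' where sp: "split_block L 1 1 = (a, w, b, K')" by (cases "split_block L 1 1") auto
  note S = split_block[OF sp, of m m]
  have dims: "dim_row L = 1 + m" "dim_col L = 1 + m" using L by auto
  note S = S[OF dims]
  have "a = 0\<^sub>m 1 1"
    using S L0[of 0] by (intro eq_matI) (auto)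
  moreover have "b = 0\<^sub>m m 1"
  proof (rule eq_matI)
    fix r c assume rc: "r < dim_row (0\<^sub>m m 1)" "c < dim_col (0\<^sub>m m 1)"
    have "L $$ (Suc r, 0) = b $$ (r, 0)" unfolding S(5) using rc S(1-4) by simp
    then show "b $$ (r, c) = 0\<^sub>m m 1 $$ (r, c)" using L0[of "Suc r"] rc by simp
  qed (use S in auto)
  ultimately have "L = four_block_mat (0\<^sub>m 1 1) w (0\<^sub>m m 1) K'" using S(5) by simp
  then show ?thesis using S(2,4) sim by blast
qed

lemma uminus_zero_mat: "- 0\<^sub>m n m = (0\<^sub>m n m :: 'a :: group_add mat)"
  by (intro eq_matI) auto

text \<open>Fitting's decomposition without eigenvalues, by induction on the dimension: if the
  determinant vanishes, a kernel vector is split off and joined to the nilpotent part of the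
  remaining block. What has to be removed is its coupling to the invertible part.\<close>

lemma fitting:
  fixes K :: "real mat"
  assumes "K \<in> carrier_mat n n"
  shows "\<exists>a b K2 K1 q. a + b = n \<and> K2 \<in> carrier_mat a a \<and> K1 \<in> carrier_mat b b \<and> K2 ^\<^sub>m q = 0\<^sub>m a a \<and> det K1 \<noteq> 0 \<and> similar_mat K (diag2 K2 K1)"
  using assms
proof (induction n arbitrary: K)
  case 0
  have "diag2 (0\<^sub>m 0 0) K = K" using 0 by (intro eq_matI) auto
  moreover have "similar_mat K K" using 0 by (rule similar_mat_refl)
  moreover have "det K \<noteq> 0" using 0 by (simp add: det_dim_zero)
  ultimately show ?case using 0
    by (intro exI[of _ 0] exI[of _ "0\<^sub>m 0 0"] exI[of _ K] conjI) (auto intro!: eq_matI)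
next
  case (Suc m)
  let ?n = "Suc m"
  show ?case
  proof (cases "det K = 0")
    case False
    have "diag2 (0\<^sub>m 0 0) K = K" using Suc by (intro eq_matI) auto
    moreover have "similar_mat K K" using Suc(2) by (rule similar_mat_refl)
    ultimately show ?thesis using Suc(2) False
      by (intro exI[of _ 0] exI[of _ ?n] exI[of _ "0\<^sub>m 0 0"] exI[of _ K] conjI) (auto intro!: eq_matI)
  next
    case True
    then obtain v where "v \<in> carrier_vec ?n" "v \<noteq> 0\<^sub>v ?n" "K *\<^sub>v v = 0\<^sub>v ?n"
      using det_0_iff_vec_prod_zero_field[OF Suc(2)] by auto
    from kernel_vector_block[OF Suc(2) this] obtain w K' where w: "w \<in> carrier_mat 1 m" and K': "K' \<in> carrier_mat m m"
      and sim1: "similar_mat K (four_block_mat (0\<^sub>m 1 1) w (0\<^sub>m m 1) K')" by auto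
    from Suc(1)[OF K'] obtain a b K2 K1 q where ab: "a + b = m" "K2 \<in> carrier_mat a a" "K1 \<in> carrier_mat b b"
      "K2 ^\<^sub>m q = 0\<^sub>m a a" "det K1 \<noteq> 0" "similar_mat K' (diag2 K2 K1)" by auto
    from similar_matE[OF ab(6) K'] obtain S T where ST: "S \<in> carrier_mat m m" "T \<in> carrier_mat m m" "S * T = 1\<^sub>m m" "T * S = 1\<^sub>m m"
      "K' = S * diag2 K2 K1 * T" by metis
    obtain R where R: "R \<in> carrier_mat b b" "K1 * R = 1\<^sub>m b" "R * K1 = 1\<^sub>m b" using mat_inverse_exists[OF ab(3,5)] by blast
    have D: "diag2 K2 K1 \<in> carrier_mat m m" using diag2_carrier[OF ab(2,3)] ab(1) by simp
    let ?F = "four_block_mat (0\<^sub>m 1 1) w (0\<^sub>m m 1) K'"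
    have F: "?F \<in> carrier_mat (1 + m) (1 + m)" using K' by (intro four_block_carrier_mat) auto
    have TKS: "T * K' * S = diag2 K2 K1"
    proof -
      have "T * K' * S = (T * S) * diag2 K2 K1 * (T * S)"
        unfolding ST(5) using ST(1,2) D by (simp add: assoc_mult_mat[of _ m m _ m _ m])
      then show ?thesis unfolding ST(4) using left_mult_one_mat[OF D] right_mult_one_mat[OF D] by simp
    qed
    have one: "1\<^sub>m 1 \<in> carrier_mat 1 1" by simp
    have "diag2 (1\<^sub>m 1) S * diag2 (1\<^sub>m 1) T = 1\<^sub>m (1 + m)" "diag2 (1\<^sub>m 1) T * diag2 (1\<^sub>m 1) S = 1\<^sub>m (1 + m)"
      unfolding diag2_mult[OF one one ST(1,2)] diag2_mult[OF one one ST(2,1)] ST(3,4) by simp_all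
    from similar_mat_conj[OF F diag2_carrier[OF one ST(1)] diag2_carrier[OF one ST(2)] this]
    have "similar_mat ?F (diag2 (1\<^sub>m 1) T * ?F * diag2 (1\<^sub>m 1) S)" .
    also have "diag2 (1\<^sub>m 1) T * ?F * diag2 (1\<^sub>m 1) S = four_block_mat (0\<^sub>m 1 1) (w * S) (0\<^sub>m m 1) (diag2 K2 K1)"
    proof -
      have "diag2 (1\<^sub>m 1) T * ?F = four_block_mat (0\<^sub>m 1 1) w (0\<^sub>m m 1) (T * K')"
        using ST(2) w K' by (subst mult_four_block_mat[of _ 1 1 _ m _ m]) auto
      also have "\<dots> * diag2 (1\<^sub>m 1) S = four_block_mat (0\<^sub>m 1 1) (w * S) (0\<^sub>m m 1) (T * K' * S)"
        using ST(1,2) w K' by (subst mult_four_block_mat[of _ 1 1 _ m _ m]) auto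
      finally show ?thesis unfolding TKS .
    qed
    finally have sim2: "similar_mat ?F (four_block_mat (0\<^sub>m 1 1) (w * S) (0\<^sub>m m 1) (diag2 K2 K1))" (is "similar_mat _ ?G") .
    have wS: "w * S \<in> carrier_mat 1 m" using w ST by auto
    \<comment> \<open>The split-off row meets both parts of the remaining block: its entries over
      the nilpotent part go into \<open>N\<close>, those over the invertible part form the first row
      of \<open>V\<close>.\<close>
    define N where "N = four_block_mat (0\<^sub>m 1 1) (mat 1 a (\<lambda>(i, j). (w * S) $$ (0, j))) (0\<^sub>m a 1) K2"
    define V where "V = mat (Suc a) b (\<lambda>(i, j). if i = 0 then (w * S) $$ (0, a + j) else 0)"
    have N: "N \<in> carrier_mat (Suc a) (Suc a)" unfolding N_def using ab four_block_carrier_mat[of "0\<^sub>m 1 1" 1 1 K2 a a] by simp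
    have V: "V \<in> carrier_mat (Suc a) b" by (simp add: V_def)
    have G: "?G = four_block_mat N V (0\<^sub>m b (Suc a)) K1"
      using ab wS by (intro eq_matI) (auto simp: N_def V_def not_less)
    \<comment> \<open>Removing \<open>V\<close> amounts to the Sylvester equation N X - X K1 = - V.
      Since \<open>V\<close> lives in the first row and the first column of \<open>N\<close> is
      zero, N V = 0, and V times the inverse of K1 is a solution.\<close>
    define X where "X = V * R"
    have X: "X \<in> carrier_mat (Suc a) b" using V R by (auto simp: X_def)
    have XK: "X * K1 = V" unfolding X_def using V R ab by (simp add: assoc_mult_mat[of _ "Suc a" b _ b _ b])
    have NX: "N * X = 0\<^sub>m (Suc a) b"
    proof -
      have NV: "N * V = 0\<^sub>m (Suc a) b"
      proof (rule eq_matI)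
        fix i j assume ij: "i < dim_row (0\<^sub>m (Suc a) b)" "j < dim_col (0\<^sub>m (Suc a) b)"
        have "(N * V) $$ (i, j) = (\<Sum>k=0..<Suc a. N $$ (i, k) * V $$ (k, j))" using ij N V by (simp add: scalar_prod_def)
        also have "\<dots> = 0"
        proof (rule sum.neutral, safe)
          fix k assume k: "k \<in> {0..<Suc a}"
          show "N $$ (i, k) * V $$ (k, j) = 0"
            using k ij ab(2) by (cases "k = 0") (auto simp: N_def V_def)
        qed
        finally show "(N * V) $$ (i, j) = 0\<^sub>m (Suc a) b $$ (i, j)" using ij by simp
      qed (use N V in auto)
      have "N * X = N * V * R" unfolding X_def using N V R by (simp add: assoc_mult_mat[of _ "Suc a" "Suc a" _ b _ b])
      then show ?thesis unfolding NV using R by simp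
    qed
    let ?U = "four_block_mat (1\<^sub>m (Suc a)) X (0\<^sub>m b (Suc a)) (1\<^sub>m b)"
    let ?U' = "four_block_mat (1\<^sub>m (Suc a)) (- X) (0\<^sub>m b (Suc a)) (1\<^sub>m b)"
    let ?GG = "four_block_mat N V (0\<^sub>m b (Suc a)) K1"
    have sn: "Suc a + b = ?n" using ab by simp
    have U: "?U \<in> carrier_mat ?n ?n" "?U' \<in> carrier_mat ?n ?n" "?GG \<in> carrier_mat ?n ?n"
      unfolding sn[symmetric] using N ab by (intro four_block_carrier_mat; simp)+
    have XX: "X + - X = 0\<^sub>m (Suc a) b" "- X + X = 0\<^sub>m (Suc a) b" using X by auto
    have UU: "?U * ?U' = 1\<^sub>m ?n" "?U' * ?U = 1\<^sub>m ?n"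
      unfolding sn[symmetric] using X XX
      by (subst mult_four_block_mat[of _ "Suc a" "Suc a" _ b _ b _ _ "Suc a" _ b]; auto simp: uminus_zero_mat)+
    have "similar_mat ?GG (?U' * ?GG * ?U)" by (rule similar_mat_conj[OF U(3,1,2) UU])
    also have "?U' * ?GG * ?U = diag2 N K1"
    proof -
      have "?U' * ?GG = four_block_mat N (V + (- X) * K1) (0\<^sub>m b (Suc a)) K1"
        using N V X ab by (subst mult_four_block_mat[of _ "Suc a" "Suc a" _ b _ b]) auto
      also have "V + (- X) * K1 = 0\<^sub>m (Suc a) b"
      proof -
        have "(- X) * K1 = - (X * K1)" using X ab by (intro eq_matI) auto
        then show ?thesis unfolding XK using V by auto
      qed
      also have "four_block_mat N (0\<^sub>m (Suc a) b) (0\<^sub>m b (Suc a)) K1 * ?U = diag2 N K1"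
        using N X ab NX by (subst mult_four_block_mat[of _ "Suc a" "Suc a" _ b _ b]) auto
      finally show ?thesis .
    qed
    finally have sim3: "similar_mat ?G (diag2 N K1)" unfolding G .
    have "N ^\<^sub>m (Suc q) = 0\<^sub>m (Suc a) (Suc a)"
    proof -
      \<comment> \<open>The upper right block of N^(k+1) is the top row of \<open>N\<close> times
        K2^k, so one more factor suffices for nilpotency.\<close>
      have "\<exists>u\<in>carrier_mat 1 a. N ^\<^sub>m (Suc k) = four_block_mat (0\<^sub>m 1 1) u (0\<^sub>m a 1) (K2 ^\<^sub>m (Suc k)) \<and> (K2 ^\<^sub>m k = 0\<^sub>m a a \<longrightarrow> u = 0\<^sub>m 1 a)" for k
      proof (induction k)
        case 0
        show ?case
        proof (intro bexI conjI)
          show "N ^\<^sub>m Suc 0 = four_block_mat (0\<^sub>m 1 1) (mat 1 a (\<lambda>(i, j). (w * S) $$ (0, j))) (0\<^sub>m a 1) (K2 ^\<^sub>m Suc 0)"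
            using N ab by (simp add: N_def)
          show "K2 ^\<^sub>m 0 = 0\<^sub>m a a \<longrightarrow> mat 1 a (\<lambda>(i, j). (w * S) $$ (0, j)) = 0\<^sub>m 1 a"
          proof
            assume "K2 ^\<^sub>m 0 = 0\<^sub>m a a"
            then have "(1\<^sub>m a :: real mat) = 0\<^sub>m a a" using ab by simp
            then have "a = 0" by (metis index_one_mat(1) index_zero_mat(1) neq0_conv zero_neq_one)
            then show "mat 1 a (\<lambda>(i, j). (w * S) $$ (0, j)) = 0\<^sub>m 1 a" by (intro eq_matI) auto
          qed
        qed auto
      next
        case (Suc k)
        then obtain u where u: "u \<in> carrier_mat 1 a" "N ^\<^sub>m (Suc k) = four_block_mat (0\<^sub>m 1 1) u (0\<^sub>m a 1) (K2 ^\<^sub>m (Suc k))"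
          "K2 ^\<^sub>m k = 0\<^sub>m a a \<longrightarrow> u = 0\<^sub>m 1 a" by auto
        let ?w = "mat 1 a (\<lambda>(i, j). (w * S) $$ (0, j))"
        have Kk: "K2 ^\<^sub>m j \<in> carrier_mat a a" for j using ab by simp
        have comm: "N ^\<^sub>m (Suc (Suc k)) = N * N ^\<^sub>m (Suc k)" "K2 ^\<^sub>m (Suc (Suc k)) = K2 * K2 ^\<^sub>m (Suc k)"
          using pow_mat_Suc_left[OF N, of "Suc k"] pow_mat_Suc_left[OF ab(2), of "Suc k"] by auto
        have "N * N ^\<^sub>m (Suc k) = four_block_mat (0\<^sub>m 1 1) (?w * K2 ^\<^sub>m (Suc k)) (0\<^sub>m a 1) (K2 * K2 ^\<^sub>m (Suc k))"
          unfolding u(2) unfolding N_def using ab u(1) Kk by (subst mult_four_block_mat[of _ 1 1 _ a _ a]) auto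
        then show ?case
          using Kk[of "Suc k"] unfolding comm
          by (intro bexI[of _ "?w * K2 ^\<^sub>m (Suc k)"] conjI impI) (simp_all only: right_mult_zero_mat[OF mat_carrier] mult_carrier_mat[OF mat_carrier])
      qed
      then obtain u where "u \<in> carrier_mat 1 a" "N ^\<^sub>m (Suc q) = four_block_mat (0\<^sub>m 1 1) u (0\<^sub>m a 1) (K2 ^\<^sub>m (Suc q))" "u = 0\<^sub>m 1 a"
        using ab(4) by blast
      moreover have "K2 ^\<^sub>m (Suc q) = 0\<^sub>m a a" using ab by simp
      ultimately show ?thesis using four_block_zero_mat[of 1 1 a a] by simp
    qed
    moreover have "similar_mat K (diag2 N K1)"
      using similar_mat_trans[OF sim1 similar_mat_trans[OF sim2 sim3]] .
    ultimately show ?thesis using N ab sn by blast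
  qed
qed

lemma similar_mat_swap:
  fixes A :: "'a :: comm_ring_1 mat"
  assumes A: "A \<in> carrier_mat a a" and D: "D \<in> carrier_mat b b"
  shows "similar_mat (diag2 A D) (diag2 D A)"
proof -
  let ?S = "four_block_mat (0\<^sub>m a b) (1\<^sub>m a) (1\<^sub>m b) (0\<^sub>m b a) :: 'a mat"
  let ?S' = "four_block_mat (0\<^sub>m b a) (1\<^sub>m b) (1\<^sub>m a) (0\<^sub>m a b) :: 'a mat"
  have S: "?S \<in> carrier_mat (a + b) (a + b)" "?S' \<in> carrier_mat (a + b) (a + b)"
    by (auto intro!: carrier_matI)
  have 1: "?S * ?S' = 1\<^sub>m (a + b)"
    by (subst mult_four_block_mat[of _ a b _ a _ b _ _ a _ b]) auto
  have 2: "?S' * ?S = 1\<^sub>m (a + b)"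
    by (subst mult_four_block_mat[of _ b a _ b _ a _ _ b _ a]) (auto simp: add.commute)
  have D': "diag2 D A \<in> carrier_mat (a + b) (a + b)" using A D by auto
  have "?S * diag2 D A = four_block_mat (0\<^sub>m a b) A D (0\<^sub>m b a)"
    using A D by (subst mult_four_block_mat[of _ a b _ a _ b _ _ b _ a]) auto
  also have "\<dots> * ?S' = diag2 A D"
    using A D by (subst mult_four_block_mat[of _ a b _ a _ b _ _ a _ b]) auto
  finally have "diag2 A D = ?S * diag2 D A * ?S'" by simp
  from similar_mat_witI[OF 1 2 this diag2_carrier[OF A D] D' S] show ?thesis unfolding similar_mat_def by blast
qed

text \<open>Strict equivalence of matrix pencils, with the inverses as witnesses because the change
  of the unknown uses them explicitly.\<close>

definition pencil_equiv :: "nat \<Rightarrow> real mat \<Rightarrow> real mat \<Rightarrow> real mat \<Rightarrow> real mat \<Rightarrow> bool" where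
  "pencil_equiv n E A E' A' \<longleftrightarrow> (\<exists>M M' N N'. M \<in> carrier_mat n n \<and> M' \<in> carrier_mat n n \<and> N \<in> carrier_mat n n \<and> N' \<in> carrier_mat n n \<and>
     M * M' = 1\<^sub>m n \<and> M' * M = 1\<^sub>m n \<and> N * N' = 1\<^sub>m n \<and> N' * N = 1\<^sub>m n \<and> M * E * N = E' \<and> M * A * N = A')"

lemma pencil_equiv_trans:
  assumes "pencil_equiv n E A E' A'" "pencil_equiv n E' A' E'' A''" and E: "E \<in> carrier_mat n n" and A: "A \<in> carrier_mat n n"
  shows "pencil_equiv n E A E'' A''"
proof -
  obtain M M' N N' where 1: "M \<in> carrier_mat n n" "M' \<in> carrier_mat n n" "N \<in> carrier_mat n n" "N' \<in> carrier_mat n n"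
     "M * M' = 1\<^sub>m n" "M' * M = 1\<^sub>m n" "N * N' = 1\<^sub>m n" "N' * N = 1\<^sub>m n" "M * E * N = E'" "M * A * N = A'"
    using assms(1) unfolding pencil_equiv_def by blast
  obtain P P' Q Q' where 2: "P \<in> carrier_mat n n" "P' \<in> carrier_mat n n" "Q \<in> carrier_mat n n" "Q' \<in> carrier_mat n n"
     "P * P' = 1\<^sub>m n" "P' * P = 1\<^sub>m n" "Q * Q' = 1\<^sub>m n" "Q' * Q = 1\<^sub>m n" "P * E' * Q = E''" "P * A' * Q = A''"
    using assms(2) unfolding pencil_equiv_def by blast
  have prod: "(X * Y) * (Y' * X') = 1\<^sub>m n"
    if "X \<in> carrier_mat n n" "Y \<in> carrier_mat n n" "Y' \<in> carrier_mat n n" "X' \<in> carrier_mat n n" "X * X' = 1\<^sub>m n" "Y * Y' = 1\<^sub>m n"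
    for X Y X' Y' :: "real mat"
  proof -
    have "(X * Y) * (Y' * X') = X * (Y * Y') * X'"
      using that(1-4) by (simp add: assoc_mult_mat[of _ n n _ n _ n])
    then show ?thesis unfolding that(6) using that(1,4,5) by simp
  qed
  have conj: "P * (M * X * N) * Q = (P * M) * X * (N * Q)" if "X \<in> carrier_mat n n" for X
    using that 1(1,3) 2(1,3) by (simp add: assoc_mult_mat[of _ n n _ n _ n])
  show ?thesis
    unfolding pencil_equiv_def
  proof (intro exI conjI)
    show "(P * M) * (M' * P') = 1\<^sub>m n" using 1 2 by (intro prod) auto
    show "(M' * P') * (P * M) = 1\<^sub>m n" using 1 2 by (intro prod) auto
    show "(N * Q) * (Q' * N') = 1\<^sub>m n" using 1 2 by (intro prod) auto
    show "(Q' * N') * (N * Q) = 1\<^sub>m n" using 1 2 by (intro prod) auto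
    show "P * M * E * (N * Q) = E''" using conj[OF E] 1 2 by simp
    show "P * M * A * (N * Q) = A''" using conj[OF A] 1 2 by simp
  qed (use 1(1-4) 2(1-4) in auto)
qed

lemma pow_mat_commute:
  fixes K U :: "'a :: semiring_1 mat"
  assumes K: "K \<in> carrier_mat n n" and U: "U \<in> carrier_mat n n" and c: "U * K = K * U"
  shows "(U * K) ^\<^sub>m k = U ^\<^sub>m k * K ^\<^sub>m k"
proof -
  have Kk: "K ^\<^sub>m j \<in> carrier_mat n n" "U ^\<^sub>m j \<in> carrier_mat n n" for j using K U by auto
  have comm: "K ^\<^sub>m j * U = U * K ^\<^sub>m j" for j
  proof (induction j)
    case (Suc j)
    have "K ^\<^sub>m Suc j * U = K ^\<^sub>m j * (U * K)" unfolding c using Kk K U by (simp add: assoc_mult_mat[of _ n n _ n _ n] mult_carrier_mat[of _ n n _ n])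
    also have "\<dots> = (K ^\<^sub>m j * U) * K" using Kk K U by (simp add: assoc_mult_mat[of _ n n _ n _ n] mult_carrier_mat[of _ n n _ n])
    also have "\<dots> = U * (K ^\<^sub>m j * K)" unfolding Suc using Kk K U by (simp add: assoc_mult_mat[of _ n n _ n _ n] mult_carrier_mat[of _ n n _ n])
    finally show ?case by simp
  qed (use K U in simp)
  show ?thesis
  proof (induction k)
    case (Suc k)
    have "(U * K) ^\<^sub>m Suc k = U ^\<^sub>m k * (K ^\<^sub>m k * U) * K"
      using Suc Kk K U by (simp add: assoc_mult_mat[of _ n n _ n _ n] mult_carrier_mat[of _ n n _ n])
    also have "\<dots> = (U ^\<^sub>m k * U) * (K ^\<^sub>m k * K)"
      unfolding comm using Kk K U by (simp add: assoc_mult_mat[of _ n n _ n _ n] mult_carrier_mat[of _ n n _ n])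
    finally show ?case by simp
  qed (use K U in simp)
qed

lemma smult_mat_mult_vec: "dim_vec v = dim_col K \<Longrightarrow> (c \<cdot>\<^sub>m K) *\<^sub>v v = c \<cdot>\<^sub>v (K *\<^sub>v (v :: 'a :: comm_semiring_1 vec))"
  by (intro eq_vecI) (auto simp: scalar_prod_def sum_distrib_left ac_simps)

lemma smult_zero_vec: "c \<cdot>\<^sub>v 0\<^sub>v n = (0\<^sub>v n :: 'a :: semiring_0 vec)"
  by (intro eq_vecI) auto

text \<open>A null vector satisfies c K v = v, hence c^k K^k v = v for every k, and the left side is
  0 for k = q.\<close>

lemma det_nilpotent_minus_one:
  fixes K :: "'a :: field mat"
  assumes K: "K \<in> carrier_mat n n" and q: "K ^\<^sub>m q = 0\<^sub>m n n"
  shows "det (c \<cdot>\<^sub>m K - 1\<^sub>m n) \<noteq> 0"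
proof (rule det_nonzeroI)
  show "c \<cdot>\<^sub>m K - 1\<^sub>m n \<in> carrier_mat n n" using K by auto
  fix v assume v: "v \<in> carrier_vec n" "(c \<cdot>\<^sub>m K - 1\<^sub>m n) *\<^sub>v v = 0\<^sub>v n"
  have e: "c \<cdot>\<^sub>v (K *\<^sub>v v) = v"
  proof (rule eq_vecI)
    fix i assume i: "i < dim_vec v"
    have "((c \<cdot>\<^sub>m K - 1\<^sub>m n) *\<^sub>v v) $ i = (c \<cdot>\<^sub>v (K *\<^sub>v v)) $ i - v $ i"
      using i v(1) K by (simp add: minus_mult_distrib_mat_vec[of _ n n] smult_mat_mult_vec)
    then show "(c \<cdot>\<^sub>v (K *\<^sub>v v)) $ i = v $ i" using v i by simp
  qed (use K v in auto)
  have "c ^ k \<cdot>\<^sub>v (K ^\<^sub>m k *\<^sub>v v) = v" for k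
  proof (induction k)
    case (Suc k)
    have "c ^ Suc k \<cdot>\<^sub>v (K ^\<^sub>m Suc k *\<^sub>v v) = c ^ k \<cdot>\<^sub>v (c \<cdot>\<^sub>v (K ^\<^sub>m k *\<^sub>v (K *\<^sub>v v)))"
      using K v by (simp add: assoc_mult_mat_vec[of _ n n _ n] smult_smult_assoc mult.commute)
    also have "c \<cdot>\<^sub>v (K ^\<^sub>m k *\<^sub>v (K *\<^sub>v v)) = K ^\<^sub>m k *\<^sub>v (c \<cdot>\<^sub>v (K *\<^sub>v v))"
      using K v by (intro mult_mat_vec[symmetric]) auto
    finally show ?case unfolding e Suc .
  qed (use K v in simp)
  from this[of q] show "v = 0\<^sub>v n" unfolding q using v by (simp add: zero_mat_mult_vec smult_zero_vec)
qed

text \<open>With \<open>R\<close> the inverse of c E - A, the pencil becomes K = R E and R A = c K -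
  1, two polynomials in one matrix. Fitting's decomposition of \<open>K\<close> splits both at once.
  On one block \<open>K1\<close> is inverted, on the other c K2 - 1, which is invertible because
  \<open>K2\<close> is nilpotent.\<close>

lemma weierstrass:
  fixes E A :: "real mat"
  assumes E: "E \<in> carrier_mat n n" and A: "A \<in> carrier_mat n n" and d: "det (c \<cdot>\<^sub>m E - A) \<noteq> 0"
  shows "\<exists>h A1 ms q. h \<le> n \<and> A1 \<in> carrier_mat h h \<and> (\<forall>k\<in>set ms. 0 < k) \<and> sum_list ms = n - h \<and>
    diag_block_mat (map (\<lambda>k. jordan_block k (0 :: real)) ms) ^\<^sub>m q = 0\<^sub>m (n - h) (n - h) \<and>
    pencil_equiv n E A (diag2 (1\<^sub>m h) (diag_block_mat (map (\<lambda>k. jordan_block k (0 :: real)) ms))) (diag2 A1 (1\<^sub>m (n - h)))"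
proof -
  note assoc = assoc_mult_mat[of _ n n _ n _ n] and mc = mult_carrier_mat[of _ n n _ n]
  have S: "c \<cdot>\<^sub>m E - A \<in> carrier_mat n n" using E A by auto
  obtain R where R: "R \<in> carrier_mat n n" "(c \<cdot>\<^sub>m E - A) * R = 1\<^sub>m n" "R * (c \<cdot>\<^sub>m E - A) = 1\<^sub>m n"
    using mat_inverse_exists[OF S d] by blast
  define K where "K = R * E"
  have K: "K \<in> carrier_mat n n" using R E by (auto simp: K_def)
  have RA: "R * A = c \<cdot>\<^sub>m K - 1\<^sub>m n"
  proof -
    have "c \<cdot>\<^sub>m K - R * A = 1\<^sub>m n"
      using R(3) unfolding K_def using R(1) E A
      by (simp add: mult_minus_distrib_mat[of _ n n _ n] mult_smult_distrib[of _ n n _ n])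
    then have "1\<^sub>m n = c \<cdot>\<^sub>m K - R * A" by simp
    moreover have "R * A \<in> carrier_mat n n" using R A by auto
    ultimately show ?thesis using K by (intro eq_matI) auto
  qed
  have e1: "pencil_equiv n E A K (c \<cdot>\<^sub>m K - 1\<^sub>m n)"
    unfolding pencil_equiv_def
    by (rule exI[of _ R], rule exI[of _ "c \<cdot>\<^sub>m E - A"], rule exI[of _ "1\<^sub>m n"], rule exI[of _ "1\<^sub>m n"])
       (use R S K RA K_def[symmetric] in simp)
  obtain a b K2 K1 q where ab: "a + b = n" "K2 \<in> carrier_mat a a" "K1 \<in> carrier_mat b b"
      "K2 ^\<^sub>m q = 0\<^sub>m a a" "det K1 \<noteq> 0" "similar_mat K (diag2 K2 K1)"
    using fitting[OF K] by blast
  have na: "n - b = a" "b + a = n" using ab(1) by auto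
  \<comment> \<open>The swap puts the invertible part first, where the canonical form has its
    identity block.\<close>
  from similar_mat_trans[OF ab(6) similar_mat_swap[OF ab(2,3)]] have "similar_mat K (diag2 K1 K2)" .
  from similar_matE[OF this K] obtain P T where PT: "P \<in> carrier_mat n n" "T \<in> carrier_mat n n"
      "diag2 K1 K2 \<in> carrier_mat n n" "P * T = 1\<^sub>m n" "T * P = 1\<^sub>m n" "K = P * diag2 K1 K2 * T" by blast
  have TKP: "T * K * P = diag2 K1 K2"
  proof -
    have "T * K * P = (T * P) * diag2 K1 K2 * (T * P)"
      unfolding PT(6) using PT(1-3) by (simp add: assoc mc)
    then show ?thesis unfolding PT(5) using left_mult_one_mat[OF PT(3)] right_mult_one_mat[OF PT(3)] by simp
  qed
  define L1 where "L1 = c \<cdot>\<^sub>m K1 - 1\<^sub>m b"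
  define L2 where "L2 = c \<cdot>\<^sub>m K2 - 1\<^sub>m a"
  have L: "L1 \<in> carrier_mat b b" "L2 \<in> carrier_mat a a" unfolding L1_def L2_def using ab by auto
  have "T * (c \<cdot>\<^sub>m K - 1\<^sub>m n) * P = c \<cdot>\<^sub>m (T * K * P) - 1\<^sub>m n"
    using PT(1,2,5) K
    by (simp add: mult_minus_distrib_mat[of _ n n _ n] minus_mult_distrib_mat[of _ n n _ _ n] mult_smult_distrib[of _ n n _ n] mult_smult_assoc_mat[of _ n n _ n] mc)
  also have "\<dots> = diag2 L1 L2"
    unfolding TKP L1_def L2_def using ab(2,3) na(2) by (intro eq_matI) auto
  finally have TLP: "T * (c \<cdot>\<^sub>m K - 1\<^sub>m n) * P = diag2 L1 L2" .
  have e2: "pencil_equiv n K (c \<cdot>\<^sub>m K - 1\<^sub>m n) (diag2 K1 K2) (diag2 L1 L2)"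
    unfolding pencil_equiv_def
    by (rule exI[of _ T], rule exI[of _ P], rule exI[of _ P], rule exI[of _ T]) (use PT(1,2,4,5) TKP TLP in simp)
  obtain V where V: "V \<in> carrier_mat b b" "K1 * V = 1\<^sub>m b" "V * K1 = 1\<^sub>m b" using mat_inverse_exists[OF ab(3,5)] by blast
  have "det L2 \<noteq> 0" unfolding L2_def by (rule det_nilpotent_minus_one[OF ab(2,4)])
  then obtain U where U: "U \<in> carrier_mat a a" "L2 * U = 1\<^sub>m a" "U * L2 = 1\<^sub>m a" using mat_inverse_exists[OF L(2)] by blast
  define X where "X = U * K2"
  define A1 where "A1 = V * L1"
  have X: "X \<in> carrier_mat a a" and A1: "A1 \<in> carrier_mat b b" using U V L ab by (auto simp: X_def A1_def)
  have e3: "pencil_equiv n (diag2 K1 K2) (diag2 L1 L2) (diag2 (1\<^sub>m b) X) (diag2 A1 (1\<^sub>m a))"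
    unfolding pencil_equiv_def
  proof (intro exI conjI)
    show "diag2 V U * diag2 K1 L2 = 1\<^sub>m n" using diag2_mult[OF V(1) ab(3) U(1) L(2)] V U na by simp
    show "diag2 K1 L2 * diag2 V U = 1\<^sub>m n" using diag2_mult[OF ab(3) V(1) L(2) U(1)] V U na by simp
    show "diag2 V U * diag2 K1 K2 * 1\<^sub>m n = diag2 (1\<^sub>m b) X"
      using diag2_mult[OF V(1) ab(3) U(1) ab(2)] V(1,3) U(1) ab(2,3) X na by (simp add: X_def)
    show "diag2 V U * diag2 L1 L2 * 1\<^sub>m n = diag2 A1 (1\<^sub>m a)"
      using diag2_mult[OF V(1) L(1) U(1) L(2)] V(1) U(1,3) L A1 na by (simp add: A1_def)
    show "diag2 V U \<in> carrier_mat n n" "diag2 K1 L2 \<in> carrier_mat n n"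
      using diag2_carrier[OF V(1) U(1)] diag2_carrier[OF ab(3) L(2)] na by simp_all
    show "1\<^sub>m n * 1\<^sub>m n = (1\<^sub>m n :: real mat)" "1\<^sub>m n * 1\<^sub>m n = (1\<^sub>m n :: real mat)" by simp_all
  qed simp_all
  \<comment> \<open>\<open>U\<close> is the inverse of a polynomial in \<open>K2\<close> and so
    commutes with it; hence \<open>X\<close> inherits nilpotency.\<close>
  have Xq: "X ^\<^sub>m q = 0\<^sub>m a a"
  proof -
    have KL: "K2 * L2 = L2 * K2"
      unfolding L2_def using ab(2)
      by (simp add: mult_minus_distrib_mat[of _ a a _ a] minus_mult_distrib_mat[of _ a a _ _ a] mult_smult_distrib[of _ a a _ a] mult_smult_assoc_mat[of _ a a _ a] mult_carrier_mat[of _ a a _ a])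
    note assoc' = assoc_mult_mat[of _ a a _ a _ a] and mc' = mult_carrier_mat[of _ a a _ a]
    have "U * K2 = U * (K2 * (L2 * U))" unfolding U(2) using U(1) ab(2) by simp
    also have "\<dots> = U * (K2 * L2) * U" using U(1) ab(2) L(2) by (simp add: assoc' mc')
    also have "\<dots> = (U * L2) * (K2 * U)" unfolding KL using U(1) ab(2) L(2) by (simp add: assoc' mc')
    also have "\<dots> = K2 * U" unfolding U(3) by (rule left_mult_one_mat[OF mc'[OF ab(2) U(1)]])
    finally have "X ^\<^sub>m q = U ^\<^sub>m q * K2 ^\<^sub>m q" unfolding X_def by (rule pow_mat_commute[OF ab(2) U(1)])
    then show ?thesis unfolding ab(4) using U(1) by simp
  qed
  from nilpotent_jordan[OF X Xq] obtain ms where ms: "\<forall>k\<in>set ms. 0 < k" "sum_list ms = a"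
    "similar_mat X (diag_block_mat (map (\<lambda>k. jordan_block k 0) ms))" by auto
  let ?G = "diag_block_mat (map (\<lambda>k. jordan_block k (0 :: real)) ms)"
  from similar_matE[OF ms(3) X] obtain P' T' where PT': "P' \<in> carrier_mat a a" "T' \<in> carrier_mat a a"
      "?G \<in> carrier_mat a a" "P' * T' = 1\<^sub>m a" "T' * P' = 1\<^sub>m a" "X = P' * ?G * T'" by blast
  have TXP: "T' * X * P' = ?G"
  proof -
    have "T' * X * P' = (T' * P') * ?G * (T' * P')"
      unfolding PT'(6) using PT'(1-3) by (simp add: assoc_mult_mat[of _ a a _ a _ a] mult_carrier_mat[of _ a a _ a])
    then show ?thesis unfolding PT'(5) using left_mult_one_mat[OF PT'(3)] right_mult_one_mat[OF PT'(3)] by simp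
  qed
  have Gq: "?G ^\<^sub>m q = 0\<^sub>m a a"
  proof -
    obtain S T where ST: "similar_mat_wit ?G X S T"
      using similar_mat_sym[OF ms(3)] unfolding similar_mat_def by blast
    from similar_mat_witD2[OF PT'(3) this] have ST': "S \<in> carrier_mat a a" "T \<in> carrier_mat a a" by auto
    have "similar_mat_wit (?G ^\<^sub>m q) (X ^\<^sub>m q) S T" by (rule similar_mat_wit_pow[OF ST])
    from similar_mat_witD2[OF _ this, of a a] PT'(3) have "?G ^\<^sub>m q = S * X ^\<^sub>m q * T" by simp
    then show ?thesis unfolding Xq using ST' by simp
  qed
  have one: "(1\<^sub>m b :: real mat) \<in> carrier_mat b b" "(1\<^sub>m a :: real mat) \<in> carrier_mat a a" by auto
  have e4: "pencil_equiv n (diag2 (1\<^sub>m b) X) (diag2 A1 (1\<^sub>m a)) (diag2 (1\<^sub>m b) ?G) (diag2 A1 (1\<^sub>m a))"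
    unfolding pencil_equiv_def
  proof (intro exI conjI)
    show 1: "diag2 (1\<^sub>m b) T' * diag2 (1\<^sub>m b) P' = 1\<^sub>m n" using diag2_mult[OF one(1) one(1) PT'(2,1)] PT'(5) na by simp
    show 2: "diag2 (1\<^sub>m b) P' * diag2 (1\<^sub>m b) T' = 1\<^sub>m n" using diag2_mult[OF one(1) one(1) PT'(1,2)] PT'(4) na by simp
    show "diag2 (1\<^sub>m b) P' * diag2 (1\<^sub>m b) T' = 1\<^sub>m n" "diag2 (1\<^sub>m b) T' * diag2 (1\<^sub>m b) P' = 1\<^sub>m n" by (rule 2, rule 1)
    have TX: "T' * X \<in> carrier_mat a a" using PT' X by auto
    show "diag2 (1\<^sub>m b) T' * diag2 (1\<^sub>m b) X * diag2 (1\<^sub>m b) P' = diag2 (1\<^sub>m b) ?G"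
      unfolding diag2_mult[OF one(1) one(1) PT'(2) X] diag2_mult[OF mult_carrier_mat[OF one(1) one(1)] one(1) TX PT'(1)] TXP by simp
    show "diag2 (1\<^sub>m b) T' * diag2 A1 (1\<^sub>m a) * diag2 (1\<^sub>m b) P' = diag2 A1 (1\<^sub>m a)"
      unfolding diag2_mult[OF one(1) A1 PT'(2) one(2)]
        diag2_mult[OF mult_carrier_mat[OF one(1) A1] one(1) mult_carrier_mat[OF PT'(2) one(2)] PT'(1)]
      using A1 PT'(1,2,5) by simp
    show "diag2 (1\<^sub>m b) T' \<in> carrier_mat n n" "diag2 (1\<^sub>m b) P' \<in> carrier_mat n n"
         "diag2 (1\<^sub>m b) P' \<in> carrier_mat n n" "diag2 (1\<^sub>m b) T' \<in> carrier_mat n n"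
      using diag2_carrier[OF one(1) PT'(1)] diag2_carrier[OF one(1) PT'(2)] na by simp_all
  qed
  have D: "diag2 L1 L2 \<in> carrier_mat n n" "diag2 (1\<^sub>m b) X \<in> carrier_mat n n" "diag2 A1 (1\<^sub>m a) \<in> carrier_mat n n"
    using diag2_carrier[OF L] diag2_carrier[OF one(1) X] diag2_carrier[OF A1 one(2)] na by simp_all
  have cK: "c \<cdot>\<^sub>m K - 1\<^sub>m n \<in> carrier_mat n n" by auto
  have eqv: "pencil_equiv n E A (diag2 (1\<^sub>m b) ?G) (diag2 A1 (1\<^sub>m a))"
    using pencil_equiv_trans[OF e1 pencil_equiv_trans[OF e2 pencil_equiv_trans[OF e3 e4 PT(3) D(1)] K cK] E A] .
  have "b \<le> n" using na by simp
  show ?thesis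
    by (rule exI[of _ b], rule exI[of _ A1], rule exI[of _ ms], rule exI[of _ q])
       (unfold na(1), intro conjI A1 ms(1,2) Gq eqv \<open>b \<le> n\<close>)
qed

text \<open>The determinant of x E - A is a polynomial with only zero values, hence the zero
  polynomial, so there is a null vector with polynomial entries. Comparing the coefficients of x^k
  gives the chain.\<close>

lemma pencil_cases:
  fixes E A :: "real mat"
  assumes E: "E \<in> carrier_mat n n" and A: "A \<in> carrier_mat n n" and sing: "\<And>c. det (c \<cdot>\<^sub>m E - A) = 0"
  shows "\<exists>p d. (\<forall>k. p k \<in> carrier_vec n) \<and> A *\<^sub>v p 0 = 0\<^sub>v n \<and> (\<forall>k. E *\<^sub>v p k = A *\<^sub>v p (Suc k)) \<and>
    (\<forall>k>d. p k = 0\<^sub>v n) \<and> (\<exists>k. p k \<noteq> 0\<^sub>v n)"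
proof -
  define Q where "Q = mat n n (\<lambda>(i, j). [:- A $$ (i, j), E $$ (i, j):])"
  have Q: "Q \<in> carrier_mat n n" by (simp add: Q_def)
  have "poly (det Q) c = 0" for c
  proof -
    have "map_mat (\<lambda>p. poly p c) Q = c \<cdot>\<^sub>m E - A" using E A by (intro eq_matI) (auto simp: Q_def)
    moreover have "poly (det Q) c = det (map_mat (\<lambda>p. poly p c) Q)" by (rule comm_ring_hom.hom_det[OF poly_hom.comm_ring_hom_axioms, symmetric])
    ultimately show ?thesis using sing by simp
  qed
  then have "det Q = 0" using poly_all_0_iff_0 by blast
  then obtain v where v: "v \<in> carrier_vec n" "v \<noteq> 0\<^sub>v n" "Q *\<^sub>v v = 0\<^sub>v n"
    using det_0_iff_vec_prod_zero[OF Q] by auto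
  define p where "p k = vec n (\<lambda>j. coeff (v $ j) k)" for k
  have row: "(\<Sum>j<n. - A $$ (i, j) * coeff (v $ j) k + (if k = 0 then 0 else E $$ (i, j) * coeff (v $ j) (k - 1))) = 0" if i: "i < n" for i k
  proof -
    have "0 = coeff ((Q *\<^sub>v v) $ i) k" unfolding v(3) using i by simp
    also have "\<dots> = coeff (\<Sum>j<n. [:- A $$ (i, j), E $$ (i, j):] * v $ j) k"
      using i v(1) Q by (simp add: Q_def scalar_prod_def lessThan_atLeast0)
    also have "\<dots> = (\<Sum>j<n. - A $$ (i, j) * coeff (v $ j) k + (if k = 0 then 0 else E $$ (i, j) * coeff (v $ j) (k - 1)))"
      unfolding coeff_sum by (intro sum.cong) (auto simp: coeff_pCons split: nat.splits)
    finally show ?thesis by simp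
  qed
  have mv: "(X *\<^sub>v p k) $ i = (\<Sum>j<n. X $$ (i, j) * coeff (v $ j) k)" if "X \<in> carrier_mat n n" "i < n" for X k i
    using that by (simp add: p_def scalar_prod_def lessThan_atLeast0)
  have "A *\<^sub>v p 0 = 0\<^sub>v n"
    using row[of _ 0] A by (intro eq_vecI) (auto simp: mv[OF A] sum_negf simp del: index_mult_mat_vec)
  moreover have "E *\<^sub>v p k = A *\<^sub>v p (Suc k)" for k
  proof (rule eq_vecI)
    fix i assume "i < dim_vec (A *\<^sub>v p (Suc k))"
    then have i: "i < n" using A by simp
    from row[OF i, of "Suc k"] show "(E *\<^sub>v p k) $ i = (A *\<^sub>v p (Suc k)) $ i"
      unfolding mv[OF E i] mv[OF A i] by (simp add: sum.distrib sum_negf sum_subtractf)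
  qed (use E A in simp)
  moreover have "\<exists>d. \<forall>k>d. p k = 0\<^sub>v n"
  proof (intro exI allI impI eq_vecI)
    fix k i assume k: "(\<Sum>j<n. degree (v $ j)) < k" and "i < dim_vec (0\<^sub>v n :: real vec)"
    then have i: "i < n" by simp
    have "degree (v $ i) \<le> (\<Sum>j<n. degree (v $ j))" using i by (intro member_le_sum) auto
    then show "p k $ i = 0\<^sub>v n $ i" using i k by (simp add: p_def coeff_eq_0)
  qed (simp add: p_def)
  moreover have "\<exists>k. p k \<noteq> 0\<^sub>v n"
  proof (rule ccontr)
    assume "\<not> ?thesis"
    then have z: "p k $ i = 0" if "i < n" for k i using that by simp
    have "v = 0\<^sub>v n"
      using v(1) z by (intro eq_vecI poly_eqI) (auto simp: p_def)
    with v(2) show False by simp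
  qed
  moreover have "\<forall>k. p k \<in> carrier_vec n" by (simp add: p_def)
  ultimately show ?thesis by blast
qed

text \<open>\<open>g i\<close> says that row i is not the last one of its block. This predicate
  replaces the block structure wherever rows are treated one at a time.\<close>

lemma jordan_entries:
  "\<exists>g. \<forall>i<sum_list ms. \<forall>j<sum_list ms. diag_block_mat (map (\<lambda>k. jordan_block k (0 :: 'a :: {zero, one})) ms) $$ (i, j) = (if j = Suc i \<and> g i then 1 else 0)"
proof (induction ms)
  case (Cons k ms)
  let ?G = "\<lambda>ms. diag_block_mat (map (\<lambda>k. jordan_block k (0 :: 'a)) ms)"
  have dim: "dim_row (?G ms) = sum_list ms" "dim_col (?G ms) = sum_list ms"
    by (auto simp: dim_diag_block_mat o_def)
  from Cons obtain g where g: "?G ms $$ (i, j) = (if j = Suc i \<and> g i then 1 else 0)" if "i < sum_list ms" "j < sum_list ms" for i j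
    by blast
  show ?case
  proof (intro exI allI impI)
    fix i j assume "i < sum_list (k # ms)" "j < sum_list (k # ms)"
    then show "?G (k # ms) $$ (i, j) = (if j = Suc i \<and> (if i < k then Suc i < k else g (i - k)) then 1 else 0)"
      using g[of "i - k" "j - k"] by (auto simp: Let_def dim)
  qed
qed simp

lemma append_rows_index:
  assumes "A \<in> carrier_mat a r" "B \<in> carrier_mat b r" "i < a + b" "j < r"
  shows "(A @\<^sub>r B) $$ (i, j) = (if i < a then A $$ (i, j) else B $$ (i - a, j))"
  using assms by (auto simp: append_rows_def)

lemma append_rows_split:
  assumes "X \<in> carrier_mat (a + b) r"
  shows "\<exists>A B. A \<in> carrier_mat a r \<and> B \<in> carrier_mat b r \<and> X = A @\<^sub>r B"
proof (intro exI conjI)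
  show "X = mat a r (\<lambda>(i, j). X $$ (i, j)) @\<^sub>r mat b r (\<lambda>(i, j). X $$ (a + i, j))"
    using assms by (intro eq_matI) (auto simp: append_rows_def)
qed auto

lemma append_rows_eq_iff:
  assumes "A \<in> carrier_mat a r" "A' \<in> carrier_mat a r" "B \<in> carrier_mat b r" "B' \<in> carrier_mat b r"
  shows "A @\<^sub>r B = A' @\<^sub>r B' \<longleftrightarrow> A = A' \<and> B = B'"
proof
  assume eq: "A @\<^sub>r B = A' @\<^sub>r B'"
  have "A $$ (i, j) = A' $$ (i, j)" if "i < a" "j < r" for i j
    using append_rows_index[OF assms(1,3), of i j] append_rows_index[OF assms(2,4), of i j] that eq by simp
  moreover have "B $$ (i, j) = B' $$ (i, j)" if "i < b" "j < r" for i j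
    using append_rows_index[OF assms(1,3), of "a + i" j] append_rows_index[OF assms(2,4), of "a + i" j] that eq by simp
  ultimately show "A = A' \<and> B = B'" using assms by (auto intro!: eq_matI)
qed simp

lemma diag_block_mult_append_rows:
  fixes A :: "'a :: semiring_1 mat"
  assumes "A \<in> carrier_mat a a" "D \<in> carrier_mat b b" "X \<in> carrier_mat a r" "Y \<in> carrier_mat b r"
  shows "diag2 A D * (X @\<^sub>r Y) = (A * X) @\<^sub>r (D * Y)"
  unfolding append_rows_def using assms
  by (subst mult_four_block_mat[of _ a a _ b _ b _ _ r _ 0]) (auto intro!: cong_four_block_mat)

text \<open>Multiplication by a nilpotent block shifts the rows up by one and loses the first, so
  nothing is said about that row and all others must vanish.\<close>

lemma jordan_block_mult_eq_0_iff:
  fixes X :: "'a :: semiring_1 mat"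
  assumes X: "X \<in> carrier_mat k r" and k: "0 < k"
  shows "jordan_block k 0 * X = 0\<^sub>m k r \<longleftrightarrow> (\<exists>b\<in>carrier_mat 1 r. X = first_row_mat k b)"
proof -
  have ent: "(jordan_block k 0 * X) $$ (i, j) = (if Suc i < k then X $$ (Suc i, j) else 0)" if ij: "i < k" "j < r" for i j
  proof -
    have "(jordan_block k 0 * X) $$ (i, j) = (\<Sum>l<k. (if l = Suc i then 1 else 0) * X $$ (l, j))"
      using ij X by (auto simp: scalar_prod_def lessThan_atLeast0 intro!: sum.cong)
    also have "\<dots> = (\<Sum>l<k. if l = Suc i then X $$ (l, j) else 0)" by (intro sum.cong) auto
    finally show ?thesis by simp
  qed
  show ?thesis
  proof
    assume eq: "jordan_block k 0 * X = 0\<^sub>m k r"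
    have "X $$ (Suc i, j) = 0" if "Suc i < k" "j < r" for i j using ent[of i j] that unfolding eq by simp
    then have z: "X $$ (i, j) = 0" if "i < k" "j < r" "i \<noteq> 0" for i j using that by (cases i) auto
    have "X = first_row_mat k (mat 1 r (\<lambda>(i, j). X $$ (0, j)))"
      using X z by (intro eq_matI) (auto simp: first_row_mat_def)
    then show "\<exists>b\<in>carrier_mat 1 r. X = first_row_mat k b" by (intro bexI) auto
  next
    assume "\<exists>b\<in>carrier_mat 1 r. X = first_row_mat k b"
    then obtain b where b: "b \<in> carrier_mat 1 r" "X = first_row_mat k b" by auto
    show "jordan_block k 0 * X = 0\<^sub>m k r"
    proof (rule eq_matI)
      fix i j assume "i < dim_row (0\<^sub>m k r)" "j < dim_col (0\<^sub>m k r)"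
      then show "(jordan_block k 0 * X) $$ (i, j) = 0\<^sub>m k r $$ (i, j)"
        using ent[of i j] b by (simp add: first_row_mat_def del: index_mult_mat)
    qed (use X in auto)
  qed
qed

lemma stack_rows_Cons: "stack_rows r (A # As) = A @\<^sub>r stack_rows r As"
  by (simp add: stack_rows_def)

lemma first_row_carrier: "b \<in> carrier_mat 1 r \<Longrightarrow> first_row_mat k b \<in> carrier_mat k r"
  by (simp add: first_row_mat_def)

lemma stack_rows_carrier:
  assumes "length bs = length ms" "\<forall>b\<in>set bs. b \<in> carrier_mat 1 r"
  shows "stack_rows r (map2 first_row_mat ms bs) \<in> carrier_mat (sum_list ms) r"
  using assms
proof (induction ms bs rule: list_induct2')
  case (4 k ms b bs)
  then show ?case by (auto simp: stack_rows_Cons intro!: carrier_append_rows first_row_carrier)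
qed (auto simp: stack_rows_def)

text \<open>Turns the shape required of \<open>B2\<close> into the equation G B2 = 0, the form in
  which the stochastic argument meets it.\<close>

lemma jordan_mult_eq_0_iff:
  fixes X :: "'a :: semiring_1 mat"
  assumes "X \<in> carrier_mat (sum_list ms) r" "\<forall>k\<in>set ms. 0 < k"
  shows "diag_block_mat (map (\<lambda>k. jordan_block k 0) ms) * X = 0\<^sub>m (sum_list ms) r \<longleftrightarrow>
    (\<exists>bs. length bs = length ms \<and> (\<forall>b\<in>set bs. b \<in> carrier_mat 1 r) \<and> X = stack_rows r (map2 first_row_mat ms bs))"
  using assms
proof (induction ms arbitrary: X)
  case Nil
  then have "X = 0\<^sub>m 0 r" by auto
  then show ?case by (auto simp: stack_rows_def intro!: eq_matI)
next
  case (Cons k ms)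
  let ?G = "\<lambda>ms. diag_block_mat (map (\<lambda>k. jordan_block k (0 :: 'a)) ms)"
  have G: "?G ms \<in> carrier_mat (sum_list ms) (sum_list ms)"
    by (auto simp: dim_diag_block_mat o_def intro!: carrier_matI)
  from Cons(2) have "X \<in> carrier_mat (k + sum_list ms) r" by simp
  then obtain Y Z where YZ: "Y \<in> carrier_mat k r" "Z \<in> carrier_mat (sum_list ms) r" "X = Y @\<^sub>r Z"
    using append_rows_split by blast
  have J: "jordan_block k (0 :: 'a) \<in> carrier_mat k k" by simp
  have JY: "jordan_block k 0 * Y \<in> carrier_mat k r" "?G ms * Z \<in> carrier_mat (sum_list ms) r"
    using mult_carrier_mat[OF J YZ(1)] mult_carrier_mat[OF G YZ(2)] by auto
  have prod: "?G (k # ms) * X = (jordan_block k 0 * Y) @\<^sub>r (?G ms * Z)"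
    unfolding YZ(3) using diag_block_mult_append_rows[OF J G YZ(1,2)] by (simp add: Let_def)
  have zero: "0\<^sub>m (sum_list (k # ms)) r = (0\<^sub>m k r @\<^sub>r 0\<^sub>m (sum_list ms) r :: 'a mat)"
    by (auto simp: append_rows_def intro!: eq_matI)
  have "?G (k # ms) * X = 0\<^sub>m (sum_list (k # ms)) r \<longleftrightarrow> jordan_block k 0 * Y = 0\<^sub>m k r \<and> ?G ms * Z = 0\<^sub>m (sum_list ms) r"
    unfolding prod zero by (rule append_rows_eq_iff[OF JY(1) zero_carrier_mat JY(2) zero_carrier_mat])
  also have "\<dots> \<longleftrightarrow> (\<exists>b\<in>carrier_mat 1 r. Y = first_row_mat k b) \<and>
      (\<exists>bs. length bs = length ms \<and> (\<forall>b\<in>set bs. b \<in> carrier_mat 1 r) \<and> Z = stack_rows r (map2 first_row_mat ms bs))"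
    using Cons(3) by (intro conj_cong jordan_block_mult_eq_0_iff Cons(1) YZ) auto
  also have "\<dots> \<longleftrightarrow> (\<exists>bs. length bs = length (k # ms) \<and> (\<forall>b\<in>set bs. b \<in> carrier_mat 1 r) \<and> X = stack_rows r (map2 first_row_mat (k # ms) bs))"
  proof safe
    fix b and bs :: "'a mat list" assume "b \<in> carrier_mat 1 r" "length bs = length ms" "\<forall>b\<in>set bs. b \<in> carrier_mat 1 r"
      "Y = first_row_mat k b" "Z = stack_rows r (map2 first_row_mat ms bs)"
    then show "\<exists>bs. length bs = length (k # ms) \<and> (\<forall>b\<in>set bs. b \<in> carrier_mat 1 r) \<and> X = stack_rows r (map2 first_row_mat (k # ms) bs)"
      using YZ(3) by (intro exI[of _ "b # bs"]) (auto simp: stack_rows_Cons)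
  next
    fix bs assume bs: "length bs = length (k # ms)" "\<forall>b\<in>set bs. b \<in> carrier_mat 1 r" "X = stack_rows r (map2 first_row_mat (k # ms) bs)"
    then obtain b cs where b: "bs = b # cs" by (cases bs) auto
    have "Y @\<^sub>r Z = first_row_mat k b @\<^sub>r stack_rows r (map2 first_row_mat ms cs)"
      using bs(3) unfolding YZ(3) b by (simp add: stack_rows_Cons)
    moreover have "first_row_mat k b \<in> carrier_mat k r" "stack_rows r (map2 first_row_mat ms cs) \<in> carrier_mat (sum_list ms) r"
      using bs b first_row_carrier stack_rows_carrier[of cs ms r] by auto
    ultimately have "Y = first_row_mat k b" "Z = stack_rows r (map2 first_row_mat ms cs)"
      using append_rows_eq_iff[of Y k r _ Z "sum_list ms"] YZ by auto
    then show "\<exists>b\<in>carrier_mat 1 r. Y = first_row_mat k b" "\<exists>bs. length bs = length ms \<and> (\<forall>b\<in>set bs. b \<in> carrier_mat 1 r) \<and> Z = stack_rows r (map2 first_row_mat ms bs)"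
      using bs b by auto
  qed
  finally show ?case .
qed

lemma diag_block_mat_pair:
  fixes A D :: "'a :: zero mat"
  assumes "A \<in> carrier_mat a a" "D \<in> carrier_mat b b"
  shows "diag_block_mat [A, D] = diag2 A D"
  using assms by (auto simp: Let_def intro!: eq_matI)

context brownian
begin

section \<open>Solutions in terms of components\<close>

text \<open>The scalar product is a finite sum of squares, so Tonelli reduces finiteness to the
  components.\<close>

lemma L2_adapted_iff:
  "x \<in> L2_adapted P Ft T k \<longleftrightarrow> (\<forall>t\<in>{0..T}. \<forall>\<omega>\<in>space P. x t \<omega> \<in> carrier_vec k) \<and> (\<forall>i<k. (\<lambda>t \<omega>. x t \<omega> $ i) \<in> H T)"
proof -
  have "(\<integral>\<^sup>+\<omega>. (\<integral>\<^sup>+t\<in>{0..T}. ennreal (scalar_prod (x t \<omega>) (x t \<omega>)) \<partial>lborel) \<partial>P) < \<infinity> \<longleftrightarrow> (\<forall>i<k. (\<lambda>t \<omega>. x t \<omega> $ i) \<in> H T)"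
    if c: "\<forall>t\<in>{0..T}. \<forall>\<omega>\<in>space P. x t \<omega> \<in> carrier_vec k" and m: "\<forall>i<k. measurable_adapted P Ft T (\<lambda>t \<omega>. x t \<omega> $ i)"
  proof -
    have cm: "cutoff T (\<lambda>t \<omega>. x t \<omega> $ i) \<in> borel_measurable Q" if "i < k" for i
    proof -
      have "measurable_adapted P Ft T (\<lambda>t \<omega>. x t \<omega> $ i)" using m that by simp
      then show ?thesis unfolding measurable_adapted_def measurable_cut[of "\<lambda>t \<omega>. x t \<omega> $ i" T] by (rule conjunct1)
    qed
    have "(\<integral>\<^sup>+\<omega>. (\<integral>\<^sup>+t\<in>{0..T}. ennreal (scalar_prod (x t \<omega>) (x t \<omega>)) \<partial>lborel) \<partial>P)
      = (\<integral>\<^sup>+\<omega>. (\<integral>\<^sup>+t. (\<Sum>i<k. ennreal ((cutoff T (\<lambda>t \<omega>. x t \<omega> $ i) (t, \<omega>))\<^sup>2)) \<partial>lborel) \<partial>P)"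
    proof (intro nn_integral_cong)
      fix \<omega> t assume w: "\<omega> \<in> space P"
      show "ennreal (scalar_prod (x t \<omega>) (x t \<omega>)) * indicator {0..T} t = (\<Sum>i<k. ennreal ((cutoff T (\<lambda>t \<omega>. x t \<omega> $ i) (t, \<omega>))\<^sup>2))"
      proof (cases "t \<in> {0..T}")
        case True
        then have "dim_vec (x t \<omega>) = k" using c w by auto
        then show ?thesis using True by (simp add: cutoff_def scalar_prod_def sum_ennreal power2_eq_square lessThan_atLeast0)
      next
        case False then show ?thesis by (auto simp: cutoff_def)
      qed
    qed
    also have "\<dots> = (\<integral>\<^sup>+z. (\<Sum>i<k. ennreal ((cutoff T (\<lambda>t \<omega>. x t \<omega> $ i) z)\<^sup>2)) \<partial>Q)"
      using cm by (intro Q.nn_integral_snd borel_measurable_sum measurable_compose[OF borel_measurable_power measurable_ennreal]) auto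
    also have "\<dots> = (\<Sum>i<k. \<integral>\<^sup>+z. ennreal ((cutoff T (\<lambda>t \<omega>. x t \<omega> $ i) z)\<^sup>2) \<partial>Q)"
      using cm by (intro nn_integral_sum measurable_compose[OF borel_measurable_power measurable_ennreal]) auto
    also have "\<dots> < \<infinity> \<longleftrightarrow> (\<forall>i<k. (\<integral>\<^sup>+z. ennreal ((cutoff T (\<lambda>t \<omega>. x t \<omega> $ i) z)\<^sup>2) \<partial>Q) < \<infinity>)"
      unfolding infinity_ennreal_def using ennreal_sum_less_top[of "{..<k}"] by auto
    also have "\<dots> \<longleftrightarrow> (\<forall>i<k. (\<lambda>t \<omega>. x t \<omega> $ i) \<in> H T)"
      using m cm unfolding H_def L2_iff_nn mem_Collect_eq by blast
    finally show ?thesis .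
  qed
  moreover have "(\<lambda>t \<omega>. x t \<omega> $ i) \<in> H T \<Longrightarrow> measurable_adapted P Ft T (\<lambda>t \<omega>. x t \<omega> $ i)" for i
    unfolding H_def by simp
  ultimately show ?thesis unfolding L2_adapted_def mem_Collect_eq by blast
qed

lemma H_mat_vec:
  assumes x: "x \<in> L2_adapted P Ft T k" and X: "X \<in> carrier_mat m k" and i: "i < m"
  shows "(\<lambda>t \<omega>. (X *\<^sub>v x t \<omega>) $ i) \<in> H T"
proof (rule H_cong)
  show "(\<lambda>t \<omega>. \<Sum>j<k. X $$ (i, j) * x t \<omega> $ j) \<in> H T"
    using x unfolding L2_adapted_iff by (auto intro!: H_sum H_cmult)
  show "(\<Sum>j<k. X $$ (i, j) * x t \<omega> $ j) = (X *\<^sub>v x t \<omega>) $ i" if "t \<in> {0..T}" "\<omega> \<in> space P" for t \<omega>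
  proof -
    have "dim_vec (x t \<omega>) = k" using x that unfolding L2_adapted_iff by auto
    then show ?thesis using X i by (simp add: scalar_prod_def lessThan_atLeast0)
  qed
qed

lemma L2_adapted_mat_vec:
  assumes x: "x \<in> L2_adapted P Ft T k" and X: "X \<in> carrier_mat m k"
  shows "(\<lambda>t \<omega>. X *\<^sub>v x t \<omega>) \<in> L2_adapted P Ft T m"
  unfolding L2_adapted_iff
proof (intro conjI ballI allI impI)
  show "X *\<^sub>v x t \<omega> \<in> carrier_vec m" for t \<omega> using X by (intro carrier_vecI) simp
  show "(\<lambda>t \<omega>. (X *\<^sub>v x t \<omega>) $ i) \<in> H T" if "i < m" for i by (rule H_mat_vec[OF assms that])
qed

lemma coeff_H:
  assumes x: "x \<in> L2_adapted P Ft T n" and u: "u \<in> L2_adapted P Ft T r"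
    and A: "A \<in> carrier_mat n n" and B: "B \<in> carrier_mat n r" and i: "i < n"
  shows "(\<lambda>s \<omega>. (A *\<^sub>v x s \<omega> + B *\<^sub>v u s \<omega>) $ i) \<in> H T"
  using H_add[OF H_mat_vec[OF x A i] H_mat_vec[OF u B i]] i A B by (simp del: index_mult_mat_vec)

text \<open>Any two versions of an Ito integral agree almost surely, so the existentially quantified
  \<open>J\<close> may be replaced by the chosen \<open>ito\<close>, and the vector equation by its
  finitely many components.\<close>

lemma is_solution_iff:
  assumes u: "u \<in> L2_adapted P Ft T r" and c: "E \<in> carrier_mat n n" "A \<in> carrier_mat n n" "B \<in> carrier_mat n r" "D \<in> carrier_mat n r" "x0 \<in> carrier_vec n"
  shows "is_solution P Ft W T n E A B D x0 u x \<longleftrightarrow> x \<in> L2_adapted P Ft T n \<and>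
    (\<forall>t\<in>{0..T}. \<forall>i<n. AE \<omega> in P. (E *\<^sub>v x t \<omega>) $ i =
      x0 $ i + stoch t (\<lambda>s \<omega>. (A *\<^sub>v x s \<omega> + B *\<^sub>v u s \<omega>) $ i) (\<lambda>s \<omega>. (A *\<^sub>v x s \<omega> + D *\<^sub>v u s \<omega>) $ i) \<omega>)"
proof -
  let ?f = "\<lambda>i s \<omega>. (A *\<^sub>v x s \<omega> + B *\<^sub>v u s \<omega>) $ i" and ?g = "\<lambda>i s \<omega>. (A *\<^sub>v x s \<omega> + D *\<^sub>v u s \<omega>) $ i"
  have "(\<exists>J. (\<forall>i<n. has_ito_integral P Ft W t (?g i) (J i)) \<and>
        (AE \<omega> in P. E *\<^sub>v x t \<omega> = x0 + vec n (\<lambda>i. LINT s:{0..t}|lborel. ?f i s \<omega>) + vec n (\<lambda>i. J i \<omega>)))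
     \<longleftrightarrow> (\<forall>i<n. AE \<omega> in P. (E *\<^sub>v x t \<omega>) $ i = x0 $ i + stoch t (?f i) (?g i) \<omega>)" (is "?L \<longleftrightarrow> ?R")
    if x: "x \<in> L2_adapted P Ft T n" and t: "t \<in> {0..T}" for t
  proof -
    have g: "?g i \<in> H t" if "i < n" for i
      using H_mono[OF coeff_H[OF x u c(2,4) that]] t by auto
    have t0: "0 \<le> t" using t by simp
    have veq: "E *\<^sub>v x t \<omega> = x0 + vec n (\<lambda>i. LINT s:{0..t}|lborel. ?f i s \<omega>) + vec n (\<lambda>i. J i \<omega>) \<longleftrightarrow>
        (\<forall>i\<in>{..<n}. (E *\<^sub>v x t \<omega>) $ i = x0 $ i + drift t (?f i) \<omega> + J i \<omega>)" for \<omega> J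
    proof -
      have "E *\<^sub>v x t \<omega> = x0 + vec n (\<lambda>i. LINT s:{0..t}|lborel. ?f i s \<omega>) + vec n (\<lambda>i. J i \<omega>) \<longleftrightarrow>
        (\<forall>i<n. (E *\<^sub>v x t \<omega>) $ i = (x0 + vec n (\<lambda>i. LINT s:{0..t}|lborel. ?f i s \<omega>) + vec n (\<lambda>i. J i \<omega>)) $ i)"
        unfolding vec_eq_iff using c(1) by (simp del: index_mult_mat_vec index_add_vec(1))
      moreover have "(x0 + vec n (\<lambda>i. LINT s:{0..t}|lborel. ?f i s \<omega>) + vec n (\<lambda>i. J i \<omega>)) $ i = x0 $ i + drift t (?f i) \<omega> + J i \<omega>"
        if "i < n" for i
        using that by (subst index_add_vec(1), simp, subst index_add_vec(1), simp) (simp only: index_vec drift_eq)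
      ultimately show ?thesis by (simp del: index_mult_mat_vec index_add_vec(1) add: lessThan_iff Ball_def)
    qed
    show ?thesis
    proof
      assume ?L
      then obtain J where J: "\<And>i. i < n \<Longrightarrow> has_ito_integral P Ft W t (?g i) (J i)"
        and ae: "AE \<omega> in P. \<forall>i\<in>{..<n}. (E *\<^sub>v x t \<omega>) $ i = x0 $ i + drift t (?f i) \<omega> + J i \<omega>"
        unfolding veq by blast
      show ?R
      proof (intro allI impI)
        fix i assume i: "i < n"
        have "AE \<omega> in P. J i \<omega> = ito t (?g i) \<omega>" by (rule has_ito_unique[OF J[OF i] has_ito[OF g[OF i] t0]])
        with ae show "AE \<omega> in P. (E *\<^sub>v x t \<omega>) $ i = x0 $ i + stoch t (?f i) (?g i) \<omega>"
          by eventually_elim (use i in \<open>simp add: stoch_def del: index_mult_mat_vec\<close>)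
      qed
    next
      assume R: ?R
      have "AE \<omega> in P. \<forall>i\<in>{..<n}. (E *\<^sub>v x t \<omega>) $ i = x0 $ i + drift t (?f i) \<omega> + ito t (?g i) \<omega>"
        using R by (intro AE_finite_allI) (auto simp: stoch_def add.assoc simp del: index_mult_mat_vec)
      then show ?L unfolding veq using has_ito[OF g t0] by (intro exI[of _ "\<lambda>i. ito t (?g i)"] conjI allI impI)
    qed
  qed
  then show ?thesis unfolding is_solution_def by blast
qed

lemma AE_vec_eq_iff:
  assumes x: "x \<in> L2_adapted P Ft T n" and y: "y \<in> L2_adapted P Ft T n"
  shows "(AE (t, \<omega>) in time_space P T. x t \<omega> = y t \<omega>) \<longleftrightarrow> (\<forall>i<n. AE z in Q. cutoff T (\<lambda>t \<omega>. x t \<omega> $ i) z = cutoff T (\<lambda>t \<omega>. y t \<omega> $ i) z)"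
proof -
  have S: "{0..T} \<times> space P \<inter> space Q \<in> sets Q" by auto
  have "(AE (t, \<omega>) in time_space P T. x t \<omega> = y t \<omega>) \<longleftrightarrow> (AE z in Q. z \<in> {0..T} \<times> space P \<longrightarrow> (case z of (t, \<omega>) \<Rightarrow> x t \<omega> = y t \<omega>))"
    unfolding time_space_eq by (rule AE_restrict_space_iff[OF S])
  also have "\<dots> \<longleftrightarrow> (AE z in Q. \<forall>i\<in>{..<n}. cutoff T (\<lambda>t \<omega>. x t \<omega> $ i) z = cutoff T (\<lambda>t \<omega>. y t \<omega> $ i) z)"
  proof (rule AE_cong)
    fix z assume z: "z \<in> space Q"
    obtain t \<omega> where tw: "z = (t, \<omega>)" "\<omega> \<in> space P" using z by (auto simp: space_pair_measure)
    have "x t \<omega> = y t \<omega> \<longleftrightarrow> (\<forall>i\<in>{..<n}. x t \<omega> $ i = y t \<omega> $ i)" if "t \<in> {0..T}"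
    proof -
      have "dim_vec (x t \<omega>) = n" "dim_vec (y t \<omega>) = n" using x y that tw by (auto simp: L2_adapted_iff)
      then show ?thesis by (auto simp: vec_eq_iff)
    qed
    then show "(z \<in> {0..T} \<times> space P \<longrightarrow> (case z of (t, \<omega>) \<Rightarrow> x t \<omega> = y t \<omega>)) = (\<forall>i\<in>{..<n}. cutoff T (\<lambda>t \<omega>. x t \<omega> $ i) z = cutoff T (\<lambda>t \<omega>. y t \<omega> $ i) z)"
      using tw by (auto simp: cutoff_def)
  qed
  also have "\<dots> \<longleftrightarrow> (\<forall>i<n. AE z in Q. cutoff T (\<lambda>t \<omega>. x t \<omega> $ i) z = cutoff T (\<lambda>t \<omega>. y t \<omega> $ i) z)"
    by (subst AE_finite_all) auto
  finally show ?thesis .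
qed

lemma stoch_add:
  assumes "f \<in> H t" "g \<in> H t" "f' \<in> H t" "g' \<in> H t" "0 \<le> t"
    and "\<And>s \<omega>. s \<in> {0..t} \<Longrightarrow> \<omega> \<in> space P \<Longrightarrow> h s \<omega> = f s \<omega> + f' s \<omega>"
    and "\<And>s \<omega>. s \<in> {0..t} \<Longrightarrow> \<omega> \<in> space P \<Longrightarrow> k s \<omega> = g s \<omega> + g' s \<omega>"
  shows "AE \<omega> in P. stoch t h k \<omega> = stoch t f g \<omega> + stoch t f' g' \<omega>"
proof -
  have "AE \<omega> in P. stoch t h k \<omega> = (\<Sum>b\<in>UNIV. 1 * stoch t (if b then f else f') (if b then g else g') \<omega>)"
    by (rule stoch_linear) (use assms in \<open>auto simp: UNIV_bool\<close>)
  then show ?thesis by eventually_elim (simp add: UNIV_bool)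
qed

lemma stoch_cong:
  assumes "f \<in> H t" "g \<in> H t" "0 \<le> t"
    and "\<And>s \<omega>. s \<in> {0..t} \<Longrightarrow> \<omega> \<in> space P \<Longrightarrow> h s \<omega> = f s \<omega>"
    and "\<And>s \<omega>. s \<in> {0..t} \<Longrightarrow> \<omega> \<in> space P \<Longrightarrow> k s \<omega> = g s \<omega>"
  shows "AE \<omega> in P. stoch t h k \<omega> = stoch t f g \<omega>"
proof -
  have "AE \<omega> in P. stoch t h k \<omega> = (\<Sum>b\<in>{()}. 1 * stoch t f g \<omega>)"
    by (rule stoch_linear) (use assms in auto)
  then show ?thesis by simp
qed

lemma stoch_zero:
  assumes "0 \<le> t" "\<And>s \<omega>. s \<in> {0..t} \<Longrightarrow> \<omega> \<in> space P \<Longrightarrow> h s \<omega> = 0" "\<And>s \<omega>. s \<in> {0..t} \<Longrightarrow> \<omega> \<in> space P \<Longrightarrow> k s \<omega> = 0"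
  shows "AE \<omega> in P. stoch t h k \<omega> = 0"
proof -
  have "AE \<omega> in P. stoch t h k \<omega> = (\<Sum>b\<in>{}. a b * stoch t (f b) (g b) \<omega>)" for a :: "nat \<Rightarrow> real" and f g
    by (rule stoch_linear) (use assms in auto)
  then show ?thesis by simp
qed

lemma AE_cutoff_slice:
  assumes "AE z in Q. cutoff T f z = 0"
  shows "AE t in lborel. t \<in> {0..T} \<longrightarrow> (AE \<omega> in P. f t \<omega> = 0)"
proof -
  have "AE t in lborel. AE \<omega> in P. cutoff T f (t, \<omega>) = 0" by (rule Q.AE_pair[OF assms])
  then show ?thesis by eventually_elim (auto simp: cutoff_def)
qed

lemma cutoff_const_zero:
  assumes "AE z in Q. cutoff T (\<lambda>s \<omega>. c) z = 0" "0 < T"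
  shows "c = 0"
proof -
  have "\<exists>t'\<in>{0..T}. (AE \<omega> in P. c = 0) \<and> \<bar>t' - 0\<bar> < 1"
    by (rule AE_dense[OF AE_cutoff_slice[OF assms(1)] assms(2)]) (use assms(2) in auto)
  then have "AE \<omega> in P. c = 0" by blast
  then show ?thesis by simp
qed

text \<open>If the left side is almost everywhere the constant k, then c - k plus an integral
  process vanishes for almost every time, so each of its parts is zero.\<close>

lemma row_step:
  assumes T: "0 < T" and f: "f \<in> H T" and g: "g \<in> H T"
    and L: "AE z in Q. cutoff T (\<lambda>s \<omega>. L s \<omega> - k) z = 0"
    and eq: "\<And>t. t \<in> {0..T} \<Longrightarrow> AE \<omega> in P. L t \<omega> = c + stoch t f g \<omega>"
  shows "c = k" "AE z in Q. cutoff T f z = 0" "AE z in Q. cutoff T g z = 0"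
proof -
  have "AE t in lborel. t \<in> {0..T} \<longrightarrow> (AE \<omega> in P. (c - k) + stoch t f g \<omega> = 0)"
    using AE_cutoff_slice[OF L]
  proof eventually_elim
    fix t assume h: "t \<in> {0..T} \<longrightarrow> (AE \<omega> in P. L t \<omega> - k = 0)"
    show "t \<in> {0..T} \<longrightarrow> (AE \<omega> in P. (c - k) + stoch t f g \<omega> = 0)"
    proof
      assume t: "t \<in> {0..T}"
      with h have "AE \<omega> in P. L t \<omega> - k = 0" by simp
      with eq[OF t] show "AE \<omega> in P. (c - k) + stoch t f g \<omega> = 0" by eventually_elim simp
    qed
  qed
  note z = stoch_zero_imp_zero[OF T f g this]
  show "c = k" using z(1) by simp
  show "AE z in Q. cutoff T f z = 0" "AE z in Q. cutoff T g z = 0" by (rule z(2), rule z(3))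
qed

end

section \<open>Change of coordinates in the equation\<close>

lemma mult_mat_vec_index:
  assumes "M \<in> carrier_mat m n" "v \<in> carrier_vec n" "i < m"
  shows "(M *\<^sub>v v) $ i = (\<Sum>k<n. M $$ (i, k) * v $ k)"
  using assms by (simp add: scalar_prod_def lessThan_atLeast0)

context brownian
begin

text \<open>Left multiplication forms linear combinations of the scalar equations, which
  \<open>stoch_linear\<close> carries into the integrals; \<open>N\<close> is absorbed by the new
  unknown.\<close>

lemma is_solution_transform:
  assumes u: "u \<in> L2_adapted P Ft T r"
    and c: "E \<in> carrier_mat n n" "A \<in> carrier_mat n n" "B \<in> carrier_mat n r" "D \<in> carrier_mat n r" "x0 \<in> carrier_vec n"
    and M: "M \<in> carrier_mat n n" and N: "N \<in> carrier_mat n n" "N' \<in> carrier_mat n n" "N * N' = 1\<^sub>m n"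
    and sol: "is_solution P Ft W T n E A B D x0 u x"
  shows "is_solution P Ft W T n (M * E * N) (M * A * N) (M * B) (M * D) (M *\<^sub>v x0) u (\<lambda>t \<omega>. N' *\<^sub>v x t \<omega>)"
proof -
  have x: "x \<in> L2_adapted P Ft T n"
    and eq: "\<And>t i. t \<in> {0..T} \<Longrightarrow> i < n \<Longrightarrow> AE \<omega> in P. (E *\<^sub>v x t \<omega>) $ i =
      x0 $ i + stoch t (\<lambda>s \<omega>. (A *\<^sub>v x s \<omega> + B *\<^sub>v u s \<omega>) $ i) (\<lambda>s \<omega>. (A *\<^sub>v x s \<omega> + D *\<^sub>v u s \<omega>) $ i) \<omega>"
    using sol unfolding is_solution_iff[OF u c] by auto
  have key: "(M * X * N) *\<^sub>v (N' *\<^sub>v v) = M *\<^sub>v (X *\<^sub>v v)" if X: "X \<in> carrier_mat n n" and v: "v \<in> carrier_vec n" for X v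
  proof -
    have MX: "M * X \<in> carrier_mat n n" using M X by auto
    have "(M * X * N) *\<^sub>v (N' *\<^sub>v v) = (M * X) *\<^sub>v (N *\<^sub>v (N' *\<^sub>v v))"
      by (rule assoc_mult_mat_vec[OF MX N(1) mult_mat_vec_carrier[OF N(2) v]])
    also have "N *\<^sub>v (N' *\<^sub>v v) = v"
      unfolding assoc_mult_mat_vec[OF N(1,2) v, symmetric] N(3) by (rule one_mult_mat_vec[OF v])
    also have "(M * X) *\<^sub>v v = M *\<^sub>v (X *\<^sub>v v)" by (rule assoc_mult_mat_vec[OF M X v])
    finally show ?thesis .
  qed
  have xc: "x s \<omega> \<in> carrier_vec n" and uc: "u s \<omega> \<in> carrier_vec r" if "s \<in> {0..T}" "\<omega> \<in> space P" for s \<omega>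
    using x u that unfolding L2_adapted_iff by auto
  have rows: "((M * A * N) *\<^sub>v (N' *\<^sub>v x s \<omega>) + (M * X) *\<^sub>v u s \<omega>) $ i = (\<Sum>k<n. M $$ (i, k) * (A *\<^sub>v x s \<omega> + X *\<^sub>v u s \<omega>) $ k)"
    if X: "X \<in> carrier_mat n r" and i: "i < n" and s: "s \<in> {0..T}" "\<omega> \<in> space P" for X i s \<omega>
  proof -
    have Ax: "A *\<^sub>v x s \<omega> \<in> carrier_vec n" "X *\<^sub>v u s \<omega> \<in> carrier_vec n" by (rule mult_mat_vec_carrier[OF c(2) xc[OF s]], rule mult_mat_vec_carrier[OF X uc[OF s]])
    have "(M * A * N) *\<^sub>v (N' *\<^sub>v x s \<omega>) + (M * X) *\<^sub>v u s \<omega> = M *\<^sub>v (A *\<^sub>v x s \<omega>) + M *\<^sub>v (X *\<^sub>v u s \<omega>)"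
      unfolding key[OF c(2) xc[OF s]] assoc_mult_mat_vec[OF M X uc[OF s]] ..
    also have "\<dots> = M *\<^sub>v (A *\<^sub>v x s \<omega> + X *\<^sub>v u s \<omega>)" by (rule mult_add_distrib_mat_vec[OF M Ax, symmetric])
    finally show ?thesis using mult_mat_vec_index[OF M add_carrier_vec[OF Ax] i] by simp
  qed
  have carr: "M * E * N \<in> carrier_mat n n" "M * A * N \<in> carrier_mat n n" "M * B \<in> carrier_mat n r" "M * D \<in> carrier_mat n r" "M *\<^sub>v x0 \<in> carrier_vec n"
    using M N c by auto
  show ?thesis
    unfolding is_solution_iff[OF u carr]
  proof (intro conjI ballI allI impI)
    show "(\<lambda>t \<omega>. N' *\<^sub>v x t \<omega>) \<in> L2_adapted P Ft T n" by (rule L2_adapted_mat_vec[OF x N(2)])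
    fix t i assume t: "t \<in> {0..T}" and i: "i < n"
    define f where "f k s \<omega> = (A *\<^sub>v x s \<omega> + B *\<^sub>v u s \<omega>) $ k" for k s \<omega>
    define g where "g k s \<omega> = (A *\<^sub>v x s \<omega> + D *\<^sub>v u s \<omega>) $ k" for k s \<omega>
    have fg: "f k \<in> H t" "g k \<in> H t" if "k \<in> {..<n}" for k
      using coeff_H[OF x u c(2,3), of k] coeff_H[OF x u c(2,4), of k] that t H_mono unfolding f_def g_def by auto
    have lin: "AE \<omega> in P. stoch t (\<lambda>s \<omega>. ((M * A * N) *\<^sub>v (N' *\<^sub>v x s \<omega>) + (M * B) *\<^sub>v u s \<omega>) $ i) (\<lambda>s \<omega>. ((M * A * N) *\<^sub>v (N' *\<^sub>v x s \<omega>) + (M * D) *\<^sub>v u s \<omega>) $ i) \<omega>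
        = (\<Sum>k<n. M $$ (i, k) * stoch t (f k) (g k) \<omega>)"
    proof (rule stoch_linear[OF _ fg])
      show "0 \<le> t" using t by simp
      fix s \<omega> assume s: "s \<in> {0..t}" "\<omega> \<in> space P"
      then have s': "s \<in> {0..T}" using t by auto
      show "((M * A * N) *\<^sub>v (N' *\<^sub>v x s \<omega>) + (M * B) *\<^sub>v u s \<omega>) $ i = (\<Sum>k<n. M $$ (i, k) * f k s \<omega>)"
        unfolding f_def by (rule rows[OF c(3) i s' s(2)])
      show "((M * A * N) *\<^sub>v (N' *\<^sub>v x s \<omega>) + (M * D) *\<^sub>v u s \<omega>) $ i = (\<Sum>k<n. M $$ (i, k) * g k s \<omega>)"
        unfolding g_def by (rule rows[OF c(4) i s' s(2)])
    qed simp
    have "AE \<omega> in P. \<forall>k\<in>{..<n}. (E *\<^sub>v x t \<omega>) $ k = x0 $ k + stoch t (f k) (g k) \<omega>"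
      using eq[OF t] unfolding f_def g_def by (intro AE_finite_allI) auto
    with lin AE_space show "AE \<omega> in P. (M * E * N *\<^sub>v (N' *\<^sub>v x t \<omega>)) $ i = (M *\<^sub>v x0) $ i +
        stoch t (\<lambda>s \<omega>. ((M * A * N) *\<^sub>v (N' *\<^sub>v x s \<omega>) + (M * B) *\<^sub>v u s \<omega>) $ i) (\<lambda>s \<omega>. ((M * A * N) *\<^sub>v (N' *\<^sub>v x s \<omega>) + (M * D) *\<^sub>v u s \<omega>) $ i) \<omega>"
    proof eventually_elim
      fix \<omega> assume l: "stoch t (\<lambda>s \<omega>. ((M * A * N) *\<^sub>v (N' *\<^sub>v x s \<omega>) + (M * B) *\<^sub>v u s \<omega>) $ i) (\<lambda>s \<omega>. ((M * A * N) *\<^sub>v (N' *\<^sub>v x s \<omega>) + (M * D) *\<^sub>v u s \<omega>) $ i) \<omega>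
        = (\<Sum>k<n. M $$ (i, k) * stoch t (f k) (g k) \<omega>)" and w: "\<omega> \<in> space P"
        and e: "\<forall>k\<in>{..<n}. (E *\<^sub>v x t \<omega>) $ k = x0 $ k + stoch t (f k) (g k) \<omega>"
      have "(M * E * N *\<^sub>v (N' *\<^sub>v x t \<omega>)) $ i = (M *\<^sub>v (E *\<^sub>v x t \<omega>)) $ i" unfolding key[OF c(1) xc[OF t w]] ..
      also have "\<dots> = (\<Sum>k<n. M $$ (i, k) * (E *\<^sub>v x t \<omega>) $ k)"
        by (rule mult_mat_vec_index[OF M mult_mat_vec_carrier[OF c(1) xc[OF t w]] i])
      also have "\<dots> = (\<Sum>k<n. M $$ (i, k) * (x0 $ k + stoch t (f k) (g k) \<omega>))"
        using e by (intro sum.cong) (simp_all del: index_mult_mat_vec)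
      also have "\<dots> = (M *\<^sub>v x0) $ i + (\<Sum>k<n. M $$ (i, k) * stoch t (f k) (g k) \<omega>)"
        unfolding mult_mat_vec_index[OF M c(5) i] by (simp add: distrib_left sum.distrib)
      finally show "(M * E * N *\<^sub>v (N' *\<^sub>v x t \<omega>)) $ i = (M *\<^sub>v x0) $ i +
        stoch t (\<lambda>s \<omega>. ((M * A * N) *\<^sub>v (N' *\<^sub>v x s \<omega>) + (M * B) *\<^sub>v u s \<omega>) $ i) (\<lambda>s \<omega>. ((M * A * N) *\<^sub>v (N' *\<^sub>v x s \<omega>) + (M * D) *\<^sub>v u s \<omega>) $ i) \<omega>"
        unfolding l .
    qed
  qed
qed

lemma is_solution_L2: "is_solution P Ft W T n E A B D x0 u x \<Longrightarrow> x \<in> L2_adapted P Ft T n"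
  by (simp add: is_solution_def)

text \<open>The transformation with the inverse matrices carries solutions of the new equation back
  to the old one, so uniqueness is transferred together with existence.\<close>

lemma has_unique_solution_transform:
  assumes u: "u \<in> L2_adapted P Ft T r"
    and c: "E \<in> carrier_mat n n" "A \<in> carrier_mat n n" "B \<in> carrier_mat n r" "D \<in> carrier_mat n r" "x0 \<in> carrier_vec n"
    and M: "M \<in> carrier_mat n n" "M' \<in> carrier_mat n n" "M' * M = 1\<^sub>m n"
    and N: "N \<in> carrier_mat n n" "N' \<in> carrier_mat n n" "N * N' = 1\<^sub>m n" "N' * N = 1\<^sub>m n"
    and uniq: "has_unique_solution P Ft W T n E A B D x0 u"
  shows "has_unique_solution P Ft W T n (M * E * N) (M * A * N) (M * B) (M * D) (M *\<^sub>v x0) u"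
proof -
  have carr: "M * E * N \<in> carrier_mat n n" "M * A * N \<in> carrier_mat n n" "M * B \<in> carrier_mat n r" "M * D \<in> carrier_mat n r" "M *\<^sub>v x0 \<in> carrier_vec n"
    using M(1) N(1) c by auto
  have conj_back: "M' * (M * X * N) * N' = X" if X: "X \<in> carrier_mat n n" for X
  proof -
    have MX: "M * X \<in> carrier_mat n n" using M(1) X by (rule mult_carrier_mat)
    have "M' * (M * X * N) = X * N"
      unfolding assoc_mult_mat[OF M(2) MX N(1), symmetric] assoc_mult_mat[OF M(2,1) X, symmetric] M(3) left_mult_one_mat[OF X] ..
    then show ?thesis
      by (simp only: assoc_mult_mat[OF X N(1,2)] N(3) right_mult_one_mat[OF X])
  qed
  have right_back: "M' * (M * X) = X" if X: "X \<in> carrier_mat n r" for X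
    unfolding assoc_mult_mat[OF M(2,1) X, symmetric] M(3) by (rule left_mult_one_mat[OF X])
  have x0_back: "M' *\<^sub>v (M *\<^sub>v x0) = x0" 
    unfolding assoc_mult_mat_vec[OF M(2,1) c(5), symmetric] M(3) by (rule one_mult_mat_vec[OF c(5)])
  have undo: "is_solution P Ft W T n E A B D x0 u (\<lambda>t \<omega>. N *\<^sub>v y t \<omega>)"
    if "is_solution P Ft W T n (M * E * N) (M * A * N) (M * B) (M * D) (M *\<^sub>v x0) u y" for y
    using is_solution_transform[OF u carr M(2) N(2,1,4) that] unfolding conj_back[OF c(1)] conj_back[OF c(2)] right_back[OF c(3)] right_back[OF c(4)] x0_back .
  have U: "AE (t, \<omega>) in time_space P T. x t \<omega> = y t \<omega>"
    if "is_solution P Ft W T n E A B D x0 u x" "is_solution P Ft W T n E A B D x0 u y" for x y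
    by (rule uniq[unfolded has_unique_solution_def, THEN conjunct2, rule_format, OF conjI[OF that]])
  obtain x where x: "is_solution P Ft W T n E A B D x0 u x" using uniq unfolding has_unique_solution_def by blast
  show ?thesis
    unfolding has_unique_solution_def
  proof (intro conjI allI impI)
    show "\<exists>x. is_solution P Ft W T n (M * E * N) (M * A * N) (M * B) (M * D) (M *\<^sub>v x0) u x"
      by (rule exI, rule is_solution_transform[OF u c M(1) N(1,2,3) x])
    fix y z assume yz: "is_solution P Ft W T n (M * E * N) (M * A * N) (M * B) (M * D) (M *\<^sub>v x0) u y \<and>
      is_solution P Ft W T n (M * E * N) (M * A * N) (M * B) (M * D) (M *\<^sub>v x0) u z"
    have L: "y \<in> L2_adapted P Ft T n" "z \<in> L2_adapted P Ft T n" by (rule is_solution_L2[OF conjunct1[OF yz]], rule is_solution_L2[OF conjunct2[OF yz]])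
    have "AE (t, \<omega>) in time_space P T. N *\<^sub>v y t \<omega> = N *\<^sub>v z t \<omega>"
      by (rule U[OF undo[OF conjunct1[OF yz]] undo[OF conjunct2[OF yz]]])
    then show "AE (t, \<omega>) in time_space P T. y t \<omega> = z t \<omega>"
    proof (rule AE_mp, intro AE_I2 impI)
      fix w assume w: "w \<in> space (time_space P T)" and e: "case w of (t, \<omega>) \<Rightarrow> N *\<^sub>v y t \<omega> = N *\<^sub>v z t \<omega>"
      obtain t \<omega> where tw: "w = (t, \<omega>)" by (cases w)
      have "t \<in> {0..T}" "\<omega> \<in> space P" using w tw by (auto simp: space_pair_measure space_restrict_space)
      then have yz: "y t \<omega> \<in> carrier_vec n" "z t \<omega> \<in> carrier_vec n" using L unfolding L2_adapted_iff by blast+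
      have un: "N' *\<^sub>v (N *\<^sub>v v) = v" if "v \<in> carrier_vec n" for v
        unfolding assoc_mult_mat_vec[OF N(2,1) that, symmetric] N(4) by (rule one_mult_mat_vec[OF that])
      have "N *\<^sub>v y t \<omega> = N *\<^sub>v z t \<omega>" using e unfolding tw by (rule case_prodD)
      then have "N' *\<^sub>v (N *\<^sub>v y t \<omega>) = N' *\<^sub>v (N *\<^sub>v z t \<omega>)" by (rule arg_cong)
      then have "y t \<omega> = z t \<omega>" unfolding un[OF yz(1)] un[OF yz(2)] .
      then show "case w of (t, \<omega>) \<Rightarrow> y t \<omega> = z t \<omega>" unfolding tw by (rule case_prodI)
    qed
  qed
qed

section \<open>Uniqueness forces a regular pencil\<close>

lemma iterated_integrals:
  assumes T: "0 < T"
  shows "\<exists>\<eta>. (\<forall>s \<omega>. \<eta> 0 s \<omega> = 1) \<and> (\<forall>k. \<eta> k \<in> H T) \<and> (\<forall>k. \<forall>t\<in>{0..T}. AE \<omega> in P. \<eta> (Suc k) t \<omega> = stoch t (\<eta> k) (\<eta> k) \<omega>)"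
proof -
  define \<eta> where "\<eta> = rec_nat (\<lambda>_ _. 1) (\<lambda>k f. SOME Y. Y \<in> H T \<and> (\<forall>t\<in>{0..T}. AE \<omega> in P. Y t \<omega> = stoch t f f \<omega>))"
  have step: "\<eta> (Suc k) \<in> H T \<and> (\<forall>t\<in>{0..T}. AE \<omega> in P. \<eta> (Suc k) t \<omega> = stoch t (\<eta> k) (\<eta> k) \<omega>)" if "\<eta> k \<in> H T" for k
  proof -
    have "\<exists>Y. Y \<in> H T \<and> (\<forall>t\<in>{0..T}. AE \<omega> in P. Y t \<omega> = stoch t (\<eta> k) (\<eta> k) \<omega>)"
      using stoch_process[OF that that T, of 0] by auto
    from someI_ex[OF this] show ?thesis by (simp add: \<eta>_def)
  qed
  have H: "\<eta> k \<in> H T" for k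
  proof (induction k)
    case 0 show ?case using H_const[of 1 T] by (simp add: \<eta>_def)
  qed (use step in blast)
  have "\<eta> 0 s \<omega> = 1" for s \<omega> by (simp add: \<eta>_def)
  then show ?thesis using H step by blast
qed

text \<open>A combination of the \<eta> k is its constant term plus the integral process of the
  combination with indices lowered by one. Both vanish by uniqueness of the decomposition, so
  induction applies to the shorter combination.\<close>

lemma iterated_integrals_independent:
  assumes T: "0 < T" and \<eta>0: "\<And>s \<omega>. \<eta> 0 s \<omega> = 1" and H: "\<And>k. \<eta> k \<in> H T"
    and step: "\<And>k t. t \<in> {0..T} \<Longrightarrow> AE \<omega> in P. \<eta> (Suc k) t \<omega> = stoch t (\<eta> k) (\<eta> k) \<omega>"
    and z: "AE z in Q. cutoff T (\<lambda>s \<omega>. \<Sum>k\<le>d. c k * \<eta> k s \<omega>) z = 0" and k: "k \<le> d"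
  shows "c k = 0"
  using z k
proof (induction d arbitrary: c k)
  case 0
  then show ?case using cutoff_const_zero[OF _ T, of "c 0"] by (simp add: \<eta>0)
next
  case (Suc d)
  let ?F = "\<lambda>s \<omega>. \<Sum>k\<le>d. c (Suc k) * \<eta> k s \<omega>"
  have F: "?F \<in> H T" by (intro H_sum H_cmult H)
  have "AE t in lborel. t \<in> {0..T} \<longrightarrow> (AE \<omega> in P. c 0 + stoch t ?F ?F \<omega> = 0)"
    using AE_cutoff_slice[OF Suc(2)]
  proof eventually_elim
    fix t assume h: "t \<in> {0..T} \<longrightarrow> (AE \<omega> in P. (\<Sum>k\<le>Suc d. c k * \<eta> k t \<omega>) = 0)"
    show "t \<in> {0..T} \<longrightarrow> (AE \<omega> in P. c 0 + stoch t ?F ?F \<omega> = 0)"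
    proof
      assume t: "t \<in> {0..T}"
      have "AE \<omega> in P. stoch t ?F ?F \<omega> = (\<Sum>k\<le>d. c (Suc k) * stoch t (\<eta> k) (\<eta> k) \<omega>)"
      proof (rule stoch_linear)
        show "\<eta> k \<in> H t" "\<eta> k \<in> H t" for k using H_mono[OF H] t by simp_all
      qed (use t in auto)
      moreover have "AE \<omega> in P. \<forall>k\<in>{..d}. \<eta> (Suc k) t \<omega> = stoch t (\<eta> k) (\<eta> k) \<omega>"
        using step[OF t] by (intro AE_finite_allI) auto
      moreover have "AE \<omega> in P. (\<Sum>k\<le>Suc d. c k * \<eta> k t \<omega>) = 0" using h t by simp
      ultimately show "AE \<omega> in P. c 0 + stoch t ?F ?F \<omega> = 0"
      proof eventually_elim
        fix \<omega> assume 1: "stoch t ?F ?F \<omega> = (\<Sum>k\<le>d. c (Suc k) * stoch t (\<eta> k) (\<eta> k) \<omega>)"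
          and 2: "\<forall>k\<in>{..d}. \<eta> (Suc k) t \<omega> = stoch t (\<eta> k) (\<eta> k) \<omega>" and 3: "(\<Sum>k\<le>Suc d. c k * \<eta> k t \<omega>) = 0"
        have "stoch t ?F ?F \<omega> = (\<Sum>k\<le>d. c (Suc k) * \<eta> (Suc k) t \<omega>)"
          unfolding 1 using 2 by (intro sum.cong) auto
        then show "c 0 + stoch t ?F ?F \<omega> = 0"
          using 3 by (simp add: sum.atMost_Suc_shift \<eta>0 del: sum.atMost_Suc)
      qed
    qed
  qed
  from stoch_zero_imp_zero[OF T F F this] have c0: "c 0 = 0" and F0: "AE z in Q. cutoff T ?F z = 0" by auto
  show ?case
  proof (cases k)
    case (Suc j)
    with Suc.prems have "j \<le> d" by simp
    from Suc.IH[OF F0 this] show ?thesis using Suc by simp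
  qed (use c0 in simp)
qed

lemma unique_solution_imp_regular:
  assumes T: "0 < T" and u: "u \<in> L2_adapted P Ft T r"
    and c: "E \<in> carrier_mat n n" "A \<in> carrier_mat n n" "B \<in> carrier_mat n r" "D \<in> carrier_mat n r" "x0 \<in> carrier_vec n"
    and uniq: "has_unique_solution P Ft W T n E A B D x0 u"
  shows "\<exists>c. det (c \<cdot>\<^sub>m E - A) \<noteq> 0"
proof (rule ccontr)
  assume "\<not> ?thesis"
  then have "det (a \<cdot>\<^sub>m E - A) = 0" for a by simp
  from pencil_cases[OF c(1,2) this] obtain p d where p: "\<And>k. p k \<in> carrier_vec n" and p0: "A *\<^sub>v p 0 = 0\<^sub>v n"
    and pS: "\<And>k. E *\<^sub>v p k = A *\<^sub>v p (Suc k)" and pd: "\<And>k. d < k \<Longrightarrow> p k = 0\<^sub>v n" and pn: "\<exists>k. p k \<noteq> 0\<^sub>v n" by blast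
  obtain \<eta> where \<eta>0: "\<And>s \<omega>. \<eta> 0 s \<omega> = 1" and \<eta>H: "\<And>k. \<eta> k \<in> H T"
    and step: "\<And>k t. t \<in> {0..T} \<Longrightarrow> AE \<omega> in P. \<eta> (Suc k) t \<omega> = stoch t (\<eta> k) (\<eta> k) \<omega>"
    using iterated_integrals[OF T] by blast
  \<comment> \<open>The indices run in opposite directions: integrating \<eta> (d-k-1) gives \<eta>
    (d-k), and A p (k+1) = E p k, so the integral process of A z is E z.\<close>
  define z where "z s \<omega> = vec n (\<lambda>j. \<Sum>k\<le>d. \<eta> (d - k) s \<omega> * p k $ j)" for s \<omega>
  have zc: "z s \<omega> \<in> carrier_vec n" for s \<omega> by (simp add: z_def)
  have Xz: "(X *\<^sub>v z s \<omega>) $ i = (\<Sum>k\<le>d. \<eta> (d - k) s \<omega> * (X *\<^sub>v p k) $ i)" if X: "X \<in> carrier_mat n n" and i: "i < n" for X i s \<omega>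
  proof -
    have "(X *\<^sub>v z s \<omega>) $ i = (\<Sum>j<n. X $$ (i, j) * (\<Sum>k\<le>d. \<eta> (d - k) s \<omega> * p k $ j))"
      unfolding mult_mat_vec_index[OF X zc i] by (intro sum.cong) (auto simp: z_def)
    also have "\<dots> = (\<Sum>k\<le>d. \<Sum>j<n. \<eta> (d - k) s \<omega> * (X $$ (i, j) * p k $ j))"
      unfolding sum_distrib_left by (subst sum.swap) (simp add: mult.left_commute)
    also have "\<dots> = (\<Sum>k\<le>d. \<eta> (d - k) s \<omega> * (X *\<^sub>v p k) $ i)"
      unfolding mult_mat_vec_index[OF X p i] sum_distrib_left ..
    finally show ?thesis .
  qed
  define a where "a i k = (A *\<^sub>v p (Suc k)) $ i" for i k
  have Ez: "(E *\<^sub>v z s \<omega>) $ i = (\<Sum>k<d. a i k * \<eta> (Suc (d - Suc k)) s \<omega>)" if i: "i < n" for i s \<omega>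
  proof -
    have "(E *\<^sub>v z s \<omega>) $ i = (\<Sum>k\<le>d. \<eta> (d - k) s \<omega> * a i k)" unfolding Xz[OF c(1) i] pS a_def ..
    also have "\<dots> = (\<Sum>k<d. \<eta> (d - k) s \<omega> * a i k) + \<eta> 0 s \<omega> * a i d"
      unfolding lessThan_Suc_atMost[symmetric] sum.lessThan_Suc by simp
    \<comment> \<open>The chain has ended beyond d, so the term with \<eta> 0, which is not an
      integral, drops out.\<close>
    also have "a i d = 0" unfolding a_def using pd[of "Suc d"] c(2) i by simp
    finally show ?thesis by (auto intro!: sum.cong simp: Suc_diff_Suc mult.commute)
  qed
  have Az: "(A *\<^sub>v z s \<omega>) $ i = (\<Sum>k<d. a i k * \<eta> (d - Suc k) s \<omega>)" if i: "i < n" for i s \<omega>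
  proof -
    have "(A *\<^sub>v z s \<omega>) $ i = (\<Sum>k<Suc d. \<eta> (d - k) s \<omega> * (A *\<^sub>v p k) $ i)" unfolding Xz[OF c(2) i] lessThan_Suc_atMost ..
    also have "\<dots> = \<eta> d s \<omega> * (A *\<^sub>v p 0) $ i + (\<Sum>k<d. \<eta> (d - Suc k) s \<omega> * (A *\<^sub>v p (Suc k)) $ i)"
      unfolding sum.lessThan_Suc_shift by simp
    also have "\<dots> = (\<Sum>k<d. a i k * \<eta> (d - Suc k) s \<omega>)" unfolding p0 a_def using i by (simp add: mult.commute)
    finally show ?thesis .
  qed
  obtain x where x: "is_solution P Ft W T n E A B D x0 u x" using uniq unfolding has_unique_solution_def by blast
  have xL: "x \<in> L2_adapted P Ft T n"
    and eq: "\<And>t i. t \<in> {0..T} \<Longrightarrow> i < n \<Longrightarrow> AE \<omega> in P. (E *\<^sub>v x t \<omega>) $ i =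
      x0 $ i + stoch t (\<lambda>s \<omega>. (A *\<^sub>v x s \<omega> + B *\<^sub>v u s \<omega>) $ i) (\<lambda>s \<omega>. (A *\<^sub>v x s \<omega> + D *\<^sub>v u s \<omega>) $ i) \<omega>"
    using x unfolding is_solution_iff[OF u c] by auto
  have zH: "(\<lambda>s \<omega>. z s \<omega> $ j) \<in> H T" if "j < n" for j
  proof (rule H_cong)
    show "(\<lambda>s \<omega>. \<Sum>k\<le>d. p k $ j * \<eta> (d - k) s \<omega>) \<in> H T" by (intro H_sum H_cmult \<eta>H)
  qed (use that in \<open>simp add: z_def mult.commute\<close>)
  have zL: "z \<in> L2_adapted P Ft T n" unfolding L2_adapted_iff using zc zH by simp
  let ?y = "\<lambda>s \<omega>. x s \<omega> + z s \<omega>"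
  have xc: "x s \<omega> \<in> carrier_vec n" if "s \<in> {0..T}" "\<omega> \<in> space P" for s \<omega>
    using xL that unfolding L2_adapted_iff by auto
  have yL: "?y \<in> L2_adapted P Ft T n"
    unfolding L2_adapted_iff
  proof (intro conjI ballI allI impI)
    show "x s \<omega> + z s \<omega> \<in> carrier_vec n" if "s \<in> {0..T}" "\<omega> \<in> space P" for s \<omega> using xc[OF that] zc by simp
    fix i assume i: "i < n"
    have "(\<lambda>s \<omega>. x s \<omega> $ i) \<in> H T" using xL i unfolding L2_adapted_iff by blast
    from H_add[OF this zH[OF i]] show "(\<lambda>s \<omega>. (x s \<omega> + z s \<omega>) $ i) \<in> H T"
      using zc[THEN carrier_vecD] i by simp
  qed
  have add: "(X *\<^sub>v (x s \<omega> + z s \<omega>)) $ i = (X *\<^sub>v x s \<omega>) $ i + (X *\<^sub>v z s \<omega>) $ i"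
    if X: "X \<in> carrier_mat n n" and i: "i < n" and s: "s \<in> {0..T}" "\<omega> \<in> space P" for X s \<omega> i
    unfolding mult_add_distrib_mat_vec[OF X xc[OF s] zc] by (rule index_add_vec(1)) (use X i in simp)
  have "is_solution P Ft W T n E A B D x0 u ?y"
    unfolding is_solution_iff[OF u c]
  proof (intro conjI yL ballI allI impI)
    fix t i assume t: "t \<in> {0..T}" and i: "i < n"
    let ?f = "\<lambda>s \<omega>. (A *\<^sub>v x s \<omega> + B *\<^sub>v u s \<omega>) $ i" and ?g = "\<lambda>s \<omega>. (A *\<^sub>v x s \<omega> + D *\<^sub>v u s \<omega>) $ i"
    let ?f' = "\<lambda>s \<omega>. (A *\<^sub>v ?y s \<omega> + B *\<^sub>v u s \<omega>) $ i" and ?g' = "\<lambda>s \<omega>. (A *\<^sub>v ?y s \<omega> + D *\<^sub>v u s \<omega>) $ i"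
    let ?h = "\<lambda>s \<omega>. \<Sum>k<d. a i k * \<eta> (d - Suc k) s \<omega>"
    have t0: "0 \<le> t" and st: "s \<in> {0..t} \<Longrightarrow> s \<in> {0..T}" for s using t by auto
    have \<eta>t: "\<eta> k \<in> H t" for k using H_mono[OF \<eta>H] t by simp
    have fg: "?f \<in> H t" "?g \<in> H t" using H_mono[OF coeff_H[OF xL u c(2,3) i]] H_mono[OF coeff_H[OF xL u c(2,4) i]] t by auto
    have h: "?h \<in> H t" by (intro H_sum H_cmult \<eta>t)
    have Aadd: "(A *\<^sub>v ?y s \<omega> + X *\<^sub>v u s \<omega>) $ i = (A *\<^sub>v x s \<omega> + X *\<^sub>v u s \<omega>) $ i + ?h s \<omega>"
      if X: "X \<in> carrier_mat n r" and s: "s \<in> {0..t}" "\<omega> \<in> space P" for s \<omega> X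
    proof -
      have "(v + X *\<^sub>v u s \<omega>) $ i = v $ i + (X *\<^sub>v u s \<omega>) $ i" for v
        by (rule index_add_vec(1)) (use X i in simp)
      then show ?thesis using add[OF c(2) i st[OF s(1)] s(2)] Az[OF i, of s \<omega>] by simp
    qed
    have "AE \<omega> in P. stoch t ?f' ?g' \<omega> = stoch t ?f ?g \<omega> + stoch t ?h ?h \<omega>"
      by (rule stoch_add[OF fg h h t0]) (rule Aadd[OF c(3)] Aadd[OF c(4)]; assumption)+
    moreover have "AE \<omega> in P. stoch t ?h ?h \<omega> = (\<Sum>k<d. a i k * stoch t (\<eta> (d - Suc k)) (\<eta> (d - Suc k)) \<omega>)"
      by (rule stoch_linear) (use \<eta>t t0 in auto)
    moreover have "AE \<omega> in P. \<forall>k\<in>{..<d}. \<eta> (Suc (d - Suc k)) t \<omega> = stoch t (\<eta> (d - Suc k)) (\<eta> (d - Suc k)) \<omega>"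
      using step[OF t] by (intro AE_finite_allI) auto
    ultimately show "AE \<omega> in P. (E *\<^sub>v ?y t \<omega>) $ i = x0 $ i + stoch t ?f' ?g' \<omega>"
      using eq[OF t i] AE_space
    proof eventually_elim
      fix \<omega> assume 1: "stoch t ?f' ?g' \<omega> = stoch t ?f ?g \<omega> + stoch t ?h ?h \<omega>"
        and 2: "stoch t ?h ?h \<omega> = (\<Sum>k<d. a i k * stoch t (\<eta> (d - Suc k)) (\<eta> (d - Suc k)) \<omega>)"
        and 3: "\<forall>k\<in>{..<d}. \<eta> (Suc (d - Suc k)) t \<omega> = stoch t (\<eta> (d - Suc k)) (\<eta> (d - Suc k)) \<omega>"
        and 4: "(E *\<^sub>v x t \<omega>) $ i = x0 $ i + stoch t ?f ?g \<omega>" and w: "\<omega> \<in> space P"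
      have "(E *\<^sub>v z t \<omega>) $ i = stoch t ?h ?h \<omega>"
        unfolding 2 Ez[OF i] using 3 by (intro sum.cong) auto
      then show "(E *\<^sub>v ?y t \<omega>) $ i = x0 $ i + stoch t ?f' ?g' \<omega>"
        unfolding 1 add[OF c(1) i t w] 4 by simp
    qed
  qed
  with x uniq have "AE (t, \<omega>) in time_space P T. x t \<omega> = x t \<omega> + z t \<omega>" unfolding has_unique_solution_def by blast
  then have ae: "AE w in Q. cutoff T (\<lambda>t \<omega>. x t \<omega> $ j) w = cutoff T (\<lambda>t \<omega>. (x t \<omega> + z t \<omega>) $ j) w" if "j < n" for j
    using that unfolding AE_vec_eq_iff[OF xL yL] by blast
  have "p k $ j = 0" if j: "j < n" and k: "k \<le> d" for j k
  proof -
    have "AE w in Q. cutoff T (\<lambda>s \<omega>. \<Sum>k\<le>d. p (d - k) $ j * \<eta> k s \<omega>) w = 0"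
      using ae[OF j]
    proof eventually_elim
      fix w assume e: "cutoff T (\<lambda>t \<omega>. x t \<omega> $ j) w = cutoff T (\<lambda>t \<omega>. (x t \<omega> + z t \<omega>) $ j) w"
      have "(x s \<omega> + z s \<omega>) $ j = x s \<omega> $ j + z s \<omega> $ j" for s \<omega> using zc[THEN carrier_vecD] j by simp
      moreover have "z s \<omega> $ j = (\<Sum>k\<le>d. p (d - k) $ j * \<eta> k s \<omega>)" for s \<omega>
        unfolding z_def index_vec[OF j] using sum.nat_diff_reindex[of "\<lambda>k. p (d - k) $ j * \<eta> k s \<omega>" "Suc d"]
        by (simp add: lessThan_Suc_atMost mult.commute)
      ultimately show "cutoff T (\<lambda>s \<omega>. \<Sum>k\<le>d. p (d - k) $ j * \<eta> k s \<omega>) w = 0" using e by (cases "0 \<le> fst w \<and> fst w \<le> T") (simp add: cutoff_def, simp only: cutoff_def if_False)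
    qed
    from iterated_integrals_independent[OF T \<eta>0 \<eta>H step this, of "d - k"] show ?thesis using k by simp
  qed
  then have "p k = 0\<^sub>v n" if "k \<le> d" for k using that p[of k] by (intro eq_vecI) auto
  with pd pn show False by (meson not_less)
qed

end

section \<open>Equations in canonical form\<close>

lemma sum_lessThan_add: "(\<Sum>j<h + k. f j) = (\<Sum>j<h. f j) + (\<Sum>j<k. f (h + j :: nat) :: 'a :: comm_monoid_add)"
  by (induction k) (simp_all add: add.assoc)

lemma diag2_mult_vec:
  assumes A: "A \<in> carrier_mat h h" and D: "D \<in> carrier_mat k k" and v: "v \<in> carrier_vec (h + k)" and i: "i < h + k"
  shows "(diag2 A D *\<^sub>v v) $ i =
    (if i < h then (\<Sum>j<h. A $$ (i, j) * v $ j) else (\<Sum>j<k. D $$ (i - h, j) * v $ (h + j)))"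
proof -
  let ?F = "diag2 A D"
  have F: "?F \<in> carrier_mat (h + k) (h + k)" using A D by auto
  show ?thesis
    unfolding mult_mat_vec_index[OF F v i] sum_lessThan_add using A D i by (auto intro!: sum.cong sum.neutral)
qed

text \<open>All that is needed of the canonical pencil: the upper rows involve only upper
  components, and a lower row has on its left side the next component or nothing.\<close>

lemma canonical_rows:
  fixes A1 :: "real mat" and ms :: "nat list" and h :: nat
  assumes A1: "A1 \<in> carrier_mat h h"
  defines "G \<equiv> diag_block_mat (map (\<lambda>k. jordan_block k (0 :: real)) ms)"
  defines "n \<equiv> h + sum_list ms"
  shows "\<exists>g. (\<forall>v\<in>carrier_vec n. \<forall>i<n.
      (diag2 (1\<^sub>m h) G *\<^sub>v v) $ i =
      (if i < h then v $ i else if g i \<and> Suc i < n then v $ Suc i else 0)) \<and>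
    (\<forall>v\<in>carrier_vec n. \<forall>i<n.
      (diag2 A1 (1\<^sub>m (sum_list ms)) *\<^sub>v v) $ i =
      (if i < h then (\<Sum>j<h. A1 $$ (i, j) * v $ j) else v $ i))"
proof -
  let ?k = "sum_list ms"
  have G: "G \<in> carrier_mat ?k ?k" unfolding G_def by (auto simp: dim_diag_block_mat o_def intro!: carrier_matI)
  obtain g where g: "G $$ (i, j) = (if j = Suc i \<and> g i then 1 else 0)" if "i < ?k" "j < ?k" for i j
    using jordan_entries[of ms, where ?'a=real] unfolding G_def by blast
  show ?thesis
  proof (intro exI[of _ "\<lambda>i. g (i - h)"] conjI ballI allI impI)
    fix v :: "real vec" and i assume v: "v \<in> carrier_vec n" and i: "i < n"
    have low: "(\<Sum>j<?k. G $$ (i - h, j) * v $ (h + j)) = (if g (i - h) \<and> Suc i < n then v $ Suc i else 0)" if "\<not> i < h"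
    proof -
      have "(\<Sum>j<?k. G $$ (i - h, j) * v $ (h + j)) = (\<Sum>j<?k. if j = Suc (i - h) then (if g (i - h) then v $ (h + j) else 0) else 0)"
        using g that i by (intro sum.cong) (auto simp: n_def)
      also have "\<dots> = (if g (i - h) \<and> Suc i < n then v $ Suc i else 0)"
        using that i by (auto simp: n_def Suc_diff_le[symmetric])
      finally show ?thesis .
    qed
    have top: "(\<Sum>j<h. (1\<^sub>m h :: real mat) $$ (i, j) * v $ j) = v $ i" if "i < h"
    proof -
      have "(\<Sum>j<h. (1\<^sub>m h :: real mat) $$ (i, j) * v $ j) = (\<Sum>j<h. if j = i then v $ j else 0)"
        using that by (intro sum.cong) auto
      then show ?thesis using that by simp
    qed
    show "(diag2 (1\<^sub>m h) G *\<^sub>v v) $ i =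
      (if i < h then v $ i else if g (i - h) \<and> Suc i < n then v $ Suc i else 0)"
      unfolding diag2_mult_vec[OF one_carrier_mat G v[unfolded n_def] i[unfolded n_def]] using low top by simp
    have bot: "(\<Sum>j<?k. (1\<^sub>m ?k :: real mat) $$ (i - h, j) * v $ (h + j)) = v $ i" if "\<not> i < h"
    proof -
      have "(\<Sum>j<?k. (1\<^sub>m ?k :: real mat) $$ (i - h, j) * v $ (h + j)) = (\<Sum>j<?k. if j = i - h then v $ (h + j) else 0)"
        using that i by (intro sum.cong) (auto simp: n_def)
      then show ?thesis using that i by (simp add: n_def)
    qed
    show "(diag2 A1 (1\<^sub>m ?k) *\<^sub>v v) $ i =
      (if i < h then (\<Sum>j<h. A1 $$ (i, j) * v $ j) else v $ i)"
      unfolding diag2_mult_vec[OF A1 one_carrier_mat v[unfolded n_def] i[unfolded n_def]] using bot by simp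
  qed
qed

context brownian
begin

lemma cutoff_eq_iff: "cutoff T f z = cutoff T g z \<longleftrightarrow> (fst z \<in> {0..T} \<longrightarrow> f (fst z) (snd z) = g (fst z) (snd z))"
  by (auto simp: cutoff_def)

lemma cutoff_eq_0_iff: "cutoff T f z = 0 \<longleftrightarrow> (fst z \<in> {0..T} \<longrightarrow> f (fst z) (snd z) = 0)"
  by (auto simp: cutoff_def)

lemma AE_cutoff_cong:
  assumes "AE z in Q. cutoff T f z = 0" "\<And>s \<omega>. s \<in> {0..T} \<Longrightarrow> \<omega> \<in> space P \<Longrightarrow> f s \<omega> = g s \<omega>"
  shows "AE z in Q. cutoff T g z = 0"
  using assms(1) AE_space
proof eventually_elim
  fix z assume z: "cutoff T f z = 0" "z \<in> space Q"
  have "snd z \<in> space P" using z(2) by (auto simp: space_pair_measure)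
  then show "cutoff T g z = 0" using z(1) assms(2)[of "fst z" "snd z"] unfolding cutoff_eq_0_iff by metis
qed

text \<open>The nilpotent rows are solved from the bottom upwards: once the next component is known, uniqueness of
  the representation as a constant plus a drift plus a stochastic integral determines the current one.\<close>

lemma nilpotent_rows:
  assumes T: "0 < T" and u: "u \<in> L2_adapted P Ft T r"
    and c: "E \<in> carrier_mat n n" "A \<in> carrier_mat n n" "B \<in> carrier_mat n r" "D \<in> carrier_mat n r" "x0 \<in> carrier_vec n"
    and Er: "\<And>v i. v \<in> carrier_vec n \<Longrightarrow> i < n \<Longrightarrow> h \<le> i \<Longrightarrow> (E *\<^sub>v v) $ i = (if g i \<and> Suc i < n then v $ Suc i else 0)"
    and Ar: "\<And>v i. v \<in> carrier_vec n \<Longrightarrow> i < n \<Longrightarrow> h \<le> i \<Longrightarrow> (A *\<^sub>v v) $ i = v $ i"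
    and sol: "is_solution P Ft W T n E A B D x0 u x"
    and \<beta>: "\<And>i s \<omega>. h \<le> i \<Longrightarrow> g i \<Longrightarrow> Suc i < n \<Longrightarrow> s \<in> {0..T} \<Longrightarrow> \<omega> \<in> space P \<Longrightarrow> (B *\<^sub>v u s \<omega>) $ Suc i = \<beta> (Suc i)"
    and i: "h \<le> i" "i < n"
  shows "(AE z in Q. cutoff T (\<lambda>s \<omega>. x s \<omega> $ i + (B *\<^sub>v u s \<omega>) $ i) z = 0) \<and> (AE z in Q. cutoff T (\<lambda>s \<omega>. x s \<omega> $ i + (D *\<^sub>v u s \<omega>) $ i) z = 0) \<and>
    x0 $ i = (if g i \<and> Suc i < n then - \<beta> (Suc i) else 0)"
  using i
proof (induction "n - i" arbitrary: i rule: less_induct)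
  case less
  note hi = less(2) and i = less(3)
  have x: "x \<in> L2_adapted P Ft T n"
    and eq: "\<And>t. t \<in> {0..T} \<Longrightarrow> AE \<omega> in P. (E *\<^sub>v x t \<omega>) $ i =
      x0 $ i + stoch t (\<lambda>s \<omega>. (A *\<^sub>v x s \<omega> + B *\<^sub>v u s \<omega>) $ i) (\<lambda>s \<omega>. (A *\<^sub>v x s \<omega> + D *\<^sub>v u s \<omega>) $ i) \<omega>"
    using sol i unfolding is_solution_iff[OF u c] by auto
  have xc: "x s \<omega> \<in> carrier_vec n" if "s \<in> {0..T}" "\<omega> \<in> space P" for s \<omega>
    using x that unfolding L2_adapted_iff by auto
  \<comment> \<open>By induction the next component is minus that of B u, which the hypothesis on
    \<open>\<beta>\<close> makes constant; so the left side is constant and \<open>row_step\<close>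
    applies.\<close>
  let ?k = "if g i \<and> Suc i < n then - \<beta> (Suc i) else 0"
  have L: "AE z in Q. cutoff T (\<lambda>s \<omega>. (E *\<^sub>v x s \<omega>) $ i - ?k) z = 0"
  proof (cases "g i \<and> Suc i < n")
    case True
    have "AE z in Q. cutoff T (\<lambda>s \<omega>. x s \<omega> $ Suc i + (B *\<^sub>v u s \<omega>) $ Suc i) z = 0"
      by (rule conjunct1[OF less(1)]) (use True hi i in auto)
    then show ?thesis
    proof (rule AE_cutoff_cong)
      fix s \<omega> assume s: "s \<in> {0..T}" "\<omega> \<in> space P"
      have "(B *\<^sub>v u s \<omega>) $ Suc i = \<beta> (Suc i)" using \<beta>[OF hi _ _ s] True by simp
      then show "x s \<omega> $ Suc i + (B *\<^sub>v u s \<omega>) $ Suc i = (E *\<^sub>v x s \<omega>) $ i - ?k"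
        unfolding Er[OF xc[OF s] i hi] using True by simp
    qed
  next
    case False
    have "AE z in Q. cutoff T (\<lambda>s \<omega>. 0) z = 0" by (simp add: cutoff_def)
    then show ?thesis
    proof (rule AE_cutoff_cong)
      fix s \<omega> assume s: "s \<in> {0..T}" "\<omega> \<in> space P"
      show "0 = (E *\<^sub>v x s \<omega>) $ i - ?k" unfolding Er[OF xc[OF s] i hi] using False by auto
    qed
  qed
  have R: "x0 $ i = ?k" "AE z in Q. cutoff T (\<lambda>s \<omega>. (A *\<^sub>v x s \<omega> + B *\<^sub>v u s \<omega>) $ i) z = 0"
      "AE z in Q. cutoff T (\<lambda>s \<omega>. (A *\<^sub>v x s \<omega> + D *\<^sub>v u s \<omega>) $ i) z = 0"
    by (rule row_step[OF T coeff_H[OF x u c(2,3) i] coeff_H[OF x u c(2,4) i] L], erule eq)+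
  have add: "(A *\<^sub>v x s \<omega> + X *\<^sub>v u s \<omega>) $ i = x s \<omega> $ i + (X *\<^sub>v u s \<omega>) $ i"
    if X: "X \<in> carrier_mat n r" and s: "s \<in> {0..T}" "\<omega> \<in> space P" for X s \<omega>
    unfolding Ar[OF xc[OF s] i hi, symmetric] by (rule index_add_vec(1)) (use X i in simp)
  show ?case
  proof (intro conjI)
    show "AE z in Q. cutoff T (\<lambda>s \<omega>. x s \<omega> $ i + (B *\<^sub>v u s \<omega>) $ i) z = 0"
      by (rule AE_cutoff_cong[OF R(2)]) (rule add[OF c(3)])
    show "AE z in Q. cutoff T (\<lambda>s \<omega>. x s \<omega> $ i + (D *\<^sub>v u s \<omega>) $ i) z = 0"
      by (rule AE_cutoff_cong[OF R(3)]) (rule add[OF c(4)])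
    show "x0 $ i = ?k" by (rule R(1))
  qed
qed

lemma const_L2_adapted: "c \<in> carrier_vec r \<Longrightarrow> (\<lambda>_ _. c) \<in> L2_adapted P Ft T r"
  unfolding L2_adapted_iff by (simp add: H_const)

text \<open>For a constant control B v is constant in time, so \<open>nilpotent_rows\<close> applies
  with \<open>\<beta>\<close> read off from it. A component that equals both - B v and - D v forces
  the two to agree.\<close>

lemma canonical_necessary:
  assumes T: "0 < T" and v: "v \<in> carrier_vec r"
    and c: "E \<in> carrier_mat n n" "A \<in> carrier_mat n n" "B \<in> carrier_mat n r" "D \<in> carrier_mat n r" "x0 \<in> carrier_vec n"
    and Er: "\<And>v i. v \<in> carrier_vec n \<Longrightarrow> i < n \<Longrightarrow> h \<le> i \<Longrightarrow> (E *\<^sub>v v) $ i = (if g i \<and> Suc i < n then v $ Suc i else 0)"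
    and Ar: "\<And>v i. v \<in> carrier_vec n \<Longrightarrow> i < n \<Longrightarrow> h \<le> i \<Longrightarrow> (A *\<^sub>v v) $ i = v $ i"
    and sol: "is_solution P Ft W T n E A B D x0 (\<lambda>_ _. v) x"
    and i: "h \<le> i" "i < n"
  shows "(B *\<^sub>v v) $ i = (D *\<^sub>v v) $ i" "x0 $ i = (if g i \<and> Suc i < n then - (B *\<^sub>v v) $ Suc i else 0)"
proof -
  have R: "(AE z in Q. cutoff T (\<lambda>s \<omega>. x s \<omega> $ i + (B *\<^sub>v v) $ i) z = 0) \<and> (AE z in Q. cutoff T (\<lambda>s \<omega>. x s \<omega> $ i + (D *\<^sub>v v) $ i) z = 0) \<and>
    x0 $ i = (if g i \<and> Suc i < n then - (B *\<^sub>v v) $ Suc i else 0)"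
    by (rule nilpotent_rows[where u="\<lambda>_ _. v" and h=h and g=g and \<beta>="\<lambda>j. (B *\<^sub>v v) $ j"])
       (rule T const_L2_adapted[OF v] c Er Ar sol refl i; assumption?)+
  have "AE z in Q. cutoff T (\<lambda>s \<omega>. (B *\<^sub>v v) $ i - (D *\<^sub>v v) $ i) z = 0"
    using conjunct1[OF R] conjunct1[OF conjunct2[OF R]]
    by eventually_elim (auto simp: cutoff_eq_0_iff simp del: index_mult_mat_vec atLeastAtMost_iff)
  from cutoff_const_zero[OF this T] show "(B *\<^sub>v v) $ i = (D *\<^sub>v v) $ i" by simp
  show "x0 $ i = (if g i \<and> Suc i < n then - (B *\<^sub>v v) $ Suc i else 0)" by (rule conjunct2[OF conjunct2[OF R]])
qed

text \<open>The upper rows are a linear stochastic equation with the input terms as inhomogeneities.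
  In a lower row - B u makes both integrands vanish, the second because \<open>B\<close> and
  \<open>D\<close> agree there; the left side vanishes because the next entry of B u is zero
  whenever it occurs.\<close>

lemma canonical_sufficient:
  assumes T: "0 < T" and u: "u \<in> L2_adapted P Ft T r"
    and c: "E \<in> carrier_mat n n" "A \<in> carrier_mat n n" "B \<in> carrier_mat n r" "D \<in> carrier_mat n r" "x0 \<in> carrier_vec n" and h: "h \<le> n"
    and Er: "\<And>v i. v \<in> carrier_vec n \<Longrightarrow> i < n \<Longrightarrow> (E *\<^sub>v v) $ i = (if i < h then v $ i else if g i \<and> Suc i < n then v $ Suc i else 0)"
    and Ar: "\<And>v i. v \<in> carrier_vec n \<Longrightarrow> i < n \<Longrightarrow> (A *\<^sub>v v) $ i = (if i < h then (\<Sum>j<h. a i j * v $ j) else v $ i)"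
    and BD: "\<And>v i. v \<in> carrier_vec r \<Longrightarrow> h \<le> i \<Longrightarrow> i < n \<Longrightarrow> (B *\<^sub>v v) $ i = (D *\<^sub>v v) $ i"
    and GB: "\<And>v i. v \<in> carrier_vec r \<Longrightarrow> h \<le> i \<Longrightarrow> g i \<Longrightarrow> Suc i < n \<Longrightarrow> (B *\<^sub>v v) $ Suc i = 0"
    and x0: "\<And>i. h \<le> i \<Longrightarrow> i < n \<Longrightarrow> x0 $ i = 0"
  shows "has_unique_solution P Ft W T n E A B D x0 u"
proof -
  define p where "p i s \<omega> = (B *\<^sub>v u s \<omega>) $ i" for i s \<omega>
  define q where "q i s \<omega> = (D *\<^sub>v u s \<omega>) $ i" for i s \<omega>
  have pH: "p i \<in> H T" and qH: "q i \<in> H T" if "i < n" for i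
    using H_mat_vec[OF u c(3) that] H_mat_vec[OF u c(4) that] unfolding p_def q_def by auto
  have uc: "u s \<omega> \<in> carrier_vec r" if "s \<in> {0..T}" "\<omega> \<in> space P" for s \<omega>
    using u that unfolding L2_adapted_iff by auto
  have add: "(v + B *\<^sub>v u s \<omega>) $ i = v $ i + p i s \<omega>" "(v + D *\<^sub>v u s \<omega>) $ i = v $ i + q i s \<omega>" if "i < n" for v s \<omega> i
    unfolding p_def q_def by (rule index_add_vec(1); use that c in simp)+
  have phn: "p j \<in> H T" "q j \<in> H T" if "j < h" for j using pH qH that h by auto
  from sde_exists[where h=h and c="\<lambda>i. x0 $ i" and a=a and p=p and q=q, OF T phn] obtain Y where YH: "\<And>j. j < h \<Longrightarrow> Y j \<in> H T"
    and Y: "\<And>t j. t \<in> {0..T} \<Longrightarrow> j < h \<Longrightarrow> AE \<omega> in P. Y j t \<omega> = rhs h a (\<lambda>i. x0 $ i) p q Y j t \<omega>" by blast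
  define x where "x s \<omega> = vec n (\<lambda>i. if i < h then Y i s \<omega> else - p i s \<omega>)" for s \<omega>
  have xc: "x s \<omega> \<in> carrier_vec n" for s \<omega> by (simp add: x_def)
  have xi: "x s \<omega> $ i = (if i < h then Y i s \<omega> else - p i s \<omega>)" if "i < n" for s \<omega> i using that by (simp add: x_def)
  have xL: "x \<in> L2_adapted P Ft T n"
    unfolding L2_adapted_iff
  proof (intro conjI ballI allI impI xc)
    fix i assume i: "i < n"
    show "(\<lambda>t \<omega>. x t \<omega> $ i) \<in> H T"
    proof (cases "i < h")
      case True then show ?thesis using YH[OF True] unfolding xi[OF i] by simp
    next
      case False
      have "(\<lambda>s \<omega>. (- 1) * p i s \<omega>) \<in> H T" by (rule H_cmult[OF pH[OF i]])
      then show ?thesis unfolding xi[OF i] using False by simp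
    qed
  qed
  have "is_solution P Ft W T n E A B D x0 u x"
    unfolding is_solution_iff[OF u c]
  proof (intro conjI xL ballI allI impI)
    fix t i assume t: "t \<in> {0..T}" and i: "i < n"
    show "AE \<omega> in P. (E *\<^sub>v x t \<omega>) $ i = x0 $ i + stoch t (\<lambda>s \<omega>. (A *\<^sub>v x s \<omega> + B *\<^sub>v u s \<omega>) $ i) (\<lambda>s \<omega>. (A *\<^sub>v x s \<omega> + D *\<^sub>v u s \<omega>) $ i) \<omega>"
    proof (cases "i < h")
      case True
      have "(\<Sum>j<h. a i j * x s \<omega> $ j) = (\<Sum>j<h. a i j * Y j s \<omega>)" for s \<omega>
        using h by (intro sum.cong) (auto simp: xi)
      then have "(A *\<^sub>v x s \<omega>) $ i = (\<Sum>j<h. a i j * Y j s \<omega>)" for s \<omega>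
        unfolding Ar[OF xc i] using True by simp
      then show ?thesis using Y[OF t True] True xi[OF i] unfolding add[OF i] Er[OF xc i] rhs_def by simp
    next
      case False
      then have hi: "h \<le> i" by simp
      have Ax: "(A *\<^sub>v x s \<omega>) $ i = - p i s \<omega>" for s \<omega> unfolding Ar[OF xc i] using False xi[OF i] by simp
      have t0: "0 \<le> t" and st: "s \<in> {0..t} \<Longrightarrow> s \<in> {0..T}" for s using t by auto
      have "AE \<omega> in P. stoch t (\<lambda>s \<omega>. (A *\<^sub>v x s \<omega> + B *\<^sub>v u s \<omega>) $ i) (\<lambda>s \<omega>. (A *\<^sub>v x s \<omega> + D *\<^sub>v u s \<omega>) $ i) \<omega> = 0"
      proof (rule stoch_zero[OF t0])
        fix s \<omega> assume s: "s \<in> {0..t}" "\<omega> \<in> space P"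
        show "(A *\<^sub>v x s \<omega> + B *\<^sub>v u s \<omega>) $ i = 0" unfolding add[OF i] Ax by simp
        have "p i s \<omega> = q i s \<omega>" unfolding p_def q_def by (rule BD[OF uc[OF st[OF s(1)] s(2)] hi i])
        then show "(A *\<^sub>v x s \<omega> + D *\<^sub>v u s \<omega>) $ i = 0" unfolding add[OF i] Ax by simp
      qed
      with AE_space show ?thesis
      proof eventually_elim
        fix \<omega> assume w: "\<omega> \<in> space P"
          and z: "stoch t (\<lambda>s \<omega>. (A *\<^sub>v x s \<omega> + B *\<^sub>v u s \<omega>) $ i) (\<lambda>s \<omega>. (A *\<^sub>v x s \<omega> + D *\<^sub>v u s \<omega>) $ i) \<omega> = 0"
        have "(E *\<^sub>v x t \<omega>) $ i = 0"
        proof (cases "g i \<and> Suc i < n")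
          case True
          then have "x t \<omega> $ Suc i = - p (Suc i) t \<omega>" using xi hi by simp
          also have "p (Suc i) t \<omega> = 0" unfolding p_def using GB[OF uc[OF t w] hi] True by simp
          finally show ?thesis unfolding Er[OF xc i] using False True by simp
        next
          case nt: False
          show ?thesis unfolding Er[OF xc i] if_not_P[OF False] if_not_P[OF nt] ..
        qed
        then show "(E *\<^sub>v x t \<omega>) $ i = x0 $ i + stoch t (\<lambda>s \<omega>. (A *\<^sub>v x s \<omega> + B *\<^sub>v u s \<omega>) $ i) (\<lambda>s \<omega>. (A *\<^sub>v x s \<omega> + D *\<^sub>v u s \<omega>) $ i) \<omega>"
          unfolding z x0[OF hi i] by simp
      qed
    qed
  qed
  moreover have "AE (t, \<omega>) in time_space P T. y t \<omega> = z t \<omega>"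
    if y: "is_solution P Ft W T n E A B D x0 u y" and z: "is_solution P Ft W T n E A B D x0 u z" for y z
  proof -
    have yL: "y \<in> L2_adapted P Ft T n" and zL: "z \<in> L2_adapted P Ft T n" by (rule is_solution_L2[OF y], rule is_solution_L2[OF z])
    have Er': "(E *\<^sub>v v) $ i = (if g i \<and> Suc i < n then v $ Suc i else 0)" if "v \<in> carrier_vec n" "i < n" "h \<le> i" for v i
      using Er[OF that(1,2)] that(3) by simp
    have Ar': "(A *\<^sub>v v) $ i = v $ i" if "v \<in> carrier_vec n" "i < n" "h \<le> i" for v i
      using Ar[OF that(1,2)] that(3) by simp
    have zeroB: "(B *\<^sub>v u s \<omega>) $ Suc i = (\<lambda>_. 0) (Suc i)" if "h \<le> i" "g i" "Suc i < n" "s \<in> {0..T}" "\<omega> \<in> space P" for i s \<omega>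
      using GB[OF uc[OF that(4,5)] that(1-3)] .
    have low: "AE w in Q. cutoff T (\<lambda>s \<omega>. v s \<omega> $ i + (B *\<^sub>v u s \<omega>) $ i) w = 0"
      if "is_solution P Ft W T n E A B D x0 u v" "h \<le> i" "i < n" for v i
      by (rule conjunct1[OF nilpotent_rows[where h=h and g=g and \<beta>="\<lambda>_. 0"]]) (rule T u c Er' Ar' that zeroB; assumption?)+
    have sde: "AE \<omega> in P. v j t \<omega> = rhs h a (\<lambda>i. x0 $ i) p q v j t \<omega>"
      if s: "is_solution P Ft W T n E A B D x0 u y'" and v: "v = (\<lambda>j t \<omega>. y' t \<omega> $ j)" and t: "t \<in> {0..T}" and j: "j < h" for y' v t j
    proof -
      have L: "y' \<in> L2_adapted P Ft T n" using s by (rule is_solution_L2)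
      have jn: "j < n" using j h by simp
      have yc: "y' s \<omega> \<in> carrier_vec n" if "s \<in> {0..T}" "\<omega> \<in> space P" for s \<omega>
        using L that unfolding L2_adapted_iff by auto
      have "AE \<omega> in P. (E *\<^sub>v y' t \<omega>) $ j = x0 $ j + stoch t (\<lambda>s \<omega>. (A *\<^sub>v y' s \<omega> + B *\<^sub>v u s \<omega>) $ j) (\<lambda>s \<omega>. (A *\<^sub>v y' s \<omega> + D *\<^sub>v u s \<omega>) $ j) \<omega>"
        using s t jn unfolding is_solution_iff[OF u c] by blast
      moreover have "AE \<omega> in P. stoch t (\<lambda>s \<omega>. (\<Sum>k<h. a j k * y' s \<omega> $ k) + p j s \<omega>) (\<lambda>s \<omega>. (\<Sum>k<h. a j k * y' s \<omega> $ k) + q j s \<omega>) \<omega>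
          = stoch t (\<lambda>s \<omega>. (A *\<^sub>v y' s \<omega> + B *\<^sub>v u s \<omega>) $ j) (\<lambda>s \<omega>. (A *\<^sub>v y' s \<omega> + D *\<^sub>v u s \<omega>) $ j) \<omega>"
      proof (rule stoch_cong)
        show "(\<lambda>s \<omega>. (A *\<^sub>v y' s \<omega> + B *\<^sub>v u s \<omega>) $ j) \<in> H t" "(\<lambda>s \<omega>. (A *\<^sub>v y' s \<omega> + D *\<^sub>v u s \<omega>) $ j) \<in> H t"
          using H_mono[OF coeff_H[OF L u c(2,3) jn]] H_mono[OF coeff_H[OF L u c(2,4) jn]] t by auto
        fix s \<omega> assume s: "s \<in> {0..t}" "\<omega> \<in> space P"
        then have s': "s \<in> {0..T}" using t by auto
        show "(\<Sum>k<h. a j k * y' s \<omega> $ k) + p j s \<omega> = (A *\<^sub>v y' s \<omega> + B *\<^sub>v u s \<omega>) $ j"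
          "(\<Sum>k<h. a j k * y' s \<omega> $ k) + q j s \<omega> = (A *\<^sub>v y' s \<omega> + D *\<^sub>v u s \<omega>) $ j"
          unfolding add[OF jn] Ar[OF yc[OF s' s(2)] jn] using j by simp_all
      qed (use t in simp)
      ultimately show ?thesis
        using AE_space
      proof eventually_elim
        fix \<omega> assume 1: "(E *\<^sub>v y' t \<omega>) $ j = x0 $ j + stoch t (\<lambda>s \<omega>. (A *\<^sub>v y' s \<omega> + B *\<^sub>v u s \<omega>) $ j) (\<lambda>s \<omega>. (A *\<^sub>v y' s \<omega> + D *\<^sub>v u s \<omega>) $ j) \<omega>"
          and 2: "stoch t (\<lambda>s \<omega>. (\<Sum>k<h. a j k * y' s \<omega> $ k) + p j s \<omega>) (\<lambda>s \<omega>. (\<Sum>k<h. a j k * y' s \<omega> $ k) + q j s \<omega>) \<omega>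
          = stoch t (\<lambda>s \<omega>. (A *\<^sub>v y' s \<omega> + B *\<^sub>v u s \<omega>) $ j) (\<lambda>s \<omega>. (A *\<^sub>v y' s \<omega> + D *\<^sub>v u s \<omega>) $ j) \<omega>" and w: "\<omega> \<in> space P"
        have "(E *\<^sub>v y' t \<omega>) $ j = y' t \<omega> $ j" unfolding Er[OF yc[OF t w] jn] using j by simp
        then show "v j t \<omega> = rhs h a (\<lambda>i. x0 $ i) p q v j t \<omega>" unfolding v rhs_def 2 using 1 by simp
      qed
    qed
    have comp: "(\<lambda>t \<omega>. v t \<omega> $ j) \<in> H T" if "v \<in> L2_adapted P Ft T n" "j < h" for v j
      using that h unfolding L2_adapted_iff by auto
    show ?thesis
      unfolding AE_vec_eq_iff[OF yL zL]
    proof (intro allI impI)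
      fix i assume i: "i < n"
      show "AE w in Q. cutoff T (\<lambda>t \<omega>. y t \<omega> $ i) w = cutoff T (\<lambda>t \<omega>. z t \<omega> $ i) w"
      proof (cases "i < h")
        case True
        show ?thesis
          by (rule sde_unique[where y="\<lambda>j t \<omega>. y t \<omega> $ j" and z="\<lambda>j t \<omega>. z t \<omega> $ j" and p=p and q=q and h=h and a=a and c="\<lambda>i. x0 $ i" and j=i and T=T,
               OF T comp[OF yL] comp[OF zL] phn sde[OF y refl] sde[OF z refl] True])
      next
        case False
        then have "h \<le> i" by simp
        from low[OF y this i] low[OF z this i] show ?thesis
          by eventually_elim (auto simp: cutoff_eq_iff cutoff_eq_0_iff simp del: index_mult_mat_vec atLeastAtMost_iff)
      qed
    qed
  qed
  ultimately show ?thesis unfolding has_unique_solution_def by blast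
qed

end

section \<open>Initial condition and kernel condition in coordinates\<close>

lemma append_cols_zero_one:
  fixes y :: "'a :: semiring_1 vec"
  assumes y: "y \<in> carrier_vec (h + k)" and i: "i < k"
  shows "((0\<^sub>m k h @\<^sub>c 1\<^sub>m k) *\<^sub>v y) $ i = y $ (h + i)"
proof -
  have "(0\<^sub>m k h @\<^sub>c 1\<^sub>m k :: 'a mat) \<in> carrier_mat k (h + k)" unfolding append_cols_def by (auto intro!: carrier_matI)
  from mult_mat_vec_index[OF this y i]
  have "((0\<^sub>m k h @\<^sub>c 1\<^sub>m k) *\<^sub>v y) $ i = (\<Sum>j<h. (0\<^sub>m k h @\<^sub>c 1\<^sub>m k) $$ (i, j) * y $ j) + (\<Sum>j<k. (0\<^sub>m k h @\<^sub>c 1\<^sub>m k) $$ (i, h + j) * y $ (h + j))"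
    by (simp only: sum_lessThan_add)
  also have "(\<Sum>j<h. (0\<^sub>m k h @\<^sub>c 1\<^sub>m k) $$ (i, j) * y $ j) = 0"
    using i by (intro sum.neutral) (auto simp: append_cols_def)
  also have "(\<Sum>j<k. (0\<^sub>m k h @\<^sub>c 1\<^sub>m k) $$ (i, h + j) * y $ (h + j)) = (\<Sum>j<k. if j = i then y $ (h + j) else 0)"
    using i by (intro sum.cong) (auto simp: append_cols_def)
  finally show ?thesis using i by simp
qed

lemma append_cols_zero_one_eq_0_iff:
  fixes y :: "'a :: semiring_1 vec"
  assumes y: "y \<in> carrier_vec (h + k)"
  shows "(0\<^sub>m k h @\<^sub>c 1\<^sub>m k) *\<^sub>v y = 0\<^sub>v k \<longleftrightarrow> (\<forall>i. h \<le> i \<and> i < h + k \<longrightarrow> y $ i = 0)"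
proof -
  have "(0\<^sub>m k h @\<^sub>c 1\<^sub>m k) *\<^sub>v y = 0\<^sub>v k \<longleftrightarrow> (\<forall>i<k. y $ (h + i) = 0)"
    using append_cols_zero_one[OF y] by (auto simp: vec_eq_iff append_cols_def simp del: index_mult_mat_vec)
  also have "\<dots> \<longleftrightarrow> (\<forall>i. h \<le> i \<and> i < h + k \<longrightarrow> y $ i = 0)"
  proof (intro iffI allI impI)
    fix i assume z: "\<forall>i<k. y $ (h + i) = 0" and i: "h \<le> i \<and> i < h + k"
    have "i - h < k" "h + (i - h) = i" using i by auto
    with z show "y $ i = 0" by metis
  qed simp
  finally show ?thesis .
qed

text \<open>The lower rows of \<open>E\<close> act as the shift described by \<open>g\<close>, so
  the product vanishes there exactly if the shifted rows of \<open>B\<close> annihilate all vectors;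
  unit vectors recover the entries.\<close>

lemma lower_rows_eq_0_iff:
  fixes E B :: "real mat"
  assumes E: "E \<in> carrier_mat n n" and B: "B \<in> carrier_mat n r" and h: "h \<le> n"
    and Er: "\<And>v i. v \<in> carrier_vec n \<Longrightarrow> i < n \<Longrightarrow> (E *\<^sub>v v) $ i = (if i < h then v $ i else if g i \<and> Suc i < n then v $ Suc i else 0)"
  shows "(\<forall>i j. h \<le> i \<and> i < n \<and> j < r \<longrightarrow> (E * B) $$ (i, j) = 0) \<longleftrightarrow>
    (\<forall>v\<in>carrier_vec r. \<forall>i. h \<le> i \<and> g i \<and> Suc i < n \<longrightarrow> (B *\<^sub>v v) $ Suc i = 0)"
proof -
  have EB: "E * B \<in> carrier_mat n r" using E B by (rule mult_carrier_mat)
  have row: "((E * B) *\<^sub>v v) $ i = (if g i \<and> Suc i < n then (B *\<^sub>v v) $ Suc i else 0)" if "v \<in> carrier_vec r" "h \<le> i" "i < n" for v i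
    unfolding assoc_mult_mat_vec[OF E B that(1)] Er[OF mult_mat_vec_carrier[OF B that(1)] that(3)] using that(2) by simp
  show ?thesis
  proof (intro iffI ballI allI impI)
    fix v :: "real vec" and i assume z: "\<forall>i j. h \<le> i \<and> i < n \<and> j < r \<longrightarrow> (E * B) $$ (i, j) = 0"
      and v: "v \<in> carrier_vec r" and i: "h \<le> i \<and> g i \<and> Suc i < n"
    have "(\<Sum>k<r. (E * B) $$ (i, k) * v $ k) = 0" using z i by (intro sum.neutral) auto
    then show "(B *\<^sub>v v) $ Suc i = 0"
      using row[OF v, of i] i mult_mat_vec_index[OF EB v, of i] by simp
  next
    fix i j assume z: "\<forall>v\<in>carrier_vec r. \<forall>i. h \<le> i \<and> g i \<and> Suc i < n \<longrightarrow> (B *\<^sub>v v) $ Suc i = 0"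
      and ij: "h \<le> i \<and> i < n \<and> j < r"
    have "(E * B) $$ (i, j) = (\<Sum>k<r. if k = j then (E * B) $$ (i, k) else 0)" using ij by simp
    also have "\<dots> = (\<Sum>k<r. (E * B) $$ (i, k) * unit_vec r j $ k)"
      using ij by (intro sum.cong) (auto simp del: index_mult_mat)
    also have "\<dots> = ((E * B) *\<^sub>v unit_vec r j) $ i"
      by (rule mult_mat_vec_index[OF EB unit_vec_carrier, symmetric]) (use ij in simp)
    also have "\<dots> = 0" using row[OF unit_vec_carrier, of i j] z ij by (simp del: index_mult_mat_vec)
    finally show "(E * B) $$ (i, j) = 0" .
  qed
qed

theorem theorem3p3:
  fixes \<P> :: "'w measure" and F :: "real \<Rightarrow> 'w measure" and W :: "real \<Rightarrow> 'w \<Rightarrow> real"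
    and E A B D :: "real mat" and x0 :: "real vec" and T :: real and n m r :: nat
  assumes "prob_space \<P>" and "complete_measure \<P>"
    and "std_brownian_motion \<P> W"
    and "F = augmented_filtration \<P> W"
    and "E \<in> carrier_mat n n" and "A \<in> carrier_mat n n"
    and "vec_space.rank n E = m" and "m < n"
    and "B \<in> carrier_mat n r" and "D \<in> carrier_mat n r"
    and "x0 \<in> carrier_vec n" and "T > 0"
  shows "(\<forall>u\<in>L2_adapted \<P> F T r. has_unique_solution \<P> F W T n E A B D x0 u) \<longleftrightarrow>
    (\<exists>M N h A1 B1 D1 G B2 ms bs.
       M \<in> carrier_mat n n \<and> invertible_mat M \<and>
       N \<in> carrier_mat n n \<and> invertible_mat N \<and>
       h \<le> n \<and>
       A1 \<in> carrier_mat h h \<and> B1 \<in> carrier_mat h r \<and> D1 \<in> carrier_mat h r \<and>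
       (\<forall>k\<in>set ms. 0 < k) \<and> sum_list ms = n - h \<and>
       G = diag_block_mat (map (\<lambda>k. jordan_block k 0) ms) \<and>
       (\<exists>q. G ^\<^sub>m q = 0\<^sub>m (n - h) (n - h)) \<and>
       length bs = length ms \<and> (\<forall>b\<in>set bs. b \<in> carrier_mat 1 r) \<and>
       B2 = stack_rows r (map2 first_row_mat ms bs) \<and>
       M * E * N = diag_block_mat [1\<^sub>m h, G] \<and>
       M * A * N = diag_block_mat [A1, 1\<^sub>m (n - h)] \<and>
       M * B = B1 @\<^sub>r B2 \<and>
       M * D = D1 @\<^sub>r B2 \<and>
       ((0\<^sub>m (n - h) h @\<^sub>c 1\<^sub>m (n - h)) * M) *\<^sub>v x0 = 0\<^sub>v (n - h))"
proof -
  note E = assms(5) and A = assms(6) and B = assms(9) and D = assms(10) and x0 = assms(11) and T = assms(12)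
  interpret brownian \<P> W
    using assms(1-3) by (auto simp: brownian_def brownian_axioms_def)
  have FF: "F = Ft" by (simp add: assms(4))
  have proj: "((0\<^sub>m k h @\<^sub>c 1\<^sub>m k) * M) *\<^sub>v x0 = 0\<^sub>v k \<longleftrightarrow> (\<forall>i. h \<le> i \<and> i < n \<longrightarrow> (M *\<^sub>v x0) $ i = 0)"
    if M: "M \<in> carrier_mat n n" and nk: "n = h + k" for M h k
  proof -
    have C: "(0\<^sub>m k h @\<^sub>c 1\<^sub>m k :: real mat) \<in> carrier_mat k n" unfolding append_cols_def nk by (auto intro!: carrier_matI)
    have "M *\<^sub>v x0 \<in> carrier_vec (h + k)" using mult_mat_vec_carrier[OF M x0] unfolding nk .
    then show ?thesis unfolding assoc_mult_mat_vec[OF C M x0] nk by (rule append_cols_zero_one_eq_0_iff)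
  qed
  have EB_index: "(diag2 (1\<^sub>m h) G * (B1 @\<^sub>r B2)) $$ (i, j)
      = (G * B2) $$ (i - h, j)"
    if "G \<in> carrier_mat k k" "B1 \<in> carrier_mat h r" "B2 \<in> carrier_mat k r" "h \<le> i" "i < h + k" "j < r" for G B1 B2 :: "real mat" and h k i j
    unfolding diag_block_mult_append_rows[OF one_carrier_mat that(1-3)]
    using append_rows_index[OF mult_carrier_mat[OF one_carrier_mat that(2)] mult_carrier_mat[OF that(1,3)] that(5,6)] that(4) by simp
  show ?thesis
    unfolding FF
  proof (rule iffI, goal_cases)
    case 1
    have const: "has_unique_solution \<P> Ft W T n E A B D x0 (\<lambda>_ _. v)" if "v \<in> carrier_vec r" for v
      using 1 const_L2_adapted[OF that] by blast
    \<comment> \<open>Regularity follows from unique solvability for a single control, for which 0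
      is taken.\<close>
    obtain c where "det (c \<cdot>\<^sub>m E - A) \<noteq> 0"
      using unique_solution_imp_regular[OF T const_L2_adapted[OF zero_carrier_vec] E A B D x0 const[OF zero_carrier_vec]] by blast
    from weierstrass[OF E A this] obtain h A1 ms q where h: "h \<le> n" and A1: "A1 \<in> carrier_mat h h"
      and ms: "\<forall>k\<in>set ms. 0 < k" "sum_list ms = n - h"
      and q: "diag_block_mat (map (\<lambda>k. jordan_block k (0 :: real)) ms) ^\<^sub>m q = 0\<^sub>m (n - h) (n - h)"
      and eqv: "pencil_equiv n E A (diag2 (1\<^sub>m h) (diag_block_mat (map (\<lambda>k. jordan_block k 0) ms))) (diag2 A1 (1\<^sub>m (n - h)))" by blast
    define G where "G = diag_block_mat (map (\<lambda>k. jordan_block k (0 :: real)) ms)"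
    have G: "G \<in> carrier_mat (n - h) (n - h)" unfolding G_def ms(2)[symmetric] by (auto simp: dim_diag_block_mat o_def intro!: carrier_matI)
    from eqv obtain M M' N N' where M: "M \<in> carrier_mat n n" "M' \<in> carrier_mat n n" "M * M' = 1\<^sub>m n" "M' * M = 1\<^sub>m n"
      and N: "N \<in> carrier_mat n n" "N' \<in> carrier_mat n n" "N * N' = 1\<^sub>m n" "N' * N = 1\<^sub>m n"
      and ME: "M * E * N = diag2 (1\<^sub>m h) G" and MA: "M * A * N = diag2 A1 (1\<^sub>m (n - h))"
      unfolding pencil_equiv_def G_def by blast
    have nh: "h + sum_list ms = n" "h + (n - h) = n" using h ms(2) by auto
    obtain g where g: "(\<forall>v\<in>carrier_vec n. \<forall>i<n. ((M * E * N) *\<^sub>v v) $ i = (if i < h then v $ i else if g i \<and> Suc i < n then v $ Suc i else 0)) \<and>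
        (\<forall>v\<in>carrier_vec n. \<forall>i<n. ((M * A * N) *\<^sub>v v) $ i = (if i < h then (\<Sum>j<h. A1 $$ (i, j) * v $ j) else v $ i))"
      using canonical_rows[OF A1, of ms, folded G_def, unfolded ms(2) nh(2)] unfolding ME MA ..
    note Er = conjunct1[OF g, rule_format] and Ar = conjunct2[OF g, rule_format]
    have Er': "((M * E * N) *\<^sub>v v) $ i = (if g i \<and> Suc i < n then v $ Suc i else 0)" if "v \<in> carrier_vec n" "i < n" "h \<le> i" for v i
      using Er[OF that(1,2)] that(3) by simp
    have Ar': "((M * A * N) *\<^sub>v v) $ i = v $ i" if "v \<in> carrier_vec n" "i < n" "h \<le> i" for v i
      using Ar[OF that(1,2)] that(3) by simp
    have carr: "M * E * N \<in> carrier_mat n n" "M * A * N \<in> carrier_mat n n" "M * B \<in> carrier_mat n r" "M * D \<in> carrier_mat n r" "M *\<^sub>v x0 \<in> carrier_vec n"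
      using M(1) N(1) E A B D x0 by auto
    have nec: "(M * B *\<^sub>v v) $ i = (M * D *\<^sub>v v) $ i" "(M *\<^sub>v x0) $ i = (if g i \<and> Suc i < n then - (M * B *\<^sub>v v) $ Suc i else 0)"
      if v: "v \<in> carrier_vec r" and i: "h \<le> i" "i < n" for v i
    proof -
      have "has_unique_solution \<P> Ft W T n (M * E * N) (M * A * N) (M * B) (M * D) (M *\<^sub>v x0) (\<lambda>_ _. v)"
        by (rule has_unique_solution_transform[OF const_L2_adapted[OF v] E A B D x0 M(1,2,4) N const[OF v]])
      then obtain x where x: "is_solution \<P> Ft W T n (M * E * N) (M * A * N) (M * B) (M * D) (M *\<^sub>v x0) (\<lambda>_ _. v) x"
        unfolding has_unique_solution_def by blast
      show "(M * B *\<^sub>v v) $ i = (M * D *\<^sub>v v) $ i" "(M *\<^sub>v x0) $ i = (if g i \<and> Suc i < n then - (M * B *\<^sub>v v) $ Suc i else 0)"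
        by (rule canonical_necessary[where h=h and g=g]; (rule T v carr Er' Ar' x i; assumption?))+
    qed
    \<comment> \<open>The zero control makes the right side of the initial value formula vanish in
      every lower row.\<close>
    have y0: "(M *\<^sub>v x0) $ i = 0" if i: "h \<le> i" "i < n" for i
    proof -
      have "(M * B *\<^sub>v 0\<^sub>v r) $ Suc i = 0" if "Suc i < n"
        unfolding mult_mat_vec_index[OF carr(3) zero_carrier_vec that] by (intro sum.neutral) simp
      then show ?thesis using nec(2)[OF zero_carrier_vec i] by (simp split: if_splits)
    qed
    have "M * B \<in> carrier_mat (h + (n - h)) r" "M * D \<in> carrier_mat (h + (n - h)) r" unfolding nh(2) by (rule carr)+
    from append_rows_split[OF this(1)] append_rows_split[OF this(2)] obtain B1 B2 D1 D2 where
      B12: "B1 \<in> carrier_mat h r" "B2 \<in> carrier_mat (n - h) r" "M * B = B1 @\<^sub>r B2" and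
      D12: "D1 \<in> carrier_mat h r" "D2 \<in> carrier_mat (n - h) r" "M * D = D1 @\<^sub>r D2" by blast
    have col: "(X *\<^sub>v unit_vec r j) $ i = X $$ (i, j)" if X: "X \<in> carrier_mat n r" and ij: "i < n" "j < r" for X :: "real mat" and i j
    proof -
      have "(\<Sum>k<r. X $$ (i, k) * unit_vec r j $ k) = (\<Sum>k<r. if k = j then X $$ (i, k) else 0)"
        using ij by (intro sum.cong) auto
      then show ?thesis unfolding mult_mat_vec_index[OF X unit_vec_carrier ij(1)] using ij by simp
    qed
    have BD2: "D2 = B2"
    proof (rule eq_matI)
      fix i j assume "i < dim_row B2" "j < dim_col B2"
      then have ij: "i < n - h" "j < r" using B12 by auto
      have i': "h \<le> h + i" "h + i < n" "h + i < h + (n - h)" using ij by auto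
      have "(M * B) $$ (h + i, j) = (M * D) $$ (h + i, j)"
        using nec(1)[OF unit_vec_carrier[of r j] i'(1,2)] unfolding col[OF carr(3) i'(2) ij(2)] col[OF carr(4) i'(2) ij(2)] .
      then show "D2 $$ (i, j) = B2 $$ (i, j)"
        unfolding B12(3) D12(3) append_rows_index[OF B12(1,2) i'(3) ij(2)] append_rows_index[OF D12(1,2) i'(3) ij(2)] by simp
    qed (use B12 D12 in auto)
    \<comment> \<open>With the initial value known to be zero, the same formula for arbitrary v says
      that the next row of M B annihilates v.\<close>
    have "(M * B *\<^sub>v v) $ Suc i = 0" if "v \<in> carrier_vec r" "h \<le> i" "g i" "Suc i < n" for v i
      using nec(2)[OF that(1,2)] y0[OF that(2)] that by simp
    then have "\<forall>v\<in>carrier_vec r. \<forall>i. h \<le> i \<and> g i \<and> Suc i < n \<longrightarrow> (M * B *\<^sub>v v) $ Suc i = 0" by blast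
    then have EB0: "\<forall>i j. h \<le> i \<and> i < n \<and> j < r \<longrightarrow> ((M * E * N) * (M * B)) $$ (i, j) = 0"
      by (rule iffD2[OF lower_rows_eq_0_iff[where g=g and h=h, OF carr(1,3) h], rotated]) (rule Er)
    have "G * B2 = 0\<^sub>m (n - h) r"
    proof (rule eq_matI)
      fix i j assume "i < dim_row (0\<^sub>m (n - h) r :: real mat)" "j < dim_col (0\<^sub>m (n - h) r :: real mat)"
      then have ij: "i < n - h" "j < r" by auto
      then show "(G * B2) $$ (i, j) = 0\<^sub>m (n - h) r $$ (i, j)"
        using EB_index[OF G B12(1,2), of "h + i" j] EB0[rule_format, of "h + i" j] unfolding ME B12(3) by simp
    qed (use G B12 in auto)
    then obtain bs where bs: "length bs = length ms" "\<forall>b\<in>set bs. b \<in> carrier_mat 1 r" "B2 = stack_rows r (map2 first_row_mat ms bs)"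
      using jordan_mult_eq_0_iff[OF B12(2)[folded ms(2)] ms(1)] unfolding G_def ms(2) by blast
    show ?case
    proof (rule exI[of _ M], rule exI[of _ N], rule exI[of _ h], rule exI[of _ A1], rule exI[of _ B1], rule exI[of _ D1],
        rule exI[of _ G], rule exI[of _ B2], rule exI[of _ ms], rule exI[of _ bs], intro conjI)
      show "M * E * N = diag_block_mat [1\<^sub>m h, G]" unfolding diag_block_mat_pair[OF one_carrier_mat G] by (rule ME)
      show "M * A * N = diag_block_mat [A1, 1\<^sub>m (n - h)]" unfolding diag_block_mat_pair[OF A1 one_carrier_mat] by (rule MA)
      show "M * D = D1 @\<^sub>r B2" using D12(3) unfolding BD2 .
      show "((0\<^sub>m (n - h) h @\<^sub>c 1\<^sub>m (n - h)) * M) *\<^sub>v x0 = 0\<^sub>v (n - h)" using y0 unfolding proj[OF M(1) nh(2)[symmetric]] by blast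
      show "\<exists>q. G ^\<^sub>m q = 0\<^sub>m (n - h) (n - h)" unfolding G_def by (rule exI, rule q)
      show "invertible_mat M" "invertible_mat N" by (rule invertible_matI[OF M], rule invertible_matI[OF N])
    qed (fact M(1) N(1) h A1 B12(1,3) D12(1) ms bs G_def)+
  next
    case 2
    then obtain M N h A1 B1 D1 G B2 ms bs where M: "M \<in> carrier_mat n n" "invertible_mat M"
       and N: "N \<in> carrier_mat n n" "invertible_mat N" and h: "h \<le> n"
       and A1: "A1 \<in> carrier_mat h h" and B1: "B1 \<in> carrier_mat h r" and D1: "D1 \<in> carrier_mat h r"
       and ms: "\<forall>k\<in>set ms. 0 < k" "sum_list ms = n - h"
       and G_def: "G = diag_block_mat (map (\<lambda>k. jordan_block k 0) ms)"
       and bs: "length bs = length ms" "\<forall>b\<in>set bs. b \<in> carrier_mat 1 r" "B2 = stack_rows r (map2 first_row_mat ms bs)"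
       and ME: "M * E * N = diag_block_mat [1\<^sub>m h, G]"
       and MA: "M * A * N = diag_block_mat [A1, 1\<^sub>m (n - h)]"
       and MB: "M * B = B1 @\<^sub>r B2" and MD: "M * D = D1 @\<^sub>r B2"
       and x0M: "((0\<^sub>m (n - h) h @\<^sub>c 1\<^sub>m (n - h)) * M) *\<^sub>v x0 = 0\<^sub>v (n - h)"
      by (elim exE conjE) (rule that)
    have inverse: "\<exists>X'\<in>carrier_mat n n. X * X' = 1\<^sub>m n \<and> X' * X = 1\<^sub>m n" if X: "X \<in> carrier_mat n n" "invertible_mat X" for X :: "real mat"
    proof -
      \<comment> \<open>The size of the inverse is not part of the definition of invertibility; it
        is recovered from the two products.\<close>
      from X(2) obtain Y where Y: "X * Y = 1\<^sub>m (dim_row X)" "Y * X = 1\<^sub>m (dim_row Y)"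
        unfolding invertible_mat_def inverts_mat_def by blast
      have "dim_row Y = n" "dim_col Y = n"
        using arg_cong[OF Y(1), of dim_col] arg_cong[OF Y(2), of dim_col] carrier_matD[OF X(1)]
        unfolding index_mult_mat index_one_mat by metis+
      then have "Y \<in> carrier_mat n n" by (rule carrier_matI)
      moreover have "X * Y = 1\<^sub>m n" "Y * X = 1\<^sub>m n" using Y \<open>dim_row Y = n\<close> carrier_matD(1)[OF X(1)] by metis+
      ultimately show ?thesis by blast
    qed
    from inverse[OF M] obtain M' where M': "M' \<in> carrier_mat n n" "M * M' = 1\<^sub>m n" "M' * M = 1\<^sub>m n" by blast
    from inverse[OF N] obtain N' where N': "N' \<in> carrier_mat n n" "N * N' = 1\<^sub>m n" "N' * N = 1\<^sub>m n" by blast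
    have nh: "h + sum_list ms = n" "h + (n - h) = n" using h ms(2) by auto
    have G: "G \<in> carrier_mat (n - h) (n - h)" unfolding G_def ms(2)[symmetric] by (auto simp: dim_diag_block_mat o_def intro!: carrier_matI)
    have B2: "B2 \<in> carrier_mat (n - h) r" unfolding bs(3) ms(2)[symmetric] by (rule stack_rows_carrier[OF bs(1,2)])
    have ME': "M * E * N = diag2 (1\<^sub>m h) G" using ME unfolding diag_block_mat_pair[OF one_carrier_mat G] .
    have MA': "M * A * N = diag2 A1 (1\<^sub>m (n - h))" using MA unfolding diag_block_mat_pair[OF A1 one_carrier_mat] .
    obtain g where g: "(\<forall>v\<in>carrier_vec n. \<forall>i<n. ((M * E * N) *\<^sub>v v) $ i = (if i < h then v $ i else if g i \<and> Suc i < n then v $ Suc i else 0)) \<and>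
        (\<forall>v\<in>carrier_vec n. \<forall>i<n. ((M * A * N) *\<^sub>v v) $ i = (if i < h then (\<Sum>j<h. A1 $$ (i, j) * v $ j) else v $ i))"
      using canonical_rows[OF A1, of ms, folded G_def, unfolded ms(2) nh(2)] unfolding ME' MA' ..
    note Er = conjunct1[OF g, rule_format] and Ar = conjunct2[OF g, rule_format]
    have carr: "M * E * N \<in> carrier_mat n n" "M * A * N \<in> carrier_mat n n" "M * B \<in> carrier_mat n r" "M * D \<in> carrier_mat n r" "M *\<^sub>v x0 \<in> carrier_vec n"
      using M(1) N(1) E A B D x0 by auto
    have GB: "G * B2 = 0\<^sub>m (n - h) r"
      using jordan_mult_eq_0_iff[OF B2[folded ms(2)] ms(1)] bs unfolding G_def ms(2) by blast
    have EB0: "\<forall>i j. h \<le> i \<and> i < n \<and> j < r \<longrightarrow> ((M * E * N) * (M * B)) $$ (i, j) = 0"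
    proof (intro allI impI)
      fix i j assume ij: "h \<le> i \<and> i < n \<and> j < r"
      then have "i - h < n - h" by (simp add: diff_less_mono)
      with ij show "((M * E * N) * (M * B)) $$ (i, j) = 0"
        using EB_index[OF G B1 B2, of i j] unfolding ME' MB GB by simp
    qed
    have EB1: "\<forall>v\<in>carrier_vec r. \<forall>i. h \<le> i \<and> g i \<and> Suc i < n \<longrightarrow> (M * B *\<^sub>v v) $ Suc i = 0"
      by (rule iffD1[OF lower_rows_eq_0_iff[where g=g and h=h, OF carr(1,3) h] EB0]) (rule Er)
    have BD: "(M * B *\<^sub>v v) $ i = (M * D *\<^sub>v v) $ i" if v: "v \<in> carrier_vec r" and i: "h \<le> i" "i < n" for v i
    proof -
      have "(M * B) $$ (i, k) = (M * D) $$ (i, k)" if "k < r" for k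
        using append_rows_index[OF B1 B2, of i k] append_rows_index[OF D1 B2, of i k] that i unfolding MB MD nh(2) by simp
      then show ?thesis unfolding mult_mat_vec_index[OF carr(3) v i(2)] mult_mat_vec_index[OF carr(4) v i(2)] by (intro sum.cong) simp_all
    qed
    have y0: "(M *\<^sub>v x0) $ i = 0" if "h \<le> i" "i < n" for i
      using x0M that unfolding proj[OF M(1) nh(2)[symmetric]] by blast
    show ?case
    proof
      fix u assume u: "u \<in> L2_adapted \<P> Ft T r"
      have canon: "has_unique_solution \<P> Ft W T n (M * E * N) (M * A * N) (M * B) (M * D) (M *\<^sub>v x0) u"
        by (rule canonical_sufficient[where h=h and g=g and a="\<lambda>i j. A1 $$ (i, j)", OF T u carr h Er Ar BD _ y0])
           (use EB1 in blast)+
      have conj_undo: "M' * (M * X * N) * N' = X" if X: "X \<in> carrier_mat n n" for X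
      proof -
        have MX: "M * X \<in> carrier_mat n n" using M(1) X by (rule mult_carrier_mat)
        have "M' * (M * X * N) = X * N"
          unfolding assoc_mult_mat[OF M'(1) MX N(1), symmetric] assoc_mult_mat[OF M'(1) M(1) X, symmetric] M'(3) left_mult_one_mat[OF X] ..
        then show ?thesis by (simp only: assoc_mult_mat[OF X N(1) N'(1)] N'(2) right_mult_one_mat[OF X])
      qed
      have undo: "M' * (M * X) = X" if X: "X \<in> carrier_mat n r" for X
        unfolding assoc_mult_mat[OF M'(1) M(1) X, symmetric] M'(3) by (rule left_mult_one_mat[OF X])
      have x0_undo: "M' *\<^sub>v (M *\<^sub>v x0) = x0"
        unfolding assoc_mult_mat_vec[OF M'(1) M(1) x0, symmetric] M'(3) by (rule one_mult_mat_vec[OF x0])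
      show "has_unique_solution \<P> Ft W T n E A B D x0 u"
        \<comment> \<open>The transformation is applied to the canonical equation, with the inverse
          matrices in place of \<open>M\<close> and \<open>N\<close>.\<close>
        using has_unique_solution_transform[OF u carr M'(1) M(1) M'(2) N'(1) N(1) N'(3,2) canon]
        unfolding conj_undo[OF E] conj_undo[OF A] undo[OF B] undo[OF D] x0_undo .
    qed
  qed
qed

end
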